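(* Let $k$ be a field of characteristic zero and let $M_3$ be the moduli space over $k$ of degree $3$ rational maps $\mathbb{P}^1\to\mathbb{P}^1$ up to conjugation. Let $\mathbb{P}(2,2,3,3,4,6)$ be the weighted projective space over $k$ with coordinates $d,i,j,a,b,c$ of weights $2,2,3,3,4,6$ respectively. Then $M_3$ is isomorphic to the $4$-dimensional variety in $\mathbb{P}(2,2,3,3,4,6)$ determined by the relation $$2 c^{2}=\tfrac{1}{54} d^{3} i^{3} - \tfrac{1}{9} d^{3} j^{2} - \tfrac{1}{12} d i^{2} a^{2} - \tfrac{1}{3} j a^{3} + d j a b + \tfrac{1}{2} i a^{2} b - \tfrac{1}{2} d i b^{2} - b^{3}$$ and the non-vanishing of $$\rho=\tfrac{1}{8}i^3 + \tfrac{1}{384} i d^2 - \tfrac{3}{4} j^2 - \tfrac{3}{16} j a + \tfrac{1}{256} a^2 + \tfrac{3}{16} i b - \tfrac{1}{64} d b - \tfrac{1}{8} c .$$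
   Context: A rational map of degree $3$ is $\phi=[F_0:F_1]$ with $F_0,F_1\in k[X_0,X_1]$ homogeneous of degree $3$ without common factor over $\bar k$. Let $A_3$ be the polynomial ring over $k$ in the $8$ coefficients of $(F_0,F_1)$, $P_3=\mathrm{Proj}\,A_3\cong\mathbb{P}^7$, and $\mathrm{Rat}_3\subset P_3$ the open locus where the resultant $\mathrm{Res}(F_0,F_1)$ does not vanish. The group $\mathrm{SL}_2$ acts on $\mathrm{Rat}_3$ by conjugation $\phi\mapsto\gamma^{-1}\circ\phi\circ\gamma$. The moduli space $M_3$ is the geometric quotient $\mathrm{Rat}_3/\mathrm{SL}_2=\mathrm{Spec}\,\bigl(H^0(\mathrm{Rat}_3,\mathcal{O})^{\mathrm{SL}_2}\bigr)$. The weighted homogeneous polynomial $\rho$ expresses the resultant in terms of generators of the ring of $\mathrm{SL}_2$-invariants. *)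

theory Defs
  imports
    "HOL-Algebra.QuotRing"
    "HOL-Algebra.Module"
    "HOL-Analysis.Function_Topology"
    "HOL-Library.Poly_Mapping"
    "HOL-Library.Extended_Nat"
    "Subresultants.Resultant_Prelim"
begin

section \<open>Schemes over a field\<close>

text \<open>
  A \<open>k\<close>-algebra is a value of the library record \<^typ>\<open>('k, 'a) module\<close>, i.e. a ring together with
  a scalar multiplication \<open>\<odot>\<close>.  All structure sheaves below are sheaves of functions on the open
  subsets of the space, so restriction of sections is restriction of functions
  (\<^const>\<open>restrict\<close>) and is not part of the record.
\<close>

record ('k, 'p, 's) ringed_space =
  topo :: "'p topology"
  sheaf :: "'p set \<Rightarrow> ('k, 'p \<Rightarrow> 's) module"

abbreviation points :: "('k, 'p, 's, 'z) ringed_space_scheme \<Rightarrow> 'p set" where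
  "points X \<equiv> topspace (topo X)"

abbreviation global_sections ::
    "('k, 'p, 's, 'z) ringed_space_scheme \<Rightarrow> ('k, 'p \<Rightarrow> 's) module" where
  "global_sections X \<equiv> sheaf X (points X)"

definition open_subspace :: "('k, 'p, 's) ringed_space \<Rightarrow> 'p set \<Rightarrow> ('k, 'p, 's) ringed_space" where
  "open_subspace X U = \<lparr>topo = subtopology (topo X) U, sheaf = sheaf X\<rparr>"

text \<open>
  An isomorphism \<open>X \<rightarrow> Y\<close> is a homeomorphism \<open>f\<close> with \<open>k\<close>-algebra isomorphisms
  \<open>\<theta> V : O(V) \<rightarrow> O(f\<^sup>-\<^sup>1 V)\<close> compatible with restriction.  The maps induced on stalks are then
  isomorphisms, hence local.
\<close>

definition isomorphic ::
    "('k, 'p, 's) ringed_space \<Rightarrow> ('k, 'q, 't) ringed_space \<Rightarrow> bool" where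
  "isomorphic X Y \<longleftrightarrow> (\<exists>f \<theta>. homeomorphic_map (topo X) (topo Y) f \<and>
     (\<forall>V. openin (topo Y) V \<longrightarrow>
        \<theta> V \<in> ring_iso (sheaf Y V) (sheaf X (points X \<inter> f -` V)) \<and>
        (\<forall>c. \<forall>s\<in>carrier (sheaf Y V).
           \<theta> V (c \<odot>\<^bsub>sheaf Y V\<^esub> s) = c \<odot>\<^bsub>sheaf X (points X \<inter> f -` V)\<^esub> \<theta> V s) \<and>
        (\<forall>W. openin (topo Y) W \<and> W \<subseteq> V \<longrightarrow> (\<forall>s\<in>carrier (sheaf Y V).
           \<theta> W (restrict s W) = restrict (\<theta> V s) (points X \<inter> f -` W)))))"

definition integral_space :: "('k, 'p, 's) ringed_space \<Rightarrow> bool" where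
  "integral_space X \<longleftrightarrow> points X \<noteq> {} \<and>
     (\<forall>U. openin (topo X) U \<and> U \<noteq> {} \<longrightarrow> domain (sheaf X U))"

definition irreducible_closed :: "'p topology \<Rightarrow> 'p set \<Rightarrow> bool" where
  "irreducible_closed T C \<longleftrightarrow> closedin T C \<and> C \<noteq> {} \<and>
     (\<forall>A B. closedin T A \<and> closedin T B \<and> C \<subseteq> A \<union> B \<longrightarrow> C \<subseteq> A \<or> C \<subseteq> B)"

definition dimension :: "('k, 'p, 's) ringed_space \<Rightarrow> enat" where
  "dimension X = Sup {enat n | n. \<exists>C :: nat \<Rightarrow> 'p set.
     (\<forall>i\<le>n. irreducible_closed (topo X) (C i)) \<and> (\<forall>i<n. C i \<subset> C (Suc i))}"

subsection \<open>Fractions\<close>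

text \<open>
  \<open>D\<close> is the set of admissible pairs (numerator, denominator); its set of denominators is
  multiplicatively closed.  The fraction \<open>a/s\<close> is the set of all admissible pairs equivalent to
  \<open>(a, s)\<close>.  Operations on fractions are defined by taking the union over all representatives,
  which all give the same fraction.
\<close>

definition fraction :: "('k, 'a) module \<Rightarrow> ('a \<times> 'a) set \<Rightarrow> 'a \<Rightarrow> 'a \<Rightarrow> ('a \<times> 'a) set" where
  "fraction R D a s = {(b, t) \<in> D. \<exists>u \<in> snd ` D. u \<otimes>\<^bsub>R\<^esub> (t \<otimes>\<^bsub>R\<^esub> a) = u \<otimes>\<^bsub>R\<^esub> (s \<otimes>\<^bsub>R\<^esub> b)}"

definition frac_add ::
    "('k, 'a) module \<Rightarrow> ('a \<times> 'a) set \<Rightarrow> ('a \<times> 'a) set \<Rightarrow> ('a \<times> 'a) set \<Rightarrow> ('a \<times> 'a) set" where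
  "frac_add R D x y = (\<Union>(a, s)\<in>x. \<Union>(b, t)\<in>y.
     fraction R D ((t \<otimes>\<^bsub>R\<^esub> a) \<oplus>\<^bsub>R\<^esub> (s \<otimes>\<^bsub>R\<^esub> b)) (s \<otimes>\<^bsub>R\<^esub> t))"

definition frac_mult ::
    "('k, 'a) module \<Rightarrow> ('a \<times> 'a) set \<Rightarrow> ('a \<times> 'a) set \<Rightarrow> ('a \<times> 'a) set \<Rightarrow> ('a \<times> 'a) set" where
  "frac_mult R D x y = (\<Union>(a, s)\<in>x. \<Union>(b, t)\<in>y. fraction R D (a \<otimes>\<^bsub>R\<^esub> b) (s \<otimes>\<^bsub>R\<^esub> t))"

definition frac_smult ::
    "('k, 'a) module \<Rightarrow> ('a \<times> 'a) set \<Rightarrow> 'k \<Rightarrow> ('a \<times> 'a) set \<Rightarrow> ('a \<times> 'a) set" where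
  "frac_smult R D c x = (\<Union>(a, s)\<in>x. fraction R D (c \<odot>\<^bsub>R\<^esub> a) s)"

subsection \<open>Spec and Proj\<close>

type_synonym ('k, 'a) frac_space = "('k, 'a set, ('a \<times> 'a) set) ringed_space"

definition zariski :: "('k, 'a) module \<Rightarrow> 'a set set \<Rightarrow> 'a set topology" where
  "zariski R P = topology_generated_by ((\<lambda>f. {p \<in> P. f \<notin> p}) ` carrier R)"

text \<open>
  Points are the primes in \<open>P\<close>, the stalk at \<open>p\<close> consists of the fractions with pairs in \<open>D p\<close>,
  and the sections over \<open>U\<close> are the functions to the stalks that are locally given by one fraction.
\<close>

definition frac_space ::
    "('k, 'a) module \<Rightarrow> 'a set set \<Rightarrow> ('a set \<Rightarrow> ('a \<times> 'a) set) \<Rightarrow> ('k, 'a) frac_space" where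
  "frac_space R P D =
     \<lparr>topo = zariski R P,
      sheaf = (\<lambda>U.
        \<lparr>carrier = {\<sigma> \<in> extensional U. \<forall>p\<in>U. \<exists>V. openin (zariski R P) V \<and> p \<in> V \<and> V \<subseteq> U \<and>
             (\<exists>a s. \<forall>q\<in>V. (a, s) \<in> D q \<and> \<sigma> q = fraction R (D q) a s)},
         monoid.mult = (\<lambda>\<sigma> \<tau>. \<lambda>p\<in>U. frac_mult R (D p) (\<sigma> p) (\<tau> p)),
         one = (\<lambda>p\<in>U. fraction R (D p) \<one>\<^bsub>R\<^esub> \<one>\<^bsub>R\<^esub>),
         zero = (\<lambda>p\<in>U. fraction R (D p) \<zero>\<^bsub>R\<^esub> \<one>\<^bsub>R\<^esub>),
         add = (\<lambda>\<sigma> \<tau>. \<lambda>p\<in>U. frac_add R (D p) (\<sigma> p) (\<tau> p)),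
         module.smult = (\<lambda>c \<sigma>. \<lambda>p\<in>U. frac_smult R (D p) c (\<sigma> p))\<rparr>)\<rparr>"

definition Spec :: "('k, 'a) module \<Rightarrow> ('k, 'a) frac_space" where
  "Spec R = frac_space R {p. primeideal p R} (\<lambda>p. carrier R \<times> (carrier R - p))"

text \<open>A grading \<open>gr\<close> assigns to \<open>n\<close> the set of homogeneous elements of degree \<open>n\<close> (with zero).\<close>

definition homogeneous_fracs :: "(nat \<Rightarrow> 'a set) \<Rightarrow> 'a set \<Rightarrow> ('a \<times> 'a) set" where
  "homogeneous_fracs gr p = (\<Union>n. gr n \<times> (gr n - p))"

definition Proj :: "('k, 'a) module \<Rightarrow> (nat \<Rightarrow> 'a set) \<Rightarrow> ('k, 'a) frac_space" where
  "Proj R gr = frac_space R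
     {p. primeideal p R \<and> Idl\<^bsub>R\<^esub> (p \<inter> (\<Union>n. gr n)) = p \<and> \<not> (\<Union>n\<in>{1..}. gr n) \<subseteq> p}
     (homogeneous_fracs gr)"

text \<open>
  For a homomorphism \<open>h\<close> of graded algebras \<open>R \<rightarrow> S\<close>, \<open>proj_map\<close> is the induced map on points
  \<open>Proj S \<rightarrow> Proj R\<close> (where defined), and \<open>proj_pullback\<close> is the value at \<open>Q\<close> of the pullback of a
  section \<open>\<sigma>\<close> along it, where \<open>gr\<close> is the grading of \<open>S\<close>.
\<close>

definition proj_map :: "('k, 'a) module \<Rightarrow> ('a \<Rightarrow> 'b) \<Rightarrow> 'b set \<Rightarrow> 'a set" where
  "proj_map R h Q = {a \<in> carrier R. h a \<in> Q}"

definition proj_pullback :: "('k, 'a) module \<Rightarrow> ('k, 'b) module \<Rightarrow> (nat \<Rightarrow> 'b set) \<Rightarrow> ('a \<Rightarrow> 'b) \<Rightarrow>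
    ('a set \<Rightarrow> ('a \<times> 'a) set) \<Rightarrow> 'b set \<Rightarrow> ('b \<times> 'b) set" where
  "proj_pullback R S gr h \<sigma> Q =
     (\<Union>(a, s)\<in>\<sigma> (proj_map R h Q). fraction S (homogeneous_fracs gr Q) (h a) (h s))"

section \<open>Polynomial rings and weighted projective spaces\<close>

type_synonym 'k mpoly = "(nat \<Rightarrow>\<^sub>0 nat) \<Rightarrow>\<^sub>0 'k"

definition const :: "'k \<Rightarrow> 'k::field mpoly" where
  "const c = Poly_Mapping.single 0 c"

definition var :: "nat \<Rightarrow> 'k::field mpoly" where
  "var x = Poly_Mapping.single (Poly_Mapping.single x 1) 1"

definition substitute :: "(nat \<Rightarrow> 'k mpoly) \<Rightarrow> 'k mpoly \<Rightarrow> 'k::field mpoly" where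
  "substitute \<sigma> p = (\<Sum>m\<in>Poly_Mapping.keys p.
     const (Poly_Mapping.lookup p m) * (\<Prod>x\<in>Poly_Mapping.keys m. \<sigma> x ^ Poly_Mapping.lookup m x))"

text \<open>The polynomial ring in the variables \<open>var 0, \<dots>, var (n - 1)\<close>.\<close>

definition poly_alg :: "nat \<Rightarrow> ('k::field, 'k mpoly) module" where
  "poly_alg n =
     \<lparr>carrier = {p. \<forall>m\<in>Poly_Mapping.keys p. Poly_Mapping.keys m \<subseteq> {..<n}},
      monoid.mult = (*), one = 1, zero = 0, add = (+), module.smult = (\<lambda>c p. const c * p)\<rparr>"

definition quot_alg :: "('k, 'a) module \<Rightarrow> 'a set \<Rightarrow> ('k, 'a set) module" where
  "quot_alg R I =
     \<lparr>carrier = carrier (R Quot I), monoid.mult = monoid.mult (R Quot I), one = monoid.one (R Quot I),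
      zero = ring.zero (R Quot I), add = ring.add (R Quot I),
      module.smult = (\<lambda>c X. \<Union>a\<in>X. I +>\<^bsub>R\<^esub> (c \<odot>\<^bsub>R\<^esub> a))\<rparr>"

text \<open>The variable \<open>var x\<close> has weight \<open>ws ! x\<close>.\<close>

definition weighted_grading :: "nat list \<Rightarrow> nat \<Rightarrow> 'k::field mpoly set" where
  "weighted_grading ws n = {p \<in> carrier (poly_alg (length ws)). \<forall>m\<in>Poly_Mapping.keys p.
     (\<Sum>x\<in>Poly_Mapping.keys m. ws ! x * Poly_Mapping.lookup m x) = n}"

definition quot_grading :: "nat list \<Rightarrow> 'k::field mpoly set \<Rightarrow> nat \<Rightarrow> 'k mpoly set set" where
  "quot_grading ws I n = (\<lambda>p. I +>\<^bsub>poly_alg (length ws)\<^esub> p) ` weighted_grading ws n"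

definition weighted_proj :: "nat list \<Rightarrow> ('k::field, 'k mpoly) frac_space" where
  "weighted_proj ws = Proj (poly_alg (length ws)) (weighted_grading ws)"

text \<open>
  The closed subscheme of \<open>weighted_proj ws\<close> defined by a homogeneous ideal \<open>I\<close>, in its canonical
  form as Proj of the quotient ring.
\<close>

definition weighted_proj_closed ::
    "nat list \<Rightarrow> 'k::field mpoly set \<Rightarrow> ('k, 'k mpoly set) frac_space" where
  "weighted_proj_closed ws I = Proj (quot_alg (poly_alg (length ws)) I) (quot_grading ws I)"

section \<open>Rational maps of degree 3 and their moduli space\<close>

text \<open>
  The binary cubic form \<open>\<Sum>m\<le>3. c\<^sub>m X\<^sub>0\<^sup>m X\<^sub>1\<^sup>3\<^sup>-\<^sup>m\<close> is encoded by the polynomial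
  \<open>\<Sum>m\<le>3. c\<^sub>m X\<^sup>m\<close>, whose degree may drop.  Accordingly the resultant uses the 6 by 6
  Sylvester matrix for the formal degrees 3 and 3.

  The variables of \<open>A\<^sub>3\<close> are \<open>var m\<close> (coefficient \<open>m\<close> of \<open>F\<^sub>0\<close>) and \<open>var (4 + m)\<close> (coefficient
  \<open>m\<close> of \<open>F\<^sub>1\<close>), for \<open>m \<le> 3\<close>.
\<close>

definition F0 :: "'k::field mpoly poly" where
  "F0 = (\<Sum>m\<le>3. monom (var m) m)"

definition F1 :: "'k::field mpoly poly" where
  "F1 = (\<Sum>m\<le>3. monom (var (4 + m)) m)"

definition Res3 :: "'k::field mpoly" where
  "Res3 = det (sylvester_mat_sub 3 3 F0 F1)"

definition A3 :: "('k::field, 'k mpoly) module" where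
  "A3 = poly_alg 8"

definition P3 :: "('k::field, 'k mpoly) frac_space" where
  "P3 = weighted_proj (replicate 8 1)"

definition Rat3 :: "('k::field, 'k mpoly) frac_space" where
  "Rat3 = open_subspace P3 {p \<in> points P3. Res3 \<notin> p}"

subsection \<open>The action of the group scheme \<open>SL\<^sub>2\<close>\<close>

text \<open>
  \<open>var 8, \<dots>, var 11\<close> are the entries of the universal matrix \<open>\<gamma>\<close> with rows
  \<open>(var 8, var 9)\<close> and \<open>(var 10, var 11)\<close>; it acts on \<open>\<P>\<^sup>1\<close> by
  \<open>(X\<^sub>0, X\<^sub>1) \<mapsto> (var 8 X\<^sub>0 + var 9 X\<^sub>1, var 10 X\<^sub>0 + var 11 X\<^sub>1)\<close>.
  \<open>cubic_comp f\<close> is the cubic form \<open>f \<circ> \<gamma>\<close>, and \<open>(conj_F0, conj_F1)\<close> is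
  \<open>\<gamma>\<^sup>-\<^sup>1 \<circ> (F\<^sub>0, F\<^sub>1) \<circ> \<gamma>\<close>, with \<open>\<gamma>\<^sup>-\<^sup>1\<close> the adjugate of \<open>\<gamma>\<close>.
\<close>

definition cubic_comp :: "'k::field mpoly poly \<Rightarrow> 'k mpoly poly" where
  "cubic_comp f = (\<Sum>m\<le>3. [:coeff f m:] * [:var 9, var 8:] ^ m * [:var 11, var 10:] ^ (3 - m))"

definition conj_F0 :: "'k::field mpoly poly" where
  "conj_F0 = [:var 11:] * cubic_comp F0 - [:var 9:] * cubic_comp F1"

definition conj_F1 :: "'k::field mpoly poly" where
  "conj_F1 = [:var 8:] * cubic_comp F1 - [:var 10:] * cubic_comp F0"

text \<open>
  \<open>SL2_A3\<close> is \<open>k[SL\<^sub>2] \<otimes> A\<^sub>3\<close>, graded by the degree in the coefficients of \<open>(F\<^sub>0, F\<^sub>1)\<close>, so that its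
  Proj is \<open>SL\<^sub>2 \<times> P\<^sub>3\<close>.  The projection to \<open>P\<^sub>3\<close> and the action \<open>SL\<^sub>2 \<times> P\<^sub>3 \<rightarrow> P\<^sub>3\<close> are induced by the
  homomorphisms \<open>pr_hom\<close> and \<open>act_hom\<close> from \<open>A3\<close> to \<open>SL2_A3\<close>.
\<close>

definition SL2_weights :: "nat list" where
  "SL2_weights = replicate 8 1 @ replicate 4 0"

definition SL2_ideal :: "'k::field mpoly set" where
  "SL2_ideal = PIdl\<^bsub>poly_alg 12\<^esub> (var 8 * var 11 - var 9 * var 10 - 1)"

definition SL2_A3 :: "('k::field, 'k mpoly set) module" where
  "SL2_A3 = quot_alg (poly_alg 12) SL2_ideal"

definition SL2_grading :: "nat \<Rightarrow> 'k::field mpoly set set" where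
  "SL2_grading = quot_grading SL2_weights SL2_ideal"

definition SL2_P3 :: "('k::field, 'k mpoly set) frac_space" where
  "SL2_P3 = Proj SL2_A3 SL2_grading"

definition pr_hom :: "'k::field mpoly \<Rightarrow> 'k mpoly set" where
  "pr_hom p = SL2_ideal +>\<^bsub>poly_alg 12\<^esub> p"

definition act_hom :: "'k::field mpoly \<Rightarrow> 'k mpoly set" where
  "act_hom p = SL2_ideal +>\<^bsub>poly_alg 12\<^esub>
     substitute (\<lambda>x. if x < 4 then coeff conj_F0 x else coeff conj_F1 (x - 4)) p"

text \<open>
  A function on \<open>Rat\<^sub>3\<close> is \<open>SL\<^sub>2\<close>-invariant if its pullbacks to \<open>SL\<^sub>2 \<times> Rat\<^sub>3\<close> along the action and
  along the projection coincide.
\<close>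

definition SL2_Rat3_points :: "'k::field mpoly set set set" where
  "SL2_Rat3_points = {Q \<in> points SL2_P3. proj_map A3 pr_hom Q \<in> points Rat3}"

definition SL2_invariant ::
    "('k::field mpoly set \<Rightarrow> ('k mpoly \<times> 'k mpoly) set) \<Rightarrow> bool" where
  "SL2_invariant \<sigma> \<longleftrightarrow> (\<forall>Q\<in>SL2_Rat3_points.
     proj_pullback A3 (SL2_A3 :: ('k, _) module) SL2_grading act_hom \<sigma> Q =
     proj_pullback A3 (SL2_A3 :: ('k, _) module) SL2_grading pr_hom \<sigma> Q)"

definition invariant_functions ::
    "('k::field, 'k mpoly set \<Rightarrow> ('k mpoly \<times> 'k mpoly) set) module" where
  "invariant_functions = (global_sections Rat3)
     \<lparr>carrier := {\<sigma> \<in> carrier (global_sections (Rat3 :: ('k, _) frac_space)). SL2_invariant \<sigma>}\<rparr>"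

definition M3 :: "('k::field, 'k mpoly set \<Rightarrow> ('k mpoly \<times> 'k mpoly) set) frac_space" where
  "M3 = Spec invariant_functions"

section \<open>The subvariety of \<open>\<P>(2,2,3,3,4,6)\<close>\<close>

text \<open>The coordinates \<open>d, i, j, a, b, c\<close> are \<open>var 0, \<dots>, var 5\<close>.\<close>

definition weights :: "nat list" where
  "weights = [2, 2, 3, 3, 4, 6]"

definition relation_poly :: "'k::field mpoly" where
  "relation_poly =
     (let d = var 0; i = var 1; j = var 2; a = var 3; b = var 4; c = var 5 in
      2 * c ^ 2 -
        (const (1/54) * d ^ 3 * i ^ 3 - const (1/9) * d ^ 3 * j ^ 2
         - const (1/12) * d * i ^ 2 * a ^ 2 - const (1/3) * j * a ^ 3 + d * j * a * b
         + const (1/2) * i * a ^ 2 * b - const (1/2) * d * i * b ^ 2 - b ^ 3))"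

definition rho :: "'k::field mpoly" where
  "rho =
     (let d = var 0; i = var 1; j = var 2; a = var 3; b = var 4; c = var 5 in
      const (1/8) * i ^ 3 + const (1/384) * i * d ^ 2 - const (3/4) * j ^ 2
      - const (3/16) * j * a + const (1/256) * a ^ 2 + const (3/16) * i * b
      - const (1/64) * d * b - const (1/8) * c)"

definition relation_ideal :: "'k::field mpoly set" where
  "relation_ideal = PIdl\<^bsub>poly_alg 6\<^esub> relation_poly"

definition relation_locus :: "('k::field, 'k mpoly set) frac_space" where
  "relation_locus = weighted_proj_closed weights relation_ideal"

definition invariant_variety :: "('k::field, 'k mpoly set) frac_space" where
  "invariant_variety = open_subspace relation_locus
     {p \<in> points relation_locus. (relation_ideal +>\<^bsub>poly_alg 6\<^esub> rho) \<notin> p}"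

end

theory Submission
  imports Defs "HOL-Computational_Algebra.Polynomial_Factorial"
begin

text \<open>
  Via the quartic \<open>X\<^sub>1 F\<^sub>0 - X\<^sub>0 F\<^sub>1\<close> and the divergence \<open>\<partial>F\<^sub>0/\<partial>X\<^sub>0 + \<partial>F\<^sub>1/\<partial>X\<^sub>1\<close>, a pair
  \<open>(F\<^sub>0, F\<^sub>1)\<close> of cubic forms is the same as a pair \<open>(\<alpha>, \<beta>)\<close> of a binary quartic and a binary
  quadratic form, and conjugation becomes the usual action of \<open>SL\<^sub>2\<close> on forms.  The coordinates
  \<open>d, i, j, a, b, c\<close> are six classical joint invariants \<open>invs\<close> of \<open>\<alpha>\<close> and \<open>\<beta>\<close>, of degrees 2, 2, 3, 3, 4, 6.

  The algebraic heart is that these invariants generate the ring of invariants in \<open>A\<^sub>3\<close>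
  (\<open>invariants_generated\<close>) and that the displayed relation generates all relations between them
  (\<open>relations_generated\<close>).  Where the discriminant \<open>d\<close> of \<open>\<beta>\<close> does not vanish, \<open>\<beta>\<close> can be moved to
  \<open>2 s X\<^sub>0 X\<^sub>1\<close>; what remains of the group there is the normaliser of a torus, whose invariants are
  elementary, so that every invariant is a polynomial in the \<open>invs\<close> divided by a power of \<open>d\<close>.  The power
  of \<open>d\<close> can be cancelled because a polynomial in the \<open>invs\<close> that is divisible by \<open>d\<close> becomes, after
  reduction by the relation to the form \<open>A + c C\<close> with \<open>A, C\<close> free of \<open>c\<close>, visibly divisible by
  \<open>d\<close>: on forms with \<open>\<beta> = X\<^sub>0\<^sup>2\<close> the invariants \<open>i, j, a, b\<close> are algebraically independent and the sign of \<open>c\<close> can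
  be flipped while they are kept fixed.  The same argument shows that a relation in reduced form is divisible
  by every power of \<open>d\<close>, hence zero.  Finally \<open>\<rho>\<close> evaluated at the \<open>invs\<close> is the resultant.

  All schemes involved are integral, so their sections over nonempty open sets are elements of one
  function field.  Two such spaces on which points are separated by their local rings are
  isomorphic as soon as the local rings, as subsets of the function field, are the same
  (\<open>isomorphic_if_same_local_rings\<close>).  This gives the standard fact that the locus \<open>f \<noteq> 0\<close> in \<open>Proj R\<close> is
  the spectrum of the degree-zero part of \<open>R[1/f]\<close> (\<open>spec_isomorphic_basic_open\<close>), and that this ring is also
  the ring of functions on that locus (\<open>regular_on_basic_open\<close>).  Applied to \<open>A\<^sub>3\<close> and the resultant, functions on
  \<open>Rat\<^sub>3\<close> are fractions \<open>F / Res\<^sup>N\<close>; such a function is invariant under the group scheme iff \<open>F\<close> is an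
  invariant polynomial, which is detected on rational points of \<open>SL\<^sub>2 \<times> Rat\<^sub>3\<close> because \<open>k\<close> is infinite.
  Applied to the coordinate ring of the relation and \<open>\<rho>\<close>, the same degree-zero ring is the coordinate ring of the
  affine variety in question, so the two are isomorphic.

  The dimension is computed from chains of homogeneous primes that avoid \<open>\<rho>\<close>.  A chain with \<open>n + 1\<close> members
  yields, together with \<open>\<rho>\<close>, \<open>n + 1\<close> homogeneous algebraically independent elements of the coordinate ring
  (\<open>prime_chain_independent\<close>), while counting monomials shows that any six homogeneous elements are
  dependent (\<open>algebraically_dependent\<close>); so \<open>n \<le> 4\<close>.  An explicit chain of five primes, coming from
  successive degenerations of a parametrisation of the locus \<open>d = 0\<close>, shows that \<open>4\<close> is attained.
\<close>

section \<open>Polynomials and their evaluation\<close>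

abbreviation PA :: "nat \<Rightarrow> 'k::field mpoly set" where
  "PA n \<equiv> carrier (poly_alg n)"

definition mono_eval :: "(nat \<Rightarrow> 'a::comm_ring_1) \<Rightarrow> (nat \<Rightarrow>\<^sub>0 nat) \<Rightarrow> 'a" where
  "mono_eval \<sigma> m = (\<Prod>x\<in>Poly_Mapping.keys m. \<sigma> x ^ Poly_Mapping.lookup m x)"

text \<open>Evaluation in an arbitrary commutative ring over which the coefficients are sent by \<open>h\<close>.
  Values in \<open>k\<close>, substitution, gradings and embeddings into function fields are all instances.\<close>

definition peval :: "('k::field \<Rightarrow> 'a::comm_ring_1) \<Rightarrow> (nat \<Rightarrow> 'a) \<Rightarrow> 'k mpoly \<Rightarrow> 'a" where
  "peval h \<sigma> p = (\<Sum>m\<in>Poly_Mapping.keys p. h (Poly_Mapping.lookup p m) * mono_eval \<sigma> m)"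

abbreviation ev :: "(nat \<Rightarrow> 'k::field) \<Rightarrow> 'k mpoly \<Rightarrow> 'k" where
  "ev \<equiv> peval (\<lambda>c. c)"

lemma substitute_peval: "substitute \<sigma> = peval const \<sigma>"
  by (rule ext) (simp add: substitute_def peval_def mono_eval_def)

lemma sum_monomials:
  "(\<Sum>m\<in>Poly_Mapping.keys p. Poly_Mapping.single m (Poly_Mapping.lookup p m)) = p"
  by (rule poly_mapping_eqI) (auto simp: lookup_sum lookup_single when_def in_keys_iff)

lemma mono_eval_superset:
  assumes "finite A" "Poly_Mapping.keys m \<subseteq> A"
  shows "mono_eval \<sigma> m = (\<Prod>x\<in>A. \<sigma> x ^ Poly_Mapping.lookup m x)"
  unfolding mono_eval_def
  by (rule prod.mono_neutral_left) (use assms in \<open>auto simp: in_keys_iff\<close>)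

lemma mono_eval_add: "mono_eval \<sigma> (m + m') = mono_eval \<sigma> m * mono_eval \<sigma> m'"
proof -
  let ?A = "Poly_Mapping.keys m \<union> Poly_Mapping.keys m'"
  have "mono_eval \<sigma> (m + m') = (\<Prod>x\<in>?A. \<sigma> x ^ Poly_Mapping.lookup (m + m') x)"
    by (rule mono_eval_superset) (use Poly_Mapping.keys_add[of m m'] in auto)
  then show ?thesis
    by (simp add: lookup_add power_add prod.distrib mono_eval_superset[of ?A])
qed

lemma mono_eval_0 [simp]: "mono_eval \<sigma> 0 = 1"
  by (simp add: mono_eval_def)

lemma mono_eval_single: "mono_eval \<sigma> (Poly_Mapping.single x e) = \<sigma> x ^ e"
  by (cases "e = 0") (simp_all add: mono_eval_def)

lemma const_0 [simp]: "const 0 = 0" and const_1 [simp]: "const 1 = 1"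
  by (simp_all add: const_def)

lemma const_hom: "comm_ring_hom (const :: 'k::field \<Rightarrow> 'k mpoly)"
  by unfold_locales (simp_all add: const_def single_add mult_single)

lemma const_add: "const (a + b) = const a + const b"
  and const_mult: "const (a * b) = const a * const b"
  and const_minus: "const (- a) = - const a"
  and const_diff: "const (a - b) = const a - const b"
  by (simp_all add: const_def single_add mult_single single_uminus single_diff)

lemma const_eq_iff [simp]: "const a = const b \<longleftrightarrow> a = b"
  by (metis const_def lookup_single_eq)

lemma const_numeral [simp]: "const (numeral w) = numeral w"
  by (simp add: const_def)

lemma const_power: "const (a ^ n) = const a ^ n"
  by (induction n) (simp_all add: const_mult)

lemma single_eq_const_mult: "Poly_Mapping.single m c = const c * Poly_Mapping.single m 1"
  by (simp add: const_def mult_single)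

lemma single_eq_mono_eval: "Poly_Mapping.single m (1::'k::field) = mono_eval var m"
proof -
  have *: "var x ^ e = Poly_Mapping.single (Poly_Mapping.single x e) (1::'k)" for x e
  proof (induction e)
    case (Suc e)
    then show ?case by (simp add: var_def mult_single flip: single_add)
  qed simp
  have **: "(\<Prod>x\<in>A. Poly_Mapping.single (f x) (1::'k)) = Poly_Mapping.single (\<Sum>x\<in>A. f x) 1"
    if "finite A" for A :: "nat set" and f :: "nat \<Rightarrow> nat \<Rightarrow>\<^sub>0 nat"
    using that by induction (simp_all add: mult_single)
  have "mono_eval var m = Poly_Mapping.single (\<Sum>x\<in>Poly_Mapping.keys m. Poly_Mapping.single x (Poly_Mapping.lookup m x)) (1::'k)"
    by (simp add: mono_eval_def * **)
  also have "(\<Sum>x\<in>Poly_Mapping.keys m. Poly_Mapping.single x (Poly_Mapping.lookup m x)) = m"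
    by (rule sum_monomials)
  finally show ?thesis by simp
qed

lemma peval_superset:
  assumes "comm_ring_hom h" "finite A" "Poly_Mapping.keys p \<subseteq> A"
  shows "peval h \<sigma> p = (\<Sum>m\<in>A. h (Poly_Mapping.lookup p m) * mono_eval \<sigma> m)"
proof -
  interpret comm_ring_hom h by fact
  show ?thesis
  unfolding peval_def
  by (rule sum.mono_neutral_left) (use assms in \<open>auto simp: in_keys_iff\<close>)
qed

context
  fixes h :: "'k::field \<Rightarrow> 'a::comm_ring_1"
  assumes h: "comm_ring_hom h"
begin

interpretation h: comm_ring_hom h by (fact h)

lemma peval_zero [simp]: "peval h \<sigma> 0 = 0"
  by (simp add: peval_def)

lemma peval_add: "peval h \<sigma> (p + q) = peval h \<sigma> p + peval h \<sigma> q"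
proof -
  let ?A = "Poly_Mapping.keys p \<union> Poly_Mapping.keys q"
  have "peval h \<sigma> (p + q) = (\<Sum>m\<in>?A. h (Poly_Mapping.lookup (p + q) m) * mono_eval \<sigma> m)"
    by (rule peval_superset[OF h]) (use Poly_Mapping.keys_add[of p q] in auto)
  then show ?thesis
    by (simp add: lookup_add h.hom_add algebra_simps sum.distrib peval_superset[OF h, of ?A])
qed

lemma peval_sum: "peval h \<sigma> (\<Sum>i\<in>A. f i) = (\<Sum>i\<in>A. peval h \<sigma> (f i))"
  by (induction A rule: infinite_finite_induct) (simp_all add: peval_add)

lemma peval_single: "peval h \<sigma> (Poly_Mapping.single m c) = h c * mono_eval \<sigma> m"
  by (cases "c = 0") (simp_all add: peval_def)

lemma peval_mult: "peval h \<sigma> (p * q) = peval h \<sigma> p * peval h \<sigma> q"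
proof -
  have 1: "peval h \<sigma> (Poly_Mapping.single m c * q) = peval h \<sigma> (Poly_Mapping.single m c) * peval h \<sigma> q" for m c
  proof -
    have "Poly_Mapping.single m c * q = (\<Sum>m'\<in>Poly_Mapping.keys q. Poly_Mapping.single m c * Poly_Mapping.single m' (Poly_Mapping.lookup q m'))"
      by (subst (1) sum_monomials[of q, symmetric]) (simp add: sum_distrib_left)
    then show ?thesis
      by (simp add: peval_sum mult_single peval_single mono_eval_add h.hom_mult)
        (simp add: peval_def sum_distrib_left algebra_simps)
  qed
  have "p * q = (\<Sum>m\<in>Poly_Mapping.keys p. Poly_Mapping.single m (Poly_Mapping.lookup p m) * q)"
    by (subst (1) sum_monomials[of p, symmetric]) (simp add: sum_distrib_right)
  then show ?thesis
    by (simp only: peval_sum 1 peval_single) (simp add: peval_def sum_distrib_right)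
qed

lemma peval_const [simp]: "peval h \<sigma> (const c) = h c"
  by (simp add: const_def peval_single)

lemma peval_one [simp]: "peval h \<sigma> 1 = 1"
  using peval_const[of \<sigma> 1] by simp

lemma peval_var [simp]: "peval h \<sigma> (var x) = \<sigma> x"
  by (simp add: var_def peval_single mono_eval_single)

lemma peval_hom: "comm_ring_hom (peval h \<sigma>)"
  by unfold_locales (simp_all add: peval_add peval_mult)

lemma peval_uminus: "peval h \<sigma> (- p) = - peval h \<sigma> p"
  using peval_add[of \<sigma> p "-p"] by (simp add: eq_neg_iff_add_eq_0 add.commute)

lemma peval_diff: "peval h \<sigma> (p - q) = peval h \<sigma> p - peval h \<sigma> q"
  using peval_add[of \<sigma> p "-q"] by (simp add: peval_uminus)

lemma peval_power: "peval h \<sigma> (p ^ n) = peval h \<sigma> p ^ n"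
  by (induction n) (simp_all add: peval_mult)

lemma peval_numeral [simp]: "peval h \<sigma> (numeral w) = numeral w"
proof -
  interpret g: comm_ring_hom "peval h \<sigma>" by (rule peval_hom)
  have "peval h \<sigma> (of_nat n) = of_nat n" for n
    by (induction n) (simp_all add: peval_add)
  from this[of "numeral w"] show ?thesis by (simp only: of_nat_numeral)
qed

lemma peval_prod: "peval h \<sigma> (\<Prod>i\<in>A. f i) = (\<Prod>i\<in>A. peval h \<sigma> (f i))"
  by (induction A rule: infinite_finite_induct) (simp_all add: peval_mult)

lemma peval_mono_eval: "peval h \<sigma> (mono_eval \<tau> m) = mono_eval (\<lambda>x. peval h \<sigma> (\<tau> x)) m"
  by (simp add: mono_eval_def peval_prod peval_power)

lemma peval_substitute: "peval h \<sigma> (substitute \<tau> p) = peval h (\<lambda>x. peval h \<sigma> (\<tau> x)) p"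
  by (simp add: substitute_peval peval_def[of const] peval_sum peval_mult peval_mono_eval)
    (simp add: peval_def)

end

lemmas peval_hom_simps = peval_add peval_mult peval_uminus peval_diff peval_power peval_sum

lemma hom_peval:
  assumes "comm_ring_hom g"
  shows "g (peval h \<sigma> p) = peval (\<lambda>c. g (h c)) (\<lambda>x. g (\<sigma> x)) p"
proof -
  interpret comm_ring_hom g by fact
  show ?thesis
    by (simp add: peval_def mono_eval_def hom_distribs)
qed

lemma id_hom: "comm_ring_hom (\<lambda>c::'k::comm_ring_1. c)"
  by unfold_locales auto

lemma to_fract_hom: "comm_ring_hom (to_fract :: 'a::idom \<Rightarrow> 'a fract)"
  by unfold_locales auto

lemma pCons_hom: "comm_ring_hom (\<lambda>c::'a::comm_ring_1. [:c:])"
  by unfold_locales (auto simp: one_pCons)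

lemma poly_hom: "comm_ring_hom (\<lambda>p::'a::comm_ring_1 poly. poly p y)"
  by unfold_locales auto

lemma comp_hom:
  assumes "comm_ring_hom f" "comm_ring_hom g"
  shows "comm_ring_hom (\<lambda>x. f (g x))"
proof -
  interpret f: comm_ring_hom f by fact
  interpret g: comm_ring_hom g by fact
  show ?thesis by unfold_locales (auto simp: hom_distribs)
qed

lemma substitute_var [simp]: "substitute var p = p"
proof -
  have "substitute var p = (\<Sum>m\<in>Poly_Mapping.keys p. Poly_Mapping.single m (Poly_Mapping.lookup p m))"
    by (simp add: substitute_peval peval_def flip: single_eq_mono_eval single_eq_const_mult)
  then show ?thesis by (simp add: sum_monomials)
qed

subsection \<open>The rings of polynomials in the first variables\<close>

lemma PA_iff: "p \<in> PA n \<longleftrightarrow> (\<forall>m\<in>Poly_Mapping.keys p. Poly_Mapping.keys m \<subseteq> {..<n})"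
  by (simp add: poly_alg_def)

lemma poly_alg_simps [simp]:
  "x \<otimes>\<^bsub>poly_alg n\<^esub> y = x * y" "x \<oplus>\<^bsub>poly_alg n\<^esub> y = x + y"
  "\<one>\<^bsub>poly_alg n\<^esub> = 1" "\<zero>\<^bsub>poly_alg n\<^esub> = 0" "c \<odot>\<^bsub>poly_alg n\<^esub> y = const c * y"
  by (simp_all add: poly_alg_def)

lemma PA_zero [simp]: "0 \<in> PA n" and PA_one [simp]: "1 \<in> PA n"
  and PA_const [simp]: "const c \<in> PA n"
  by (simp_all add: PA_iff const_def)

lemma PA_numeral [simp]: "numeral w \<in> PA n"
  using PA_const[of "numeral w" n] by simp

lemma PA_var [simp]: "var x \<in> PA n \<longleftrightarrow> x < n"
  by (simp add: PA_iff var_def)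

lemma PA_add [intro]: "p \<in> PA n \<Longrightarrow> q \<in> PA n \<Longrightarrow> p + q \<in> PA n"
  using Poly_Mapping.keys_add[of p q] unfolding PA_iff by blast

lemma PA_uminus [intro]: "p \<in> PA n \<Longrightarrow> - p \<in> PA n"
  by (simp add: PA_iff in_keys_iff)

lemma PA_diff [intro]: "p \<in> PA n \<Longrightarrow> q \<in> PA n \<Longrightarrow> p - q \<in> PA n"
  using PA_add[of p n "- q"] by (simp add: PA_uminus)

lemma PA_mult [intro]:
  assumes "p \<in> PA n" "q \<in> PA n" shows "p * q \<in> PA n"
  unfolding PA_iff
proof
  fix m assume "m \<in> Poly_Mapping.keys (p * q)"
  then obtain a b where "a \<in> Poly_Mapping.keys p" "b \<in> Poly_Mapping.keys q" "m = a + b"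
    using Poly_Mapping.keys_mult[of p q] by auto
  then show "Poly_Mapping.keys m \<subseteq> {..<n}"
    using assms Poly_Mapping.keys_add[of a b] unfolding PA_iff by blast
qed

lemma PA_power [intro]: "p \<in> PA n \<Longrightarrow> p ^ e \<in> PA n"
  by (induction e) (auto intro: PA_mult)

lemma PA_sum [intro]: "(\<And>i. i \<in> A \<Longrightarrow> f i \<in> PA n) \<Longrightarrow> sum f A \<in> PA n"
  by (induction A rule: infinite_finite_induct) auto

lemma PA_prod [intro]: "(\<And>i. i \<in> A \<Longrightarrow> f i \<in> PA n) \<Longrightarrow> prod f A \<in> PA n"
  by (induction A rule: infinite_finite_induct) (auto intro: PA_mult)

lemma PA_single: "Poly_Mapping.single m c \<in> PA n" if "Poly_Mapping.keys m \<subseteq> {..<n}"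
  using that by (simp add: PA_iff)

lemma PA_substitute:
  assumes "p \<in> PA n" "\<And>x. x < n \<Longrightarrow> \<sigma> x \<in> PA l"
  shows "substitute \<sigma> p \<in> PA l"
  unfolding substitute_peval peval_def mono_eval_def
  by (intro PA_sum PA_mult PA_const PA_prod PA_power assms(2)) (use assms(1) in \<open>auto simp: PA_iff\<close>)

lemma peval_cong:
  assumes "p \<in> PA n" "\<And>x. x < n \<Longrightarrow> \<sigma> x = \<tau> x"
  shows "peval h \<sigma> p = peval h \<tau> p"
  unfolding peval_def mono_eval_def
  by (intro sum.cong prod.cong refl arg_cong2[where f = "(*)"] arg_cong2[where f = "(^)"] assms(2))
    (use assms(1) in \<open>auto simp: PA_iff\<close>)

lemma PA_exists: "\<exists>n. (p :: 'k::field mpoly) \<in> PA n"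
proof -
  have "finite (\<Union>m\<in>Poly_Mapping.keys p. Poly_Mapping.keys m)" by simp
  then obtain n where "\<forall>x\<in>(\<Union>m\<in>Poly_Mapping.keys p. Poly_Mapping.keys m). x < n"
    using finite_nat_set_iff_bounded by blast
  then have "p \<in> PA n" by (auto simp: PA_iff)
  then show ?thesis ..
qed

subsection \<open>Polynomials over an infinite field are determined by their values\<close>

text \<open>Expansions to base \<open>N\<close> with \<open>n\<close> digits, in preparation for Kronecker's substitution.\<close>

lemma radix_less:
  assumes "\<And>x. x < n \<Longrightarrow> f x < (N::nat)"
  shows "(\<Sum>x<n. f x * N ^ x) < N ^ n"
  using assms
proof (induction n)
  case (Suc n)
  have "(\<Sum>x<n. f x * N ^ x) < N ^ n" using Suc by simp
  moreover have "(f n + 1) * N ^ n \<le> N * N ^ n"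
    by (intro mult_right_mono) (use Suc.prems[of n] in auto)
  ultimately show ?case by (simp add: algebra_simps)
qed simp

lemma radix_inj:
  assumes "\<And>x. x < n \<Longrightarrow> f x < (N::nat)" "\<And>x. x < n \<Longrightarrow> g x < N"
    and "(\<Sum>x<n. f x * N ^ x) = (\<Sum>x<n. g x * N ^ x)" "x < n"
  shows "f x = g x"
  using assms
proof (induction n)
  case (Suc n)
  let ?F = "\<Sum>x<n. f x * N ^ x" and ?G = "\<Sum>x<n. g x * N ^ x"
  have F: "?F < N ^ n" and G: "?G < N ^ n"
    using Suc.prems by (auto intro!: radix_less)
  have eq: "?F + f n * N ^ n = ?G + g n * N ^ n"
    using Suc.prems(3) by simp
  have "N \<noteq> 0" using Suc.prems(1)[of n] by auto
  then have "f n = (?F + f n * N ^ n) div N ^ n" using F by (simp add: div_mult_self1)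
  also have "\<dots> = g n" using G \<open>N \<noteq> 0\<close> by (subst eq) (simp add: div_mult_self1)
  finally have fg: "f n = g n" .
  then have "?F = ?G" using eq by simp
  then show ?case using Suc.IH Suc.prems fg by (cases "x = n") auto
qed simp

text \<open>Kronecker's substitution \<open>x \<mapsto> t\<^bsup>N\<^sup>x\<^esup>\<close> separates the monomials with exponents below \<open>N\<close>.\<close>

lemma ev_all_zero_imp_zero:
  fixes p :: "'k::field mpoly"
  assumes inf: "infinite (UNIV :: 'k set)" and 0: "\<And>\<sigma>. ev \<sigma> p = 0"
  shows "p = 0"
proof (rule ccontr)
  assume "p \<noteq> 0"
  then obtain m0 where m0: "m0 \<in> Poly_Mapping.keys p"
    by (metis sum_monomials sum.empty ex_in_conv)
  obtain n where n: "p \<in> PA n" using PA_exists by blast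
  have "finite (\<Union>m\<in>Poly_Mapping.keys p. Poly_Mapping.lookup m ` Poly_Mapping.keys m)" by simp
  then obtain N where "\<forall>y\<in>(\<Union>m\<in>Poly_Mapping.keys p. Poly_Mapping.lookup m ` Poly_Mapping.keys m). y < N"
    using finite_nat_set_iff_bounded by blast
  then have N: "Poly_Mapping.lookup m x < Suc N" if "m \<in> Poly_Mapping.keys p" for m x
    using that by (cases "x \<in> Poly_Mapping.keys m") (auto simp: in_keys_iff less_Suc_eq)
  define code where "code m = (\<Sum>x<n. Poly_Mapping.lookup m x * Suc N ^ x)" for m
  have inj: "inj_on code (Poly_Mapping.keys p)"
  proof (rule inj_onI, rule poly_mapping_eqI)
    fix m m' x assume m: "m \<in> Poly_Mapping.keys p" "m' \<in> Poly_Mapping.keys p" "code m = code m'"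
    show "Poly_Mapping.lookup m x = Poly_Mapping.lookup m' x"
    proof (cases "x < n")
      case True
      show ?thesis by (rule radix_inj[of n _ "Suc N"]) (use m N True in \<open>auto simp: code_def\<close>)
    next
      case False
      then have "x \<notin> Poly_Mapping.keys m" "x \<notin> Poly_Mapping.keys m'"
        using m n by (auto simp: PA_iff)
      then show ?thesis by (simp add: in_keys_iff)
    qed
  qed
  define F where "F = (\<Sum>m\<in>Poly_Mapping.keys p. monom (Poly_Mapping.lookup p m) (code m))"
  have "coeff F (code m0) = (\<Sum>m\<in>Poly_Mapping.keys p. if m = m0 then Poly_Mapping.lookup p m else 0)"
    unfolding F_def coeff_sum
    by (rule sum.cong) (use inj m0 in \<open>auto simp: inj_on_def\<close>)
  then have "coeff F (code m0) \<noteq> 0" using m0 by (simp add: in_keys_iff)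
  then have "F \<noteq> 0" by auto
  moreover have "poly F t = 0" for t
  proof -
    have "mono_eval (\<lambda>x. t ^ (Suc N ^ x)) m = t ^ code m" if "m \<in> Poly_Mapping.keys p" for m
    proof -
      have "mono_eval (\<lambda>x. t ^ (Suc N ^ x)) m = (\<Prod>x<n. (t ^ (Suc N ^ x)) ^ Poly_Mapping.lookup m x)"
        by (rule mono_eval_superset) (use that n in \<open>auto simp: PA_iff\<close>)
      also have "\<dots> = t ^ code m"
        by (simp add: code_def power_sum mult.commute flip: power_mult)
      finally show ?thesis .
    qed
    then have "ev (\<lambda>x. t ^ (Suc N ^ x)) p = poly F t"
      by (simp add: peval_def F_def poly_sum poly_monom)
    then show ?thesis using 0 by simp
  qed
  then have "{t. poly F t = 0} = UNIV" by auto
  ultimately show False using poly_roots_finite[of F] inf by simp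
qed

lemma ev_eqI:
  fixes p q :: "'k::field mpoly"
  assumes "infinite (UNIV :: 'k set)" "\<And>\<sigma>. ev \<sigma> p = ev \<sigma> q"
  shows "p = q"
  using ev_all_zero_imp_zero[of "p - q"] assms by (simp add: peval_diff[OF id_hom])

lemma ev_poly_in_one_variable:
  fixes E :: "'k::field mpoly"
  shows "\<exists>F. \<forall>y. ev (x(v := y)) E = poly F y"
proof (intro exI allI)
  fix y
  show "ev (x(v := y)) E = poly (peval (\<lambda>c. [:c:]) (\<lambda>z. if z = v then [:0, 1:] else [:x z:]) E) y"
    unfolding hom_peval[OF poly_hom] by (auto intro!: arg_cong2[where f = "\<lambda>a b. peval a b E"])
qed

text \<open>Restricted to a line parallel to a coordinate axis, a polynomial is a polynomial in one
  variable, which has only finitely many roots unless it vanishes.\<close>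

lemma ev_zero_if_infinitely_many:
  fixes E :: "'k::field mpoly"
  assumes "infinite {y. ev (x(v := y)) E = 0}"
  shows "ev x E = 0"
proof -
  obtain F where F: "\<And>y. ev (x(v := y)) E = poly F y"
    using ev_poly_in_one_variable by blast
  have "F = 0"
    using assms poly_roots_finite[of F] unfolding F by auto
  then show ?thesis using F[of "x v"] by simp
qed

text \<open>The complement of a hypersurface is dense: \<open>E H\<close> vanishes everywhere.\<close>

lemma ev_zero_if_dense:
  fixes E H :: "'k::field mpoly"
  assumes "infinite (UNIV :: 'k set)" "H \<noteq> 0" "\<And>x. ev x H \<noteq> 0 \<Longrightarrow> ev x E = 0"
  shows "E = 0"
proof -
  have "E * H = 0"
    by (rule ev_all_zero_imp_zero[OF assms(1)]) (use assms(3) in \<open>auto simp: peval_mult[OF id_hom]\<close>)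
  then show ?thesis using assms(2) by simp
qed

section \<open>Integral spaces of fractions\<close>

text \<open>Coordinate rings and rings of sections are recognised as domains through their embeddings into a function
  field.\<close>

lemma domain_if_embeds:
  fixes R :: "('a, 'm) ring_scheme" (structure) and \<iota> :: "'a \<Rightarrow> 'f::field"
  assumes inj: "inj_on \<iota> (carrier R)"
    and z: "\<zero> \<in> carrier R" "\<iota> \<zero> = 0" and o: "\<one> \<in> carrier R" "\<iota> \<one> = 1"
    and a: "\<And>a b. a \<in> carrier R \<Longrightarrow> b \<in> carrier R \<Longrightarrow> a \<oplus> b \<in> carrier R \<and> \<iota> (a \<oplus> b) = \<iota> a + \<iota> b"
    and m: "\<And>a b. a \<in> carrier R \<Longrightarrow> b \<in> carrier R \<Longrightarrow> a \<otimes> b \<in> carrier R \<and> \<iota> (a \<otimes> b) = \<iota> a * \<iota> b"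
    and n: "\<And>a. a \<in> carrier R \<Longrightarrow> \<exists>b\<in>carrier R. \<iota> b = - \<iota> a"
  shows "domain R"
proof -
  have eq: "x = y" if "x \<in> carrier R" "y \<in> carrier R" "\<iota> x = \<iota> y" for x y
    using inj that by (auto simp: inj_on_def)
  have "abelian_group R"
  proof (rule abelian_groupI)
    fix x assume x: "x \<in> carrier R"
    then obtain y where "y \<in> carrier R" "\<iota> y = - \<iota> x" using n by blast
    then show "\<exists>y\<in>carrier R. y \<oplus> x = \<zero>"
      by (intro bexI[of _ y] eq) (auto simp: a x z)
  qed (auto intro!: eq simp: a z algebra_simps)
  moreover have "comm_monoid R"
    by (rule comm_monoidI) (auto intro!: eq simp: m o algebra_simps)
  ultimately have "cring R"
    by (rule cringI) (auto intro!: eq simp: a m algebra_simps)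
  then show ?thesis
  proof (intro domain.intro domain_axioms.intro)
    show "\<one> \<noteq> \<zero>" using z o by (metis zero_neq_one)
    fix x y assume "x \<otimes> y = \<zero>" "x \<in> carrier R" "y \<in> carrier R"
    then show "x = \<zero> \<or> y = \<zero>"
      using m[of x y] z eq[of x \<zero>] eq[of y \<zero>] by (metis mult_eq_0_iff)
  qed
qed

text \<open>The sets \<open>D(f)\<close> form a basis, not only a subbasis, since \<open>D(f) \<inter> D(g) = D(f g)\<close> on primes.\<close>

lemma openin_zariski:
  fixes R :: "('k, 'a) module" (structure)
  assumes R: "cring R" and P: "\<And>p. p \<in> P \<Longrightarrow> primeideal p R"
  shows "openin (zariski R P) U \<longleftrightarrow>
    U \<subseteq> P \<and> (\<forall>p\<in>U. \<exists>f\<in>carrier R. f \<notin> p \<and> {q \<in> P. f \<notin> q} \<subseteq> U)"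
proof -
  interpret cring R by (rule R)
  let ?B = "(\<lambda>f. {p \<in> P. f \<notin> p}) ` carrier R"
  show ?thesis
  proof
  assume "openin (zariski R P) U"
  then have "generate_topology_on ?B U"
    by (simp add: zariski_def openin_topology_generated_by_iff)
  then show "U \<subseteq> P \<and> (\<forall>p\<in>U. \<exists>f\<in>carrier R. f \<notin> p \<and> {q \<in> P. f \<notin> q} \<subseteq> U)"
  proof induction
    case (Int a b)
    show ?case
    proof (intro conjI ballI)
      fix p assume p: "p \<in> a \<inter> b"
      obtain f where f: "f \<in> carrier R" "f \<notin> p" "{q \<in> P. f \<notin> q} \<subseteq> a" using Int p by blast
      obtain g where g: "g \<in> carrier R" "g \<notin> p" "{q \<in> P. g \<notin> q} \<subseteq> b" using Int p by blast
      have pP: "primeideal p R" using Int p P by blast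
      have "f \<otimes> g \<notin> p" using primeideal.I_prime[OF pP f(1) g(1)] f g by blast
      moreover have "{q \<in> P. f \<otimes> g \<notin> q} \<subseteq> a \<inter> b"
      proof
        fix q assume q: "q \<in> {q \<in> P. f \<otimes> g \<notin> q}"
        then have "ideal q R" using P primeideal.axioms(1) by blast
        then have "f \<notin> q" "g \<notin> q"
          using q f(1) g(1) ideal.I_r_closed ideal.I_l_closed by fastforce+
        then show "q \<in> a \<inter> b" using f g q by blast
      qed
      ultimately show "\<exists>f\<in>carrier R. f \<notin> p \<and> {q \<in> P. f \<notin> q} \<subseteq> a \<inter> b"
        using f g by (intro bexI[of _ "f \<otimes> g"]) auto
    qed (use Int in blast)
  next
    case (UN K)
    show ?case
    proof (intro conjI ballI)
      show "\<Union> K \<subseteq> P" using UN by blast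
      fix p assume "p \<in> \<Union> K"
      then obtain k where k: "k \<in> K" "p \<in> k" by blast
      then obtain f where "f \<in> carrier R" "f \<notin> p" "{q \<in> P. f \<notin> q} \<subseteq> k" using UN by blast
      then show "\<exists>f\<in>carrier R. f \<notin> p \<and> {q \<in> P. f \<notin> q} \<subseteq> \<Union> K" using k by blast
    qed
  qed auto
next
  assume R: "U \<subseteq> P \<and> (\<forall>p\<in>U. \<exists>f\<in>carrier R. f \<notin> p \<and> {q \<in> P. f \<notin> q} \<subseteq> U)"
  show "openin (zariski R P) U"
  proof (subst openin_subopen, intro ballI)
    fix p assume p: "p \<in> U"
    then obtain f where f: "f \<in> carrier R" "f \<notin> p" "{q \<in> P. f \<notin> q} \<subseteq> U" using R by blast
    have "openin (zariski R P) {q \<in> P. f \<notin> q}"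
      unfolding zariski_def by (rule topology_generated_by_Basis) (use f in auto)
    then show "\<exists>T. openin (zariski R P) T \<and> p \<in> T \<and> T \<subseteq> U" using f p R by blast
  qed
  qed
qed

lemma topspace_zariski:
  fixes R :: "('k, 'a) module" (structure)
  assumes R: "cring R" and P: "\<And>p. p \<in> P \<Longrightarrow> primeideal p R"
  shows "topspace (zariski R P) = P"
proof -
  interpret cring R by (rule R)
  have one: "\<one> \<notin> p" if "p \<in> P" for p
    using primeideal.I_notcarr[OF P[OF that]] ideal.one_imp_carrier[OF primeideal.axioms(1)[OF P[OF that]]]
    by blast
  have "openin (zariski R P) P"
    by (subst openin_zariski[OF R]) (use P one in \<open>auto intro!: bexI[of _ \<one>]\<close>)
  moreover have "topspace (zariski R P) \<subseteq> P"
    using openin_zariski[OF R, of P "topspace (zariski R P)"] P by simp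
  ultimately show ?thesis by (simp add: openin_subset subset_antisym)
qed

subsection \<open>Sections as elements of the function field\<close>

text \<open>A fraction, as an equivalence class of pairs, is determined by its value \<open>x\<close> in the function
  field; the class is \<open>stalk \<iota> D p x\<close>.\<close>

definition stalk :: "('a \<Rightarrow> 'f::field) \<Rightarrow> ('a set \<Rightarrow> ('a \<times> 'a) set) \<Rightarrow> 'a set \<Rightarrow> 'f \<Rightarrow> ('a \<times> 'a) set" where
  "stalk \<iota> D p x = {(a, s) \<in> D p. \<iota> a / \<iota> s = x}"

definition local_ring :: "('a \<Rightarrow> 'f::field) \<Rightarrow> ('a set \<Rightarrow> ('a \<times> 'a) set) \<Rightarrow> 'a set \<Rightarrow> 'f set" where
  "local_ring \<iota> D p = {\<iota> a / \<iota> s |a s. (a, s) \<in> D p}"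

definition const_section ::
    "('a \<Rightarrow> 'f::field) \<Rightarrow> ('a set \<Rightarrow> ('a \<times> 'a) set) \<Rightarrow> 'a set set \<Rightarrow> 'f \<Rightarrow> 'a set \<Rightarrow> ('a \<times> 'a) set" where
  "const_section \<iota> D U x = (\<lambda>p\<in>U. stalk \<iota> D p x)"

definition regular :: "('a \<Rightarrow> 'f::field) \<Rightarrow> ('a set \<Rightarrow> ('a \<times> 'a) set) \<Rightarrow> 'a set set \<Rightarrow> 'f set" where
  "regular \<iota> D U = {x. \<forall>p\<in>U. x \<in> local_ring \<iota> D p}"

lemma stalk_inj:
  assumes "x \<in> local_ring \<iota> D p" "stalk \<iota> D p x = stalk \<iota> D p y" shows "x = y"
proof -
  obtain a s where "(a, s) \<in> D p" "x = \<iota> a / \<iota> s" using assms(1) by (auto simp: local_ring_def)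
  then have "(a, s) \<in> stalk \<iota> D p x" by (simp add: stalk_def)
  then have "(a, s) \<in> stalk \<iota> D p y" using assms(2) by simp
  then show ?thesis using \<open>x = _\<close> by (simp add: stalk_def)
qed

lemma const_section_inj:
  assumes "x \<in> regular \<iota> D U" "const_section \<iota> D U x = const_section \<iota> D U y" "U \<noteq> {}"
  shows "x = y"
proof -
  obtain p where p: "p \<in> U" using assms(3) by blast
  then have "stalk \<iota> D p x = stalk \<iota> D p y"
    using fun_cong[OF assms(2), of p] by (simp add: const_section_def)
  moreover have "x \<in> local_ring \<iota> D p" using assms(1) p by (simp add: regular_def)
  ultimately show ?thesis by (rule stalk_inj[rotated])
qed

lemma restrict_const_section:
  "W \<subseteq> U \<Longrightarrow> restrict (const_section \<iota> D U x) W = const_section \<iota> D W x"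
  by (auto simp: const_section_def fun_eq_iff)

lemma const_section_empty [simp]: "const_section \<iota> D {} x = (\<lambda>p. undefined)"
  by (auto simp: const_section_def)

text \<open>An integral domain that is a \<open>k\<close>-algebra, given with an embedding into a field.  The
  assumptions are stated elementwise so that they can be checked for rings whose elements are
  residue classes or sections of a sheaf.\<close>

locale frac_embed =
  fixes R :: "('k::field, 'a) module" (structure) and \<iota> :: "'a \<Rightarrow> 'f::field" and \<kappa> :: "'k \<Rightarrow> 'f"
  assumes inj: "inj_on \<iota> (carrier R)"
    and zero_closed: "\<zero> \<in> carrier R" and \<iota>_zero: "\<iota> \<zero> = 0"
    and one_closed: "\<one> \<in> carrier R" and \<iota>_one: "\<iota> \<one> = 1"
    and add_closed: "a \<in> carrier R \<Longrightarrow> b \<in> carrier R \<Longrightarrow> a \<oplus> b \<in> carrier R"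
    and \<iota>_add: "a \<in> carrier R \<Longrightarrow> b \<in> carrier R \<Longrightarrow> \<iota> (a \<oplus> b) = \<iota> a + \<iota> b"
    and mult_closed: "a \<in> carrier R \<Longrightarrow> b \<in> carrier R \<Longrightarrow> a \<otimes> b \<in> carrier R"
    and \<iota>_mult: "a \<in> carrier R \<Longrightarrow> b \<in> carrier R \<Longrightarrow> \<iota> (a \<otimes> b) = \<iota> a * \<iota> b"
    and neg_ex: "a \<in> carrier R \<Longrightarrow> \<exists>b\<in>carrier R. \<iota> b = - \<iota> a"
    and smult_closed: "a \<in> carrier R \<Longrightarrow> c \<odot> a \<in> carrier R"
    and \<iota>_smult: "a \<in> carrier R \<Longrightarrow> \<iota> (c \<odot> a) = \<kappa> c * \<iota> a"
    and \<kappa>_neg_one: "\<kappa> (- 1) = - 1"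
begin

lemma is_domain: "domain R"
  by (rule domain_if_embeds[of \<iota>])
    (use inj zero_closed \<iota>_zero one_closed \<iota>_one add_closed \<iota>_add mult_closed \<iota>_mult neg_ex in auto)

sublocale dom: domain R by (rule is_domain)

lemma eqI: "x \<in> carrier R \<Longrightarrow> y \<in> carrier R \<Longrightarrow> \<iota> x = \<iota> y \<Longrightarrow> x = y"
  using inj by (auto simp: inj_on_def)

lemma \<iota>_eq_0_iff: "x \<in> carrier R \<Longrightarrow> \<iota> x = 0 \<longleftrightarrow> x = \<zero>"
  using eqI[of x \<zero>] \<iota>_zero zero_closed by auto

lemma \<iota>_minus: "x \<in> carrier R \<Longrightarrow> \<iota> (\<ominus> x) = - \<iota> x"
proof -
  assume x: "x \<in> carrier R"
  then have "\<iota> (x \<oplus> \<ominus> x) = 0" by (simp only: dom.r_neg \<iota>_zero)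
  then have "\<iota> x + \<iota> (\<ominus> x) = 0" using \<iota>_add[of x "\<ominus> x"] x by simp
  then show ?thesis by (simp add: add_eq_0_iff)
qed

lemma primeideal_zero: "primeideal {\<zero>} R"
  by (rule dom.zeroprimeideal)

end

text \<open>A common frame for \<open>Spec\<close> and \<open>Proj\<close>: a set of primes that contains the zero ideal, with the
  pairs admissible at \<open>p\<close> cut out of one fixed set \<open>E\<close> by the condition that the denominator is not in \<open>p\<close>.
  Having the generic point in \<open>P\<close> is what makes sections elements of the function field.\<close>

locale integral_frac_space = frac_embed R \<iota> \<kappa>
  for R :: "('k::field, 'a) module" (structure) and \<iota> :: "'a \<Rightarrow> 'f::field" and \<kappa> :: "'k \<Rightarrow> 'f" +
  fixes P :: "'a set set" and D :: "'a set \<Rightarrow> ('a \<times> 'a) set" and E :: "('a \<times> 'a) set"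
  assumes primes: "p \<in> P \<Longrightarrow> primeideal p R"
    and zero_in_P: "{\<zero>} \<in> P"
    and D_eq: "p \<in> P \<Longrightarrow> D p = {(a, s) \<in> E. s \<notin> p}"
    and E_sub: "E \<subseteq> carrier R \<times> carrier R"
    and E_add: "(a, s) \<in> E \<Longrightarrow> (b, t) \<in> E \<Longrightarrow> ((t \<otimes> a) \<oplus> (s \<otimes> b), s \<otimes> t) \<in> E"
    and E_mult: "(a, s) \<in> E \<Longrightarrow> (b, t) \<in> E \<Longrightarrow> (a \<otimes> b, s \<otimes> t) \<in> E"
    and E_smult: "(a, s) \<in> E \<Longrightarrow> (c \<odot> a, s) \<in> E"
    and E_one: "(\<one>, \<one>) \<in> E" and E_zero: "(\<zero>, \<one>) \<in> E"
begin

abbreviation "loc \<equiv> local_ring \<iota> D"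
abbreviation "sec \<equiv> const_section \<iota> D"
abbreviation "reg \<equiv> regular \<iota> D"
abbreviation "X \<equiv> frac_space R P D"

lemma D_carrier: "p \<in> P \<Longrightarrow> (a, s) \<in> D p \<Longrightarrow> a \<in> carrier R \<and> s \<in> carrier R \<and> s \<notin> p \<and> \<iota> s \<noteq> 0 \<and> (a, s) \<in> E"
proof -
  assume p: "p \<in> P" "(a, s) \<in> D p"
  then have as: "a \<in> carrier R" "s \<in> carrier R" "s \<notin> p" "(a, s) \<in> E" using D_eq E_sub by auto
  have "ideal p R" using primes p(1) primeideal.axioms(1) by blast
  then have "s \<noteq> \<zero>" using as(3) by (metis additive_subgroup.zero_closed ideal.axioms(1))
  then show ?thesis using as \<iota>_eq_0_iff by auto
qed

lemma one_notin: "p \<in> P \<Longrightarrow> \<one> \<notin> p"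
  using primes primeideal.I_notcarr ideal.one_imp_carrier primeideal.axioms(1) by metis

lemma D_mult:
  assumes "p \<in> P" "(a, s) \<in> D p" "(b, t) \<in> D p"
  shows "(a \<otimes> b, s \<otimes> t) \<in> D p" "((t \<otimes> a) \<oplus> (s \<otimes> b), s \<otimes> t) \<in> D p"
proof -
  have "s \<otimes> t \<notin> p"
    using primeideal.I_prime[OF primes[OF assms(1)], of s t] D_carrier[OF assms(1,2)] D_carrier[OF assms(1,3)] by blast
  then show "(a \<otimes> b, s \<otimes> t) \<in> D p" "((t \<otimes> a) \<oplus> (s \<otimes> b), s \<otimes> t) \<in> D p"
    using assms D_eq E_mult E_add by auto
qed

text \<open>In a domain the auxiliary factor \<open>u\<close> in the equality of fractions can be cancelled, so the
  class of \<open>(a, s)\<close> consists of the pairs with the same value in the function field.\<close>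

lemma fraction_eq:
  assumes p: "p \<in> P" and as: "(a, s) \<in> D p"
  shows "fraction R (D p) a s = stalk \<iota> D p (\<iota> a / \<iota> s)"
proof -
  have "(\<exists>u\<in>snd ` D p. u \<otimes> (t \<otimes> a) = u \<otimes> (s \<otimes> b)) \<longleftrightarrow> \<iota> b / \<iota> t = \<iota> a / \<iota> s" if bt: "(b, t) \<in> D p" for b t
  proof -
    note A = D_carrier[OF p as] and B = D_carrier[OF p bt]
    have "u \<otimes> (t \<otimes> a) = u \<otimes> (s \<otimes> b) \<longleftrightarrow> \<iota> b / \<iota> t = \<iota> a / \<iota> s" if "u \<in> snd ` D p" for u
    proof -
      have u: "u \<in> carrier R" "\<iota> u \<noteq> 0" using that D_carrier[OF p] by auto
      have "u \<otimes> (t \<otimes> a) = u \<otimes> (s \<otimes> b) \<longleftrightarrow> \<iota> (u \<otimes> (t \<otimes> a)) = \<iota> (u \<otimes> (s \<otimes> b))"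
      proof -
        have "u \<otimes> (t \<otimes> a) \<in> carrier R" "u \<otimes> (s \<otimes> b) \<in> carrier R" using A B u by simp_all
        from inj_on_eq_iff[OF inj this] show ?thesis by simp
      qed
      also have "\<dots> \<longleftrightarrow> \<iota> t * \<iota> a = \<iota> s * \<iota> b"
        using A B u by (simp add: \<iota>_mult)
      also have "\<dots> \<longleftrightarrow> \<iota> b / \<iota> t = \<iota> a / \<iota> s"
        using A B by (auto simp: frac_eq_eq mult.commute)
      finally show ?thesis .
    qed
    moreover have "s \<in> snd ` D p" using as by force
    ultimately show ?thesis by blast
  qed
  then show ?thesis unfolding fraction_def stalk_def by auto
qed

lemma loc_memE:
  assumes "x \<in> loc p" obtains a s where "(a, s) \<in> D p" "x = \<iota> a / \<iota> s"
  using assms by (auto simp: local_ring_def)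

lemma loc_memI: "(a, s) \<in> D p \<Longrightarrow> \<iota> a / \<iota> s \<in> loc p"
  by (auto simp: local_ring_def)

lemma frac_mult_eq:
  assumes p: "p \<in> P" and "x \<in> loc p" "y \<in> loc p"
  shows "frac_mult R (D p) (stalk \<iota> D p x) (stalk \<iota> D p y) = stalk \<iota> D p (x * y)"
    and "frac_add R (D p) (stalk \<iota> D p x) (stalk \<iota> D p y) = stalk \<iota> D p (x + y)"
    and "x * y \<in> loc p" and "x + y \<in> loc p"
proof -
  have *: "fraction R (D p) (a \<otimes> b) (s \<otimes> t) = stalk \<iota> D p (x * y) \<and>
      fraction R (D p) ((t \<otimes> a) \<oplus> (s \<otimes> b)) (s \<otimes> t) = stalk \<iota> D p (x + y) \<and> x * y \<in> loc p \<and> x + y \<in> loc p"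
    if "(a, s) \<in> stalk \<iota> D p x" "(b, t) \<in> stalk \<iota> D p y" for a s b t
  proof -
    have as: "(a, s) \<in> D p" "x = \<iota> a / \<iota> s" and bt: "(b, t) \<in> D p" "y = \<iota> b / \<iota> t"
      using that by (auto simp: stalk_def)
    note A = D_carrier[OF p as(1)] and B = D_carrier[OF p bt(1)]
    have 1: "\<iota> (a \<otimes> b) / \<iota> (s \<otimes> t) = x * y"
      using A B by (simp add: \<iota>_mult as bt)
    have 2: "\<iota> ((t \<otimes> a) \<oplus> (s \<otimes> b)) / \<iota> (s \<otimes> t) = x + y"
      using A B by (simp add: \<iota>_mult \<iota>_add mult_closed as bt field_simps)
    show ?thesis
      using fraction_eq[OF p D_mult(1)[OF p as(1) bt(1)]] fraction_eq[OF p D_mult(2)[OF p as(1) bt(1)]]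
        loc_memI[OF D_mult(1)[OF p as(1) bt(1)]] loc_memI[OF D_mult(2)[OF p as(1) bt(1)]] 1 2 by simp
  qed
  have "stalk \<iota> D p x \<noteq> {}" "stalk \<iota> D p y \<noteq> {}"
    using assms(2,3) by (auto simp: stalk_def elim!: loc_memE)
  then obtain a s b t where "(a, s) \<in> stalk \<iota> D p x" "(b, t) \<in> stalk \<iota> D p y" by auto
  with * show "frac_mult R (D p) (stalk \<iota> D p x) (stalk \<iota> D p y) = stalk \<iota> D p (x * y)"
    and "frac_add R (D p) (stalk \<iota> D p x) (stalk \<iota> D p y) = stalk \<iota> D p (x + y)"
    and "x * y \<in> loc p" and "x + y \<in> loc p"
    unfolding frac_mult_def frac_add_def by fast+
qed

lemma frac_smult_eq:
  assumes p: "p \<in> P" and "x \<in> loc p"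
  shows "frac_smult R (D p) c (stalk \<iota> D p x) = stalk \<iota> D p (\<kappa> c * x)"
    and "\<kappa> c * x \<in> loc p"
proof -
  have *: "fraction R (D p) (c \<odot> a) s = stalk \<iota> D p (\<kappa> c * x) \<and> \<kappa> c * x \<in> loc p"
    if "(a, s) \<in> stalk \<iota> D p x" for a s
  proof -
    have as: "(a, s) \<in> D p" "x = \<iota> a / \<iota> s" using that by (auto simp: stalk_def)
    have d: "(c \<odot> a, s) \<in> D p" using as(1) D_eq[OF p] E_smult by auto
    show ?thesis using fraction_eq[OF p d] loc_memI[OF d] D_carrier[OF p as(1)] as by (simp add: \<iota>_smult)
  qed
  have "stalk \<iota> D p x \<noteq> {}" using assms(2) by (auto simp: stalk_def elim!: loc_memE)
  then obtain a s where "(a, s) \<in> stalk \<iota> D p x" by auto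
  with * show "frac_smult R (D p) c (stalk \<iota> D p x) = stalk \<iota> D p (\<kappa> c * x)" "\<kappa> c * x \<in> loc p"
    unfolding frac_smult_def by fast+
qed

lemma one_loc: "p \<in> P \<Longrightarrow> 1 \<in> loc p" "p \<in> P \<Longrightarrow> fraction R (D p) \<one> \<one> = stalk \<iota> D p 1"
  and zero_loc: "p \<in> P \<Longrightarrow> 0 \<in> loc p" "p \<in> P \<Longrightarrow> fraction R (D p) \<zero> \<one> = stalk \<iota> D p 0"
proof -
  assume p: "p \<in> P"
  have d: "(\<one>, \<one>) \<in> D p" "(\<zero>, \<one>) \<in> D p" using D_eq[OF p] E_one E_zero one_notin[OF p] by auto
  show "1 \<in> loc p" "fraction R (D p) \<one> \<one> = stalk \<iota> D p 1" "0 \<in> loc p" "fraction R (D p) \<zero> \<one> = stalk \<iota> D p 0"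
    using fraction_eq[OF p d(1)] fraction_eq[OF p d(2)] loc_memI[OF d(1)] loc_memI[OF d(2)]
    by (simp_all add: \<iota>_one \<iota>_zero)
qed

lemma uminus_loc: "p \<in> P \<Longrightarrow> x \<in> loc p \<Longrightarrow> - x \<in> loc p"
  using frac_smult_eq(2)[of p x "- 1"] by (simp add: \<kappa>_neg_one)

lemma openin_iff:
  "openin (topo X) U \<longleftrightarrow> U \<subseteq> P \<and> (\<forall>p\<in>U. \<exists>f\<in>carrier R. f \<notin> p \<and> {q \<in> P. f \<notin> q} \<subseteq> U)"
  unfolding frac_space_def by (simp add: openin_zariski[OF dom.is_cring primes])

lemma points_X: "points X = P"
  unfolding frac_space_def by (simp add: topspace_zariski[OF dom.is_cring primes])

lemma open_subset: "openin (topo X) U \<Longrightarrow> U \<subseteq> P"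
  by (simp add: openin_iff)

lemma generic_point:
  assumes "openin (topo X) U" "U \<noteq> {}" shows "{\<zero>} \<in> U"
proof -
  obtain p where p: "p \<in> U" using assms(2) by blast
  then obtain f where f: "f \<in> carrier R" "f \<notin> p" "{q \<in> P. f \<notin> q} \<subseteq> U"
    using assms(1) by (auto simp: openin_iff)
  have "ideal p R" using primes p open_subset[OF assms(1)] primeideal.axioms(1) by blast
  then have "f \<noteq> \<zero>" using f(2) by (metis additive_subgroup.zero_closed ideal.axioms(1))
  then show ?thesis using f zero_in_P by auto
qed

text \<open>If \<open>x = a / s\<close> at \<open>p\<close>, the same pair is admissible at all points where \<open>s\<close> does not vanish.\<close>

lemma open_loc: "openin (topo X) U \<Longrightarrow> openin (topo X) {p \<in> U. x \<in> loc p}"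
  unfolding openin_iff
proof (intro conjI ballI)
  assume U: "U \<subseteq> P \<and> (\<forall>p\<in>U. \<exists>f\<in>carrier R. f \<notin> p \<and> {q \<in> P. f \<notin> q} \<subseteq> U)"
  then show "{p \<in> U. x \<in> loc p} \<subseteq> P" by blast
  fix p assume p: "p \<in> {p \<in> U. x \<in> loc p}"
  then have pP: "p \<in> P" using U by blast
  obtain f where f: "f \<in> carrier R" "f \<notin> p" "{q \<in> P. f \<notin> q} \<subseteq> U" using U p by blast
  obtain a s where as: "(a, s) \<in> D p" "x = \<iota> a / \<iota> s" using p by (auto elim: loc_memE)
  note A = D_carrier[OF pP as(1)]
  have "f \<otimes> s \<notin> p" using primeideal.I_prime[OF primes[OF pP], of f s] A f by blast
  moreover have "q \<in> U \<and> x \<in> loc q" if "q \<in> P" "f \<otimes> s \<notin> q" for q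
  proof -
    have "ideal q R" using primes that(1) primeideal.axioms(1) by blast
    then have "f \<notin> q" "s \<notin> q" using that(2) ideal.I_r_closed ideal.I_l_closed f(1) A by fastforce+
    then show ?thesis using f(3) that(1) A D_eq[OF that(1)] loc_memI[of a s q] as(2) by auto
  qed
  ultimately show "\<exists>f\<in>carrier R. f \<notin> p \<and> {q \<in> P. f \<notin> q} \<subseteq> {p \<in> U. x \<in> loc p}"
    using f(1) A by (intro bexI[of _ "f \<otimes> s"]) auto
qed

text \<open>Every nonempty open set contains the generic point, so a section is one element of the
  function field; which elements occur is decided by the local rings.\<close>

lemma sections_eq:
  assumes U: "openin (topo X) U"
  shows "carrier (sheaf X U) = sec U ` reg U"
proof
  have UP: "U \<subseteq> P" using open_subset[OF U] .
  show "sec U ` reg U \<subseteq> carrier (sheaf X U)"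
  proof
    fix \<sigma> assume "\<sigma> \<in> sec U ` reg U"
    then obtain x where x: "x \<in> reg U" "\<sigma> = sec U x" by blast
    have "\<exists>V. openin (topo X) V \<and> p \<in> V \<and> V \<subseteq> U \<and>
        (\<exists>a s. \<forall>q\<in>V. (a, s) \<in> D q \<and> \<sigma> q = fraction R (D q) a s)" if p: "p \<in> U" for p
    proof -
      have pP: "p \<in> P" using p UP by blast
      obtain a s where as: "(a, s) \<in> D p" "x = \<iota> a / \<iota> s"
        using x(1) p loc_memE[of x p] unfolding regular_def by blast
      note A = D_carrier[OF pP as(1)]
      have "openin (topo X) {q \<in> P. s \<notin> q}"
        unfolding openin_iff using A by auto
      then have "openin (topo X) (U \<inter> {q \<in> P. s \<notin> q})" using U by blast
      moreover have "(a, s) \<in> D q \<and> \<sigma> q = fraction R (D q) a s" if "q \<in> U \<inter> {q \<in> P. s \<notin> q}" for q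
      proof -
        have "(a, s) \<in> D q" using that A D_eq[of q] by auto
        then show ?thesis using fraction_eq[of q a s] that as(2) x(2) by (simp add: const_section_def)
      qed
      ultimately show ?thesis using p pP A by (intro exI[of _ "U \<inter> {q \<in> P. s \<notin> q}"]) blast
    qed
    moreover have "\<sigma> \<in> extensional U" by (simp add: x(2) const_section_def)
    ultimately show "\<sigma> \<in> carrier (sheaf X U)" by (simp add: frac_space_def)
  qed
  show "carrier (sheaf X U) \<subseteq> sec U ` reg U"
  proof
    fix \<sigma> assume "\<sigma> \<in> carrier (sheaf X U)"
    then have ext: "\<sigma> \<in> extensional U" and L: "\<And>p. p \<in> U \<Longrightarrow> \<exists>V. openin (topo X) V \<and> p \<in> V \<and> V \<subseteq> U \<and>
        (\<exists>a s. \<forall>q\<in>V. (a, s) \<in> D q \<and> \<sigma> q = fraction R (D q) a s)"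
      by (simp_all add: frac_space_def)
    show "\<sigma> \<in> sec U ` reg U"
    proof (cases "U = {}")
      case True
      then have "\<sigma> = sec U 0" using ext by (simp add: extensional_def fun_eq_iff)
      then show ?thesis using True by (auto simp: regular_def)
    next
      case False
      define g where "g = {\<zero>}"
      have g: "g \<in> V" if "openin (topo X) V" "V \<noteq> {}" for V using generic_point that by (simp add: g_def)
      have gU: "g \<in> U" using g U False by blast
      obtain a0 s0 where a0: "(a0, s0) \<in> D g" "\<sigma> g = fraction R (D g) a0 s0"
        using L[OF gU] by blast
      define x where "x = \<iota> a0 / \<iota> s0"
      have gP: "g \<in> P" using gU UP by blast
      have sg: "\<sigma> g = stalk \<iota> D g x" using a0 fraction_eq[OF gP a0(1)] by (simp add: x_def)
      have "x \<in> loc p \<and> \<sigma> p = stalk \<iota> D p x" if p: "p \<in> U" for p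
      proof -
        obtain V a s where V: "openin (topo X) V" "p \<in> V" "V \<subseteq> U"
          "\<And>q. q \<in> V \<Longrightarrow> (a, s) \<in> D q \<and> \<sigma> q = fraction R (D q) a s" using L[OF p] by blast
        have gV: "g \<in> V" using g V(1,2) by blast
        have "\<sigma> g = stalk \<iota> D g (\<iota> a / \<iota> s)" using V(4)[OF gV] fraction_eq[OF gP] by simp
        then have "\<iota> a / \<iota> s = x"
          using stalk_inj[of "\<iota> a / \<iota> s" \<iota> D g x] loc_memI V(4)[OF gV] sg by metis
        then show ?thesis using V(4)[OF V(2)] fraction_eq[of p a s] loc_memI[of a s p] p UP by auto
      qed
      then have "\<sigma> = sec U x" "x \<in> reg U"
        using ext by (auto simp: const_section_def regular_def extensional_def fun_eq_iff)
      then show ?thesis by blast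
    qed
  qed
qed

lemma sheaf_ops:
  assumes U: "U \<subseteq> P" and "x \<in> reg U" "y \<in> reg U"
  shows "sec U x \<otimes>\<^bsub>sheaf X U\<^esub> sec U y = sec U (x * y)"
    and "sec U x \<oplus>\<^bsub>sheaf X U\<^esub> sec U y = sec U (x + y)"
    and "c \<odot>\<^bsub>sheaf X U\<^esub> sec U x = sec U (\<kappa> c * x)"
  using assms frac_mult_eq frac_smult_eq
  by (auto simp: frac_space_def const_section_def regular_def fun_eq_iff subset_eq restrict_def)

lemma sheaf_consts:
  assumes U: "U \<subseteq> P"
  shows "\<one>\<^bsub>sheaf X U\<^esub> = sec U 1" and "\<zero>\<^bsub>sheaf X U\<^esub> = sec U 0"
  using assms one_loc zero_loc
  by (auto simp: frac_space_def const_section_def fun_eq_iff subset_eq restrict_def)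

lemma reg_ops:
  assumes "U \<subseteq> P"
  shows "x \<in> reg U \<Longrightarrow> y \<in> reg U \<Longrightarrow> x * y \<in> reg U" "x \<in> reg U \<Longrightarrow> y \<in> reg U \<Longrightarrow> x + y \<in> reg U"
    "x \<in> reg U \<Longrightarrow> - x \<in> reg U" "x \<in> reg U \<Longrightarrow> \<kappa> c * x \<in> reg U" "1 \<in> reg U" "0 \<in> reg U"
proof -
  have P: "p \<in> P" if "p \<in> U" for p using that assms by blast
  show "x \<in> reg U \<Longrightarrow> y \<in> reg U \<Longrightarrow> x * y \<in> reg U" "x \<in> reg U \<Longrightarrow> y \<in> reg U \<Longrightarrow> x + y \<in> reg U"
    using frac_mult_eq(3)[OF P, of _ x y] frac_mult_eq(4)[OF P, of _ x y] by (simp_all add: regular_def)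
  show "x \<in> reg U \<Longrightarrow> - x \<in> reg U" using uminus_loc[OF P] by (simp add: regular_def)
  show "x \<in> reg U \<Longrightarrow> \<kappa> c * x \<in> reg U" using frac_smult_eq(2)[OF P] by (simp add: regular_def)
  show "1 \<in> reg U" "0 \<in> reg U" using one_loc(1)[OF P] zero_loc(1)[OF P] by (simp_all add: regular_def)
qed

definition section_value :: "'a set set \<Rightarrow> ('a set \<Rightarrow> ('a \<times> 'a) set) \<Rightarrow> 'f" where
  "section_value U \<sigma> = (SOME x. x \<in> reg U \<and> \<sigma> = sec U x)"

lemma section_value:
  assumes "openin (topo X) U" "\<sigma> \<in> carrier (sheaf X U)"
  shows "section_value U \<sigma> \<in> reg U" "\<sigma> = sec U (section_value U \<sigma>)"
proof -
  have "\<exists>x. x \<in> reg U \<and> \<sigma> = sec U x" using assms sections_eq by blast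
  then have "section_value U \<sigma> \<in> reg U \<and> \<sigma> = sec U (section_value U \<sigma>)"
    unfolding section_value_def by (rule someI_ex)
  then show "section_value U \<sigma> \<in> reg U" "\<sigma> = sec U (section_value U \<sigma>)" by auto
qed

lemma section_value_sec:
  assumes "openin (topo X) U" "U \<noteq> {}" "x \<in> reg U"
  shows "section_value U (sec U x) = x"
proof -
  have "sec U x \<in> carrier (sheaf X U)" using assms sections_eq by blast
  from section_value[OF assms(1) this] show ?thesis
    using const_section_inj[OF assms(3) _ assms(2)] by metis
qed

text \<open>The sections over a nonempty open set are a subring of the function field.\<close>

lemma sections_embed:
  assumes U: "openin (topo X) U" "U \<noteq> {}"
  shows "frac_embed (sheaf X U) (section_value U) \<kappa>"
proof -
  have UP: "U \<subseteq> P" using open_subset[OF U(1)] .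
  note [simp] = sections_eq[OF U(1)] section_value_sec[OF U] sheaf_ops[OF UP] sheaf_consts[OF UP] reg_ops[OF UP]
  show ?thesis
  proof
    show "inj_on (section_value U) (carrier (sheaf X U))"
      by (rule inj_onI) (metis U(1) section_value(2))
    fix a assume "a \<in> carrier (sheaf X U)"
    then obtain x where "x \<in> reg U" "a = sec U x" by auto
    then show "\<exists>b\<in>carrier (sheaf X U). section_value U b = - section_value U a"
      by (intro bexI[of _ "sec U (- x)"]) auto
  qed (auto simp: \<kappa>_neg_one)
qed

lemma sections_domain: "openin (topo X) U \<Longrightarrow> U \<noteq> {} \<Longrightarrow> domain (sheaf X U)"
  using sections_embed frac_embed.is_domain by blast

end

text \<open>The open subspace \<open>U0\<close> is separated by its local rings: the Zariski topology on it is
  generated by the domains of definition of the elements of the function field.\<close>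

locale loc_separated = integral_frac_space +
  fixes U0
  assumes U0_open: "openin (topo X) U0" and U0_nonempty: "U0 \<noteq> {}"
    and separation: "p \<in> U0 \<Longrightarrow> f \<in> carrier R \<Longrightarrow> f \<notin> p \<Longrightarrow> \<exists>x\<in>loc p. \<forall>q\<in>U0. x \<in> loc q \<longrightarrow> f \<notin> q"
begin

lemma loc_inj: "inj_on loc U0"
proof (rule inj_onI)
  have *: "p \<subseteq> q" if "p \<in> U0" "q \<in> U0" "loc p = loc q" for p q
  proof
    fix f assume f: "f \<in> p"
    have "ideal p R" using primes that(1) open_subset[OF U0_open] primeideal.axioms(1) by blast
    then have "f \<in> carrier R" using f by (meson additive_subgroup.a_Hcarr ideal.axioms(1))
    then show "f \<in> q" using separation[OF that(2), of f] that f by blast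
  qed
  fix p q assume "p \<in> U0" "q \<in> U0" "loc p = loc q"
  with * show "p = q" by (metis subset_antisym)
qed

lemma openin_loc_iff:
  "openin (topo X) V \<and> V \<subseteq> U0 \<longleftrightarrow> V \<subseteq> U0 \<and> (\<forall>p\<in>V. \<exists>x\<in>loc p. {q \<in> U0. x \<in> loc q} \<subseteq> V)"
proof (intro iffI conjI ballI; (elim conjE)?)
  fix p assume V: "openin (topo X) V" "V \<subseteq> U0" and p: "p \<in> V"
  then obtain f where f: "f \<in> carrier R" "f \<notin> p" "{q \<in> P. f \<notin> q} \<subseteq> V" by (auto simp: openin_iff)
  then obtain x where "x \<in> loc p" "\<forall>q\<in>U0. x \<in> loc q \<longrightarrow> f \<notin> q" using separation[of p f] V p by blast
  then show "\<exists>x\<in>loc p. {q \<in> U0. x \<in> loc q} \<subseteq> V"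
    using f open_subset[OF U0_open] by (intro bexI[of _ x]) auto
next
  assume V: "V \<subseteq> U0" "\<forall>p\<in>V. \<exists>x\<in>loc p. {q \<in> U0. x \<in> loc q} \<subseteq> V"
  show "openin (topo X) V"
    by (subst openin_subopen) (use V open_loc[OF U0_open] in blast)
qed auto

end

text \<open>A point is recovered from its local ring, the topology from the sets
  \<open>{p. x \<in> loc p}\<close>, and the sections from the intersections of local rings.  So the local rings as
  subsets of the common function field determine the space up to isomorphism.\<close>

theorem isomorphic_if_same_local_rings:
  assumes "loc_separated R1 \<iota>1 \<kappa> P1 D1 E1 U1" "loc_separated R2 \<iota>2 \<kappa> P2 D2 E2 U2"
    and same: "local_ring \<iota>1 D1 ` U1 = local_ring \<iota>2 D2 ` U2"
  shows "isomorphic (open_subspace (frac_space R1 P1 D1) U1) (open_subspace (frac_space R2 P2 D2) U2)"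
proof -
  interpret A: loc_separated R1 \<iota>1 \<kappa> P1 D1 E1 U1 by fact
  interpret B: loc_separated R2 \<iota>2 \<kappa> P2 D2 E2 U2 by fact
  let ?T1 = "topo (open_subspace A.X U1)" and ?T2 = "topo (open_subspace B.X U2)"
  have U1: "topspace ?T1 = U1" and U2: "topspace ?T2 = U2"
    using A.open_subset[OF A.U0_open] B.open_subset[OF B.U0_open] A.points_X B.points_X
    by (auto simp: open_subspace_def)
  have op1: "openin ?T1 V \<longleftrightarrow> openin (topo A.X) V \<and> V \<subseteq> U1" for V
    using openin_open_subtopology[OF A.U0_open] by (simp add: open_subspace_def)
  have op2: "openin ?T2 V \<longleftrightarrow> openin (topo B.X) V \<and> V \<subseteq> U2" for V
    using openin_open_subtopology[OF B.U0_open] by (simp add: open_subspace_def)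
  define f where "f p = inv_into U2 B.loc (A.loc p)" for p
  have f: "f p \<in> U2" "B.loc (f p) = A.loc p" if "p \<in> U1" for p
  proof -
    have "A.loc p \<in> B.loc ` U2" using that same by blast
    then show "f p \<in> U2" "B.loc (f p) = A.loc p"
      unfolding f_def by (rule inv_into_into, rule f_inv_into_f)
  qed
  have surj: "f ` U1 = U2"
  proof
    show "U2 \<subseteq> f ` U1"
    proof
      fix q assume q: "q \<in> U2"
      then obtain p where p: "p \<in> U1" "A.loc p = B.loc q" using same by (metis imageE imageI)
      then have "f p = q" using B.loc_inj q by (simp add: f_def)
      then show "q \<in> f ` U1" using p by blast
    qed
  qed (use f in blast)
  have inj: "inj_on f U1"
    by (rule inj_onI) (metis f(2) A.loc_inj inj_onD)
  have cont: "openin ?T1 (U1 \<inter> f -` V)" if "openin ?T2 V" for V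
  proof -
    have V: "V \<subseteq> U2" "\<forall>p\<in>V. \<exists>x\<in>B.loc p. {q \<in> U2. x \<in> B.loc q} \<subseteq> V"
      using that unfolding op2 B.openin_loc_iff by auto
    show ?thesis unfolding op1 A.openin_loc_iff
    proof (intro conjI ballI)
      fix p assume p: "p \<in> U1 \<inter> f -` V"
      then obtain x where x: "x \<in> B.loc (f p)" "{q \<in> U2. x \<in> B.loc q} \<subseteq> V" using V(2) by blast
      have "f q \<in> V" if "q \<in> U1" "x \<in> A.loc q" for q
        using that x(2) f[OF that(1)] by (metis (mono_tags, lifting) mem_Collect_eq subsetD)
      then have "{q \<in> U1. x \<in> A.loc q} \<subseteq> U1 \<inter> f -` V" by blast
      moreover have "x \<in> A.loc p" using x(1) f(2) p by simp
      ultimately show "\<exists>x\<in>A.loc p. {q \<in> U1. x \<in> A.loc q} \<subseteq> U1 \<inter> f -` V" by (intro bexI[where x = x])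
    qed blast
  qed
  have homeo: "homeomorphic_map ?T1 ?T2 f"
  proof (rule bijective_open_imp_homeomorphic_map)
    show "continuous_map ?T1 ?T2 f"
      unfolding continuous_map_def U1 U2
    proof (intro conjI allI impI)
      fix V assume "openin ?T2 V"
      from cont[OF this] show "openin ?T1 {x \<in> U1. f x \<in> V}"
        by (simp add: vimage_def Int_def)
    qed (use f in auto)
    show "open_map ?T1 ?T2 f"
      unfolding open_map_def
    proof (intro allI impI)
      fix W assume "openin ?T1 W"
      then have W: "W \<subseteq> U1" "\<forall>p\<in>W. \<exists>x\<in>A.loc p. {q \<in> U1. x \<in> A.loc q} \<subseteq> W"
        unfolding op1 A.openin_loc_iff by auto
      show "openin ?T2 (f ` W)"
        unfolding op2 B.openin_loc_iff
      proof (intro conjI ballI)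
        fix q assume "q \<in> f ` W"
        then obtain p where p: "p \<in> W" "q = f p" by blast
        then obtain x where x: "x \<in> A.loc p" "{q \<in> U1. x \<in> A.loc q} \<subseteq> W" using W by blast
        have "{q \<in> U2. x \<in> B.loc q} \<subseteq> f ` W"
        proof
          fix r assume r: "r \<in> {q \<in> U2. x \<in> B.loc q}"
          then obtain p' where "p' \<in> U1" "r = f p'" using surj by blast
          moreover from this have "x \<in> A.loc p'" using r f(2)[of p'] by simp
          ultimately show "r \<in> f ` W" using x(2) by blast
        qed
        moreover have "x \<in> B.loc q" using x(1) p W(1) f(2) by auto
        ultimately show "\<exists>x\<in>B.loc q. {q \<in> U2. x \<in> B.loc q} \<subseteq> f ` W" by (intro bexI[where x = x])
      next
        show "f ` W \<subseteq> U2" using W(1) f(1) by blast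
      qed
    qed
  qed (use inj surj U1 U2 in auto)
  define \<theta> where "\<theta> V \<sigma> = A.sec (U1 \<inter> f -` V) (B.section_value V \<sigma>)" for V \<sigma>
  have reg: "A.reg (U1 \<inter> f -` V) = B.reg V" if "V \<subseteq> U2" for V
  proof
    show "A.reg (U1 \<inter> f -` V) \<subseteq> B.reg V"
    proof
      fix x assume x: "x \<in> A.reg (U1 \<inter> f -` V)"
      have "x \<in> B.loc q" if q: "q \<in> V" for q
      proof -
        obtain p where "p \<in> U1" "q = f p" using surj q \<open>V \<subseteq> U2\<close> by blast
        then show ?thesis using x q f(2)[of p] by (auto simp: regular_def)
      qed
      then show "x \<in> B.reg V" by (simp add: regular_def)
    qed
    show "B.reg V \<subseteq> A.reg (U1 \<inter> f -` V)"
      using that f by (auto simp: regular_def)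
  qed
  have \<theta>_sec: "\<theta> V (B.sec V x) = A.sec (U1 \<inter> f -` V) x" if "openin ?T2 V" "x \<in> B.reg V" for V x
  proof (cases "V = {}")
    case False
    then show ?thesis using B.section_value_sec[of V x] that op2 by (simp add: \<theta>_def)
  qed (simp add: \<theta>_def)
  have "isomorphic (open_subspace A.X U1) (open_subspace B.X U2)"
    unfolding isomorphic_def U1
  proof (intro exI[of _ f] exI[of _ \<theta>] conjI homeo allI impI ballI)
    fix V assume V: "openin ?T2 V"
    let ?W = "U1 \<inter> f -` V"
    have V': "openin (topo B.X) V" "V \<subseteq> U2" "V \<subseteq> P2" using V op2 B.open_subset by auto
    have W: "openin (topo A.X) ?W" "?W \<subseteq> P1" using cont[OF V] op1 A.open_subset by auto
    have sh: "sheaf (open_subspace B.X U2) V = sheaf B.X V" "sheaf (open_subspace A.X U1) ?W = sheaf A.X ?W"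
      by (simp_all add: open_subspace_def)
    note cA = A.sections_eq[OF W(1)] and cB = B.sections_eq[OF V'(1)]
    note rg = reg[OF V'(2)]
    have bij: "bij_betw (\<theta> V) (carrier (sheaf B.X V)) (carrier (sheaf A.X ?W))"
      unfolding bij_betw_def
    proof
      show "\<theta> V ` carrier (sheaf B.X V) = carrier (sheaf A.X ?W)"
        unfolding cA cB rg using \<theta>_sec[OF V] by (auto simp: image_image)
      show "inj_on (\<theta> V) (carrier (sheaf B.X V))"
        unfolding cB
      proof (rule inj_onI, elim imageE)
        fix \<sigma> \<tau> x y assume *: "\<theta> V \<sigma> = \<theta> V \<tau>" "\<sigma> = B.sec V x" "x \<in> B.reg V" "\<tau> = B.sec V y" "y \<in> B.reg V"
        show "\<sigma> = \<tau>"
        proof (cases "V = {}")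
          case False
          then have "?W \<noteq> {}" using surj V'(2) by auto
          moreover have "A.sec ?W x = A.sec ?W y" using * \<theta>_sec[OF V] by simp
          ultimately have "x = y" using const_section_inj[of x \<iota>1 D1 ?W y] * rg by blast
          then show ?thesis using * by simp
        qed (use * in simp)
      qed
    qed
    have hom: "\<theta> V \<in> Ring.ring_hom (sheaf B.X V) (sheaf A.X ?W)"
    proof (rule ring_hom_memI)
      fix \<sigma> \<tau> assume "\<sigma> \<in> carrier (sheaf B.X V)" "\<tau> \<in> carrier (sheaf B.X V)"
      then obtain x y where xy: "x \<in> B.reg V" "\<sigma> = B.sec V x" "y \<in> B.reg V" "\<tau> = B.sec V y"
        unfolding cB by blast
      show "\<theta> V (\<sigma> \<otimes>\<^bsub>sheaf B.X V\<^esub> \<tau>) = \<theta> V \<sigma> \<otimes>\<^bsub>sheaf A.X ?W\<^esub> \<theta> V \<tau>"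
        and "\<theta> V (\<sigma> \<oplus>\<^bsub>sheaf B.X V\<^esub> \<tau>) = \<theta> V \<sigma> \<oplus>\<^bsub>sheaf A.X ?W\<^esub> \<theta> V \<tau>"
        using xy rg
        by (simp_all add: B.sheaf_ops[OF V'(3)] A.sheaf_ops[OF W(2)] \<theta>_sec[OF V] B.reg_ops[OF V'(3)])
    next
      show "\<theta> V \<one>\<^bsub>sheaf B.X V\<^esub> = \<one>\<^bsub>sheaf A.X ?W\<^esub>"
        by (simp add: B.sheaf_consts[OF V'(3)] A.sheaf_consts[OF W(2)] \<theta>_sec[OF V] B.reg_ops[OF V'(3)])
    qed (use bij in \<open>auto simp: bij_betw_def\<close>)
    show "\<theta> V \<in> ring_iso (sheaf (open_subspace B.X U2) V) (sheaf (open_subspace A.X U1) ?W)"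
      unfolding sh ring_iso_def using bij hom by simp
    {
      fix c \<sigma> assume "\<sigma> \<in> carrier (sheaf (open_subspace B.X U2) V)"
      then obtain x where x: "x \<in> B.reg V" "\<sigma> = B.sec V x" unfolding sh cB by blast
      show "\<theta> V (c \<odot>\<^bsub>sheaf (open_subspace B.X U2) V\<^esub> \<sigma>) = c \<odot>\<^bsub>sheaf (open_subspace A.X U1) ?W\<^esub> \<theta> V \<sigma>"
        using x rg unfolding sh
        by (simp add: B.sheaf_ops[OF V'(3)] A.sheaf_ops[OF W(2)] \<theta>_sec[OF V] B.reg_ops[OF V'(3)])
    }
    {
      fix W' \<sigma> assume W': "openin ?T2 W' \<and> W' \<subseteq> V" and "\<sigma> \<in> carrier (sheaf (open_subspace B.X U2) V)"
      then obtain x where x: "x \<in> B.reg V" "\<sigma> = B.sec V x" unfolding sh cB by blast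
      have "x \<in> B.reg W'" using x W' by (auto simp: regular_def)
      then show "\<theta> W' (restrict \<sigma> W') = restrict (\<theta> V \<sigma>) (U1 \<inter> f -` W')"
        using x W' by (auto simp: restrict_const_section \<theta>_sec[OF V] \<theta>_sec[of W'] intro!: restrict_const_section[symmetric])
    }
  qed
  then show ?thesis .
qed

section \<open>Basic open subsets of projective spectra\<close>

lemma (in cring) ideal_if_closed:
  assumes "I \<subseteq> carrier R" "\<zero> \<in> I" "\<And>x y. x \<in> I \<Longrightarrow> y \<in> I \<Longrightarrow> x \<oplus> y \<in> I"
    and m: "\<And>x y. x \<in> I \<Longrightarrow> y \<in> carrier R \<Longrightarrow> x \<otimes> y \<in> I"
  shows "ideal I R"
proof (rule idealI)
  have neg: "\<ominus> x \<in> I" if "x \<in> I" for x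
  proof -
    have "x \<otimes> \<ominus> \<one> = \<ominus> x" using that assms(1) by (simp add: r_minus subset_iff)
    then show ?thesis using m[OF that, of "\<ominus> \<one>"] by simp
  qed
  show "subgroup I (add_monoid R)"
    using assms neg add.subgroupI[of I] by (auto simp: a_inv_def)
qed (use assms ring_axioms m_comm in \<open>auto simp: subset_iff\<close>)

context frac_embed
begin

lemma spec_integral: "integral_frac_space R \<iota> \<kappa> {p. primeideal p R} (\<lambda>p. carrier R \<times> (carrier R - p)) (carrier R \<times> carrier R)"
proof (rule integral_frac_space.intro[OF frac_embed_axioms], rule integral_frac_space_axioms.intro)
  show "{\<zero>} \<in> {p. primeideal p R}" using primeideal_zero by simp
  fix p assume "p \<in> {p. primeideal p R}"
  then show "primeideal p R" by simp
next
  fix p show "carrier R \<times> (carrier R - p) = {(a, s) \<in> carrier R \<times> carrier R. s \<notin> p}"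
    by auto
qed (simp_all add: smult_closed)

text \<open>In \<open>Spec R\<close> the element \<open>1 / f\<close> lies in the local ring at \<open>p\<close> iff \<open>f \<notin> p\<close>.\<close>

lemma spec_separated:
  "loc_separated R \<iota> \<kappa> {p. primeideal p R} (\<lambda>p. carrier R \<times> (carrier R - p)) (carrier R \<times> carrier R) {p. primeideal p R}"
proof -
  interpret S: integral_frac_space R \<iota> \<kappa> "{p. primeideal p R}" "\<lambda>p. carrier R \<times> (carrier R - p)" "carrier R \<times> carrier R"
    by (rule spec_integral)
  show ?thesis
  proof
    show "openin (topo S.X) {p. primeideal p R}"
      using openin_topspace[of "topo S.X"] by (simp add: S.points_X)
    show "{p. primeideal p R} \<noteq> {}" using primeideal_zero by blast
    fix p f assume p: "p \<in> {p. primeideal p R}" and f: "f \<in> carrier R" "f \<notin> p"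
    show "\<exists>x\<in>S.loc p. \<forall>q\<in>{p. primeideal p R}. x \<in> S.loc q \<longrightarrow> f \<notin> q"
    proof (intro bexI ballI impI notI)
      show "\<iota> \<one> / \<iota> f \<in> S.loc p" by (rule S.loc_memI) (use f in auto)
      fix q assume q: "q \<in> {p. primeideal p R}" "\<iota> \<one> / \<iota> f \<in> S.loc q" "f \<in> q"
      then obtain a s where as: "a \<in> carrier R" "s \<in> carrier R" "s \<notin> q" "\<iota> \<one> / \<iota> f = \<iota> a / \<iota> s"
        by (auto elim: S.loc_memE)
      have "{\<zero>} \<subseteq> p" "{\<zero>} \<subseteq> q" using p q
        by (auto intro: additive_subgroup.zero_closed ideal.axioms(1) primeideal.axioms(1))
      then have "\<iota> f \<noteq> 0" "\<iota> s \<noteq> 0" using as f \<iota>_eq_0_iff by auto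
      then have "\<iota> s = \<iota> (f \<otimes> a)" using as f by (simp add: \<iota>_one \<iota>_mult field_simps)
      then have "s = f \<otimes> a" using eqI as f by simp
      moreover have "f \<otimes> a \<in> q" using q as by (auto intro: ideal.I_r_closed primeideal.axioms(1))
      ultimately show False using as by simp
    qed
  qed
qed

end

text \<open>A graded domain inside a field.  The grading is recorded by the homomorphism \<open>\<epsilon>\<close> that sends
  \<open>x\<close> to \<open>\<Sum>n. x\<^sub>n t\<^sup>n\<close>, where \<open>x\<^sub>n\<close> are the homogeneous components; an element is homogeneous iff its image is a
  monomial, and no choice of representatives is involved.  The element \<open>f\<close> is homogeneous of positive degree \<open>e\<close>
  and defines the basic open set under study.\<close>

locale graded_embed = frac_embed R \<iota> \<kappa>
  for R :: "('k::field, 'b) module" (structure) and \<iota> :: "'b \<Rightarrow> 'c::field" and \<kappa> :: "'k \<Rightarrow> 'c" +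
  fixes gr :: "nat \<Rightarrow> 'b set" and \<epsilon> :: "'b \<Rightarrow> 'c poly" and e :: nat and f :: 'b
  assumes \<epsilon>_add: "x \<in> carrier R \<Longrightarrow> y \<in> carrier R \<Longrightarrow> \<epsilon> (x \<oplus> y) = \<epsilon> x + \<epsilon> y"
    and \<epsilon>_mult: "x \<in> carrier R \<Longrightarrow> y \<in> carrier R \<Longrightarrow> \<epsilon> (x \<otimes> y) = \<epsilon> x * \<epsilon> y"
    and \<epsilon>_one: "\<epsilon> \<one> = 1"
    and \<iota>_\<epsilon>: "x \<in> carrier R \<Longrightarrow> \<iota> x = poly (\<epsilon> x) 1"
    and gr_iff: "x \<in> gr n \<longleftrightarrow> x \<in> carrier R \<and> \<epsilon> x = monom (\<iota> x) n"
    and component: "x \<in> carrier R \<Longrightarrow> \<exists>y\<in>carrier R. \<epsilon> y = monom (coeff (\<epsilon> x) n) n"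
    and gr_smult: "x \<in> gr n \<Longrightarrow> c \<odot> x \<in> gr n"
    and f_gr: "f \<in> gr e" and e_pos: "e > 0" and f_nz: "\<iota> f \<noteq> 0"
begin

definition G :: "nat \<Rightarrow> 'c set" where "G n = \<iota> ` gr n"

abbreviation "\<phi> \<equiv> \<iota> f"

lemma gr_carrier: "x \<in> gr n \<Longrightarrow> x \<in> carrier R" by (simp add: gr_iff)

lemma \<epsilon>_zero: "\<epsilon> \<zero> = 0"
proof -
  have "\<epsilon> \<zero> = \<epsilon> \<zero> + \<epsilon> \<zero>"
    using \<epsilon>_add[of \<zero> \<zero>] by (simp only: dom.l_zero dom.zero_closed)
  then show ?thesis by (metis add_cancel_right_right)
qed

lemma \<epsilon>_eq_0D: "x \<in> carrier R \<Longrightarrow> \<epsilon> x = 0 \<Longrightarrow> x = \<zero>"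
  using \<iota>_\<epsilon>[of x] \<iota>_eq_0_iff[of x] by (metis poly_0)

lemma \<epsilon>_neg: "x \<in> carrier R \<Longrightarrow> \<epsilon> (\<ominus> x) = - \<epsilon> x"
proof -
  assume x: "x \<in> carrier R"
  then have "\<epsilon> x + \<epsilon> (\<ominus> x) = 0" using \<epsilon>_add[of x "\<ominus> x"] by (simp add: dom.r_neg \<epsilon>_zero)
  then show ?thesis by (simp add: add_eq_0_iff)
qed

lemma gr_closed:
  "\<zero> \<in> gr n" "\<one> \<in> gr 0"
  "x \<in> gr n \<Longrightarrow> y \<in> gr n \<Longrightarrow> x \<oplus> y \<in> gr n"
  "x \<in> gr n \<Longrightarrow> \<ominus> x \<in> gr n"
  "x \<in> gr m \<Longrightarrow> y \<in> gr n \<Longrightarrow> x \<otimes> y \<in> gr (m + n)"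
  by (auto simp: gr_iff \<epsilon>_zero \<epsilon>_one \<epsilon>_add \<epsilon>_mult \<epsilon>_neg \<iota>_zero \<iota>_one \<iota>_add \<iota>_mult \<iota>_minus add_monom mult_monom minus_monom one_pCons monom_0)

lemma G_closed:
  "0 \<in> G n" "1 \<in> G 0" "a \<in> G n \<Longrightarrow> b \<in> G n \<Longrightarrow> a + b \<in> G n" "a \<in> G n \<Longrightarrow> - a \<in> G n"
  "a \<in> G m \<Longrightarrow> b \<in> G n \<Longrightarrow> a * b \<in> G (m + n)" "\<phi> \<in> G e" "a \<in> G n \<Longrightarrow> \<kappa> c * a \<in> G n"
proof -
  show "0 \<in> G n" "1 \<in> G 0" unfolding G_def using gr_closed(1,2) \<iota>_zero \<iota>_one by (metis imageI)+
  show "a \<in> G n \<Longrightarrow> b \<in> G n \<Longrightarrow> a + b \<in> G n" unfolding G_def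
    using gr_closed(3)[of _ n] \<iota>_add gr_carrier by (auto simp flip: \<iota>_add)
  show "a \<in> G n \<Longrightarrow> - a \<in> G n" unfolding G_def
    using gr_closed(4)[of _ n] \<iota>_minus gr_carrier by (auto simp flip: \<iota>_minus)
  show "a \<in> G m \<Longrightarrow> b \<in> G n \<Longrightarrow> a * b \<in> G (m + n)" unfolding G_def
    using gr_closed(5)[of _ m _ n] \<iota>_mult gr_carrier by (auto simp flip: \<iota>_mult)
  show "\<phi> \<in> G e" unfolding G_def using f_gr by blast
  show "a \<in> G n \<Longrightarrow> \<kappa> c * a \<in> G n" unfolding G_def
    using gr_smult[of _ n c] \<iota>_smult gr_carrier by (auto simp flip: \<iota>_smult)
qed

lemma G_pow: "a \<in> G n \<Longrightarrow> a ^ N \<in> G (n * N)"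
  by (induction N) (use G_closed(2,5) in auto)

lemma G_E:
  assumes "c \<in> G n" obtains y where "y \<in> gr n" "y \<in> carrier R" "\<iota> y = c" "\<epsilon> y = monom c n"
  using assms gr_iff unfolding G_def by blast

lemma coeff_G: "x \<in> carrier R \<Longrightarrow> coeff (\<epsilon> x) n \<in> G n"
proof -
  assume "x \<in> carrier R"
  then obtain y where y: "y \<in> carrier R" "\<epsilon> y = monom (coeff (\<epsilon> x) n) n" using component by blast
  then have "\<iota> y = coeff (\<epsilon> x) n" using \<iota>_\<epsilon>[of y] by (simp add: poly_monom)
  then have "y \<in> gr n" using y by (simp add: gr_iff)
  then show ?thesis using \<open>\<iota> y = _\<close> unfolding G_def by (metis imageI)
qed

subsection \<open>Homogeneous ideals\<close>

text \<open>Homogeneous ideals are represented by the set of pairs of a degree and an element of that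
  degree; zero belongs to every degree.  This makes primes that avoid the irrelevant ideal
  constructible from their homogeneous elements alone.\<close>

definition graded_ideal :: "(nat \<times> 'c) set \<Rightarrow> bool" where
  "graded_ideal H \<longleftrightarrow> (\<forall>n c. (n, c) \<in> H \<longrightarrow> c \<in> G n) \<and> (\<forall>n. (n, 0) \<in> H) \<and>
    (\<forall>n c d. (n, c) \<in> H \<and> (n, d) \<in> H \<longrightarrow> (n, c + d) \<in> H) \<and>
    (\<forall>m n c d. (m, c) \<in> H \<and> d \<in> G n \<longrightarrow> (m + n, c * d) \<in> H)"

definition graded_prime :: "(nat \<times> 'c) set \<Rightarrow> bool" where
  "graded_prime H \<longleftrightarrow> graded_ideal H \<and> (0, 1) \<notin> H \<and>
    (\<forall>m n c d. c \<in> G m \<and> d \<in> G n \<and> (m + n, c * d) \<in> H \<longrightarrow> (m, c) \<in> H \<or> (n, d) \<in> H)"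

definition idl :: "(nat \<times> 'c) set \<Rightarrow> 'b set" where
  "idl H = {x \<in> carrier R. \<forall>n. (n, coeff (\<epsilon> x) n) \<in> H}"

context
  fixes H assumes H: "graded_ideal H"
begin

lemma graded_idealD: "(n, c) \<in> H \<Longrightarrow> c \<in> G n" "(n, 0) \<in> H" "(n, c) \<in> H \<Longrightarrow> (n, d) \<in> H \<Longrightarrow> (n, c + d) \<in> H"
  "(m, c) \<in> H \<Longrightarrow> d \<in> G n \<Longrightarrow> (m + n, c * d) \<in> H"
  using H unfolding graded_ideal_def by blast+

lemma graded_ideal_neg: "(n, c) \<in> H \<Longrightarrow> (n, - c) \<in> H"
  using graded_idealD(4)[of n c "-1" 0] G_closed(4)[OF G_closed(2)] by simp

lemma graded_ideal_sum: "(\<And>i. i \<in> A \<Longrightarrow> (n, t i) \<in> H) \<Longrightarrow> (n, sum t A) \<in> H"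
  by (induction A rule: infinite_finite_induct) (auto simp: graded_idealD)

lemma idl_ideal: "ideal (idl H) R"
proof (rule dom.ideal_if_closed)
  fix x y assume x: "x \<in> idl H"
  {
    assume "y \<in> idl H"
    then show "x \<oplus> y \<in> idl H" using x by (auto simp: idl_def \<epsilon>_add graded_idealD)
  }
  {
    assume y: "y \<in> carrier R"
    have "(n, \<Sum>i\<le>n. coeff (\<epsilon> x) i * coeff (\<epsilon> y) (n - i)) \<in> H" for n
    proof (rule graded_ideal_sum)
      fix i assume "i \<in> {..n}"
      then show "(n, coeff (\<epsilon> x) i * coeff (\<epsilon> y) (n - i)) \<in> H"
        using graded_idealD(4)[of i "coeff (\<epsilon> x) i" "coeff (\<epsilon> y) (n - i)" "n - i"] x coeff_G[OF y]
        by (simp add: idl_def)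
    qed
    then show "x \<otimes> y \<in> idl H" using x y by (simp add: idl_def \<epsilon>_mult coeff_mult)
  }
qed (auto simp: idl_def \<epsilon>_zero graded_idealD)

lemma idl_gr: "y \<in> gr n \<Longrightarrow> y \<in> idl H \<longleftrightarrow> (n, \<iota> y) \<in> H"
  by (auto simp: idl_def gr_iff graded_idealD)

lemma idl_homogeneous: "Idl (idl H \<inter> (\<Union>n. gr n)) = idl H"
proof
  let ?I = "Idl (idl H \<inter> (\<Union>n. gr n))"
  have sub: "idl H \<inter> (\<Union>n. gr n) \<subseteq> carrier R" by (auto simp: idl_def)
  show "?I \<subseteq> idl H" by (rule dom.genideal_minimal[OF idl_ideal]) blast
  interpret I: ideal ?I R by (rule dom.genideal_ideal[OF sub])
  have "x \<in> ?I" if "x \<in> idl H" "\<And>n. n \<ge> N \<Longrightarrow> coeff (\<epsilon> x) n = 0" for x N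
    using that
  proof (induction N arbitrary: x)
    case 0
    then have "\<epsilon> x = 0" by (simp add: poly_eq_iff)
    then have "x = \<zero>" using 0(1) \<epsilon>_eq_0D by (simp add: idl_def)
    then show ?case by simp
  next
    case (Suc N)
    have x: "x \<in> carrier R" using Suc.prems by (simp add: idl_def)
    obtain y where y: "y \<in> gr N" "y \<in> carrier R" "\<iota> y = coeff (\<epsilon> x) N" "\<epsilon> y = monom (coeff (\<epsilon> x) N) N"
      using G_E[OF coeff_G[OF x]] by metis
    have yH: "y \<in> idl H" using idl_gr[OF y(1)] y(3) Suc.prems(1) by (simp add: idl_def)
    have "x \<oplus> \<ominus> y \<in> ?I"
    proof (rule Suc.IH)
      show "x \<oplus> \<ominus> y \<in> idl H"
        using Suc.prems(1) yH x y by (auto simp: idl_def \<epsilon>_add \<epsilon>_neg intro!: graded_idealD(3) graded_ideal_neg graded_idealD(2) simp del: add_uminus_conv_diff)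
      fix n assume "N \<le> n"
      then show "coeff (\<epsilon> (x \<oplus> \<ominus> y)) n = 0"
        using Suc.prems(2)[of n] x y by (cases "n = N") (simp_all add: \<epsilon>_add \<epsilon>_neg)
    qed
    moreover have "y \<in> ?I" using dom.genideal_self[OF sub] yH y(1) by blast
    ultimately have "(x \<oplus> \<ominus> y) \<oplus> y \<in> ?I" by simp
    then show ?case using x y by (simp add: dom.a_assoc dom.l_neg)
  qed
  moreover have "coeff (\<epsilon> x) n = 0" if "n \<ge> Suc (degree (\<epsilon> x))" for x n
    using that by (simp add: coeff_eq_0)
  ultimately show "idl H \<subseteq> ?I" by blast
qed

end

text \<open>Homogeneous primality suffices: if \<open>x\<^sub>m\<close> and \<open>y\<^sub>n\<close> are the components of largest degree outside
  \<open>H\<close>, then \<open>x\<^sub>m y\<^sub>n\<close> is the only term outside \<open>H\<close> in the component of degree \<open>m + n\<close> of \<open>x y\<close>.\<close>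

lemma idl_prime:
  assumes "graded_prime H" shows "primeideal (idl H) R"
proof (rule primeidealI)
  have H: "graded_ideal H" using assms by (simp add: graded_prime_def)
  show "ideal (idl H) R" by (rule idl_ideal[OF H])
  show "cring R" by (rule dom.is_cring)
  have "coeff (1 :: 'c poly) 0 = 1" by (simp add: one_pCons)
  then have "\<one> \<notin> idl H" using assms unfolding idl_def
    by (metis (no_types, lifting) \<epsilon>_one graded_prime_def mem_Collect_eq)
  then show "carrier R \<noteq> idl H" by auto
  fix x y assume x: "x \<in> carrier R" and y: "y \<in> carrier R" and xy: "x \<otimes> y \<in> idl H"
  have top: "\<exists>m. (m, coeff (\<epsilon> z) m) \<notin> H \<and> (\<forall>i>m. (i, coeff (\<epsilon> z) i) \<in> H)" if "z \<in> carrier R" "z \<notin> idl H" for z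
  proof -
    let ?S = "{n. (n, coeff (\<epsilon> z) n) \<notin> H}"
    have "?S \<subseteq> {..degree (\<epsilon> z)}"
      using coeff_eq_0[of "\<epsilon> z"] graded_idealD(2)[OF H] by (auto simp: not_le[symmetric]) (metis not_le)
    then have fin: "finite ?S" by (rule finite_subset) simp
    have ne: "?S \<noteq> {}" using that by (auto simp: idl_def)
    have "Max ?S \<in> ?S" by (rule Max_in[OF fin ne])
    moreover have "(i, coeff (\<epsilon> z) i) \<in> H" if "i > Max ?S" for i
    proof (rule ccontr)
      assume "(i, coeff (\<epsilon> z) i) \<notin> H"
      then have "i \<le> Max ?S" by (intro Max_ge[OF fin]) simp
      then show False using that by simp
    qed
    ultimately show ?thesis by blast
  qed
  show "x \<in> idl H \<or> y \<in> idl H"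
  proof (rule ccontr)
    assume "\<not> (x \<in> idl H \<or> y \<in> idl H)"
    then obtain m n where m: "(m, coeff (\<epsilon> x) m) \<notin> H" "\<And>i. i > m \<Longrightarrow> (i, coeff (\<epsilon> x) i) \<in> H"
      and n: "(n, coeff (\<epsilon> y) n) \<notin> H" "\<And>i. i > n \<Longrightarrow> (i, coeff (\<epsilon> y) i) \<in> H"
      using top[OF x] top[OF y] by blast
    let ?t = "\<lambda>i. coeff (\<epsilon> x) i * coeff (\<epsilon> y) (m + n - i)"
    have sum: "(\<Sum>i\<le>m + n. ?t i) = ?t m + sum ?t ({..m + n} - {m})"
      by (rule sum.remove) auto
    have "(m + n, sum ?t ({..m + n} - {m})) \<in> H"
    proof (rule graded_ideal_sum[OF H])
      fix i assume i: "i \<in> {..m + n} - {m}"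
      show "(m + n, ?t i) \<in> H"
      proof (cases "i > m")
        case True
        then show ?thesis
          using graded_idealD(4)[OF H m(2)[OF True] coeff_G[OF y, of "m + n - i"]] i by simp
      next
        case False
        then have "m + n - i > n" using i by auto
        from graded_idealD(4)[OF H n(2)[OF this] coeff_G[OF x, of i]] show ?thesis
          using i by (simp add: mult.commute)
      qed
    qed
    moreover have "(m + n, \<Sum>i\<le>m + n. ?t i) \<in> H"
      using xy x y by (simp add: idl_def \<epsilon>_mult coeff_mult)
    ultimately have "(m + n, (\<Sum>i\<le>m + n. ?t i) + - sum ?t ({..m + n} - {m})) \<in> H"
      by (intro graded_idealD(3)[OF H] graded_ideal_neg[OF H])
    then have "(m + n, coeff (\<epsilon> x) m * coeff (\<epsilon> y) n) \<in> H" unfolding sum by simp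
    then show False
      using assms m(1) n(1) coeff_G[OF x] coeff_G[OF y] unfolding graded_prime_def by blast
  qed
qed

definition hprimes :: "'b set set" where
  "hprimes = {p. primeideal p R \<and> Idl (p \<inter> (\<Union>n. gr n)) = p \<and> \<not> (\<Union>n\<in>{1..}. gr n) \<subseteq> p}"

definition U0 :: "'b set set" where "U0 = {p \<in> hprimes. f \<notin> p}"

text \<open>On \<open>D(f)\<close> the condition on the irrelevant ideal is automatic, as \<open>f\<close> has positive degree.\<close>

lemma U0_iff: "p \<in> U0 \<longleftrightarrow> (\<exists>H. graded_prime H \<and> (e, \<phi>) \<notin> H \<and> p = idl H)"
proof
  assume "\<exists>H. graded_prime H \<and> (e, \<phi>) \<notin> H \<and> p = idl H"
  then obtain H where H: "graded_prime H" "(e, \<phi>) \<notin> H" "p = idl H" by blast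
  have gi: "graded_ideal H" using H(1) by (simp add: graded_prime_def)
  have "f \<notin> p" using idl_gr[OF gi f_gr] H by simp
  moreover have "f \<in> (\<Union>n\<in>{1..}. gr n)" using f_gr e_pos by (auto intro!: bexI[of _ e])
  ultimately show "p \<in> U0"
    using idl_prime[OF H(1)] idl_homogeneous[OF gi] H(3) by (auto simp: U0_def hprimes_def)
next
  assume "p \<in> U0"
  then have p: "primeideal p R" "Idl (p \<inter> (\<Union>n. gr n)) = p" "f \<notin> p" by (auto simp: U0_def hprimes_def)
  interpret p: primeideal p R by (rule p)
  define H where "H = {(n, c). \<exists>y\<in>p \<inter> gr n. \<iota> y = c}"
  have H_iff: "(n, \<iota> y) \<in> H \<longleftrightarrow> y \<in> p" if "y \<in> gr n" for n y
    using that eqI gr_carrier unfolding H_def by auto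
  have gi: "graded_ideal H"
    unfolding graded_ideal_def
  proof (intro conjI allI impI; (elim conjE)?)
    fix n c assume "(n, c) \<in> H" then show "c \<in> G n" by (auto simp: H_def G_def)
  next
    fix n show "(n, 0) \<in> H" using H_iff[OF gr_closed(1)] \<iota>_zero by simp
  next
    fix n c d assume "(n, c) \<in> H" "(n, d) \<in> H"
    then obtain x y where xy: "x \<in> p" "x \<in> gr n" "\<iota> x = c" "y \<in> p" "y \<in> gr n" "\<iota> y = d" by (auto simp: H_def)
    then have "(n, \<iota> (x \<oplus> y)) \<in> H" using H_iff[OF gr_closed(3)] by simp
    then show "(n, c + d) \<in> H" using xy gr_carrier by (simp add: \<iota>_add)
  next
    fix m n c d assume "(m, c) \<in> H" "d \<in> G n"
    then obtain x y where xy: "x \<in> p" "x \<in> gr m" "\<iota> x = c" "y \<in> gr n" "\<iota> y = d" by (auto simp: H_def G_def)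
    then have "(m + n, \<iota> (x \<otimes> y)) \<in> H" using H_iff[OF gr_closed(5)] gr_carrier p.I_r_closed by simp
    then show "(m + n, c * d) \<in> H" using xy gr_carrier by (simp add: \<iota>_mult)
  qed
  have same: "idl H \<inter> (\<Union>n. gr n) = p \<inter> (\<Union>n. gr n)"
    using idl_gr[OF gi] H_iff by auto
  have "graded_prime H"
    unfolding graded_prime_def
  proof (intro conjI allI impI gi; (elim conjE)?)
    have "\<one> \<notin> p" using p.I_notcarr p.one_imp_carrier by metis
    then show "(0, 1) \<notin> H" using H_iff[OF gr_closed(2)] \<iota>_one by simp
  next
    fix m n c d assume cd: "c \<in> G m" "d \<in> G n" "(m + n, c * d) \<in> H"
    obtain x where x: "x \<in> gr m" "x \<in> carrier R" "\<iota> x = c" using cd(1) by (auto elim: G_E)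
    obtain y where y: "y \<in> gr n" "y \<in> carrier R" "\<iota> y = d" using cd(2) by (auto elim: G_E)
    have "x \<otimes> y \<in> p" using H_iff[OF gr_closed(5)[OF x(1) y(1)]] cd(3) x y by (simp add: \<iota>_mult)
    then have "x \<in> p \<or> y \<in> p" using p.I_prime x y by blast
    then show "(m, c) \<in> H \<or> (n, d) \<in> H" using H_iff x y by blast
  qed
  moreover have "(e, \<phi>) \<notin> H" using H_iff[OF f_gr] p(3) by simp
  moreover have "p = idl H" using idl_homogeneous[OF gi] same p(2) by simp
  ultimately show "\<exists>H. graded_prime H \<and> (e, \<phi>) \<notin> H \<and> p = idl H" by blast
qed

lemma zero_in_U0: "{\<zero>} \<in> U0"
proof -
  let ?H = "UNIV \<times> {0::'c}"
  have "graded_prime ?H" unfolding graded_prime_def graded_ideal_def using G_closed by auto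
  moreover have "idl ?H = {\<zero>}"
  proof -
    have "x = \<zero>" if "x \<in> carrier R" "\<forall>n. coeff (\<epsilon> x) n = 0" for x
    proof -
      have "\<epsilon> x = 0" using that by (simp add: poly_eq_iff)
      then show ?thesis using \<epsilon>_eq_0D that by blast
    qed
    then show ?thesis by (auto simp: idl_def \<epsilon>_zero)
  qed
  ultimately show ?thesis using f_nz U0_iff[of "{\<zero>}"] by (metis SigmaE2 singletonD)
qed

abbreviation "HD \<equiv> homogeneous_fracs gr"

lemma proj_integral: "integral_frac_space R \<iota> \<kappa> hprimes HD (\<Union>n. gr n \<times> gr n)"
proof (rule integral_frac_space.intro[OF frac_embed_axioms], rule integral_frac_space_axioms.intro)
  show "{\<zero>} \<in> hprimes" using zero_in_U0 by (simp add: U0_def)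
  fix a s b t assume "(a, s) \<in> (\<Union>n. gr n \<times> gr n)" "(b, t) \<in> (\<Union>n. gr n \<times> gr n)"
  then obtain m n where *: "a \<in> gr m" "s \<in> gr m" "b \<in> gr n" "t \<in> gr n" by blast
  have "t \<otimes> a \<in> gr (m + n)" using gr_closed(5)[OF *(4,1)] by (simp add: add.commute)
  then have "(t \<otimes> a) \<oplus> (s \<otimes> b) \<in> gr (m + n)" by (rule gr_closed(3)) (rule gr_closed(5)[OF *(2,3)])
  moreover have "s \<otimes> t \<in> gr (m + n)" by (rule gr_closed(5)[OF *(2,4)])
  ultimately show "((t \<otimes> a) \<oplus> (s \<otimes> b), s \<otimes> t) \<in> (\<Union>n. gr n \<times> gr n)" by blast
  have "a \<otimes> b \<in> gr (m + n)" by (rule gr_closed(5)[OF *(1,3)])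
  then show "(a \<otimes> b, s \<otimes> t) \<in> (\<Union>n. gr n \<times> gr n)" using \<open>s \<otimes> t \<in> gr (m + n)\<close> by blast
next
  show "(\<one>, \<one>) \<in> (\<Union>n. gr n \<times> gr n)" using gr_closed(2) by blast
  show "(\<zero>, \<one>) \<in> (\<Union>n. gr n \<times> gr n)" using gr_closed(1,2) by blast
  show "(\<Union>n. gr n \<times> gr n) \<subseteq> carrier R \<times> carrier R" using gr_carrier by blast
  fix a s c assume "(a, s) \<in> (\<Union>n. gr n \<times> gr n)"
  then show "(c \<odot> a, s) \<in> (\<Union>n. gr n \<times> gr n)" using gr_smult by blast
next
  fix p assume "p \<in> hprimes"
  then show "primeideal p R" by (simp add: hprimes_def)
  show "HD p = {(a, s) \<in> (\<Union>n. gr n \<times> gr n). s \<notin> p}"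
    unfolding homogeneous_fracs_def by auto
qed

sublocale proj: integral_frac_space R \<iota> \<kappa> hprimes HD "\<Union>n. gr n \<times> gr n"
  by (rule proj_integral)

lemma Proj_eq: "Proj R gr = proj.X"
  by (simp add: Proj_def hprimes_def)

definition gloc :: "(nat \<times> 'c) set \<Rightarrow> 'c set" where
  "gloc H = {c / d |c d n. c \<in> G n \<and> d \<in> G n \<and> (n, d) \<notin> H}"

lemma loc_idl:
  assumes "graded_ideal H" shows "proj.loc (idl H) = gloc H"
proof
  show "proj.loc (idl H) \<subseteq> gloc H"
    unfolding local_ring_def gloc_def homogeneous_fracs_def G_def
    using idl_gr[OF assms] by fastforce
  show "gloc H \<subseteq> proj.loc (idl H)"
  proof
    fix x assume "x \<in> gloc H"
    then obtain c d n where x: "c \<in> G n" "d \<in> G n" "(n, d) \<notin> H" "x = c / d" unfolding gloc_def by blast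
    obtain a where a: "a \<in> gr n" "\<iota> a = c" using G_E[OF x(1)] by blast
    obtain s where s: "s \<in> gr n" "\<iota> s = d" using G_E[OF x(2)] by blast
    have "(a, s) \<in> HD (idl H)"
      unfolding homogeneous_fracs_def using a s x(3) idl_gr[OF assms s(1)] by blast
    from proj.loc_memI[OF this] show "x \<in> proj.loc (idl H)" using a s x(4) by simp
  qed
qed

context
  fixes H assumes H: "graded_prime H" and \<phi>H: "(e, \<phi>) \<notin> H"
begin

lemma gi: "graded_ideal H" using H by (simp add: graded_prime_def)

lemma gprimeD: "c \<in> G m \<Longrightarrow> d \<in> G n \<Longrightarrow> (m, c) \<notin> H \<Longrightarrow> (n, d) \<notin> H \<Longrightarrow> (m + n, c * d) \<notin> H"
  using H unfolding graded_prime_def by blast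

lemma one_notin_H: "(0, 1) \<notin> H" using H by (simp add: graded_prime_def)

lemma pow_notin_H: "c \<in> G n \<Longrightarrow> (n, c) \<notin> H \<Longrightarrow> (n * N, c ^ N) \<notin> H"
proof (induction N)
  case (Suc N)
  then show ?case using gprimeD[of c n "c ^ N" "n * N"] G_pow[of c n N] by simp
qed (simp add: one_notin_H)

lemma notin_H_nz: "(n, d) \<notin> H \<Longrightarrow> d \<noteq> 0"
  using graded_idealD(2)[OF gi] by auto

text \<open>A homogeneous \<open>h\<close> of degree \<open>n\<close> is a unit at a point of \<open>D(f)\<close> iff the degree-zero
  fraction \<open>f\<^sup>n / h\<^sup>e\<close> is defined there.\<close>

lemma notin_iff_gloc: "h \<in> G n \<Longrightarrow> h \<noteq> 0 \<Longrightarrow> (n, h) \<notin> H \<longleftrightarrow> \<phi> ^ n / h ^ e \<in> gloc H"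
proof
  assume h: "h \<in> G n" "(n, h) \<notin> H"
  have "\<phi> ^ n \<in> G (e * n)" "h ^ e \<in> G (e * n)" "(e * n, h ^ e) \<notin> H"
    using G_pow[OF G_closed(6), of n] G_pow[OF h(1), of e] pow_notin_H[OF h, of e] by (simp_all add: mult.commute)
  then show "\<phi> ^ n / h ^ e \<in> gloc H" by (auto simp: gloc_def)
next
  assume h: "h \<in> G n" "h \<noteq> 0" "\<phi> ^ n / h ^ e \<in> gloc H"
  then obtain a s m where as: "a \<in> G m" "s \<in> G m" "(m, s) \<notin> H" "\<phi> ^ n / h ^ e = a / s" by (auto simp: gloc_def)
  have he: "h ^ e = h * h ^ (e - 1)" using e_pos by (simp add: power_eq_if)
  have "\<phi> ^ n * s = a * h ^ e"
    using as(4) notin_H_nz[OF as(3)] h(2) by (simp add: frac_eq_eq)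
  then have eq: "\<phi> ^ n * s = h * (h ^ (e - 1) * a)" by (simp add: he mult.left_commute)
  show "(n, h) \<notin> H"
  proof
    assume nh: "(n, h) \<in> H"
    have d: "h ^ (e - 1) * a \<in> G (n * (e - 1) + m)" by (intro G_closed(5) G_pow h(1) as)
    have "(n + (n * (e - 1) + m), h * (h ^ (e - 1) * a)) \<in> H" by (rule graded_idealD(4)[OF gi nh d])
    moreover have "n + (n * (e - 1) + m) = e * n + m" using e_pos by (cases e) (auto simp: algebra_simps)
    ultimately have "(e * n + m, \<phi> ^ n * s) \<in> H" by (simp only: eq)
    moreover have "(e * n + m, \<phi> ^ n * s) \<notin> H"
      by (intro gprimeD G_pow G_closed(6) as pow_notin_H \<phi>H)
    ultimately show False by blast
  qed
qed

end

lemma U0_separated: "loc_separated R \<iota> \<kappa> hprimes HD (\<Union>n. gr n \<times> gr n) U0"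
proof
  show "U0 \<noteq> {}" using zero_in_U0 by blast
  show "openin (topo proj.X) U0"
    unfolding proj.openin_iff U0_def using gr_carrier[OF f_gr] by auto
  fix p h assume p: "p \<in> U0" and h: "h \<in> carrier R" "h \<notin> p"
  obtain H where H: "graded_prime H" "(e, \<phi>) \<notin> H" "p = idl H" using p unfolding U0_iff by blast
  obtain n where n: "(n, coeff (\<epsilon> h) n) \<notin> H" using h H by (auto simp: idl_def)
  define c where "c = coeff (\<epsilon> h) n"
  have c: "c \<in> G n" "(n, c) \<notin> H" using coeff_G[OF h(1)] n by (simp_all add: c_def)
  have c0: "c \<noteq> 0" using notin_H_nz[OF H(1,2) c(2)] .
  show "\<exists>x\<in>proj.loc p. \<forall>q\<in>U0. x \<in> proj.loc q \<longrightarrow> h \<notin> q"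
  proof (intro bexI ballI impI notI)
    show "\<phi> ^ n / c ^ e \<in> proj.loc p"
      using notin_iff_gloc[OF H(1,2) c(1) c0] c loc_idl[OF gi[OF H(1,2)]] H(3) by simp
    fix q assume q: "q \<in> U0" "\<phi> ^ n / c ^ e \<in> proj.loc q" "h \<in> q"
    obtain H' where H': "graded_prime H'" "(e, \<phi>) \<notin> H'" "q = idl H'" using q unfolding U0_iff by blast
    have "(n, c) \<notin> H'"
      using notin_iff_gloc[OF H'(1,2) c(1) c0] q(2) loc_idl[OF gi[OF H'(1,2)]] H'(3) by simp
    then show False using q(3) H'(3) by (simp add: idl_def c_def)
  qed
qed

sublocale basic: loc_separated R \<iota> \<kappa> hprimes HD "\<Union>n. gr n \<times> gr n" U0
  by (rule U0_separated)

definition W :: "'c set" where "W = {b / \<phi> ^ N |b N. b \<in> G (e * N)}"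

lemma W_memI: "b \<in> G n \<Longrightarrow> n = e * N \<Longrightarrow> b / \<phi> ^ N \<in> W"
  unfolding W_def by blast

lemma \<phi>_pow: "\<phi> ^ N \<in> G (e * N)" "\<phi> ^ N \<noteq> 0"
  using G_pow[OF G_closed(6)] f_nz by auto

lemma W_closed: "0 \<in> W" "1 \<in> W" "x \<in> W \<Longrightarrow> y \<in> W \<Longrightarrow> x + y \<in> W" "x \<in> W \<Longrightarrow> y \<in> W \<Longrightarrow> x * y \<in> W"
proof -
  show "0 \<in> W" "1 \<in> W" using W_memI[OF G_closed(1), of 0 0] W_memI[OF G_closed(2), of 0] by simp_all
  assume "x \<in> W" "y \<in> W"
  then obtain b N b' N' where x: "b \<in> G (e * N)" "x = b / \<phi> ^ N" and y: "b' \<in> G (e * N')" "y = b' / \<phi> ^ N'"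
    unfolding W_def by blast
  have "b * \<phi> ^ N' + b' * \<phi> ^ N \<in> G (e * N + e * N')"
    using G_closed(5)[OF x(1) \<phi>_pow(1)[of N']] G_closed(5)[OF y(1) \<phi>_pow(1)[of N]]
    by (intro G_closed(3)) (simp_all add: add.commute)
  from W_memI[OF this, of "N + N'"] show "x + y \<in> W"
    using x y f_nz by (simp add: algebra_simps power_add add_divide_distrib)
  from W_memI[OF G_closed(5)[OF x(1) y(1)], of "N + N'"] show "x * y \<in> W"
    using x y by (simp add: algebra_simps power_add)
qed

definition degree_zero_part :: "(nat \<times> 'c) set \<Rightarrow> 'c set" where
  "degree_zero_part H = {b / \<phi> ^ N |b N. (e * N, b) \<in> H}"

definition wloc :: "'c set \<Rightarrow> 'c set" where
  "wloc Q = {a / s |a s. a \<in> W \<and> s \<in> W \<and> s \<notin> Q}"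

text \<open>Whether \<open>b / f\<^sup>N\<close> lies in the degree-zero part depends on the fraction only: \<open>f\<close> is not in the
  prime, so powers of \<open>f\<close> can be cancelled.\<close>

lemma degree_zero_part_iff:
  assumes H: "graded_prime H" "(e, \<phi>) \<notin> H" and b: "b \<in> G (e * N)"
  shows "b / \<phi> ^ N \<in> degree_zero_part H \<longleftrightarrow> (e * N, b) \<in> H"
proof
  assume "b / \<phi> ^ N \<in> degree_zero_part H"
  then obtain b' N' where b': "(e * N', b') \<in> H" "b / \<phi> ^ N = b' / \<phi> ^ N'" unfolding degree_zero_part_def by blast
  have "b * \<phi> ^ N' = b' * \<phi> ^ N" using b'(2) f_nz by (simp add: frac_eq_eq)
  moreover have "(e * N' + e * N, b' * \<phi> ^ N) \<in> H"
    by (rule graded_idealD(4)[OF gi[OF H] b'(1) \<phi>_pow(1)])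
  ultimately have "(e * N + e * N', b * \<phi> ^ N') \<in> H" by (simp add: add.commute)
  then show "(e * N, b) \<in> H"
    using gprimeD[OF H b \<phi>_pow(1)] pow_notin_H[OF H G_closed(6) H(2), of N'] by blast
qed (auto simp: degree_zero_part_def)

lemma degree_zero_part_prime:
  assumes H: "graded_prime H" "(e, \<phi>) \<notin> H"
  defines "Q \<equiv> degree_zero_part H"
  shows "Q \<subseteq> W" "0 \<in> Q" "x \<in> Q \<Longrightarrow> y \<in> Q \<Longrightarrow> x + y \<in> Q" "x \<in> Q \<Longrightarrow> y \<in> W \<Longrightarrow> x * y \<in> Q"
    "1 \<notin> Q" "x \<in> W \<Longrightarrow> y \<in> W \<Longrightarrow> x * y \<in> Q \<Longrightarrow> x \<in> Q \<or> y \<in> Q" "wloc Q = gloc H"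
proof -
  note gD = graded_idealD[OF gi[OF H]] and iff = degree_zero_part_iff[OF H, folded Q_def]
  show "Q \<subseteq> W" unfolding Q_def degree_zero_part_def W_def using gD(1) by blast
  show "0 \<in> Q" using iff[OF G_closed(1), of 0] gD(2) by simp
  show "1 \<notin> Q" using iff[of 1 0] G_closed(2) one_notin_H[OF H] by simp
  {
    assume "x \<in> Q" "y \<in> Q"
    then obtain b N b' N' where x: "(e * N, b) \<in> H" "x = b / \<phi> ^ N" and y: "(e * N', b') \<in> H" "y = b' / \<phi> ^ N'"
      unfolding Q_def degree_zero_part_def by blast
    have "(e * (N + N'), b * \<phi> ^ N' + b' * \<phi> ^ N) \<in> H"
      using gD(4)[OF x(1) \<phi>_pow(1)[of N']] gD(4)[OF y(1) \<phi>_pow(1)[of N]]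
      by (intro gD(3)) (simp_all add: algebra_simps)
    moreover have "(b * \<phi> ^ N' + b' * \<phi> ^ N) / \<phi> ^ (N + N') = x + y"
      using f_nz by (simp add: x(2) y(2) power_add add_divide_distrib)
    ultimately show "x + y \<in> Q" unfolding Q_def degree_zero_part_def by (metis (mono_tags, lifting) mem_Collect_eq)
  }
  {
    assume "x \<in> Q" "y \<in> W"
    then obtain b N b' N' where x: "(e * N, b) \<in> H" "x = b / \<phi> ^ N" and y: "b' \<in> G (e * N')" "y = b' / \<phi> ^ N'"
      unfolding Q_def degree_zero_part_def W_def by blast
    have "(e * (N + N'), b * b') \<in> H" using gD(4)[OF x(1) y(1)] by (simp add: algebra_simps)
    moreover have "x * y = (b * b') / \<phi> ^ (N + N')" using x y by (simp add: power_add)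
    ultimately show "x * y \<in> Q" unfolding Q_def degree_zero_part_def by blast
  }
  {
    assume "x \<in> W" "y \<in> W" and xy: "x * y \<in> Q"
    then obtain b N b' N' where x: "b \<in> G (e * N)" "x = b / \<phi> ^ N" and y: "b' \<in> G (e * N')" "y = b' / \<phi> ^ N'"
      unfolding W_def by blast
    have bb: "b * b' \<in> G (e * (N + N'))" using G_closed(5)[OF x(1) y(1)] by (simp add: algebra_simps)
    have "x * y = (b * b') / \<phi> ^ (N + N')" using x y by (simp add: power_add)
    then have "(e * (N + N'), b * b') \<in> H" using iff[OF bb] xy by simp
    then have "(e * N, b) \<in> H \<or> (e * N', b') \<in> H"
      using gprimeD[OF H x(1) y(1)] by (auto simp: algebra_simps)
    then show "x \<in> Q \<or> y \<in> Q" using iff x y by simp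
  }
  show "wloc Q = gloc H"
  proof
    show "wloc Q \<subseteq> gloc H"
    proof
      fix z assume "z \<in> wloc Q"
      then obtain b N b' N' where x: "b \<in> G (e * N)" and y: "b' \<in> G (e * N')" "b' / \<phi> ^ N' \<notin> Q"
        and z: "z = (b / \<phi> ^ N) / (b' / \<phi> ^ N')"
        unfolding wloc_def W_def by blast
      have "(e * N', b') \<notin> H" using iff[OF y(1)] y(2) by simp
      then have "(e * N' + e * N, b' * \<phi> ^ N) \<notin> H"
        by (intro gprimeD[OF H] y(1) \<phi>_pow(1) pow_notin_H[OF H G_closed(6) H(2)])
      moreover have "b' * \<phi> ^ N \<in> G (e * N' + e * N)" by (rule G_closed(5)[OF y(1) \<phi>_pow(1)])
      moreover have "b * \<phi> ^ N' \<in> G (e * N' + e * N)"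
        using G_closed(5)[OF x \<phi>_pow(1)[of N']] by (simp only: add.commute)
      moreover have "z = (b * \<phi> ^ N') / (b' * \<phi> ^ N)" by (simp add: z)
      ultimately show "z \<in> gloc H" unfolding gloc_def by blast
    qed
    show "gloc H \<subseteq> wloc Q"
    proof
      fix z assume "z \<in> gloc H"
      then obtain b h n where *: "b \<in> G n" "h \<in> G n" "(n, h) \<notin> H" "z = b / h" unfolding gloc_def by blast
      have h0: "h \<noteq> 0" using notin_H_nz[OF H *(3)] .
      have h: "h ^ e \<in> G (e * n)" "(e * n, h ^ e) \<notin> H"
        using G_pow[OF *(2), of e] pow_notin_H[OF H *(2,3), of e] by (simp_all add: mult.commute)
      have "n + n * (e - 1) = e * n" using e_pos by (cases e) auto
      then have b: "b * h ^ (e - 1) \<in> G (e * n)" using G_closed(5)[OF *(1) G_pow[OF *(2), of "e - 1"]] by simp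
      have "h ^ e = h * h ^ (e - 1)" using e_pos by (simp add: power_eq_if)
      then have "z = (b * h ^ (e - 1) / \<phi> ^ n) / (h ^ e / \<phi> ^ n)" using h0 f_nz by (simp add: *(4))
      moreover have "h ^ e / \<phi> ^ n \<notin> Q" using iff[OF h(1)] h(2) by simp
      ultimately show "z \<in> wloc Q" unfolding wloc_def using W_memI[OF b] W_memI[OF h(1)] by blast
    qed
  qed
qed

text \<open>Conversely, a homogeneous \<open>c\<close> belongs to the homogeneous prime above \<open>Q\<close> iff all its
  degree-zero multiples \<open>c d / f\<^sup>N\<close> lie in \<open>Q\<close>; in this form additivity is immediate.\<close>

lemma graded_prime_above:
  assumes Q: "Q \<subseteq> W" "0 \<in> Q" "\<And>x y. x \<in> Q \<Longrightarrow> y \<in> Q \<Longrightarrow> x + y \<in> Q" "1 \<notin> Q"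
    "\<And>x y. x \<in> W \<Longrightarrow> y \<in> W \<Longrightarrow> x * y \<in> Q \<Longrightarrow> x \<in> Q \<or> y \<in> Q"
  shows "\<exists>H. graded_prime H \<and> (e, \<phi>) \<notin> H \<and> gloc H = wloc Q"
proof -
  define H where "H = {(n, c). c \<in> G n \<and> (\<forall>m N d. d \<in> G m \<and> n + m = e * N \<longrightarrow> c * d / \<phi> ^ N \<in> Q)}"
  have notin: "(n, c) \<notin> H \<longleftrightarrow> (\<exists>m N d. d \<in> G m \<and> n + m = e * N \<and> c * d / \<phi> ^ N \<notin> Q)" if "c \<in> G n" for n c
    using that unfolding H_def by blast
  have prime: "graded_prime H"
    unfolding graded_prime_def graded_ideal_def
  proof (intro conjI allI impI; (elim conjE)?)
    fix n c d assume cd: "(n, c) \<in> H" "(n, d) \<in> H"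
    then show "(n, c + d) \<in> H" using Q(3) G_closed(3) by (auto simp: H_def distrib_right add_divide_distrib)
  next
    fix m n c d assume c: "(m, c) \<in> H" and d: "d \<in> G n"
    have "c * d * d' / \<phi> ^ N \<in> Q" if "d' \<in> G m'" "m + n + m' = e * N" for d' m' N
    proof -
      have "\<forall>m' N d. d \<in> G m' \<and> m + m' = e * N \<longrightarrow> c * d / \<phi> ^ N \<in> Q" using c by (simp add: H_def)
      moreover have "m + (n + m') = e * N" using that(2) by (simp add: add.assoc)
      ultimately have "c * (d * d') / \<phi> ^ N \<in> Q" using G_closed(5)[OF d that(1)] by blast
      then show ?thesis by (simp add: mult.assoc)
    qed
    moreover have "c * d \<in> G (m + n)" using c d G_closed(5) by (simp add: H_def)
    ultimately show "(m + n, c * d) \<in> H" unfolding H_def by blast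
  next
    show "(0, 1) \<notin> H" using notin[OF G_closed(2)] G_closed(2) Q(4) by (metis add_0 div_by_1 mult_1 mult_zero_right power_0)
  next
    fix m n c d assume cd: "c \<in> G m" "d \<in> G n" "(m + n, c * d) \<in> H"
    show "(m, c) \<in> H \<or> (n, d) \<in> H"
    proof (rule ccontr)
      assume "\<not> ((m, c) \<in> H \<or> (n, d) \<in> H)"
      then obtain m' N c' n' N' d' where c': "c' \<in> G m'" "m + m' = e * N" "c * c' / \<phi> ^ N \<notin> Q"
        and d': "d' \<in> G n'" "n + n' = e * N'" "d * d' / \<phi> ^ N' \<notin> Q"
        using notin[OF cd(1)] notin[OF cd(2)] by blast
      have 1: "c' * d' \<in> G (m' + n')" "m + n + (m' + n') = e * (N + N')"
        using G_closed(5)[OF c'(1) d'(1)] c'(2) d'(2) by (simp_all add: algebra_simps)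
      have "(c * d) * (c' * d') / \<phi> ^ (N + N') \<in> Q" using cd(3) 1 by (simp add: H_def)
      moreover have "(c * d) * (c' * d') / \<phi> ^ (N + N') = (c * c' / \<phi> ^ N) * (d * d' / \<phi> ^ N')"
        by (simp add: power_add algebra_simps)
      moreover have "c * c' / \<phi> ^ N \<in> W" "d * d' / \<phi> ^ N' \<in> W"
        using W_memI[OF G_closed(5)[OF cd(1) c'(1)] c'(2)] W_memI[OF G_closed(5)[OF cd(2) d'(1)] d'(2)] by simp_all
      ultimately show False using Q(5) c'(3) d'(3) by metis
    qed
  qed (auto simp: H_def G_closed Q(2))
  have fH: "(e, \<phi>) \<notin> H"
    unfolding notin[OF G_closed(6)]
    by (intro exI[of _ 0] exI[of _ 1] exI[of _ 1]) (use G_closed(2) Q(4) f_nz in simp)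
  have "gloc H = wloc Q"
  proof
    show "gloc H \<subseteq> wloc Q"
    proof
      fix z assume "z \<in> gloc H"
      then obtain b h n where *: "b \<in> G n" "h \<in> G n" "(n, h) \<notin> H" "z = b / h" unfolding gloc_def by blast
      obtain m N d where d: "d \<in> G m" "n + m = e * N" "h * d / \<phi> ^ N \<notin> Q" using notin[OF *(2)] *(3) by blast
      have "d \<noteq> 0" using d(3) Q(2) by auto
      then have "z = (b * d / \<phi> ^ N) / (h * d / \<phi> ^ N)" using f_nz by (simp add: *(4))
      then show "z \<in> wloc Q" unfolding wloc_def
        using W_memI[OF G_closed(5)[OF *(1) d(1)] d(2)] W_memI[OF G_closed(5)[OF *(2) d(1)] d(2)] d(3) by blast
    qed
    show "wloc Q \<subseteq> gloc H"
    proof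
      fix z assume "z \<in> wloc Q"
      then obtain b N b' N' where x: "b \<in> G (e * N)" and y: "b' \<in> G (e * N')" "b' / \<phi> ^ N' \<notin> Q"
        and z: "z = (b / \<phi> ^ N) / (b' / \<phi> ^ N')"
        unfolding wloc_def W_def by blast
      have "(e * N', b') \<notin> H"
        unfolding notin[OF y(1)] by (intro exI[of _ 0] exI[of _ N'] exI[of _ 1]) (use G_closed(2) y(2) in simp)
      then have "(e * N' + e * N, b' * \<phi> ^ N) \<notin> H"
        by (intro gprimeD[OF prime fH] y(1) \<phi>_pow(1) pow_notin_H[OF prime fH G_closed(6) fH])
      moreover have "b' * \<phi> ^ N \<in> G (e * N' + e * N)" by (rule G_closed(5)[OF y(1) \<phi>_pow(1)])
      moreover have "b * \<phi> ^ N' \<in> G (e * N' + e * N)"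
        using G_closed(5)[OF x \<phi>_pow(1)[of N']] by (simp only: add.commute)
      moreover have "z = (b * \<phi> ^ N') / (b' * \<phi> ^ N)" by (simp add: z)
      ultimately show "z \<in> gloc H" unfolding gloc_def by blast
    qed
  qed
  then show ?thesis using prime fH by blast
qed

text \<open>\<open>W\<close> is the degree-zero part of \<open>R[1/f]\<close>.  Its primes correspond to the homogeneous primes of
  \<open>R\<close> that avoid \<open>f\<close>, with the same local rings.\<close>

theorem spec_isomorphic_basic_open:
  assumes T: "frac_embed T \<iota>' \<kappa>" and W: "\<iota>' ` carrier T = W"
  shows "isomorphic (Spec T) (open_subspace (Proj R gr) U0)"
proof -
  interpret T: frac_embed T \<iota>' \<kappa> by (rule T)
  let ?PT = "{p. primeideal p T}" and ?DT = "\<lambda>p. carrier T \<times> (carrier T - p)"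
  interpret S: loc_separated T \<iota>' \<kappa> ?PT ?DT "carrier T \<times> carrier T" ?PT by (rule T.spec_separated)
  have locT: "local_ring \<iota>' ?DT q = wloc (\<iota>' ` q)" if "primeideal q T" for q
  proof -
    have "q \<subseteq> carrier T"
      using that by (meson additive_subgroup.a_subset ideal.axioms(1) primeideal.axioms(1))
    then have *: "\<iota>' s \<notin> \<iota>' ` q \<longleftrightarrow> s \<notin> q" if "s \<in> carrier T" for s
      using T.inj that by (meson inj_on_image_mem_iff)
    show ?thesis unfolding local_ring_def wloc_def W[symmetric] using * by auto
  qed
  have "local_ring \<iota>' ?DT ` ?PT = proj.loc ` U0"
  proof
    show "local_ring \<iota>' ?DT ` ?PT \<subseteq> proj.loc ` U0"
    proof (rule image_subsetI)
      fix q assume "q \<in> ?PT"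
      then have q: "primeideal q T" by simp
      interpret q: primeideal q T by (rule q)
      have sub: "x \<in> carrier T" if "x \<in> q" for x using that by (rule q.a_Hcarr)
      have mem: "\<iota>' x \<in> \<iota>' ` q \<longleftrightarrow> x \<in> q" if "x \<in> carrier T" for x
        using T.inj that sub inj_on_image_mem_iff[OF T.inj] by (simp add: subset_iff)
      have "\<exists>H. graded_prime H \<and> (e, \<phi>) \<notin> H \<and> gloc H = wloc (\<iota>' ` q)"
      proof (rule graded_prime_above)
        show "\<iota>' ` q \<subseteq> W" unfolding W[symmetric] using sub by blast
        show "0 \<in> \<iota>' ` q" using T.\<iota>_zero q.zero_closed by (metis imageI)
        have "\<one>\<^bsub>T\<^esub> \<notin> q" using q.I_notcarr q.one_imp_carrier by metis
        then show "1 \<notin> \<iota>' ` q" using mem[OF T.one_closed] T.\<iota>_one by simp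
        fix x y
        {
          assume "x \<in> \<iota>' ` q" "y \<in> \<iota>' ` q"
          then obtain a b where "a \<in> q" "b \<in> q" "x = \<iota>' a" "y = \<iota>' b" by blast
          then show "x + y \<in> \<iota>' ` q" using q.a_closed T.\<iota>_add sub by (metis imageI)
        }
        {
          assume "x \<in> W" "y \<in> W" "x * y \<in> \<iota>' ` q"
          then obtain a b where ab: "a \<in> carrier T" "b \<in> carrier T" "x = \<iota>' a" "y = \<iota>' b" unfolding W[symmetric] by blast
          then have "a \<otimes>\<^bsub>T\<^esub> b \<in> q" using mem[of "a \<otimes>\<^bsub>T\<^esub> b"] \<open>x * y \<in> _\<close> T.\<iota>_mult by simp
          then show "x \<in> \<iota>' ` q \<or> y \<in> \<iota>' ` q" using q.I_prime ab by blast
        }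
      qed
      then obtain H where H: "graded_prime H" "(e, \<phi>) \<notin> H" "gloc H = wloc (\<iota>' ` q)" by blast
      then have "idl H \<in> U0" using U0_iff by blast
      moreover have "proj.loc (idl H) = local_ring \<iota>' ?DT q"
        using loc_idl[OF gi[OF H(1,2)]] H(3) locT[OF q] by simp
      ultimately show "local_ring \<iota>' ?DT q \<in> proj.loc ` U0" by (metis imageI)
    qed
    show "proj.loc ` U0 \<subseteq> local_ring \<iota>' ?DT ` ?PT"
    proof (rule image_subsetI)
      fix p assume "p \<in> U0"
      then obtain H where H: "graded_prime H" "(e, \<phi>) \<notin> H" "p = idl H" unfolding U0_iff by blast
      let ?Q = "degree_zero_part H"
      note Q = degree_zero_part_prime[OF H(1,2)]
      define q where "q = {t \<in> carrier T. \<iota>' t \<in> ?Q}"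
      have img: "\<iota>' ` q = ?Q" using Q(1) unfolding q_def W[symmetric] by auto
      have "primeideal q T"
      proof (rule primeidealI)
        show "ideal q T"
        proof (rule T.dom.ideal_if_closed)
          fix x y assume x: "x \<in> q"
          {
            assume "y \<in> q"
            then show "x \<oplus>\<^bsub>T\<^esub> y \<in> q" using x Q(3) by (simp add: q_def T.\<iota>_add)
          }
          {
            assume "y \<in> carrier T"
            moreover from this have "\<iota>' y \<in> W" unfolding W[symmetric] by blast
            ultimately show "x \<otimes>\<^bsub>T\<^esub> y \<in> q" using x Q(4) by (simp add: q_def T.\<iota>_mult)
          }
        qed (auto simp: q_def T.\<iota>_zero Q(2))
        show "cring T" by (rule T.dom.is_cring)
        have "\<one>\<^bsub>T\<^esub> \<notin> q" using Q(5) by (simp add: q_def T.\<iota>_one)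
        then show "carrier T \<noteq> q" by auto
        fix a b assume ab: "a \<in> carrier T" "b \<in> carrier T" "a \<otimes>\<^bsub>T\<^esub> b \<in> q"
        then have "\<iota>' a \<in> W" "\<iota>' b \<in> W" unfolding W[symmetric] by blast+
        then show "a \<in> q \<or> b \<in> q" using Q(6) ab by (simp add: q_def T.\<iota>_mult)
      qed
      moreover from this have "local_ring \<iota>' ?DT q = proj.loc p"
        using locT[of q] img Q(7) loc_idl[OF gi[OF H(1,2)]] H(3) by simp
      ultimately show "proj.loc p \<in> local_ring \<iota>' ?DT ` ?PT" by (metis imageI mem_Collect_eq)
    qed
  qed
  from isomorphic_if_same_local_rings[OF S.loc_separated_axioms U0_separated this]
  have "isomorphic (open_subspace (frac_space T ?PT ?DT) ?PT) (open_subspace (Proj R gr) U0)"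
    by (simp add: Proj_eq)
  moreover have "open_subspace (frac_space T ?PT ?DT) ?PT = Spec T"
  proof -
    have "subtopology (topo S.X) ?PT = topo S.X" using subtopology_topspace[of "topo S.X"] by (simp add: S.points_X)
    moreover have "S.X = \<lparr>topo = topo S.X, sheaf = sheaf S.X\<rparr>" by simp
    ultimately show ?thesis by (simp add: open_subspace_def Spec_def)
  qed
  ultimately show ?thesis by simp
qed

text \<open>The denominators of \<open>x\<close> form a homogeneous ideal.  If \<open>x\<close> is regular on \<open>D(f)\<close>, then no
  homogeneous prime avoiding \<open>f\<close> contains it, so it contains a power of \<open>f\<close>.\<close>

lemma graded_prime_avoiding:
  assumes J: "graded_ideal J" and avoid: "\<And>N. (e * N, \<phi> ^ N) \<notin> J"
  shows "\<exists>H. J \<subseteq> H \<and> graded_prime H \<and> (e, \<phi>) \<notin> H"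
proof -
  let ?A = "{H. graded_ideal H \<and> J \<subseteq> H \<and> (\<forall>N. (e * N, \<phi> ^ N) \<notin> H)}"
  \<comment> \<open>An ideal maximal among those that avoid all powers of \<open>f\<close> is prime.\<close>
  have "\<exists>M\<in>?A. \<forall>X\<in>?A. M \<subseteq> X \<longrightarrow> X = M"
  proof (rule subset_Zorn_nonempty)
    show "?A \<noteq> {}" using J avoid by blast
    fix C assume C: "C \<noteq> {}" "subset.chain ?A C"
    then have CA: "C \<subseteq> ?A" and tot: "\<And>X Y. X \<in> C \<Longrightarrow> Y \<in> C \<Longrightarrow> X \<subseteq> Y \<or> Y \<subseteq> X"
      by (auto simp: subset_chain_def)
    have "graded_ideal (\<Union>C)"
      unfolding graded_ideal_def
    proof (intro conjI allI impI; (elim conjE)?)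
      fix n c assume "(n, c) \<in> \<Union>C" then show "c \<in> G n" using CA graded_idealD(1) by blast
    next
      fix n show "(n, 0) \<in> \<Union>C" using C(1) CA graded_idealD(2) by blast
    next
      fix n c d assume "(n, c) \<in> \<Union>C" "(n, d) \<in> \<Union>C"
      then obtain X where "X \<in> C" "(n, c) \<in> X" "(n, d) \<in> X" using tot by (meson UnionE subsetD)
      then show "(n, c + d) \<in> \<Union>C" using CA graded_idealD(3) by blast
    next
      fix m n c d assume "(m, c) \<in> \<Union>C" "d \<in> G n"
      then show "(m + n, c * d) \<in> \<Union>C" using CA graded_idealD(4) by blast
    qed
    then show "\<Union>C \<in> ?A" using C(1) CA by blast
  qed
  then obtain M where M: "graded_ideal M" "J \<subseteq> M" "\<And>N. (e * N, \<phi> ^ N) \<notin> M"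
    and max: "\<And>X. graded_ideal X \<Longrightarrow> M \<subseteq> X \<Longrightarrow> X \<noteq> M \<Longrightarrow> \<exists>N. (e * N, \<phi> ^ N) \<in> X"
    by (smt (verit, best) mem_Collect_eq subset_trans)
  note MD = graded_idealD[OF M(1)]
  \<comment> \<open>If \<open>M\<close> were not prime, two ideal quotients would be larger than \<open>M\<close> and contain powers of \<open>f\<close>.\<close>
  define colon where "colon n d = {(m, c). c \<in> G m \<and> (m + n, c * d) \<in> M}" for n d
  have colon_ideal: "graded_ideal (colon n d)" "M \<subseteq> colon n d" if d: "d \<in> G n" for n d
  proof -
    show "M \<subseteq> colon n d" using MD(1,4) d by (auto simp: colon_def)
    show "graded_ideal (colon n d)"
      unfolding graded_ideal_def
    proof (intro conjI allI impI; (elim conjE)?)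
      fix m c c' assume "(m, c) \<in> colon n d" "(m, c') \<in> colon n d"
      then show "(m, c + c') \<in> colon n d" using MD(3) G_closed(3) by (auto simp: colon_def distrib_right)
    next
      fix m m' c c' assume c: "(m, c) \<in> colon n d" "c' \<in> G m'"
      then have "(m + n + m', c * d * c') \<in> M" using MD(4) by (auto simp: colon_def)
      then have "(m + m' + n, c * c' * d) \<in> M" by (simp add: ac_simps)
      then show "(m + m', c * c') \<in> colon n d" using c G_closed(5) by (auto simp: colon_def)
    qed (auto simp: colon_def G_closed MD(2))
  qed
  have "graded_prime M"
    unfolding graded_prime_def
  proof (intro conjI allI impI M(1); (elim conjE)?)
    show "(0, 1) \<notin> M" using M(3)[of 0] by simp
    fix m n c d assume cd: "c \<in> G m" "d \<in> G n" "(m + n, c * d) \<in> M"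
    show "(m, c) \<in> M \<or> (n, d) \<in> M"
    proof (rule ccontr)
      assume no: "\<not> ((m, c) \<in> M \<or> (n, d) \<in> M)"
      have "(m, c) \<in> colon n d" using cd by (simp add: colon_def)
      then obtain N where "(e * N, \<phi> ^ N) \<in> colon n d" using max[OF colon_ideal[OF cd(2)]] no by blast
      then have "(n, d) \<in> colon (e * N) (\<phi> ^ N)" using cd(2) by (simp add: colon_def ac_simps)
      then obtain N' where "(e * N', \<phi> ^ N') \<in> colon (e * N) (\<phi> ^ N)"
        using max[OF colon_ideal[OF \<phi>_pow(1)]] no by blast
      then have "(e * (N' + N), \<phi> ^ (N' + N)) \<in> M" by (simp add: colon_def power_add distrib_left)
      then show False using M(3) by blast
    qed
  qed
  moreover have "(e, \<phi>) \<notin> M" using M(3)[of 1] by simp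
  ultimately show ?thesis using M(2) by blast
qed

theorem regular_on_basic_open: "proj.reg U0 = W"
proof
  show "W \<subseteq> proj.reg U0"
  proof
    fix x assume "x \<in> W"
    then obtain b N where b: "b \<in> G (e * N)" "x = b / \<phi> ^ N" unfolding W_def by blast
    have "x \<in> proj.loc p" if p: "p \<in> U0" for p
    proof -
      obtain H where H: "graded_prime H" "(e, \<phi>) \<notin> H" "p = idl H" using iffD1[OF U0_iff p] by blast
      have "(e * N, \<phi> ^ N) \<notin> H" by (rule pow_notin_H[OF H(1,2) G_closed(6) H(2)])
      then have "x \<in> gloc H" unfolding gloc_def b(2) using b(1) \<phi>_pow(1)[of N] by blast
      then show ?thesis using loc_idl[OF gi[OF H(1,2)]] H(3) by simp
    qed
    then show "x \<in> proj.reg U0" by (simp add: regular_def)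
  qed
  show "proj.reg U0 \<subseteq> W"
  proof
    fix x assume x: "x \<in> proj.reg U0"
    \<comment> \<open>The homogeneous denominators of \<open>x\<close>.\<close>
    define J where "J = {(n, s). s \<in> G n \<and> x * s \<in> G n}"
    have J: "graded_ideal J"
      unfolding graded_ideal_def J_def using G_closed(1,3,5)
      by (auto simp: distrib_left simp flip: mult.assoc)
    have "\<exists>N. (e * N, \<phi> ^ N) \<in> J"
    proof (rule ccontr)
      assume "\<not> (\<exists>N. (e * N, \<phi> ^ N) \<in> J)"
      then obtain H where H: "J \<subseteq> H" "graded_prime H" "(e, \<phi>) \<notin> H" using graded_prime_avoiding[OF J] by blast
      then have "idl H \<in> U0" using U0_iff by blast
      then have "x \<in> gloc H" using x loc_idl[OF gi[OF H(2,3)]] by (auto simp: regular_def)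
      then obtain a s n where as: "a \<in> G n" "s \<in> G n" "(n, s) \<notin> H" "x = a / s" unfolding gloc_def by blast
      then have "x * s = a" using notin_H_nz[OF H(2,3) as(3)] by simp
      then show False using as H(1) by (auto simp: J_def)
    qed
    then obtain N where "x * \<phi> ^ N \<in> G (e * N)" by (auto simp: J_def)
    from W_memI[OF this refl] show "x \<in> W" using f_nz by simp
  qed
qed

end

section \<open>Covariants of a binary quartic and a binary quadratic form\<close>

text \<open>Coefficients are binomially normalised: \<open>a\<close> stands for the quartic \<open>\<Sum>m\<le>4. C(4,m) a\<^sub>m X\<^sub>0\<^sup>m X\<^sub>1\<^sup>4\<^sup>-\<^sup>m\<close>.\<close>

text \<open>The second transvectant of two quadratic forms, the invariant bilinear pairing.\<close>

definition pair2 :: "(nat \<Rightarrow> 'a::comm_ring_1) \<Rightarrow> (nat \<Rightarrow> 'a) \<Rightarrow> 'a" where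
  "pair2 b c = b 0 * c 2 - 2 * b 1 * c 1 + b 2 * c 0"

text \<open>The second transvectant of a quartic and a quadratic form, a quadratic form.\<close>

definition contract :: "(nat \<Rightarrow> 'a::comm_ring_1) \<Rightarrow> (nat \<Rightarrow> 'a) \<Rightarrow> nat \<Rightarrow> 'a" where
  "contract a b m = a m * b 2 - 2 * a (m + 1) * b 1 + a (m + 2) * b 0"

definition det3 :: "(nat \<Rightarrow> 'a::comm_ring_1) \<Rightarrow> (nat \<Rightarrow> 'a) \<Rightarrow> (nat \<Rightarrow> 'a) \<Rightarrow> 'a" where
  "det3 p q r = p 0 * (q 1 * r 2 - q 2 * r 1) - p 1 * (q 0 * r 2 - q 2 * r 0) + p 2 * (q 0 * r 1 - q 1 * r 0)"

text \<open>The two classical invariants of a quartic.\<close>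

definition quartic_i :: "(nat \<Rightarrow> 'a::comm_ring_1) \<Rightarrow> 'a" where
  "quartic_i a = a 0 * a 4 - 4 * a 1 * a 3 + 3 * a 2 ^ 2"

definition quartic_j :: "(nat \<Rightarrow> 'a::comm_ring_1) \<Rightarrow> 'a" where
  "quartic_j a = a 0 * a 2 * a 4 + 2 * a 1 * a 2 * a 3 - a 2 ^ 3 - a 0 * a 3 ^ 2 - a 1 ^ 2 * a 4"

text \<open>The six joint invariants, in the order \<open>d, i, j, a, b, c\<close> and with the normalisations that
  produce the stated relation.\<close>

definition invariant_of :: "(nat \<Rightarrow> 'a::field) \<Rightarrow> (nat \<Rightarrow> 'a) \<Rightarrow> nat \<Rightarrow> 'a" where
  "invariant_of a b l =
    (if l = 0 then pair2 b b
     else if l = 1 then 2 * quartic_i a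
     else if l = 2 then 6 * quartic_j a
     else if l = 3 then pair2 (contract a b) b
     else if l = 4 then pair2 (contract a b) (contract a b) - pair2 b b * (2 * quartic_i a) / 3
     else det3 b (contract a b) (contract a (contract a b)))"

text \<open>The coefficients of a quartic and of a quadratic form after the substitution
  \<open>(X\<^sub>0, X\<^sub>1) \<mapsto> (p X\<^sub>0 + q X\<^sub>1, r X\<^sub>0 + s X\<^sub>1)\<close>, in binomial normalisation.\<close>

definition subst4 :: "'a::comm_ring_1 \<Rightarrow> 'a \<Rightarrow> 'a \<Rightarrow> 'a \<Rightarrow> (nat \<Rightarrow> 'a) \<Rightarrow> nat \<Rightarrow> 'a" where
  "subst4 p q r s a m =
     (if m = 0 then s^4*(a 0) + 4*q*s^3*(a 1) + 6*q^2*s^2*(a 2) + 4*q^3*s*(a 3) + q^4*(a 4)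
      else if m = 1 then r*s^3*(a 0) + 3*r*q*s^2*(a 1) + 3*r*q^2*s*(a 2) + r*q^3*(a 3) + p*s^3*(a 1) + 3*p*q*s^2*(a 2) + 3*p*q^2*s*(a 3) + p*q^3*(a 4)
      else if m = 2 then r^2*s^2*(a 0) + 2*r^2*q*s*(a 1) + r^2*q^2*(a 2) + 2*p*r*s^2*(a 1) + 4*p*r*q*s*(a 2) + 2*p*r*q^2*(a 3) + p^2*s^2*(a 2) + 2*p^2*q*s*(a 3) + p^2*q^2*(a 4)
      else if m = 3 then r^3*s*(a 0) + r^3*q*(a 1) + 3*p*r^2*s*(a 1) + 3*p*r^2*q*(a 2) + 3*p^2*r*s*(a 2) + 3*p^2*r*q*(a 3) + p^3*s*(a 3) + p^3*q*(a 4)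
      else r^4*(a 0) + 4*p*r^3*(a 1) + 6*p^2*r^2*(a 2) + 4*p^3*r*(a 3) + p^4*(a 4))"

definition subst2 :: "'a::comm_ring_1 \<Rightarrow> 'a \<Rightarrow> 'a \<Rightarrow> 'a \<Rightarrow> (nat \<Rightarrow> 'a) \<Rightarrow> nat \<Rightarrow> 'a" where
  "subst2 p q r s b m =
     (if m = 0 then s^2*(b 0) + 2*q*s*(b 1) + q^2*(b 2)
      else if m = 1 then r*s*(b 0) + r*q*(b 1) + p*s*(b 1) + p*q*(b 2)
      else r^2*(b 0) + 2*p*r*(b 1) + p^2*(b 2))"

lemma all_le_2: "(\<forall>m\<le>2::nat. Q m) \<longleftrightarrow> Q 0 \<and> Q 1 \<and> Q 2"
  by (auto simp: le_Suc_eq numeral_2_eq_2)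

lemma pair2_subst:
  fixes b c :: "nat \<Rightarrow> 'a::field_char_0"
  assumes "\<forall>m\<le>2. B m = k * subst2 p q r s b m" "\<forall>m\<le>2. C m = l * subst2 p q r s c m"
  shows "pair2 B C = k * l * (p * s - q * r) ^ 2 * pair2 b c"
proof -
  have B: "B 0 = k * subst2 p q r s b 0" "B 1 = k * subst2 p q r s b 1" "B 2 = k * subst2 p q r s b 2"
    and C: "C 0 = l * subst2 p q r s c 0" "C 1 = l * subst2 p q r s c 1" "C 2 = l * subst2 p q r s c 2"
    using assms by (simp_all add: all_le_2)
  show ?thesis unfolding pair2_def B C by (simp add: subst2_def) Groebner_Basis.algebra
qed

text \<open>Transvection is covariant.  The factors \<open>k\<close> are carried along because the operation is iterated
  and every application contributes a square of the determinant.\<close>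

lemma contract_subst:
  fixes a b :: "nat \<Rightarrow> 'a::field_char_0"
  assumes "\<forall>m\<le>2. B m = k * subst2 p q r s b m"
  shows "\<forall>m\<le>2. contract (subst4 p q r s a) B m = k * (p * s - q * r) ^ 2 * subst2 p q r s (contract a b) m"
proof -
  have B: "B 0 = k * subst2 p q r s b 0" "B 1 = k * subst2 p q r s b 1" "B 2 = k * subst2 p q r s b 2"
    using assms by (simp_all add: all_le_2)
  have "contract (subst4 p q r s a) B 0 = k * (p * s - q * r) ^ 2 * subst2 p q r s (contract a b) 0"
    unfolding contract_def B by (simp add: subst4_def subst2_def contract_def numeral_2_eq_2[symmetric] numeral_3_eq_3[symmetric] flip: One_nat_def) Groebner_Basis.algebra
  moreover have "contract (subst4 p q r s a) B 1 = k * (p * s - q * r) ^ 2 * subst2 p q r s (contract a b) 1"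
    unfolding contract_def B by (simp add: subst4_def subst2_def contract_def numeral_2_eq_2[symmetric] numeral_3_eq_3[symmetric] flip: One_nat_def) Groebner_Basis.algebra
  moreover have "contract (subst4 p q r s a) B 2 = k * (p * s - q * r) ^ 2 * subst2 p q r s (contract a b) 2"
    unfolding contract_def B by (simp add: subst4_def subst2_def contract_def numeral_2_eq_2[symmetric] numeral_3_eq_3[symmetric] flip: One_nat_def) Groebner_Basis.algebra
  ultimately show ?thesis by (simp add: all_le_2)
qed

lemma det3_subst:
  fixes b c e :: "nat \<Rightarrow> 'a::field_char_0"
  assumes "\<forall>m\<le>2. B m = k * subst2 p q r s b m" "\<forall>m\<le>2. C m = l * subst2 p q r s c m"
    "\<forall>m\<le>2. E m = n * subst2 p q r s e m"
  shows "det3 B C E = k * l * n * (p * s - q * r) ^ 3 * det3 b c e"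
proof -
  have B: "B 0 = k * subst2 p q r s b 0" "B 1 = k * subst2 p q r s b 1" "B 2 = k * subst2 p q r s b 2"
    and C: "C 0 = l * subst2 p q r s c 0" "C 1 = l * subst2 p q r s c 1" "C 2 = l * subst2 p q r s c 2"
    and E: "E 0 = n * subst2 p q r s e 0" "E 1 = n * subst2 p q r s e 1" "E 2 = n * subst2 p q r s e 2"
    using assms by (simp_all add: all_le_2)
  show ?thesis unfolding det3_def B C E by (simp add: subst2_def) Groebner_Basis.algebra
qed

lemma quartic_i_subst:
  fixes a :: "nat \<Rightarrow> 'a::field_char_0"
  shows "quartic_i (subst4 p q r s a) = (p * s - q * r) ^ 4 * quartic_i a"
  unfolding quartic_i_def by (simp add: subst4_def) Groebner_Basis.algebra

lemma quartic_j_subst: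
  fixes a :: "nat \<Rightarrow> 'a::field_char_0"
  shows "quartic_j (subst4 p q r s a) = (p * s - q * r) ^ 6 * quartic_j a"
  unfolding quartic_j_def by (simp add: subst4_def) Groebner_Basis.algebra

text \<open>The form \<open>b\<close> is allowed an additional factor, the determinant of the substitution: this is how the
  quadratic form of a rational map transforms under conjugation with the adjugate in place of the inverse.\<close>

lemma invariant_of_subst:
  fixes a b :: "nat \<Rightarrow> 'a::field_char_0"
  assumes A: "\<And>m. m \<le> 4 \<Longrightarrow> A m = subst4 p q r s a m"
    and B: "\<And>m. m \<le> 2 \<Longrightarrow> B m = (p * s - q * r) * subst2 p q r s b m" and l: "l < 6"
  shows "invariant_of A B l = (p * s - q * r) ^ (2 * weights ! l) * invariant_of a b l"
proof -
  let ?\<Delta> = "p * s - q * r" and ?A = "subst4 p q r s a"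
  have B': "\<forall>m\<le>2. B m = ?\<Delta> * subst2 p q r s b m" using B by blast
  have c: "contract A B m = contract ?A B m" if "m \<le> 2" for m
    using A that by (simp add: contract_def)
  have C: "\<forall>m\<le>2. contract A B m = ?\<Delta> ^ 3 * subst2 p q r s (contract a b) m"
    using contract_subst[OF B', of a] c by (simp add: power3_eq_cube power2_eq_square mult.assoc)
  have c2: "contract A (contract A B) m = contract ?A (contract A B) m" if "m \<le> 2" for m
    using A that by (simp add: contract_def)
  have C2: "\<forall>m\<le>2. contract A (contract A B) m = ?\<Delta> ^ 5 * subst2 p q r s (contract a (contract a b)) m"
    using contract_subst[OF C, of a] c2 by (simp flip: power_add)
  have i: "quartic_i A = ?\<Delta> ^ 4 * quartic_i a" and j: "quartic_j A = ?\<Delta> ^ 6 * quartic_j a"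
    using A quartic_i_subst[of p q r s a] quartic_j_subst[of p q r s a]
    by (simp_all add: quartic_i_def quartic_j_def)
  have 1: "pair2 B B = ?\<Delta> ^ 4 * pair2 b b"
    unfolding pair2_subst[OF B' B'] by (simp add: power_numeral_reduce algebra_simps)
  have 2: "pair2 (contract A B) B = ?\<Delta> ^ 6 * pair2 (contract a b) b"
    unfolding pair2_subst[OF C B'] by (simp flip: power_Suc2 power_add)
  have 3: "pair2 (contract A B) (contract A B) = ?\<Delta> ^ 8 * pair2 (contract a b) (contract a b)"
    unfolding pair2_subst[OF C C] by (simp flip: power_add)
  have 4: "det3 B (contract A B) (contract A (contract A B)) = ?\<Delta> ^ 12 * det3 b (contract a b) (contract a (contract a b))"
    unfolding det3_subst[OF B' C C2] by (simp flip: power_Suc power_add)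
  have "l = 0 \<or> l = 1 \<or> l = 2 \<or> l = 3 \<or> l = 4 \<or> l = 5" using l by auto
  then show ?thesis
    by (elim disjE) (simp_all add: invariant_of_def weights_def 1 2 3 4 i j right_diff_distrib flip: power_add)
qed

subsection \<open>The quartic and the quadratic form of a cubic rational map\<close>

text \<open>The quartic \<open>X\<^sub>1 F\<^sub>0 - X\<^sub>0 F\<^sub>1\<close>, whose zeros are the fixed points of the map, and the
  divergence of \<open>(F\<^sub>0, F\<^sub>1)\<close>.  Together they carry the same information as \<open>(F\<^sub>0, F\<^sub>1)\<close>.\<close>

definition al :: "nat \<Rightarrow> 'k::field mpoly" where
  "al m = (if m = 0 then var 0 else if m = 1 then const (1/4) * (var 1 - var 4)
     else if m = 2 then const (1/6) * (var 2 - var 5) else if m = 3 then const (1/4) * (var 3 - var 6) else - var 7)"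

definition be :: "nat \<Rightarrow> 'k::field mpoly" where
  "be m = (if m = 0 then var 1 + 3 * var 4 else if m = 1 then var 2 + var 5 else 3 * var 3 + var 6)"

definition invs :: "nat \<Rightarrow> 'k::field mpoly" where
  "invs l =
    (if l = 0 then pair2 be be
     else if l = 1 then 2 * quartic_i al
     else if l = 2 then 6 * quartic_j al
     else if l = 3 then pair2 (contract al be) be
     else if l = 4 then pair2 (contract al be) (contract al be) - const (1/3) * (pair2 be be * (2 * quartic_i al))
     else det3 be (contract al be) (contract al (contract al be)))"

abbreviation alv :: "(nat \<Rightarrow> 'k::field) \<Rightarrow> nat \<Rightarrow> 'k" where "alv x m \<equiv> ev x (al m)"
abbreviation bev :: "(nat \<Rightarrow> 'k::field) \<Rightarrow> nat \<Rightarrow> 'k" where "bev x m \<equiv> ev x (be m)"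

lemmas ev_simps [simp] = peval_hom_simps[OF id_hom]

lemma alv: "alv x 0 = x 0" "alv x 1 = (x 1 - x 4) / 4" "alv x 2 = (x 2 - x 5) / 6" "alv x 3 = (x 3 - x 6) / 4" "alv x 4 = - x 7"
  for x :: "nat \<Rightarrow> 'k::field_char_0"
  by (simp_all add: al_def id_hom)

lemma bev: "bev x 0 = x 1 + 3 * x 4" "bev x 1 = x 2 + x 5" "bev x 2 = 3 * x 3 + x 6"
  for x :: "nat \<Rightarrow> 'k::field_char_0"
  by (simp_all add: be_def id_hom)

lemma ev_invs: "ev x (invs l) = invariant_of (alv x) (bev x) l"
  for x :: "nat \<Rightarrow> 'k::field_char_0"
  by (simp add: invs_def invariant_of_def pair2_def contract_def quartic_i_def quartic_j_def det3_def id_hom)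

lemma PA_al [simp]: "al m \<in> PA 8" and PA_be [simp]: "be m \<in> PA 8"
  by (auto simp: al_def be_def intro!: PA_add PA_mult PA_diff PA_uminus)

lemma PA_invs [simp]: "invs l \<in> PA 8"
  unfolding invs_def pair2_def contract_def quartic_i_def quartic_j_def det3_def
  by (auto intro!: PA_add PA_mult PA_diff PA_uminus PA_power)

lemma coords_from_forms:
  fixes x :: "nat \<Rightarrow> 'k::field_char_0"
  shows "4 * x 0 = 4 * alv x 0" "4 * x 1 = 12 * alv x 1 + bev x 0" "4 * x 2 = 12 * alv x 2 + 2 * bev x 1"
    "4 * x 3 = 4 * alv x 3 + bev x 2" "4 * x 4 = bev x 0 - 4 * alv x 1" "4 * x 5 = 2 * bev x 1 - 12 * alv x 2"
    "4 * x 6 = bev x 2 - 12 * alv x 3" "4 * x 7 = - 4 * alv x 4"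
  unfolding alv bev by (simp_all add: field_simps)

lemma all_less_8: "(\<forall>m<8::nat. Q m) \<longleftrightarrow> Q 0 \<and> Q 1 \<and> Q 2 \<and> Q 3 \<and> Q 4 \<and> Q 5 \<and> Q 6 \<and> Q 7"
proof -
  have "m < 8 \<longleftrightarrow> m = 0 \<or> m = 1 \<or> m = 2 \<or> m = 3 \<or> m = 4 \<or> m = 5 \<or> m = 6 \<or> m = 7" for m :: nat by auto
  then show ?thesis by metis
qed

text \<open>The two forms determine the rational map: four times each coordinate is an integral combination of
  their coefficients.\<close>

lemma ev_cong_forms:
  fixes x y :: "nat \<Rightarrow> 'k::field_char_0"
  assumes F: "F \<in> PA 8" and a: "\<And>m. m \<le> 4 \<Longrightarrow> alv x m = alv y m" and b: "\<And>m. m \<le> 2 \<Longrightarrow> bev x m = bev y m"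
  shows "ev x F = ev y F"
proof (rule peval_cong[OF F])
  have "4 * x 0 = 4 * y 0 \<and> 4 * x 1 = 4 * y 1 \<and> 4 * x 2 = 4 * y 2 \<and> 4 * x 3 = 4 * y 3 \<and>
      4 * x 4 = 4 * y 4 \<and> 4 * x 5 = 4 * y 5 \<and> 4 * x 6 = 4 * y 6 \<and> 4 * x 7 = 4 * y 7"
    unfolding coords_from_forms using a b by simp
  then have "\<forall>m<8. x m = y m" unfolding all_less_8 by simp
  then show "\<And>m. m < 8 \<Longrightarrow> x m = y m" by blast
qed

subsection \<open>The action\<close>

definition act_sub :: "nat \<Rightarrow> 'k::field mpoly" where
  "act_sub x = (if x < 4 then coeff conj_F0 x else coeff conj_F1 (x - 4))"

lemma act_hom_eq: "act_hom p = SL2_ideal +>\<^bsub>poly_alg 12\<^esub> substitute act_sub p"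
  unfolding act_hom_def act_sub_def by simp

lemma cubic_comp_eq: "cubic_comp f = [:coeff f 0*var 11^3 + coeff f 1*var 9*var 11^2 + coeff f 2*var 9^2*var 11 + coeff f 3*var 9^3, 3*coeff f 0*var 10*var 11^2 + 2*coeff f 1*var 9*var 10*var 11 + coeff f 1*var 8*var 11^2 + coeff f 2*var 9^2*var 10 + 2*coeff f 2*var 8*var 9*var 11 + 3*coeff f 3*var 8*var 9^2, 3*coeff f 0*var 10^2*var 11 + coeff f 1*var 9*var 10^2 + 2*coeff f 1*var 8*var 10*var 11 + 2*coeff f 2*var 8*var 9*var 10 + coeff f 2*var 8^2*var 11 + 3*coeff f 3*var 8^2*var 9, coeff f 0*var 10^3 + coeff f 1*var 8*var 10^2 + coeff f 2*var 8^2*var 10 + coeff f 3*var 8^3:]"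
  unfolding cubic_comp_def
  by (simp add: eval_nat_numeral) (intro conjI; Groebner_Basis.algebra)

lemma coeff_F01: "coeff F0 m = (if m \<le> 3 then var m else 0)" "coeff F1 m = (if m \<le> 3 then var (4 + m) else 0)"
  unfolding F0_def F1_def by (simp_all add: coeff_sum)

lemma act_sub_values:
  fixes z :: "nat \<Rightarrow> 'k::field_char_0"
  defines "p \<equiv> z 8" and "q \<equiv> z 9" and "r \<equiv> z 10" and "s \<equiv> z 11"
  defines "c \<equiv> (\<lambda>f m. ev z (coeff (cubic_comp f) m))"
  shows "m < 4 \<Longrightarrow> ev z (act_sub m) = s * c F0 m - q * c F1 m"
    and "m < 4 \<Longrightarrow> ev z (act_sub (4 + m)) = p * c F1 m - r * c F0 m"
  by (simp_all add: act_sub_def conj_F0_def conj_F1_def c_def p_def q_def r_def s_def id_hom)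

text \<open>Coordinates adapted to the two forms, chosen without denominators so that polynomial identities
  can be verified by normalisation.\<close>

lemma ex_form_coords:
  fixes z :: "nat \<Rightarrow> 'k::field_char_0"
  shows "\<exists>a0 a1 a2 a3 a4 h0 h1 h2. z 0 = a0 \<and> z 1 = 3 * a1 + h0 \<and> z 2 = 3 * a2 + h1 \<and> z 3 = a3 + h2 \<and>
    z 4 = h0 - a1 \<and> z 5 = h1 - 3 * a2 \<and> z 6 = h2 - 3 * a3 \<and> z 7 = - a4 \<and>
    alv z 0 = a0 \<and> alv z 1 = a1 \<and> alv z 2 = a2 \<and> alv z 3 = a3 \<and> alv z 4 = a4 \<and>
    bev z 0 = 4 * h0 \<and> bev z 1 = 2 * h1 \<and> bev z 2 = 4 * h2"
  by (rule exI[of _ "alv z 0"], rule exI[of _ "alv z 1"], rule exI[of _ "alv z 2"], rule exI[of _ "alv z 3"],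
      rule exI[of _ "alv z 4"], rule exI[of _ "bev z 0 / 4"], rule exI[of _ "bev z 1 / 2"], rule exI[of _ "bev z 2 / 4"])
    (simp add: alv bev alv[unfolded One_nat_def] bev[unfolded One_nat_def] field_simps)

lemma act_sub_eq:
  fixes z :: "nat \<Rightarrow> 'k::field_char_0"
  defines "y \<equiv> (\<lambda>m. ev z (act_sub m))" and "\<Delta> \<equiv> z 8 * z 11 - z 9 * z 10"
  shows "m \<le> 4 \<Longrightarrow> alv y m = subst4 (z 8) (z 9) (z 10) (z 11) (alv z) m"
    and "m \<le> 2 \<Longrightarrow> bev y m = \<Delta> * subst2 (z 8) (z 9) (z 10) (z 11) (bev z) m"
proof -
  obtain a0 a1 a2 a3 a4 h0 h1 h2 where
    z: "z 0 = a0" "z 1 = 3 * a1 + h0" "z 2 = 3 * a2 + h1" "z 3 = a3 + h2"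
      "z 4 = h0 - a1" "z 5 = h1 - 3 * a2" "z 6 = h2 - 3 * a3" "z 7 = - a4"
    and ab: "alv z 0 = a0" "alv z 1 = a1" "alv z 2 = a2" "alv z 3 = a3" "alv z 4 = a4"
      "bev z 0 = 4 * h0" "bev z 1 = 2 * h1" "bev z 2 = 4 * h2"
    using ex_form_coords[of z] by blast
  define p q r s where "p = z 8" and "q = z 9" and "r = z 10" and "s = z 11"
  note pqrs = p_def[symmetric] q_def[symmetric] r_def[symmetric] s_def[symmetric]
  have y: "y 0 = s * ev z (coeff (cubic_comp F0) 0) - q * ev z (coeff (cubic_comp F1) 0)"
    "y 1 = s * ev z (coeff (cubic_comp F0) 1) - q * ev z (coeff (cubic_comp F1) 1)"
    "y 2 = s * ev z (coeff (cubic_comp F0) 2) - q * ev z (coeff (cubic_comp F1) 2)"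
    "y 3 = s * ev z (coeff (cubic_comp F0) 3) - q * ev z (coeff (cubic_comp F1) 3)"
    "y 4 = p * ev z (coeff (cubic_comp F1) 0) - r * ev z (coeff (cubic_comp F0) 0)"
    "y 5 = p * ev z (coeff (cubic_comp F1) 1) - r * ev z (coeff (cubic_comp F0) 1)"
    "y 6 = p * ev z (coeff (cubic_comp F1) 2) - r * ev z (coeff (cubic_comp F0) 2)"
    "y 7 = p * ev z (coeff (cubic_comp F1) 3) - r * ev z (coeff (cubic_comp F0) 3)"
    using act_sub_values(1)[of 0 z] act_sub_values(1)[of 1 z] act_sub_values(1)[of 2 z] act_sub_values(1)[of 3 z]
      act_sub_values(2)[of 0 z] act_sub_values(2)[of 1 z] act_sub_values(2)[of 2 z] act_sub_values(2)[of 3 z]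
    by (simp_all add: y_def p_def q_def r_def s_def)
  have c3: "coeff [:u, v, w, t:] 0 = u" "coeff [:u, v, w, t:] 1 = v" "coeff [:u, v, w, t:] 2 = w" "coeff [:u, v, w, t:] 3 = t"
    for u v w t :: "'k mpoly" by (simp_all add: eval_nat_numeral)
  note Y = y[unfolded cubic_comp_eq c3 coeff_F01, simplified id_hom ev_simps peval_var peval_numeral, simplified id_hom z pqrs]
  have av: "alv y 0 = y 0" "4 * alv y 1 = y 1 - y 4" "6 * alv y 2 = y 2 - y 5" "4 * alv y 3 = y 3 - y 6" "alv y 4 = - y 7"
    by (simp_all add: alv alv[unfolded One_nat_def])
  {
    assume "m \<le> 4"
    then have "m = 0 \<or> m = 1 \<or> m = 2 \<or> m = 3 \<or> m = 4" by auto
    moreover have "alv y 0 = subst4 p q r s (alv z) 0" unfolding av Y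
      by (simp add: subst4_def ab ab[unfolded One_nat_def] id_hom z z[unfolded One_nat_def]) Groebner_Basis.algebra
    moreover have "4 * alv y 1 = 4 * subst4 p q r s (alv z) 1" unfolding av Y
      by (simp add: subst4_def ab ab[unfolded One_nat_def] id_hom z z[unfolded One_nat_def]) Groebner_Basis.algebra
    moreover have "6 * alv y 2 = 6 * subst4 p q r s (alv z) 2" unfolding av Y
      by (simp add: subst4_def ab ab[unfolded One_nat_def] id_hom z z[unfolded One_nat_def]) Groebner_Basis.algebra
    moreover have "4 * alv y 3 = 4 * subst4 p q r s (alv z) 3" unfolding av Y
      by (simp add: subst4_def ab ab[unfolded One_nat_def] id_hom z z[unfolded One_nat_def]) Groebner_Basis.algebra
    moreover have "alv y 4 = subst4 p q r s (alv z) 4" unfolding av Y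
      by (simp add: subst4_def ab ab[unfolded One_nat_def] id_hom z z[unfolded One_nat_def]) Groebner_Basis.algebra
    ultimately show "alv y m = subst4 (z 8) (z 9) (z 10) (z 11) (alv z) m" unfolding pqrs by fastforce
  }
  {
    assume "m \<le> 2"
    then have "m = 0 \<or> m = 1 \<or> m = 2" by auto
    moreover have "bev y 0 = \<Delta> * subst2 p q r s (bev z) 0" unfolding bev(1)[of y] Y \<Delta>_def pqrs
      by (simp add: subst2_def ab ab[unfolded One_nat_def] id_hom z z[unfolded One_nat_def]) Groebner_Basis.algebra
    moreover have "bev y 1 = \<Delta> * subst2 p q r s (bev z) 1" unfolding bev(2)[of y] Y \<Delta>_def pqrs
      by (simp add: subst2_def ab ab[unfolded One_nat_def] id_hom z z[unfolded One_nat_def]) Groebner_Basis.algebra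
    moreover have "bev y 2 = \<Delta> * subst2 p q r s (bev z) 2" unfolding bev(3)[of y] Y \<Delta>_def pqrs
      by (simp add: subst2_def ab ab[unfolded One_nat_def] id_hom z z[unfolded One_nat_def]) Groebner_Basis.algebra
    ultimately show "bev y m = \<Delta> * subst2 (z 8) (z 9) (z 10) (z 11) (bev z) m" unfolding pqrs by fastforce
  }
qed

lemma det_mat_expand:
  "det (mat (Suc n) (Suc n) f) =
    (\<Sum>j<Suc n. f (0, j) * ((- 1) ^ j * det (mat n n (\<lambda>(a, b). f (Suc a, if b < j then b else Suc b)))))"
  for f :: "nat \<times> nat \<Rightarrow> 'a::comm_ring_1"
proof -
  let ?A = "mat (Suc n) (Suc n) f"
  have "det ?A = (\<Sum>j<Suc n. ?A $$ (0, j) * cofactor ?A 0 j)"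
    by (rule laplace_expansion_row) auto
  also have "\<dots> = (\<Sum>j<Suc n. f (0, j) * ((- 1) ^ j * det (mat n n (\<lambda>(a, b). f (Suc a, if b < j then b else Suc b)))))"
  proof (rule sum.cong, simp)
    fix j assume j: "j \<in> {..<Suc n}"
    have "mat_delete ?A 0 j = mat n n (\<lambda>(a, b). f (Suc a, if b < j then b else Suc b))"
      by (rule eq_matI) (auto simp: mat_delete_def)
    then show "?A $$ (0, j) * cofactor ?A 0 j = f (0, j) * ((- 1) ^ j * det (mat n n (\<lambda>(a, b). f (Suc a, if b < j then b else Suc b))))"
      using j by (simp add: cofactor_def)
  qed
  finally show ?thesis .
qed

lemma det_mat_3:
  "det (mat 3 3 f) = f (0, 0) * (f (1, 1) * f (2, 2) - f (1, 2) * f (2, 1))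
    - f (0, 1) * (f (1, 0) * f (2, 2) - f (1, 2) * f (2, 0)) + f (0, 2) * (f (1, 0) * f (2, 1) - f (1, 1) * f (2, 0))"
  for f :: "nat \<times> nat \<Rightarrow> 'a::comm_ring_1"
  unfolding numeral_3_eq_3 det_mat_expand
  by (simp add: sum.lessThan_Suc numeral_2_eq_2 algebra_simps)

lemma all_less_3: "(\<forall>m<3::nat. Q m) \<longleftrightarrow> Q 0 \<and> Q 1 \<and> Q 2"
proof -
  have "m < 3 \<longleftrightarrow> m = 0 \<or> m = 1 \<or> m = 2" for m :: nat by auto
  then show ?thesis by metis
qed

text \<open>Bezout's formula: the Sylvester matrix consists of four triangular Toeplitz blocks, two of
  which commute, so its determinant is that of a matrix of size 3.\<close>

lemma resultant_bezout:
  fixes f g :: "'a::idom poly"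
  defines "c0 \<equiv> coeff f 0" and "c1 \<equiv> coeff f 1" and "c2 \<equiv> coeff f 2" and "c3 \<equiv> coeff f 3"
    and "e0 \<equiv> coeff g 0" and "e1 \<equiv> coeff g 1" and "e2 \<equiv> coeff g 2" and "e3 \<equiv> coeff g 3"
  shows "det (sylvester_mat_sub 3 3 f g) = - ((c1 * e0 - c0 * e1)*(((c3 * e0 - c0 * e3) + (c2 * e1 - c1 * e2))*(c3 * e2 - c2 * e3)-(c3 * e1 - c1 * e3)*(c3 * e1 - c1 * e3)) - (c2 * e0 - c0 * e2)*((c2 * e0 - c0 * e2)*(c3 * e2 - c2 * e3)-(c3 * e1 - c1 * e3)*(c3 * e0 - c0 * e3)) + (c3 * e0 - c0 * e3)*((c2 * e0 - c0 * e2)*(c3 * e1 - c1 * e3)-((c3 * e0 - c0 * e3) + (c2 * e1 - c1 * e2))*(c3 * e0 - c0 * e3)))"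
proof -
  define up where "up h = (\<lambda>(i, j). if i \<le> j then coeff h (j - i) else 0)" for h :: "'a poly"
  define lo where "lo h = (\<lambda>(i, j). if j \<le> i then coeff h (3 + j - i) else 0)" for h :: "'a poly"
  let ?A = "mat 3 3 (lo f)" and ?B = "mat 3 3 (lo g)" and ?C = "mat 3 3 (up f)" and ?D = "mat 3 3 (up g)"
  let ?S = "sylvester_mat_sub 3 3 f g"
  have prod: "mat 3 3 F * mat 3 3 G = mat 3 3 (\<lambda>(i, j). F (i, 0) * G (0, j) + F (i, 1) * G (1, j) + F (i, 2) * G (2, j))"
    for F G :: "nat \<times> nat \<Rightarrow> 'a"
    by (rule eq_matI) (auto simp: scalar_prod_def numeral_3_eq_3 numeral_2_eq_2)
  have comm: "?C * ?D = ?D * ?C"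
    unfolding prod
  proof (rule eq_matI, goal_cases)
    case (1 i j)
    have "\<forall>i<3. \<forall>j<3. up f (i, 0) * up g (0, j) + up f (i, 1) * up g (1, j) + up f (i, 2) * up g (2, j) =
        up g (i, 0) * up f (0, j) + up g (i, 1) * up f (1, j) + up g (i, 2) * up f (2, j)"
      unfolding all_less_3 by (simp add: up_def algebra_simps)
    then show ?case using 1 by simp
  qed auto
  have "?S\<^sup>T = four_block_mat ?A ?B ?C ?D"
    by (rule eq_matI) (auto simp: sylvester_mat_sub_def up_def lo_def intro!: arg_cong[where f = "coeff _"])
  then have "det ?S = det (four_block_mat ?A ?B ?C ?D)"
    using det_transpose[OF sylvester_mat_sub_carrier[of 3 3 f g]] by simp
  also have "\<dots> = det (?A * ?D - ?B * ?C)"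
    by (rule det_four_block_mat[OF _ _ _ _ comm]) auto
  also have "?A * ?D - ?B * ?C = mat 3 3 (\<lambda>(i, j).
      lo f (i, 0) * up g (0, j) + lo f (i, 1) * up g (1, j) + lo f (i, 2) * up g (2, j)
      - (lo g (i, 0) * up f (0, j) + lo g (i, 1) * up f (1, j) + lo g (i, 2) * up f (2, j)))"
    unfolding prod by (rule eq_matI) auto
  also have "det \<dots> = - ((c1 * e0 - c0 * e1)*(((c3 * e0 - c0 * e3) + (c2 * e1 - c1 * e2))*(c3 * e2 - c2 * e3)-(c3 * e1 - c1 * e3)*(c3 * e1 - c1 * e3)) - (c2 * e0 - c0 * e2)*((c2 * e0 - c0 * e2)*(c3 * e2 - c2 * e3)-(c3 * e1 - c1 * e3)*(c3 * e0 - c0 * e3)) + (c3 * e0 - c0 * e3)*((c2 * e0 - c0 * e2)*(c3 * e1 - c1 * e3)-((c3 * e0 - c0 * e3) + (c2 * e1 - c1 * e2))*(c3 * e0 - c0 * e3)))"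
    unfolding det_mat_3
    by (simp add: up_def lo_def c0_def c1_def c2_def c3_def e0_def e1_def e2_def e3_def) Groebner_Basis.algebra
  finally show ?thesis .
qed

section \<open>The ring of invariants\<close>

lemma inf_UNIV: "infinite (UNIV :: 'k::field_char_0 set)"
  by (rule infinite_UNIV_char_0)

subsection \<open>The relation and the resultant\<close>

lemma invariant_of_simps:
  "invariant_of a b 0 = pair2 b b" "invariant_of a b 1 = 2 * quartic_i a" "invariant_of a b (Suc 0) = 2 * quartic_i a"
  "invariant_of a b 2 = 6 * quartic_j a"
  "invariant_of a b 3 = pair2 (contract a b) b"
  "invariant_of a b 4 = pair2 (contract a b) (contract a b) - pair2 b b * (2 * quartic_i a) / 3"
  "invariant_of a b 5 = det3 b (contract a b) (contract a (contract a b))"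
  by (simp_all add: invariant_of_def)

lemma relation_at_forms:
  fixes a b :: "nat \<Rightarrow> 'k::field_char_0"
  shows "ev (invariant_of a b) relation_poly = 0"
proof -
  define d i j A B where "d = pair2 b b" and "i = 2 * quartic_i a" and "j = 6 * quartic_j a"
    and "A = pair2 (contract a b) b" and "B = pair2 (contract a b) (contract a b)"
  define c where "c = det3 b (contract a b) (contract a (contract a b))"
  note defs = d_def i_def j_def A_def B_def c_def
  \<comment> \<open>The relation multiplied by 108, with \<open>b\<close> replaced by \<open>B - d i / 3\<close> to clear denominators.\<close>
  have "216 * c ^ 2 = 2 * d ^ 3 * i ^ 3 - 12 * d ^ 3 * j ^ 2 - 9 * d * i ^ 2 * A ^ 2 - 36 * j * A ^ 3
      + 36 * d * j * A * (3 * B - d * i) + 18 * i * A ^ 2 * (3 * B - d * i) - 6 * d * i * (3 * B - d * i) ^ 2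
      - 4 * (3 * B - d * i) ^ 3"
    unfolding defs pair2_def contract_def quartic_i_def quartic_j_def det3_def
    by (simp flip: One_nat_def add: numeral_2_eq_2[symmetric]) Groebner_Basis.algebra
  moreover have "108 * ev (invariant_of a b) relation_poly = 216 * c ^ 2 - (2 * d ^ 3 * i ^ 3 - 12 * d ^ 3 * j ^ 2 - 9 * d * i ^ 2 * A ^ 2 - 36 * j * A ^ 3
      + 36 * d * j * A * (3 * B - d * i) + 18 * i * A ^ 2 * (3 * B - d * i) - 6 * d * i * (3 * B - d * i) ^ 2
      - 4 * (3 * B - d * i) ^ 3)"
    unfolding relation_poly_def Let_def
    apply (simp add: id_hom invariant_of_simps flip: d_def i_def j_def A_def B_def c_def)
    apply (simp add: field_simps)
    apply Groebner_Basis.algebra?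
    done
  ultimately show ?thesis by simp
qed

lemma substitute_invs_relation: "substitute invs relation_poly = (0 :: 'k::field_char_0 mpoly)"
proof (rule ev_eqI[OF inf_UNIV])
  fix x :: "nat \<Rightarrow> 'k"
  show "ev x (substitute invs relation_poly) = ev x 0"
    using relation_at_forms[of "alv x" "bev x"] by (simp add: peval_substitute id_hom ev_invs[abs_def])
qed

lemma substitute_invs_rho: "substitute invs rho = (Res3 :: 'k::field_char_0 mpoly)"
proof (rule ev_eqI[OF inf_UNIV])
  fix x :: "nat \<Rightarrow> 'k"
  obtain a0 a1 a2 a3 a4 h0 h1 h2 where
    x: "x 0 = a0" "x 1 = 3 * a1 + h0" "x 2 = 3 * a2 + h1" "x 3 = a3 + h2"
      "x 4 = h0 - a1" "x 5 = h1 - 3 * a2" "x 6 = h2 - 3 * a3" "x 7 = - a4"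
    and ab: "alv x 0 = a0" "alv x 1 = a1" "alv x 2 = a2" "alv x 3 = a3" "alv x 4 = a4"
      "bev x 0 = 4 * h0" "bev x 1 = 2 * h1" "bev x 2 = 4 * h2"
    using ex_form_coords[of x] by blast
  define d i j A B where "d = pair2 (bev x) (bev x)" and "i = 2 * quartic_i (alv x)" and "j = 6 * quartic_j (alv x)"
    and "A = pair2 (contract (alv x) (bev x)) (bev x)" and "B = pair2 (contract (alv x) (bev x)) (contract (alv x) (bev x))"
  define c where "c = det3 (bev x) (contract (alv x) (bev x)) (contract (alv x) (contract (alv x) (bev x)))"
  note defs = d_def i_def j_def A_def B_def c_def
  have "768 * ev x (substitute invs rho) =
      96 * i ^ 3 + 2 * i * d ^ 2 - 576 * j ^ 2 - 144 * j * A + 3 * A ^ 2 + 144 * i * B - 48 * d * i ^ 2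
      - 12 * d * B + 4 * d ^ 2 * i - 96 * c"
    unfolding peval_substitute[OF id_hom] ev_invs[abs_def] rho_def Let_def
    apply (simp add: id_hom invariant_of_simps flip: d_def i_def j_def A_def B_def c_def)
    apply (simp add: field_simps)
    apply Groebner_Basis.algebra?
    done
  also have "\<dots> = 768 * ev x Res3"
    unfolding Res3_def resultant_bezout coeff_F01 defs pair2_def contract_def quartic_i_def quartic_j_def det3_def
    by (simp add: id_hom x x[unfolded One_nat_def] ab ab[unfolded One_nat_def] flip: numeral_2_eq_2 numeral_3_eq_3)
      Groebner_Basis.algebra
  finally show "ev x (substitute invs rho) = ev x Res3" by simp
qed

subsection \<open>Invariance\<close>

text \<open>The determinant of the universal matrix.  It is not 1 in the polynomial ring, so invariance
  there holds only up to a power of it.\<close>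

definition Delta :: "'k::field mpoly" where "Delta = var 8 * var 11 - var 9 * var 10"

lemma substitute_act_invs:
  assumes l: "l < 6"
  shows "substitute act_sub (invs l) = Delta ^ (2 * weights ! l) * (invs l :: 'k::field_char_0 mpoly)"
proof (rule ev_eqI[OF inf_UNIV])
  fix z :: "nat \<Rightarrow> 'k"
  show "ev z (substitute act_sub (invs l)) = ev z (Delta ^ (2 * weights ! l) * invs l)"
    using invariant_of_subst[OF act_sub_eq(1)[of _ z] act_sub_eq(2)[of _ z] l]
    by (simp add: peval_substitute id_hom ev_invs Delta_def)
qed

definition point :: "(nat \<Rightarrow> 'a) \<Rightarrow> 'a \<Rightarrow> 'a \<Rightarrow> 'a \<Rightarrow> 'a \<Rightarrow> nat \<Rightarrow> 'a" where
  "point x p q r s = (\<lambda>m. if m < 8 then x m else if m = 8 then p else if m = 9 then q else if m = 10 then r else s)"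

definition act :: "(nat \<Rightarrow> 'k::field) \<Rightarrow> 'k \<Rightarrow> 'k \<Rightarrow> 'k \<Rightarrow> 'k \<Rightarrow> nat \<Rightarrow> 'k" where
  "act x p q r s = (\<lambda>m. ev (point x p q r s) (act_sub m))"

text \<open>Invariance under the rational points of \<open>SL\<^sub>2\<close>, which are dense.\<close>

definition invariant_poly :: "'k::field mpoly \<Rightarrow> bool" where
  "invariant_poly F \<longleftrightarrow> (\<forall>x p q r s. p * s - q * r = 1 \<longrightarrow> ev (act x p q r s) F = ev x F)"

lemma ev_point: "F \<in> PA 8 \<Longrightarrow> ev (point x p q r s) F = ev x F"
  by (rule peval_cong) (auto simp: point_def)

lemma act_forms:
  fixes x :: "nat \<Rightarrow> 'k::field_char_0" and p q r s :: 'k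
  assumes "p * s - q * r = 1"
  shows "m \<le> 4 \<Longrightarrow> alv (act x p q r s) m = subst4 p q r s (alv x) m"
    and "m \<le> 2 \<Longrightarrow> bev (act x p q r s) m = subst2 p q r s (bev x) m"
proof -
  have e: "alv (point x p q r s) = alv x" "bev (point x p q r s) = bev x"
    by (simp_all add: ev_point fun_eq_iff)
  have pt: "point x p q r s 8 = p" "point x p q r s 9 = q" "point x p q r s 10 = r" "point x p q r s 11 = s"
    by (simp_all add: point_def)
  show "m \<le> 4 \<Longrightarrow> alv (act x p q r s) m = subst4 p q r s (alv x) m"
    using act_sub_eq(1)[of m "point x p q r s"] by (simp only: act_def e pt)
  show "m \<le> 2 \<Longrightarrow> bev (act x p q r s) m = subst2 p q r s (bev x) m"
    using act_sub_eq(2)[of m "point x p q r s"] assms by (simp only: act_def e pt mult_1)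
qed

lemma invariant_poly_invs: "l < 6 \<Longrightarrow> invariant_poly (invs l :: 'k::field_char_0 mpoly)"
  unfolding invariant_poly_def
proof (intro allI impI)
  fix x :: "nat \<Rightarrow> 'k" and p q r s :: 'k assume l: "l < 6" and D: "p * s - q * r = 1"
  have "bev (act x p q r s) m = (p * s - q * r) * subst2 p q r s (bev x) m" if "m \<le> 2" for m
    using act_forms(2)[OF D that] D by simp
  from invariant_of_subst[OF act_forms(1)[OF D] this l]
  show "ev (act x p q r s) (invs l) = ev x (invs l)" by (simp add: ev_invs D)
qed

lemma invariant_poly_ops:
  "invariant_poly F \<Longrightarrow> invariant_poly G \<Longrightarrow> invariant_poly (F + G)"
  "invariant_poly F \<Longrightarrow> invariant_poly G \<Longrightarrow> invariant_poly (F - G)"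
  "invariant_poly F \<Longrightarrow> invariant_poly G \<Longrightarrow> invariant_poly (F * G)"
  "invariant_poly F \<Longrightarrow> invariant_poly (F ^ n)" "invariant_poly (const c)"
  by (auto simp: invariant_poly_def id_hom)

lemma invariant_poly_substitute:
  assumes P: "P \<in> PA 6"
  shows "invariant_poly (substitute invs P :: 'k::field_char_0 mpoly)"
  unfolding invariant_poly_def peval_substitute[OF id_hom]
proof (intro allI impI peval_cong[OF P])
  fix x :: "nat \<Rightarrow> 'k" and p q r s :: 'k and l :: nat
  assume "p * s - q * r = 1" "l < 6"
  then show "ev (act x p q r s) (invs l) = ev x (invs l)"
    using invariant_poly_invs[of l, where ?'k = 'k] unfolding invariant_poly_def by blast
qed

subsection \<open>Density of the orbits of the slice\<close>

text \<open>A form \<open>\<beta>\<close> whose discriminant is a nonzero square \<open>s\<^sup>2\<close> splits into two linear factors and is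
  equivalent to a multiple of \<open>X\<^sub>0 X\<^sub>1\<close>.  The maps with such \<open>\<beta>\<close> are dense over every infinite field:
  when the other coordinates are fixed, infinitely many values of \<open>F\<^sub>1\<close>'s lowest coefficient give squares.\<close>

lemma invariant_zero_if_zero_on_slice:
  fixes F :: "'k::field_char_0 mpoly"
  assumes inv: "invariant_poly F" and slice: "\<And>x. bev x 0 = 0 \<Longrightarrow> bev x 2 = 0 \<Longrightarrow> ev x F = 0"
  shows "F = 0"
proof (rule ev_zero_if_dense[OF inf_UNIV, of "be 2"])
  have "ev (\<lambda>m. if m = 3 then 1 else 0) (be 2) \<noteq> (0::'k)" unfolding bev by simp
  then show "be 2 \<noteq> (0 :: 'k mpoly)" by (auto simp: id_hom)
  fix x :: "nat \<Rightarrow> 'k" assume x: "bev x 2 \<noteq> 0"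
  let ?b1 = "bev x 1" and ?b2 = "bev x 2"
  have zero: "ev y F = 0" if y: "bev y 2 \<noteq> 0" and s: "s \<noteq> 0" "bev y 0 * bev y 2 = bev y 1 ^ 2 - s ^ 2" for y s
  proof -
    define b0 b1 b2 where "b0 = bev y 0" and "b1 = bev y 1" and "b2 = bev y 2"
    define t where "t = 1 / (2 * s * b2)"
    have b2: "b2 \<noteq> 0" and rel: "b0 * b2 = b1 ^ 2 - s ^ 2" using y s by (simp_all add: b0_def b1_def b2_def)
    \<comment> \<open>The columns are the two roots \<open>(s - b\<^sub>1, b\<^sub>2)\<close> and \<open>(- s - b\<^sub>1, b\<^sub>2)\<close> of \<open>\<beta>\<close>, the second scaled by \<open>t\<close> to make the determinant 1.\<close>
    let ?p = "s - b1" and ?r = b2 and ?q = "t * (- s - b1)" and ?s = "t * b2"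
    have D: "?p * ?s - ?q * ?r = 1"
      using b2 s(1) by (simp add: t_def field_simps)
    have "bev (act y ?p ?q ?r ?s) 0 = t ^ 2 * b2 * (b2 * b0 - (b1 ^ 2 - s ^ 2))"
      unfolding act_forms(2)[OF D, of 0, simplified] subst2_def
      by (simp add: b0_def[symmetric] b1_def[symmetric] b2_def[symmetric] b1_def[symmetric, unfolded One_nat_def]) Groebner_Basis.algebra
    then have 0: "bev (act y ?p ?q ?r ?s) 0 = 0" using rel by (simp add: mult.commute)
    have "bev (act y ?p ?q ?r ?s) 2 = b2 * (b2 * b0 - (b1 ^ 2 - s ^ 2))"
      unfolding act_forms(2)[OF D, of 2, simplified] subst2_def
      by (simp add: b0_def[symmetric] b1_def[symmetric] b2_def[symmetric] b1_def[symmetric, unfolded One_nat_def]) Groebner_Basis.algebra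
    then have 2: "bev (act y ?p ?q ?r ?s) 2 = 0" using rel by (simp add: mult.commute)
    have "ev y F = ev (act y ?p ?q ?r ?s) F" using inv D unfolding invariant_poly_def by metis
    then show ?thesis using slice[OF 0 2] by simp
  qed
  show "ev x F = 0"
  proof (rule ev_zero_if_infinitely_many[where v = 4])
    \<comment> \<open>With this value of the coordinate 4 the discriminant of \<open>\<beta>\<close> is \<open>(n + 1)\<^sup>2\<close>.\<close>
    define g where "g n = (((?b1 ^ 2 - of_nat (Suc n) ^ 2) / ?b2) - x 1) / 3" for n :: nat
    have "inj g"
    proof (rule injI)
      fix m n assume "g m = g n"
      then have "of_nat (Suc m) ^ 2 = (of_nat (Suc n) ^ 2 :: 'k)" using x by (simp add: g_def)
      then have "of_nat (Suc m ^ 2) = (of_nat (Suc n ^ 2) :: 'k)" by (simp only: of_nat_power)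
      then have "Suc m ^ 2 = Suc n ^ 2" by (simp only: of_nat_eq_iff)
      then show "m = n" by (simp add: power2_eq_iff_nonneg)
    qed
    moreover have "g n \<in> {y. ev (x(4 := y)) F = 0}" for n
    proof -
      let ?y = "x(4 := g n)"
      have b: "bev ?y 0 = (?b1 ^ 2 - of_nat (Suc n) ^ 2) / ?b2" "bev ?y 1 = ?b1" "bev ?y 2 = ?b2"
      proof -
        show "bev ?y 0 = (?b1 ^ 2 - of_nat (Suc n) ^ 2) / ?b2"
        proof -
          have *: "u + 3 * ((A - u) / 3) = A" for u A :: 'k by (simp add: field_simps)
          have "bev ?y 0 = x 1 + 3 * g n" unfolding bev(1) by simp
          then show ?thesis unfolding g_def * .
        qed
      qed (simp_all only: bev(2)[of ?y] bev(3)[of ?y] bev(2)[of x] bev(3)[of x], simp_all)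
      have "ev ?y F = 0"
        by (rule zero[of _ "of_nat (Suc n)"]) (use x b of_nat_neq_0 in simp_all)
      then show ?thesis by simp
    qed
    ultimately show "infinite {y. ev (x(4 := y)) F = 0}"
      by (metis finite_subset image_subsetI infinite_UNIV_nat finite_imageD)
  qed
qed

subsection \<open>The slice of forms with quadratic part \<open>2 s X\<^sub>0 X\<^sub>1\<close>\<close>

text \<open>The rational map with quartic \<open>(y\<^sub>0, \<dots>, y\<^sub>4)\<close> and quadratic form \<open>(0, y\<^sub>5, 0)\<close>.\<close>

definition slice_sub :: "nat \<Rightarrow> 'k::field mpoly" where
  "slice_sub m = (if m = 0 then var 0 else if m = 1 then 3 * var 1 else if m = 2 then 3 * var 2 + const (1/2) * var 5
     else if m = 3 then var 3 else if m = 4 then - var 1 else if m = 5 then const (1/2) * var 5 - 3 * var 2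
     else if m = 6 then - (3 * var 3) else - var 4)"

definition slice :: "(nat \<Rightarrow> 'k::field) \<Rightarrow> nat \<Rightarrow> 'k" where
  "slice y = (\<lambda>m. ev y (slice_sub m))"

lemma PA_slice_sub [simp]: "slice_sub m \<in> PA 6"
  by (auto simp: slice_sub_def intro!: PA_add PA_mult PA_diff PA_uminus)

lemma slice_forms:
  fixes y :: "nat \<Rightarrow> 'k::field_char_0"
  shows "m \<le> 4 \<Longrightarrow> alv (slice y) m = y m" "bev (slice y) 0 = 0" "bev (slice y) 1 = y 5" "bev (slice y) 2 = 0"
proof -
  assume "m \<le> 4"
  then have "m = 0 \<or> m = 1 \<or> m = 2 \<or> m = 3 \<or> m = 4" by auto
  then show "alv (slice y) m = y m"
    by (elim disjE) (simp_all add: alv alv[unfolded One_nat_def] slice_def slice_sub_def id_hom)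
qed (simp_all add: bev bev[unfolded One_nat_def] slice_def slice_sub_def id_hom)

lemma ev_slice_unique:
  fixes x :: "nat \<Rightarrow> 'k::field_char_0"
  assumes F: "F \<in> PA 8" and x: "bev x 0 = 0" "bev x 2 = 0" and y: "\<And>m. m \<le> 4 \<Longrightarrow> y m = alv x m" "y 5 = bev x 1"
  shows "ev x F = ev (slice y) F"
proof (rule ev_cong_forms[OF F])
  fix m :: nat assume "m \<le> 2"
  then have "m = 0 \<or> m = 1 \<or> m = 2" by auto
  then show "bev x m = bev (slice y) m" using x y slice_forms(2-4)[of y] by (elim disjE) simp_all
next
  fix m :: nat assume "m \<le> 4"
  then show "alv x m = alv (slice y) m" using y(1) slice_forms(1)[of m y] by simp
qed

abbreviation slice_inv :: "(nat \<Rightarrow> 'k::field) \<Rightarrow> nat \<Rightarrow> 'k" where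
  "slice_inv y l \<equiv> ev (slice y) (invs l)"

lemma slice_inv:
  fixes y :: "nat \<Rightarrow> 'k::field_char_0"
  shows "slice_inv y 0 = - 2 * y 5 ^ 2"
    "slice_inv y 1 = 2 * (y 0 * y 4 - 4 * (y 1 * y 3) + 3 * y 2 ^ 2)"
    "slice_inv y 2 = 6 * (y 0 * y 4 * y 2 + 2 * (y 1 * y 3) * y 2 - y 2 ^ 3 - (y 0 * y 3 ^ 2 + y 4 * y 1 ^ 2))"
    "slice_inv y 3 = 4 * (y 5 ^ 2 * y 2)"
    "slice_inv y 4 = 8 * (y 5 ^ 2 * (y 1 * y 3 - y 2 ^ 2)) + 2 / 3 * (y 5 ^ 2 * slice_inv y 1)"
    "slice_inv y 5 = - 4 * (y 5 ^ 2 * (y 5 * (y 4 * y 1 ^ 2 - y 0 * y 3 ^ 2)))"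
proof -
  have a: "alv (slice y) 0 = y 0" "alv (slice y) 1 = y 1" "alv (slice y) (Suc 0) = y 1" "alv (slice y) 2 = y 2"
    "alv (slice y) 3 = y 3" "alv (slice y) 4 = y 4"
    using slice_forms(1)[of 0 y] slice_forms(1)[of 1 y] slice_forms(1)[of 2 y] slice_forms(1)[of 3 y] slice_forms(1)[of 4 y]
    by simp_all
  have b: "bev (slice y) 0 = 0" "bev (slice y) 1 = y 5" "bev (slice y) (Suc 0) = y 5" "bev (slice y) 2 = 0"
    using slice_forms(2-4)[of y] by simp_all
  note u = ev_invs invariant_of_simps pair2_def contract_def quartic_i_def quartic_j_def det3_def
  have n: "Suc (Suc 0) = 2" "Suc 2 = 3" by simp_all
  show "slice_inv y 0 = - 2 * y 5 ^ 2" unfolding u by (simp add: a b power2_eq_square)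
  show 1: "slice_inv y 1 = 2 * (y 0 * y 4 - 4 * (y 1 * y 3) + 3 * y 2 ^ 2)" unfolding u by (simp add: a b)
  show "slice_inv y 2 = 6 * (y 0 * y 4 * y 2 + 2 * (y 1 * y 3) * y 2 - y 2 ^ 3 - (y 0 * y 3 ^ 2 + y 4 * y 1 ^ 2))"
    unfolding u by (simp add: a b algebra_simps)
  show "slice_inv y 3 = 4 * (y 5 ^ 2 * y 2)"
    unfolding u by (simp add: a b n) Groebner_Basis.algebra
  show "slice_inv y 4 = 8 * (y 5 ^ 2 * (y 1 * y 3 - y 2 ^ 2)) + 2 / 3 * (y 5 ^ 2 * slice_inv y 1)"
    unfolding 1 unfolding u by (simp add: a b n field_simps) Groebner_Basis.algebra
  show "slice_inv y 5 = - 4 * (y 5 ^ 2 * (y 5 * (y 4 * y 1 ^ 2 - y 0 * y 3 ^ 2)))"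
    unfolding u by (simp add: a b n) Groebner_Basis.algebra
qed

text \<open>Functions on the slice that become polynomials in the invariants after multiplication by a
  power of \<open>s\<^sup>2\<close>.\<close>

definition inv_frac :: "((nat \<Rightarrow> 'k::field_char_0) \<Rightarrow> 'k) set" where
  "inv_frac = {h. \<exists>N P. P \<in> PA 6 \<and> (\<forall>y. y 5 ^ (2 * N) * h y = ev (slice_inv y) P)}"

lemma inv_frac_scale:
  assumes "P \<in> PA 6" "\<forall>y::nat \<Rightarrow> 'k::field_char_0. y 5 ^ (2 * N) * h y = ev (slice_inv y) P"
  shows "\<exists>P'\<in>PA 6. \<forall>y. y 5 ^ (2 * (N + M)) * h y = ev (slice_inv y) P'"
proof (rule bexI[of _ "(const (- 1 / 2) * var 0) ^ M * P"], rule allI)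
  fix y :: "nat \<Rightarrow> 'k"
  have "ev (slice_inv y) ((const (- 1 / 2) * var 0) ^ M * P) = (y 5 ^ 2) ^ M * (y 5 ^ (2 * N) * h y)"
    using assms(2) by (simp add: id_hom slice_inv(1))
  then show "y 5 ^ (2 * (N + M)) * h y = ev (slice_inv y) ((const (- 1 / 2) * var 0) ^ M * P)"
    by (simp add: power_add algebra_simps flip: power_mult)
qed (use assms in \<open>auto intro!: PA_mult PA_power\<close>)

lemma inv_frac_add: "h \<in> inv_frac \<Longrightarrow> k \<in> inv_frac \<Longrightarrow> (\<lambda>y. h y + k y) \<in> inv_frac"
proof -
  assume "h \<in> inv_frac" "k \<in> inv_frac"
  then obtain N P M Q where P: "P \<in> PA 6" "\<forall>y. y 5 ^ (2 * N) * h y = ev (slice_inv y) P"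
    and Q: "Q \<in> PA 6" "\<forall>y. y 5 ^ (2 * M) * k y = ev (slice_inv y) Q" unfolding inv_frac_def by blast
  obtain P' where P': "P' \<in> PA 6" "\<forall>y. y 5 ^ (2 * (N + M)) * h y = ev (slice_inv y) P'"
    using inv_frac_scale[OF P, of M] by blast
  obtain Q' where Q': "Q' \<in> PA 6" "\<forall>y. y 5 ^ (2 * (N + M)) * k y = ev (slice_inv y) Q'"
    using inv_frac_scale[OF Q, of N] by (metis add.commute)
  have "\<forall>y. y 5 ^ (2 * (N + M)) * (h y + k y) = ev (slice_inv y) (P' + Q')"
    using P' Q' by (simp add: distrib_left id_hom)
  then show ?thesis using P'(1) Q'(1) unfolding inv_frac_def by blast
qed

lemma inv_frac_mult: "h \<in> inv_frac \<Longrightarrow> k \<in> inv_frac \<Longrightarrow> (\<lambda>y. h y * k y) \<in> inv_frac"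
proof -
  assume "h \<in> inv_frac" "k \<in> inv_frac"
  then obtain N P M Q where P: "P \<in> PA 6" "\<forall>y. y 5 ^ (2 * N) * h y = ev (slice_inv y) P"
    and Q: "Q \<in> PA 6" "\<forall>y. y 5 ^ (2 * M) * k y = ev (slice_inv y) Q" unfolding inv_frac_def by blast
  have "y 5 ^ (2 * (N + M)) * (h y * k y) = ev (slice_inv y) (P * Q)" for y
  proof -
    have "y 5 ^ (2 * (N + M)) * (h y * k y) = (y 5 ^ (2 * N) * h y) * (y 5 ^ (2 * M) * k y)"
      by (simp add: power_add algebra_simps)
    then show ?thesis using P(2) Q(2) by (simp add: id_hom)
  qed
  then show ?thesis using P(1) Q(1) unfolding inv_frac_def by blast
qed

lemma inv_frac_const: "(\<lambda>y. c) \<in> inv_frac"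
  unfolding inv_frac_def by (simp, rule exI[of _ 0], rule exI[of _ "const c"]) (simp add: id_hom)

lemma inv_frac_cmult: "h \<in> inv_frac \<Longrightarrow> (\<lambda>y. c * h y) \<in> inv_frac"
  by (rule inv_frac_mult[OF inv_frac_const])

lemma inv_frac_diff: "h \<in> inv_frac \<Longrightarrow> k \<in> inv_frac \<Longrightarrow> (\<lambda>y. h y - k y) \<in> inv_frac"
  using inv_frac_add[OF _ inv_frac_cmult[of k "- 1"], of h] by simp

lemma inv_frac_power: "h \<in> inv_frac \<Longrightarrow> (\<lambda>y. h y ^ n) \<in> inv_frac"
  by (induction n) (simp_all add: inv_frac_const inv_frac_mult)

lemma inv_frac_sum: "(\<And>i. i \<in> A \<Longrightarrow> h i \<in> inv_frac) \<Longrightarrow> (\<lambda>y. \<Sum>i\<in>A. h i y) \<in> inv_frac"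
  by (induction A rule: infinite_finite_induct) (simp_all add: inv_frac_const inv_frac_add)

lemma inv_frac_div: "(\<lambda>y. y 5 ^ 2 * h y) \<in> inv_frac \<Longrightarrow> h \<in> inv_frac"
proof -
  assume "(\<lambda>y. y 5 ^ 2 * h y) \<in> inv_frac"
  then obtain N P where P: "P \<in> PA 6" "\<And>y. y 5 ^ (2 * N) * (y 5 ^ 2 * h y) = ev (slice_inv y) P"
    unfolding inv_frac_def by blast
  have "\<forall>y. y 5 ^ (2 * Suc N) * h y = ev (slice_inv y) P"
    using P(2) by (simp add: power2_eq_square algebra_simps)
  then show ?thesis using P(1) unfolding inv_frac_def by blast
qed

lemma inv_frac_inv: "l < 6 \<Longrightarrow> (\<lambda>y. slice_inv y l) \<in> inv_frac"
  unfolding inv_frac_def by (simp, rule exI[of _ 0], rule exI[of _ "var l"]) (simp add: id_hom)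

text \<open>The invariants of the normaliser of the torus.  They are read off one after another from the
  values of the six invariants on the slice, dividing by \<open>s\<^sup>2 = y\<^sub>5\<^sup>2\<close> where necessary.\<close>

lemma inv_frac_generators:
  "(\<lambda>y :: nat \<Rightarrow> 'k::field_char_0. y 5 ^ 2) \<in> inv_frac" "(\<lambda>y :: nat \<Rightarrow> 'k::field_char_0. y 2) \<in> inv_frac" "(\<lambda>y :: nat \<Rightarrow> 'k::field_char_0. y 1 * y 3) \<in> inv_frac" "(\<lambda>y :: nat \<Rightarrow> 'k::field_char_0. y 0 * y 4) \<in> inv_frac"
  "(\<lambda>y :: nat \<Rightarrow> 'k::field_char_0. y 0 * y 3 ^ 2 + y 4 * y 1 ^ 2) \<in> inv_frac"
  "(\<lambda>y :: nat \<Rightarrow> 'k::field_char_0. y 5 * (y 4 * y 1 ^ 2 - y 0 * y 3 ^ 2)) \<in> inv_frac"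
proof -
  note I = inv_frac_inv[of 0, simplified] inv_frac_inv[of 1, simplified] inv_frac_inv[of 2, simplified]
    inv_frac_inv[of 3, simplified] inv_frac_inv[of 4, simplified] inv_frac_inv[of 5, simplified]
  note I' = I[folded One_nat_def]
  note C = inv_frac_add inv_frac_diff inv_frac_mult inv_frac_cmult inv_frac_power
  have e: "h = k \<Longrightarrow> k \<in> inv_frac \<Longrightarrow> h \<in> inv_frac" for h k :: "(nat \<Rightarrow> 'k) \<Rightarrow> 'k" by simp
  show s: "(\<lambda>y::nat\<Rightarrow>'k. y 5 ^ 2) \<in> inv_frac"
    by (rule e[of _ "\<lambda>y. (- 1 / 2) * slice_inv y 0"]) (simp add: slice_inv, intro inv_frac_cmult I')
  show y2: "(\<lambda>y::nat \<Rightarrow> 'k. y 2) \<in> inv_frac"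
    by (rule inv_frac_div, rule e[of _ "\<lambda>y. (1 / 4) * slice_inv y 3"]) (simp add: slice_inv, intro inv_frac_cmult I')
  show r: "(\<lambda>y::nat \<Rightarrow> 'k. y 1 * y 3) \<in> inv_frac"
  proof (rule inv_frac_div, rule e)
    show "(\<lambda>y::nat \<Rightarrow> 'k. y 5 ^ 2 * (y 1 * y 3)) = (\<lambda>y. (1 / 8) * (slice_inv y 4 + 8 * (y 5 ^ 2 * y 2 ^ 2) - (2 / 3) * (y 5 ^ 2 * slice_inv y 1)))"
      unfolding slice_inv(5) by (rule ext) (simp add: algebra_simps)
    show "(\<lambda>y::nat \<Rightarrow> 'k. (1 / 8) * (slice_inv y 4 + 8 * (y 5 ^ 2 * y 2 ^ 2) - (2 / 3) * (y 5 ^ 2 * slice_inv y 1))) \<in> inv_frac"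
      by (intro inv_frac_cmult inv_frac_add inv_frac_diff inv_frac_mult[OF s] inv_frac_power[OF y2] I')
  qed
  show p: "(\<lambda>y::nat \<Rightarrow> 'k. y 0 * y 4) \<in> inv_frac"
  proof (rule e)
    show "(\<lambda>y::nat \<Rightarrow> 'k. y 0 * y 4) = (\<lambda>y. (1 / 2) * slice_inv y 1 + 4 * (y 1 * y 3) - 3 * y 2 ^ 2)"
      unfolding slice_inv(2) by (rule ext) (simp add: algebra_simps)
    show "(\<lambda>y::nat \<Rightarrow> 'k. (1 / 2) * slice_inv y 1 + 4 * (y 1 * y 3) - 3 * y 2 ^ 2) \<in> inv_frac"
      by (intro inv_frac_add inv_frac_diff inv_frac_cmult r inv_frac_power[OF y2] I')
  qed
  show "(\<lambda>y::nat \<Rightarrow> 'k. y 0 * y 3 ^ 2 + y 4 * y 1 ^ 2) \<in> inv_frac"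
  proof (rule e)
    show "(\<lambda>y::nat \<Rightarrow> 'k. y 0 * y 3 ^ 2 + y 4 * y 1 ^ 2) = (\<lambda>y. (y 0 * y 4) * y 2 + 2 * ((y 1 * y 3) * y 2) - y 2 ^ 3 - (1 / 6) * slice_inv y 2)"
      unfolding slice_inv(3) by (rule ext) (simp add: algebra_simps)
    show "(\<lambda>y::nat \<Rightarrow> 'k. (y 0 * y 4) * y 2 + 2 * ((y 1 * y 3) * y 2) - y 2 ^ 3 - (1 / 6) * slice_inv y 2) \<in> inv_frac"
      by (intro inv_frac_add inv_frac_diff inv_frac_cmult[OF inv_frac_mult[OF r y2]] inv_frac_mult[OF p y2]
          inv_frac_power[OF y2] inv_frac_cmult[OF I'(3)])
  qed
  show "(\<lambda>y::nat \<Rightarrow> 'k. y 5 * (y 4 * y 1 ^ 2 - y 0 * y 3 ^ 2)) \<in> inv_frac"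
    by (rule inv_frac_div, rule e[of _ "\<lambda>y. (- 1 / 4) * slice_inv y 5"])
      (simp add: slice_inv, intro inv_frac_cmult I')
qed

text \<open>Newton's recursion for \<open>u = y\<^sub>0 y\<^sub>3\<^sup>2\<close> and \<open>v = y\<^sub>4 y\<^sub>1\<^sup>2\<close>: both \<open>u + v\<close> and \<open>u v = y\<^sub>0 y\<^sub>4 (y\<^sub>1 y\<^sub>3)\<^sup>2\<close> are available.
  The antisymmetric expressions are available after multiplication by \<open>y\<^sub>5\<close>, which changes sign as well.\<close>

lemma inv_frac_power_sums:
  "(\<lambda>y :: nat \<Rightarrow> 'k::field_char_0. (y 0 * y 3 ^ 2) ^ n + (y 4 * y 1 ^ 2) ^ n) \<in> inv_frac \<and>
   (\<lambda>y :: nat \<Rightarrow> 'k::field_char_0. (y 0 * y 3 ^ 2) ^ Suc n + (y 4 * y 1 ^ 2) ^ Suc n) \<in> inv_frac"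
  "(\<lambda>y :: nat \<Rightarrow> 'k::field_char_0. y 5 * ((y 4 * y 1 ^ 2) ^ n - (y 0 * y 3 ^ 2) ^ n)) \<in> inv_frac \<and>
   (\<lambda>y :: nat \<Rightarrow> 'k::field_char_0. y 5 * ((y 4 * y 1 ^ 2) ^ Suc n - (y 0 * y 3 ^ 2) ^ Suc n)) \<in> inv_frac"
proof -
  note G = inv_frac_generators
  have e: "h = k \<Longrightarrow> k \<in> inv_frac \<Longrightarrow> h \<in> inv_frac" for h k :: "(nat \<Rightarrow> 'k) \<Rightarrow> 'k" by simp
  have step: "(\<lambda>y. (y 0 * y 3 ^ 2 + y 4 * y 1 ^ 2) * h y - (y 0 * y 4) * (y 1 * y 3) ^ 2 * k y) \<in> inv_frac"
    if "h \<in> inv_frac" "k \<in> inv_frac" for h k :: "(nat \<Rightarrow> 'k) \<Rightarrow> 'k"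
    using that by (intro inv_frac_diff inv_frac_mult G inv_frac_power)
  show "(\<lambda>y. (y 0 * y 3 ^ 2) ^ n + (y 4 * y 1 ^ 2) ^ n) \<in> (inv_frac :: ((nat \<Rightarrow> 'k) \<Rightarrow> 'k) set) \<and>
    (\<lambda>y. (y 0 * y 3 ^ 2) ^ Suc n + (y 4 * y 1 ^ 2) ^ Suc n) \<in> (inv_frac :: ((nat \<Rightarrow> 'k) \<Rightarrow> 'k) set)"
  proof (induction n)
    case 0
    then show ?case using G(5)[where ?'k = 'k] inv_frac_const[of "2 :: 'k"] by simp
  next
    case (Suc n)
    then show ?case
      using e[OF _ step[of "\<lambda>y. (y 0 * y 3 ^ 2) ^ Suc n + (y 4 * y 1 ^ 2) ^ Suc n" "\<lambda>y. (y 0 * y 3 ^ 2) ^ n + (y 4 * y 1 ^ 2) ^ n"],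
          of "\<lambda>y. (y 0 * y 3 ^ 2) ^ Suc (Suc n) + (y 4 * y 1 ^ 2) ^ Suc (Suc n)"]
      by (auto simp: fun_eq_iff power2_eq_square algebra_simps)
  qed
  show "(\<lambda>y. y 5 * ((y 4 * y 1 ^ 2) ^ n - (y 0 * y 3 ^ 2) ^ n)) \<in> (inv_frac :: ((nat \<Rightarrow> 'k) \<Rightarrow> 'k) set) \<and>
    (\<lambda>y. y 5 * ((y 4 * y 1 ^ 2) ^ Suc n - (y 0 * y 3 ^ 2) ^ Suc n)) \<in> (inv_frac :: ((nat \<Rightarrow> 'k) \<Rightarrow> 'k) set)"
  proof (induction n)
    case 0
    then show ?case using G(6)[where ?'k = 'k] inv_frac_const[of "0 :: 'k"] by simp
  next
    case (Suc n)
    then show ?case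
      using e[OF _ step[of "\<lambda>y. y 5 * ((y 4 * y 1 ^ 2) ^ Suc n - (y 0 * y 3 ^ 2) ^ Suc n)" "\<lambda>y. y 5 * ((y 4 * y 1 ^ 2) ^ n - (y 0 * y 3 ^ 2) ^ n)"],
          of "\<lambda>y. y 5 * ((y 4 * y 1 ^ 2) ^ Suc (Suc n) - (y 0 * y 3 ^ 2) ^ Suc (Suc n))"]
      by (auto simp: fun_eq_iff power2_eq_square algebra_simps)
  qed
qed

lemma inv_frac_base:
  "(\<lambda>y :: nat \<Rightarrow> 'k::field_char_0. y 5 ^ e * ((y 0 * y 3 ^ 2) ^ n + (- 1) ^ e * (y 4 * y 1 ^ 2) ^ n)) \<in> inv_frac"
  "(\<lambda>y :: nat \<Rightarrow> 'k. y 5 ^ e * ((y 4 * y 1 ^ 2) ^ n + (- 1) ^ e * (y 0 * y 3 ^ 2) ^ n)) \<in> inv_frac"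
proof -
  let ?Y = "\<lambda>y :: nat \<Rightarrow> 'k. y 0 * y 3 ^ 2" and ?Z = "\<lambda>y :: nat \<Rightarrow> 'k. y 4 * y 1 ^ 2"
  have ev: "(\<lambda>y. (y 5 ^ 2) ^ j * (?Y y ^ n + ?Z y ^ n)) \<in> inv_frac"
    and od: "(\<lambda>y. (y 5 ^ 2) ^ j * (y 5 * (?Z y ^ n - ?Y y ^ n))) \<in> inv_frac" for j
    using inv_frac_power_sums(1)[of n, where ?'k = 'k] inv_frac_power_sums(2)[of n, where ?'k = 'k]
    by (auto intro!: inv_frac_mult[OF inv_frac_power[OF inv_frac_generators(1)]])
  have "(\<lambda>y. y 5 ^ e * (?Y y ^ n + (- 1) ^ e * ?Z y ^ n)) \<in> inv_frac \<and>
    (\<lambda>y. y 5 ^ e * (?Z y ^ n + (- 1) ^ e * ?Y y ^ n)) \<in> inv_frac"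
  proof (cases "even e")
    case True
    then obtain j where "e = 2 * j" by blast
    then show ?thesis using ev[of j] by (simp add: power_mult add.commute)
  next
    case False
    then obtain j where j: "e = 2 * j + 1" by (auto elim: oddE)
    have 1: "y 5 ^ e * (?Y y ^ n + (- 1) ^ e * ?Z y ^ n) = (- 1) * ((y 5 ^ 2) ^ j * (y 5 * (?Z y ^ n - ?Y y ^ n)))"
      and 2: "y 5 ^ e * (?Z y ^ n + (- 1) ^ e * ?Y y ^ n) = (y 5 ^ 2) ^ j * (y 5 * (?Z y ^ n - ?Y y ^ n))" for y
    proof -
      have s: "(- 1 :: 'k) ^ e = - 1" and p: "y 5 ^ e = (y 5 ^ 2) ^ j * y 5" by (simp_all add: j power_mult power_add)
      have *: "K * v * (A + - 1 * B) = - 1 * (K * (v * (B - A)))" "K * v * (B + - 1 * A) = K * (v * (B - A))"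
        for K v A B :: 'k by (simp_all add: algebra_simps)
      show "y 5 ^ e * (?Y y ^ n + (- 1) ^ e * ?Z y ^ n) = (- 1) * ((y 5 ^ 2) ^ j * (y 5 * (?Z y ^ n - ?Y y ^ n)))"
        "y 5 ^ e * (?Z y ^ n + (- 1) ^ e * ?Y y ^ n) = (y 5 ^ 2) ^ j * (y 5 * (?Z y ^ n - ?Y y ^ n))"
        unfolding s p by (rule *)+
    qed
    show ?thesis unfolding 1 2 using od[of j] inv_frac_cmult[OF od[of j], of "- 1"] by blast
  qed
  then show "(\<lambda>y. y 5 ^ e * (?Y y ^ n + (- 1) ^ e * ?Z y ^ n)) \<in> inv_frac"
    "(\<lambda>y. y 5 ^ e * (?Z y ^ n + (- 1) ^ e * ?Y y ^ n)) \<in> inv_frac" by auto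
qed

text \<open>A monomial of weight zero is a product of \<open>y\<^sub>0 y\<^sub>4\<close>, \<open>y\<^sub>1 y\<^sub>3\<close> and a power of either
  \<open>y\<^sub>0 y\<^sub>3\<^sup>2\<close> or \<open>y\<^sub>4 y\<^sub>1\<^sup>2\<close>.\<close>

lemma inv_frac_symmetrised:
  assumes "2 * m0 + m1 = m3 + 2 * m4"
  shows "(\<lambda>y :: nat \<Rightarrow> 'k::field_char_0. y 5 ^ e * (y 0 ^ m0 * y 1 ^ m1 * y 3 ^ m3 * y 4 ^ m4
    + (- 1) ^ e * (y 4 ^ m0 * y 3 ^ m1 * y 1 ^ m3 * y 0 ^ m4))) \<in> inv_frac"
  using assms
proof (induction "m0 + m1 + m3 + m4" arbitrary: m0 m1 m3 m4 rule: less_induct)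
  case less
  let ?S = "\<lambda>m0 m1 m3 m4 (y :: nat \<Rightarrow> 'k). y 5 ^ e * (y 0 ^ m0 * y 1 ^ m1 * y 3 ^ m3 * y 4 ^ m4
    + (- 1) ^ e * (y 4 ^ m0 * y 3 ^ m1 * y 1 ^ m3 * y 0 ^ m4))"
  consider "m0 > 0 \<and> m4 > 0" | "m1 > 0 \<and> m3 > 0" | "m4 = 0 \<and> m1 = 0 \<and> m3 = 2 * m0" | "m0 = 0 \<and> m3 = 0 \<and> m1 = 2 * m4"
    using less.prems by linarith
  then show ?case
  proof cases
    case 1
    then obtain n0 n4 where n: "m0 = Suc n0" "m4 = Suc n4" by (metis gr0_implies_Suc)
    have "?S n0 m1 m3 n4 \<in> inv_frac" by (rule less.hyps) (use less.prems n in auto)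
    from inv_frac_mult[OF inv_frac_generators(4) this]
    have "(\<lambda>y. y 0 * y 4 * ?S n0 m1 m3 n4 y) \<in> inv_frac" .
    moreover have "(\<lambda>y. y 0 * y 4 * ?S n0 m1 m3 n4 y) = ?S m0 m1 m3 m4" by (rule ext) (simp add: n algebra_simps)
    ultimately show ?thesis by (simp only:)
  next
    case 2
    then obtain n1 n3 where n: "m1 = Suc n1" "m3 = Suc n3" by (metis gr0_implies_Suc)
    have "?S m0 n1 n3 m4 \<in> inv_frac" by (rule less.hyps) (use less.prems n in auto)
    from inv_frac_mult[OF inv_frac_generators(3) this]
    have "(\<lambda>y. y 1 * y 3 * ?S m0 n1 n3 m4 y) \<in> inv_frac" .
    moreover have "(\<lambda>y. y 1 * y 3 * ?S m0 n1 n3 m4 y) = ?S m0 m1 m3 m4" by (rule ext) (simp add: n algebra_simps)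
    ultimately show ?thesis by (simp only:)
  next
    case 3
    from inv_frac_base(1)[of e m0, where ?'k = 'k]
    have "(\<lambda>y :: nat \<Rightarrow> 'k. y 5 ^ e * (y 0 ^ m0 * y 3 ^ (2 * m0) + (- 1) ^ e * (y 4 ^ m0 * y 1 ^ (2 * m0)))) \<in> inv_frac"
      by (simp only: power_mult_distrib power_mult[symmetric])
    then show ?thesis using 3 by simp
  next
    case 4
    from inv_frac_base(2)[of e m4, where ?'k = 'k]
    have "(\<lambda>y :: nat \<Rightarrow> 'k. y 5 ^ e * (y 4 ^ m4 * y 1 ^ (2 * m4) + (- 1) ^ e * (y 0 ^ m4 * y 3 ^ (2 * m4)))) \<in> inv_frac"
      by (simp only: power_mult_distrib power_mult[symmetric])
    then show ?thesis using 4 by (simp add: mult.commute)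
  qed
qed

lemma lookup_scale_variables:
  fixes g :: "'k::field mpoly"
  shows "Poly_Mapping.lookup (substitute (\<lambda>x. const (u x) * var x) g) m = Poly_Mapping.lookup g m * mono_eval u m"
proof -
  have c: "mono_eval (\<lambda>x. const (u x) * var x) m' = Poly_Mapping.single m' (mono_eval u m')" for m'
  proof -
    have "mono_eval (\<lambda>x. const (u x) * var x) m' = const (mono_eval u m') * mono_eval var m'"
    proof -
      have "const (mono_eval u m') = mono_eval (\<lambda>x. const (u x)) m'"
      proof -
        interpret c: comm_ring_hom "const :: 'k \<Rightarrow> 'k mpoly" by (rule const_hom)
        show ?thesis by (simp add: mono_eval_def hom_distribs)
      qed
      then show ?thesis by (simp add: mono_eval_def power_mult_distrib prod.distrib)
    qed
    then show ?thesis using single_eq_const_mult[of m' "mono_eval u m'"] by (simp add: single_eq_mono_eval)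
  qed
  have "substitute (\<lambda>x. const (u x) * var x) g = (\<Sum>m'\<in>Poly_Mapping.keys g. Poly_Mapping.single m' (Poly_Mapping.lookup g m' * mono_eval u m'))"
    unfolding substitute_peval peval_def c by (simp add: const_def mult_single)
  then show ?thesis
    by (auto simp: lookup_sum lookup_single when_def in_keys_iff)
qed

lemma mono_eval_6:
  assumes "Poly_Mapping.keys m \<subseteq> {..<6}"
  shows "mono_eval y m = y 0 ^ Poly_Mapping.lookup m 0 * y 1 ^ Poly_Mapping.lookup m 1 * y 2 ^ Poly_Mapping.lookup m 2
    * y 3 ^ Poly_Mapping.lookup m 3 * y 4 ^ Poly_Mapping.lookup m 4 * y 5 ^ Poly_Mapping.lookup m 5"
proof -
  have "{..<6} = {0, 1, 2, 3, 4, 5::nat}" by auto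
  then have "mono_eval y m = (\<Prod>x\<in>{0, 1, 2, 3, 4, 5}. y x ^ Poly_Mapping.lookup m x)"
    using mono_eval_superset[OF _ assms, of y] by simp
  then show ?thesis by (simp add: mult.assoc)
qed

text \<open>The diagonal matrix with entries \<open>2\<close> and \<open>1/2\<close> forces weight zero, and the Weyl element
  allows to symmetrise.\<close>

lemma inv_frac_invariant:
  fixes F :: "'k::field_char_0 mpoly"
  assumes F: "F \<in> PA 8" and inv: "invariant_poly F"
  shows "(\<lambda>y. ev (slice y) F) \<in> inv_frac"
proof -
  define g where "g = substitute slice_sub F"
  have g: "g \<in> PA 6" unfolding g_def by (rule PA_substitute[OF F]) simp
  have ev_g: "ev y g = ev (slice y) F" for y by (simp add: g_def peval_substitute id_hom slice_def)
  \<comment> \<open>The diagonal matrix multiplies \<open>y\<^sub>m\<close> by \<open>4\<^bsup>m-2\<^esup>\<close>, so each monomial that occurs satisfies the weight condition.\<close>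
  define u :: "nat \<Rightarrow> 'k" where "u m = (if m < 5 then 4 ^ m / 16 else 1)" for m
  have "ev y g = ev (\<lambda>m. u m * y m) g" for y
  proof -
    have D: "2 * (1 / 2) - 0 * 0 = (1::'k)" by simp
    have "ev (slice y) F = ev (act (slice y) 2 0 0 (1 / 2)) F" using inv D unfolding invariant_poly_def by metis
    also have "\<dots> = ev (slice (\<lambda>m. u m * y m)) F"
    proof (rule ev_slice_unique[OF F])
      note b = act_forms(2)[OF D, of _ "slice y"] slice_forms(2-4)[of y]
      show "bev (act (slice y) 2 0 0 (1 / 2)) 0 = 0" "bev (act (slice y) 2 0 0 (1 / 2)) 2 = 0"
        "u 5 * y 5 = bev (act (slice y) 2 0 0 (1 / 2)) 1"
        using b by (simp_all add: subst2_def u_def)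
      fix m :: nat assume m: "m \<le> 4"
      then have "m = 0 \<or> m = 1 \<or> m = 2 \<or> m = 3 \<or> m = 4" by auto
      then show "u m * y m = alv (act (slice y) 2 0 0 (1 / 2)) m"
        using slice_forms(1)[of 0 y] slice_forms(1)[of 1 y] slice_forms(1)[of 2 y] slice_forms(1)[of 3 y] slice_forms(1)[of 4 y]
        unfolding act_forms(1)[OF D m] by (elim disjE) (simp_all add: subst4_def u_def power_divide)
    qed
    finally show ?thesis by (simp add: ev_g)
  qed
  then have "substitute (\<lambda>x. const (u x) * var x) g = g"
    by (intro ev_eqI[OF inf_UNIV]) (simp add: peval_substitute id_hom)
  then have uk: "mono_eval u m = 1" if "m \<in> Poly_Mapping.keys g" for m
    using lookup_scale_variables[of u g m] that by (simp add: in_keys_iff)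
  have weight: "2 * Poly_Mapping.lookup m 0 + Poly_Mapping.lookup m 1 = Poly_Mapping.lookup m 3 + 2 * Poly_Mapping.lookup m 4"
    if m: "m \<in> Poly_Mapping.keys g" for m
  proof -
    have k: "Poly_Mapping.keys m \<subseteq> {..<6}" using g m by (simp add: PA_iff)
    have "(1 / 16) ^ Poly_Mapping.lookup m 0 * (1 / 4) ^ Poly_Mapping.lookup m 1 * 4 ^ Poly_Mapping.lookup m 3 * 16 ^ Poly_Mapping.lookup m 4 = (1::'k)"
      using uk[OF m] unfolding mono_eval_6[OF k] by (simp add: u_def)
    then have "4 ^ Poly_Mapping.lookup m 3 * 16 ^ Poly_Mapping.lookup m 4 = 16 ^ Poly_Mapping.lookup m 0 * (4::'k) ^ Poly_Mapping.lookup m 1"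
      by (simp add: power_divide field_simps)
    then have "(of_nat (4 ^ Poly_Mapping.lookup m 3 * 16 ^ Poly_Mapping.lookup m 4) :: 'k) = of_nat (16 ^ Poly_Mapping.lookup m 0 * 4 ^ Poly_Mapping.lookup m 1)"
      by simp
    then have "(4::nat) ^ Poly_Mapping.lookup m 3 * 16 ^ Poly_Mapping.lookup m 4 = 16 ^ Poly_Mapping.lookup m 0 * 4 ^ Poly_Mapping.lookup m 1"
      by (simp only: of_nat_eq_iff)
    moreover have "(16::nat) = 4 ^ 2" by simp
    ultimately have "(4::nat) ^ (Poly_Mapping.lookup m 3 + 2 * Poly_Mapping.lookup m 4) = 4 ^ (2 * Poly_Mapping.lookup m 0 + Poly_Mapping.lookup m 1)"
      by (simp only: power_add power_mult)
    then show ?thesis by (subst (asm) power_inject_exp) auto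
  qed
  \<comment> \<open>The effect of the Weyl element on the coordinates of the slice.\<close>
  define w where "w y = (\<lambda>m::nat. if m \<le> 4 then (- 1) ^ m * y (4 - m) else - y 5 :: 'k)" for y :: "nat \<Rightarrow> 'k"
  have ev_w: "ev y g = ev (w y) g" for y
  proof -
    have D: "0 * 0 - 1 * (- 1) = (1::'k)" by simp
    have "ev (slice y) F = ev (act (slice y) 0 1 (- 1) 0) F" using inv D unfolding invariant_poly_def by metis
    also have "\<dots> = ev (slice (w y)) F"
    proof (rule ev_slice_unique[OF F])
      note b = act_forms(2)[OF D, of _ "slice y"] slice_forms(2-4)[of y]
      show "bev (act (slice y) 0 1 (- 1) 0) 0 = 0" "bev (act (slice y) 0 1 (- 1) 0) 2 = 0"
        "w y 5 = bev (act (slice y) 0 1 (- 1) 0) 1"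
        using b by (simp_all add: subst2_def w_def)
      fix m :: nat assume m: "m \<le> 4"
      then have "m = 0 \<or> m = 1 \<or> m = 2 \<or> m = 3 \<or> m = 4" by auto
      then show "w y m = alv (act (slice y) 0 1 (- 1) 0) m"
        using slice_forms(1)[of 0 y] slice_forms(1)[of 1 y] slice_forms(1)[of 2 y] slice_forms(1)[of 3 y] slice_forms(1)[of 4 y]
        unfolding act_forms(1)[OF D m] by (elim disjE) (simp_all add: subst4_def w_def)
    qed
    finally show ?thesis by (simp add: ev_g)
  qed
  have mono: "(\<lambda>y. mono_eval y m + mono_eval (w y) m) \<in> inv_frac" if m: "m \<in> Poly_Mapping.keys g" for m
  proof -
    let ?m = "Poly_Mapping.lookup m"
    have k: "Poly_Mapping.keys m \<subseteq> {..<6}" using g m by (simp add: PA_iff)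
    have w: "w y 0 = y 4" "w y 1 = - y 3" "w y 2 = y 2" "w y 3 = - y 1" "w y 4 = y 0" "w y 5 = - y 5" for y
      by (simp_all add: w_def)
    have "even (?m 1 + ?m 3)" using weight[OF m] by presburger
    then have sign: "(- 1 :: 'k) ^ ?m 1 * (- 1) ^ ?m 3 = 1" by (simp flip: power_add)
    have "mono_eval y m + mono_eval (w y) m = y 2 ^ ?m 2 * (y 5 ^ ?m 5 * (y 0 ^ ?m 0 * y 1 ^ ?m 1 * y 3 ^ ?m 3 * y 4 ^ ?m 4
        + (- 1) ^ ?m 5 * (y 4 ^ ?m 0 * y 3 ^ ?m 1 * y 1 ^ ?m 3 * y 0 ^ ?m 4)))" for y
    proof -
      have "mono_eval (w y) m = ((- 1) ^ ?m 1 * (- 1) ^ ?m 3) * (y 2 ^ ?m 2 * (y 5 ^ ?m 5 * ((- 1) ^ ?m 5 * (y 4 ^ ?m 0 * y 3 ^ ?m 1 * y 1 ^ ?m 3 * y 0 ^ ?m 4))))"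
        unfolding mono_eval_6[OF k] w power_minus[of "y 3"] power_minus[of "y 1"] power_minus[of "y 5"]
        by (simp only: ac_simps)
      then show ?thesis unfolding sign mono_eval_6[OF k, of y] by (simp add: algebra_simps)
    qed
    then show ?thesis
      using inv_frac_mult[OF inv_frac_power[OF inv_frac_generators(2)[where ?'k = 'k], of "?m 2"]
          inv_frac_symmetrised[OF weight[OF m], of "?m 5", where ?'k = 'k]]
      by simp
  qed
  have "ev (slice y) F = (\<Sum>m\<in>Poly_Mapping.keys g. (1 / 2 * Poly_Mapping.lookup g m) * (mono_eval y m + mono_eval (w y) m))" for y
  proof -
    have "ev (slice y) F = 1 / 2 * (ev y g + ev (w y) g)" using ev_g[of y] ev_w[of y] by simp
    then show ?thesis by (simp add: peval_def sum_distrib_left algebra_simps sum.distrib)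
  qed
  moreover have "(\<lambda>y. \<Sum>m\<in>Poly_Mapping.keys g. (1 / 2 * Poly_Mapping.lookup g m) * (mono_eval y m + mono_eval (w y) m)) \<in> inv_frac"
    by (rule inv_frac_sum, rule inv_frac_cmult, rule mono)
  ultimately show ?thesis by (simp only:)
qed

subsection \<open>Normal forms modulo the relation\<close>

lemma PA_mono: "n \<le> l \<Longrightarrow> p \<in> PA n \<Longrightarrow> p \<in> PA l"
  unfolding PA_iff by (meson lessThan_subset_iff subset_trans)

lemma PA_induct [consumes 1, case_names const var add mult]:
  assumes p: "p \<in> PA n" and "\<And>c. const c \<in> S" "\<And>x. x < n \<Longrightarrow> var x \<in> S"
    and a: "\<And>p q. p \<in> S \<Longrightarrow> q \<in> S \<Longrightarrow> p + q \<in> S" and m: "\<And>p q. p \<in> S \<Longrightarrow> q \<in> S \<Longrightarrow> p * q \<in> S"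
  shows "p \<in> S"
proof -
  have 1: "1 \<in> S" and 0: "0 \<in> S" using assms(2)[of 1] assms(2)[of 0] by simp_all
  have pow: "q ^ e \<in> S" if "q \<in> S" for q e using that by (induction e) (auto intro: 1 m)
  have prod: "prod f A \<in> S" if "\<And>i. i \<in> A \<Longrightarrow> f i \<in> S" for f and A :: "nat set"
    using that by (induction A rule: infinite_finite_induct) (auto intro: 1 m)
  have sum: "sum f A \<in> S" if "\<And>i. i \<in> A \<Longrightarrow> f i \<in> S" for f and A :: "(nat \<Rightarrow>\<^sub>0 nat) set"
    using that by (induction A rule: infinite_finite_induct) (auto intro: 0 a)
  have "substitute var p \<in> S"
    unfolding substitute_peval peval_def mono_eval_def
    by (intro sum m prod pow assms(2,3)) (use p in \<open>auto simp: PA_iff\<close>)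
  then show ?thesis by simp
qed

definition relation_rest :: "'k::field mpoly" where
  "relation_rest = const (1/54) * var 0 ^ 3 * var 1 ^ 3 - const (1/9) * var 0 ^ 3 * var 2 ^ 2
     - const (1/12) * var 0 * var 1 ^ 2 * var 3 ^ 2 - const (1/3) * var 2 * var 3 ^ 3 + var 0 * var 2 * var 3 * var 4
     + const (1/2) * var 1 * var 3 ^ 2 * var 4 - const (1/2) * var 0 * var 1 * var 4 ^ 2 - var 4 ^ 3"

lemma relation_poly_eq: "relation_poly = 2 * var 5 ^ 2 - relation_rest"
  by (simp add: relation_poly_def relation_rest_def Let_def)

lemma PA_relation_rest [simp]: "relation_rest \<in> PA 5"
  unfolding relation_rest_def by (intro PA_add PA_mult PA_diff PA_power PA_const) simp_all

lemma PA_relation_poly [simp]: "relation_poly \<in> PA 6"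
  unfolding relation_poly_eq by (intro PA_mult PA_diff PA_power PA_numeral PA_mono[OF _ PA_relation_rest]) simp_all

text \<open>The relation expresses \<open>c\<^sup>2\<close> by the other variables.\<close>

lemma normal_form:
  fixes P :: "'k::field_char_0 mpoly"
  assumes "P \<in> PA 6"
  shows "\<exists>A\<in>PA 5. \<exists>C\<in>PA 5. \<exists>X\<in>PA 6. P = A + var 5 * C + X * relation_poly"
proof -
  define S :: "'k mpoly set" where "S = {P. \<exists>A\<in>PA 5. \<exists>C\<in>PA 5. \<exists>X\<in>PA 6. P = A + var 5 * C + X * relation_poly}"
  have SI: "P \<in> S" if "A \<in> PA 5" "C \<in> PA 5" "X \<in> PA 6" "P = A + var 5 * C + X * relation_poly" for A C X P
    using that unfolding S_def by blast
  have up: "q \<in> PA 6" if "q \<in> PA 5" for q :: "'k mpoly" using that by (rule PA_mono[rotated]) simp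
  have v5: "var 5 \<in> (PA 6 :: 'k mpoly set)" by simp
  have "P \<in> S"
    using assms
  proof (induction rule: PA_induct)
    case (const c)
    show ?case by (rule SI[of "const c" 0 0]) auto
  next
    case (var x)
    show ?case
    proof (cases "x = 5")
      case True
      then show ?thesis by (intro SI[of 0 1 0]) auto
    next
      case False
      then show ?thesis using var by (intro SI[of "var x" 0 0]) auto
    qed
  next
    case (add p q)
    then obtain A C X A' C' X' where *: "A \<in> PA 5" "C \<in> PA 5" "X \<in> PA 6" "p = A + var 5 * C + X * relation_poly"
      "A' \<in> PA 5" "C' \<in> PA 5" "X' \<in> PA 6" "q = A' + var 5 * C' + X' * relation_poly" unfolding S_def by blast
    show ?case
      by (rule SI[of "A + A'" "C + C'" "X + X'"]) (use * in \<open>auto simp: algebra_simps\<close>)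
  next
    case (mult p q)
    then obtain A C X A' C' X' where *: "A \<in> PA 5" "C \<in> PA 5" "X \<in> PA 6" "p = A + var 5 * C + X * relation_poly"
      "A' \<in> PA 5" "C' \<in> PA 5" "X' \<in> PA 6" "q = A' + var 5 * C' + X' * relation_poly" unfolding S_def by blast
    have half: "2 * const (1 / 2) = (1 :: 'k mpoly)"
      using const_mult[of 2 "1/2 :: 'k"] by simp
    let ?h = "const (1 / 2) :: 'k mpoly" and ?v = "var 5 :: 'k mpoly" and ?R = relation_poly
    have vv: "?v * ?v = ?h * relation_rest + ?h * ?R"
    proof -
      have "?h * relation_rest + ?h * ?R = 2 * ?h * (?v * ?v)"
        unfolding relation_poly_eq by (simp add: algebra_simps power2_eq_square)
      then show ?thesis using half by simp
    qed
    have "p * q = A * A' + ?v * (A * C' + C * A') + ?v * ?v * (C * C')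
      + (X * (A' + ?v * C' + X' * ?R) + (A + ?v * C) * X') * ?R"
      unfolding *(4,8) by (simp add: algebra_simps)
    also have "\<dots> = (A * A' + ?h * relation_rest * (C * C')) + ?v * (A * C' + C * A')
      + (?h * (C * C') + X * (A' + ?v * C' + X' * ?R) + (A + ?v * C) * X') * ?R"
      unfolding vv by (simp add: algebra_simps)
    finally have "p * q = (A * A' + ?h * relation_rest * (C * C')) + ?v * (A * C' + C * A')
      + (?h * (C * C') + X * (A' + ?v * C' + X' * ?R) + (A + ?v * C) * X') * ?R" .
    moreover have "A \<in> PA 6" "C \<in> PA 6" "A' \<in> PA 6" "C' \<in> PA 6" using up * by blast+
    then have "?h * (C * C') + X * (A' + ?v * C' + X' * ?R) + (A + ?v * C) * X' \<in> PA 6"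
      using *(3,7) v5 by (intro PA_add PA_mult PA_const PA_relation_poly)
    moreover have "A * A' + ?h * relation_rest * (C * C') \<in> PA 5"
      using *(1,2,5,6) by (intro PA_add PA_mult PA_const PA_relation_rest)
    moreover have "A * C' + C * A' \<in> PA 5"
      using *(1,2,5,6) by (intro PA_add PA_mult)
    ultimately show ?case by (intro SI)
  qed
  then show ?thesis by (simp add: S_def)
qed

text \<open>Reduction modulo \<open>d\<close>.\<close>

definition drop_d :: "'k::field mpoly \<Rightarrow> 'k mpoly" where
  "drop_d = substitute (\<lambda>x. if x = 0 then 0 else var x)"

lemma drop_d_split:
  assumes "A \<in> PA n" shows "\<exists>A1\<in>PA n. A = drop_d A + var 0 * A1"
proof -
  have hom: "drop_d (p + q) = drop_d p + drop_d q" "drop_d (p * q) = drop_d p * drop_d q" "drop_d (const c) = const c"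
    "drop_d (var x) = (if x = 0 then 0 else var x)" for p q and c :: 'a and x
    by (simp_all add: drop_d_def substitute_peval peval_add peval_mult const_hom)
  have cl: "drop_d q \<in> PA n" if "q \<in> PA n" for q :: "'a mpoly"
    unfolding drop_d_def by (rule PA_substitute[OF that]) auto
  have "A \<in> {A \<in> PA n. \<exists>A1\<in>PA n. A = drop_d A + var 0 * A1}"
    using assms
  proof (induction rule: PA_induct)
    case (const c)
    show ?case by (auto simp: hom intro!: bexI[of _ 0])
  next
    case (var x)
    then show ?case by (auto simp: hom intro!: bexI[of _ "if x = 0 then 1 else 0"])
  next
    case (add p q)
    then obtain p1 q1 where *: "p1 \<in> PA n" "q1 \<in> PA n" "p = drop_d p + var 0 * p1" "q = drop_d q + var 0 * q1"
      "p \<in> PA n" "q \<in> PA n" by blast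
    have "p + q = (drop_d p + var 0 * p1) + (drop_d q + var 0 * q1)" by (rule arg_cong2[where f = "(+)", OF *(3,4)])
    also have "\<dots> = drop_d (p + q) + var 0 * (p1 + q1)" by (simp add: hom algebra_simps)
    finally show ?case using * by blast
  next
    case (mult p q)
    then obtain p1 q1 where *: "p1 \<in> PA n" "q1 \<in> PA n" "p = drop_d p + var 0 * p1" "q = drop_d q + var 0 * q1" "p \<in> PA n" "q \<in> PA n" by blast
    have "p * q = drop_d p * q + var 0 * (p1 * q)" using *(3) by (metis distrib_right mult.assoc)
    also have "drop_d p * q = drop_d p * drop_d q + var 0 * (drop_d p * q1)"
      using *(4) by (metis distrib_left mult.left_commute)
    finally have "p * q = drop_d p * drop_d q + var 0 * (p1 * q + drop_d p * q1)" by (simp add: distrib_left)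
    then have "p * q = drop_d (p * q) + var 0 * (p1 * q + drop_d p * q1)" by (metis hom(2))
    moreover have "p1 * q + drop_d p * q1 \<in> PA n" using * cl by (intro PA_add PA_mult)
    ultimately show ?case using * by blast
  qed
  then show ?thesis by blast
qed

text \<open>At the points with quadratic part \<open>X\<^sub>0\<^sup>2\<close> and \<open>a\<^sub>1 = 0\<close> the discriminant \<open>d\<close> vanishes and the
  other invariants satisfy nothing but the relation.\<close>

definition null_point :: "'k::field \<Rightarrow> 'k \<Rightarrow> 'k \<Rightarrow> 'k \<Rightarrow> nat \<Rightarrow> 'k" where
  "null_point a0 a2 a3 a4 = (\<lambda>m. if m = 0 then a0 else if m = 2 then 3 * a2 else if m = 3 then a3 + 1 / 4
     else if m = 5 then - 3 * a2 else if m = 6 then 1 / 4 - 3 * a3 else if m = 7 then - a4 else 0)"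

lemma null_point_inv:
  fixes a0 a2 a3 a4 :: "'k::field_char_0"
  defines "I \<equiv> \<lambda>l. ev (null_point a0 a2 a3 a4) (invs l)"
  shows "I 0 = 0" "I 1 = 2 * (a0 * a4 + 3 * a2 ^ 2)" "I 2 = 6 * (a0 * a2 * a4 - a2 ^ 3 - a0 * a3 ^ 2)"
    "I 3 = a0" "I 4 = 2 * a0 * a2" "I 5 = a0 ^ 2 * a3"
proof -
  let ?x = "null_point a0 a2 a3 a4"
  have a: "alv ?x 0 = a0" "alv ?x 1 = 0" "alv ?x (Suc 0) = 0" "alv ?x 2 = a2" "alv ?x 3 = a3" "alv ?x 4 = a4"
    by (simp_all add: alv alv[unfolded One_nat_def] null_point_def field_simps)
  have b: "bev ?x 0 = 0" "bev ?x 1 = 0" "bev ?x (Suc 0) = 0" "bev ?x 2 = 1"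
    by (simp_all add: bev bev[unfolded One_nat_def] null_point_def field_simps)
  note u = I_def ev_invs invariant_of_simps pair2_def contract_def quartic_i_def quartic_j_def det3_def
  have n: "Suc (Suc 0) = 2" "Suc 2 = 3" by simp_all
  show "I 0 = 0" "I 1 = 2 * (a0 * a4 + 3 * a2 ^ 2)" "I 2 = 6 * (a0 * a2 * a4 - a2 ^ 3 - a0 * a3 ^ 2)"
    "I 3 = a0" "I 4 = 2 * a0 * a2" "I 5 = a0 ^ 2 * a3"
    unfolding u by (simp_all add: a b n power2_eq_square)
qed

text \<open>The values of \<open>a \<noteq> 0\<close>, \<open>b\<close> and \<open>i\<close> can be prescribed by the choice of \<open>a\<^sub>0, a\<^sub>2, a\<^sub>4\<close>; letting \<open>a\<^sub>3\<close> run
  through the positive integers then gives infinitely many values of \<open>j\<close>.\<close>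

lemma null_point_independent:
  fixes E :: "'k::field_char_0 mpoly"
  assumes E: "E \<in> PA 5" "drop_d E = E"
    and 0: "\<And>a0 a2 a3 a4. a0 \<noteq> 0 \<Longrightarrow> a3 \<noteq> 0 \<Longrightarrow> ev (\<lambda>l. ev (null_point a0 a2 a3 a4) (invs l)) E = 0"
  shows "E = 0"
proof (rule ev_zero_if_dense[OF inf_UNIV, of "var 3"])
  show "var 3 \<noteq> (0 :: 'k mpoly)"
  proof
    assume "var 3 = (0 :: 'k mpoly)"
    then have "ev (\<lambda>x. 1 :: 'k) (var 3) = 0" by (simp only: peval_zero[OF id_hom])
    then show False by (simp add: id_hom)
  qed
  fix x :: "nat \<Rightarrow> 'k" assume "ev x (var 3) \<noteq> 0"
  then have a0: "x 3 \<noteq> 0" by (simp add: id_hom)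
  define a0 a2 where "a0 = x 3" and "a2 = x 4 / (2 * x 3)"
  define a4 where "a4 = (x 1 / 2 - 3 * a2 ^ 2) / a0"
  define g where "g n = 6 * (a0 * a2 * a4 - a2 ^ 3 - a0 * (of_nat (Suc n)) ^ 2)" for n
  have drop: "ev y E = ev (y(0 := 0)) E" for y
  proof -
    have "ev y E = ev y (drop_d E)" by (simp add: E(2))
    also have "\<dots> = ev (y(0 := 0)) E"
      unfolding drop_d_def peval_substitute[OF id_hom] by (intro arg_cong2[where f = "\<lambda>a b. peval a b E"]) (auto simp: id_hom)
    finally show ?thesis .
  qed
  show "ev x E = 0"
  proof (rule ev_zero_if_infinitely_many[where v = 2])
    have "inj g"
    proof (rule injI)
      fix m n assume "g m = g n"
      then have "of_nat (Suc m) ^ 2 = (of_nat (Suc n) ^ 2 :: 'k)" using a0 by (simp add: g_def a0_def)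
      then have "of_nat (Suc m ^ 2) = (of_nat (Suc n ^ 2) :: 'k)" by (simp only: of_nat_power)
      then have "Suc m ^ 2 = Suc n ^ 2" by (simp only: of_nat_eq_iff)
      then show "m = n" by (simp add: power2_eq_iff_nonneg)
    qed
    moreover have "g n \<in> {y. ev (x(2 := y)) E = 0}" for n
    proof -
      let ?I = "\<lambda>l. ev (null_point a0 a2 (of_nat (Suc n)) a4) (invs l)"
      have "ev (x(2 := g n)) E = ev ((x(2 := g n))(0 := 0)) E" by (rule drop)
      also have "\<dots> = ev ?I E"
      proof (rule peval_cong[OF E(1)])
        fix l :: nat assume "l < 5"
        then have "l = 0 \<or> l = 1 \<or> l = 2 \<or> l = 3 \<or> l = 4" by auto
        then show "((x(2 := g n))(0 := 0)) l = ?I l"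
          by (elim disjE) (use a0 in \<open>simp_all only: null_point_inv, simp_all add: g_def a0_def a2_def a4_def field_simps\<close>)
      qed
      also have "\<dots> = 0" by (rule 0) (use a0 of_nat_neq_0 in \<open>auto simp: a0_def simp del: of_nat_Suc\<close>)
      finally show ?thesis by simp
    qed
    ultimately show "infinite {y. ev (x(2 := y)) E = 0}"
      by (metis finite_subset image_subsetI infinite_UNIV_nat finite_imageD)
  qed
qed

lemma substitute_simps:
  "substitute \<sigma> (p + q) = substitute \<sigma> p + substitute \<sigma> q" "substitute \<sigma> (p * q) = substitute \<sigma> p * substitute \<sigma> q"
  "substitute \<sigma> (p - q) = substitute \<sigma> p - substitute \<sigma> q" "substitute \<sigma> (p ^ n) = substitute \<sigma> p ^ n"
  "substitute \<sigma> (const c) = const c" "substitute \<sigma> (var x) = \<sigma> x" "substitute \<sigma> 0 = 0" "substitute \<sigma> 1 = 1"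
  by (simp_all add: substitute_peval peval_hom_simps const_hom)

text \<open>At the null points \<open>A + c C\<close> vanishes with \<open>d\<close>.  Changing the sign of \<open>a\<^sub>3\<close> changes the sign of
  \<open>c\<close> and fixes the other invariants, so \<open>A\<close> and \<open>C\<close> vanish separately modulo \<open>d\<close>.\<close>

lemma d_divides_normal_form:
  fixes A C F :: "'k::field_char_0 mpoly"
  assumes A: "A \<in> PA 5" and C: "C \<in> PA 5" and eq: "substitute invs (A + var 5 * C) = invs 0 * F"
  shows "\<exists>A1\<in>PA 5. \<exists>C1\<in>PA 5. A = var 0 * A1 \<and> C = var 0 * C1"
proof -
  obtain A1 where A1: "A1 \<in> PA 5" "A = drop_d A + var 0 * A1" using drop_d_split[OF A] by blast
  obtain C1 where C1: "C1 \<in> PA 5" "C = drop_d C + var 0 * C1" using drop_d_split[OF C] by blast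
  have idem: "drop_d (drop_d E) = drop_d E" for E :: "'k mpoly"
    unfolding drop_d_def by (simp add: substitute_peval peval_substitute[OF const_hom, unfolded substitute_peval] const_hom if_distrib cong: if_cong)
  have cl: "drop_d E \<in> PA 5" if "E \<in> PA 5" for E :: "'k mpoly"
    unfolding drop_d_def by (rule PA_substitute[OF that]) auto
  let ?I = "\<lambda>a0 a2 a3 a4 l. ev (null_point a0 a2 a3 a4) (invs l) :: 'k"
  have zero: "ev (?I a0 a2 a3 a4) (drop_d A) + a0 ^ 2 * a3 * ev (?I a0 a2 a3 a4) (drop_d C) = 0" for a0 a2 a3 a4
  proof -
    have d: "ev (?I a0 a2 a3 a4) E = ev (?I a0 a2 a3 a4) (drop_d E)" for E
      unfolding drop_d_def peval_substitute[OF id_hom]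
      by (intro arg_cong2[where f = "\<lambda>a b. peval a b E"]) (auto simp: id_hom null_point_inv(1))
    have "ev (?I a0 a2 a3 a4) (A + var 5 * C) = 0"
      using arg_cong[OF eq, of "ev (null_point a0 a2 a3 a4)"]
      by (simp only: peval_substitute[OF id_hom] ev_simps null_point_inv(1) mult_zero_left)
    then show ?thesis using d[of A] d[of C] by (simp add: id_hom null_point_inv(6))
  qed
  have flip: "ev (?I a0 a2 (- a3) a4) E = ev (?I a0 a2 a3 a4) E" if "E \<in> PA 5" for E a0 a2 a3 a4
  proof (rule peval_cong[OF that])
    fix l :: nat assume "l < 5"
    then have "l = 0 \<or> l = 1 \<or> l = 2 \<or> l = 3 \<or> l = 4" by auto
    then show "?I a0 a2 (- a3) a4 l = ?I a0 a2 a3 a4 l"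
      by (elim disjE) (simp_all only: null_point_inv, simp_all)
  qed
  have split: "ev (?I a0 a2 a3 a4) (drop_d A) = 0 \<and> a0 ^ 2 * a3 * ev (?I a0 a2 a3 a4) (drop_d C) = 0" for a0 a2 a3 a4
  proof -
    let ?u = "ev (?I a0 a2 a3 a4) (drop_d A)" and ?w = "a0 ^ 2 * a3 * ev (?I a0 a2 a3 a4) (drop_d C)"
    have "?u + ?w = 0" "?u - ?w = 0"
      using zero[of a0 a2 a3 a4] zero[of a0 a2 "- a3" a4] flip[OF cl[OF A], of a0 a2 a3 a4] flip[OF cl[OF C], of a0 a2 a3 a4]
      by simp_all
    moreover have "u = 0 \<and> v = 0" if "u + v = 0" "u - v = 0" for u v :: 'k
    proof -
      have "2 * u = (u + v) + (u - v)" by simp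
      then have "u = 0" using that by simp
      then show ?thesis using that by simp
    qed
    ultimately show ?thesis by blast
  qed
  have "drop_d A = 0" by (rule null_point_independent) (use split cl[OF A] idem in auto)
  moreover have "drop_d C = 0"
  proof (rule null_point_independent)
    fix a0 a2 a3 a4 :: 'k assume "a0 \<noteq> 0" "a3 \<noteq> 0"
    then show "ev (?I a0 a2 a3 a4) (drop_d C) = 0" using split[of a0 a2 a3 a4] by simp
  qed (use cl[OF C] idem in auto)
  ultimately show ?thesis using A1 C1 by auto
qed

lemma invs_0_nz: "invs 0 \<noteq> (0 :: 'k::field_char_0 mpoly)"
proof
  assume "invs 0 = (0 :: 'k mpoly)"
  then have "slice_inv (\<lambda>m. 1 :: 'k) 0 = 0" by (simp add: id_hom)
  then show False by (simp add: slice_inv(1))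
qed

text \<open>A factor \<open>d\<close> can be cancelled within the subring generated by the invariants.\<close>

lemma descent:
  fixes P F :: "'k::field_char_0 mpoly"
  assumes P: "P \<in> PA 6" and eq: "substitute invs P = invs 0 * F"
  shows "\<exists>P'\<in>PA 6. F = substitute invs P'"
proof -
  obtain A C X where *: "A \<in> PA 5" "C \<in> PA 5" "X \<in> PA 6" "P = A + var 5 * C + X * relation_poly"
    using normal_form[OF P] by blast
  have e: "substitute invs (A + var 5 * C) = invs 0 * F"
    using eq *(4) by (simp add: substitute_simps substitute_invs_relation)
  obtain A1 C1 where 1: "A1 \<in> PA 5" "C1 \<in> PA 5" "A = var 0 * A1" "C = var 0 * C1"
    using d_divides_normal_form[OF *(1,2) e] by blast
  have "invs 0 * substitute invs (A1 + var 5 * C1) = invs 0 * F"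
    using e 1 by (simp add: substitute_simps algebra_simps)
  then have "F = substitute invs (A1 + var 5 * C1)" using invs_0_nz[where ?'k = 'k] by simp
  moreover have "A1 + var 5 * C1 \<in> PA 6" using 1 PA_mono[of 5 6] by (intro PA_add PA_mult) auto
  ultimately show ?thesis by blast
qed

text \<open>On the slice a multiple of \<open>F\<close> by a power of \<open>d\<close> agrees with a polynomial in the invariants, hence it does so
  everywhere by density; then the power of \<open>d\<close> is cancelled.\<close>

theorem invariants_generated:
  fixes F :: "'k::field_char_0 mpoly"
  assumes F: "F \<in> PA 8" and inv: "invariant_poly F"
  shows "\<exists>P\<in>PA 6. F = substitute invs P"
proof -
  obtain N P where P: "P \<in> PA 6" "\<And>y. y 5 ^ (2 * N) * ev (slice y) F = ev (slice_inv y) P"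
    using inv_frac_invariant[OF F inv] unfolding inv_frac_def by blast
  define D where "D = (const (- 1 / 2) * invs 0 :: 'k mpoly) ^ N * F - substitute invs P"
  have D: "D \<in> PA 8" unfolding D_def
    by (intro PA_diff PA_mult PA_power PA_const PA_invs F PA_substitute[OF P(1)])
  have "D = 0"
  proof (rule invariant_zero_if_zero_on_slice)
    show "invariant_poly D" unfolding D_def
      by (intro invariant_poly_ops inv invariant_poly_invs invariant_poly_substitute P(1)) simp
    fix x :: "nat \<Rightarrow> 'k" assume x: "bev x 0 = 0" "bev x 2 = 0"
    define y where "y m = (if m \<le> 4 then alv x m else bev x 1)" for m
    have "ev x D = ev (slice y) D" by (rule ev_slice_unique[OF D x]) (simp_all add: y_def)
    also have "\<dots> = 0" using P(2)[of y]
      by (simp add: D_def id_hom slice_inv(1) peval_substitute flip: power_mult)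
    finally show "ev x D = 0" .
  qed
  then have "(const (- 1 / 2) * invs 0) ^ N * F = substitute invs P" by (simp add: D_def)
  then have "\<exists>P\<in>PA 6. substitute invs P = invs 0 ^ N * F"
  proof -
    assume a: "(const (- 1 / 2) * invs 0) ^ N * F = substitute invs P"
    have "const ((- 2) ^ N) * const (- 1 / 2) ^ N = (1 :: 'k mpoly)"
      by (simp flip: const_power const_mult power_mult_distrib)
    then have "substitute invs (const ((- 2) ^ N) * P) = invs 0 ^ N * F"
      by (simp add: substitute_simps power_mult_distrib mult.assoc flip: a)
    then show ?thesis using P(1) by (intro bexI[of _ "const ((- 2) ^ N) * P"]) auto
  qed
  then show ?thesis
  proof (induction N)
    case (Suc N)
    then obtain P where "P \<in> PA 6" "substitute invs P = invs 0 * (invs 0 ^ N * F)" by (auto simp: mult.assoc)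
    from descent[OF this] show ?case using Suc.IH by metis
  qed auto
qed

text \<open>In normal form, a relation is divisible by \<open>d\<close>, and the quotient is again a relation in normal form;
  so it is divisible by all powers of \<open>d\<close>.\<close>

theorem relations_generated:
  fixes P :: "'k::field_char_0 mpoly"
  assumes P: "P \<in> PA 6" and eq: "substitute invs P = 0"
  shows "\<exists>X\<in>PA 6. P = X * relation_poly"
proof -
  obtain A C X where *: "A \<in> PA 5" "C \<in> PA 5" "X \<in> PA 6" "P = A + var 5 * C + X * relation_poly"
    using normal_form[OF P] by blast
  have e: "substitute invs (A + var 5 * C) = 0"
    using eq *(4) by (simp add: substitute_simps substitute_invs_relation)
  have div: "\<exists>A'\<in>PA 5. \<exists>C'\<in>PA 5. A = var 0 ^ n * A' \<and> C = var 0 ^ n * C' \<and> substitute invs (A' + var 5 * C') = 0" for n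
  proof (induction n)
    case 0
    then show ?case using *(1,2) e by auto
  next
    case (Suc n)
    then obtain A' C' where 1: "A' \<in> PA 5" "C' \<in> PA 5" "A = var 0 ^ n * A'" "C = var 0 ^ n * C'"
      "substitute invs (A' + var 5 * C') = 0" by blast
    obtain A1 C1 where 2: "A1 \<in> PA 5" "C1 \<in> PA 5" "A' = var 0 * A1" "C' = var 0 * C1"
      using d_divides_normal_form[OF 1(1,2), of 0] 1(5) by auto
    have "invs 0 * substitute invs (A1 + var 5 * C1) = 0"
      using 1(5) 2 by (simp add: substitute_simps algebra_simps)
    then have "substitute invs (A1 + var 5 * C1) = 0" using invs_0_nz[where ?'k = 'k] by simp
    then show ?case using 1 2 by (intro bexI[of _ A1] bexI[of _ C1]) (auto simp: algebra_simps)
  qed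
  have zero: "E = 0" if E: "\<And>n. \<exists>E'. E = var 0 ^ n * E'" for E :: "'k mpoly"
  proof (rule ev_all_zero_imp_zero[OF inf_UNIV])
    fix x :: "nat \<Rightarrow> 'k"
    \<comment> \<open>Specialise all variables except \<open>d\<close> and compare degrees in \<open>d\<close>.\<close>
    define \<psi> where "\<psi> = peval (\<lambda>c. [:c:]) (\<lambda>z. if z = 0 then [:0, 1:] else [:x z:])"
    have "\<psi> E = 0"
    proof (rule ccontr)
      assume nz: "\<psi> E \<noteq> 0"
      obtain E' where E': "E = var 0 ^ Suc (degree (\<psi> E)) * E'" using E by blast
      have "\<psi> E = [:0, 1:] ^ Suc (degree (\<psi> E)) * \<psi> E'"
        by (subst (1) E') (simp add: \<psi>_def peval_hom_simps pCons_hom del: power_Suc)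
      then have "degree (\<psi> E) = Suc (degree (\<psi> E)) + degree (\<psi> E')"
        using nz by (metis degree_linear_power degree_mult_eq mult_zero_left mult_zero_right)
      then show False by simp
    qed
    moreover have "ev x E = poly (\<psi> E) (x 0)"
      unfolding \<psi>_def hom_peval[OF poly_hom] by (auto intro!: arg_cong2[where f = "\<lambda>a b. peval a b E"])
    ultimately show "ev x E = 0" by simp
  qed
  have "A = 0" "C = 0" using zero div by metis+
  then show ?thesis using * by auto
qed

section \<open>Weighted gradings\<close>

text \<open>The homomorphism \<open>p \<mapsto> p(t\<^bsup>w0\<^esup> x\<^sub>0, t\<^bsup>w1\<^esup> x\<^sub>1, \<dots>)\<close>, whose coefficients in \<open>t\<close> are the components of weighted
  degree \<open>n\<close>.\<close>

definition wpoly :: "nat list \<Rightarrow> 'k::field mpoly \<Rightarrow> 'k mpoly poly" where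
  "wpoly ws = peval (\<lambda>c. [:const c:]) (\<lambda>x. monom (var x) (ws ! x))"

lemma const_pCons_hom: "comm_ring_hom (\<lambda>c::'k::field. [:const c:])"
  by (rule comp_hom[OF pCons_hom const_hom])

lemma wpoly_hom: "comm_ring_hom (wpoly ws)"
  unfolding wpoly_def by (rule peval_hom[OF const_pCons_hom])

lemma wpoly_simps:
  "wpoly ws (p + q) = wpoly ws p + wpoly ws q" "wpoly ws (p * q) = wpoly ws p * wpoly ws q"
  "wpoly ws (- p) = - wpoly ws p" "wpoly ws (p - q) = wpoly ws p - wpoly ws q" "wpoly ws (p ^ n) = wpoly ws p ^ n"
  by (simp_all add: wpoly_def peval_hom_simps const_pCons_hom)

lemma wpoly_const [simp]: "wpoly ws (const c) = monom (const c) 0" and wpoly_var [simp]: "wpoly ws (var x) = monom (var x) (ws ! x)"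
  by (simp_all add: wpoly_def const_pCons_hom monom_0)

lemma wpoly_0 [simp]: "wpoly ws 0 = 0" and wpoly_1 [simp]: "wpoly ws 1 = 1"
  by (simp_all add: wpoly_def const_pCons_hom)

definition wdeg :: "nat list \<Rightarrow> (nat \<Rightarrow>\<^sub>0 nat) \<Rightarrow> nat" where
  "wdeg ws m = (\<Sum>x\<in>Poly_Mapping.keys m. ws ! x * Poly_Mapping.lookup m x)"

lemma wpoly_mono: "mono_eval (\<lambda>x. monom (\<sigma> x) (d x)) m = monom (mono_eval \<sigma> m) (\<Sum>x\<in>Poly_Mapping.keys m. d x * Poly_Mapping.lookup m x)"
  for \<sigma> :: "nat \<Rightarrow> 'a::comm_ring_1"
proof -
  have p: "monom a n ^ e = monom (a ^ e) (n * e)" for a :: 'a and n e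
    by (induction e) (simp_all add: mult_monom monom_0 one_pCons)
  have "finite A \<Longrightarrow> (\<Prod>x\<in>A. monom (f x) (g x)) = monom (\<Prod>x\<in>A. f x) (\<Sum>x\<in>A. g x)" for A :: "nat set" and f :: "nat \<Rightarrow> 'a" and g
    by (induction A rule: finite_induct) (simp_all add: mult_monom monom_0 one_pCons)
  then show ?thesis by (simp add: mono_eval_def p)
qed

lemma wpoly_sum: "wpoly ws p = (\<Sum>m\<in>Poly_Mapping.keys p. monom (Poly_Mapping.single m (Poly_Mapping.lookup p m)) (wdeg ws m))"
  unfolding wpoly_def peval_def wpoly_mono
  by (rule sum.cong) (simp_all add: wdeg_def smult_monom flip: single_eq_mono_eval single_eq_const_mult)

lemma lookup_coeff_wpoly:
  "Poly_Mapping.lookup (coeff (wpoly ws p) n) m = (if wdeg ws m = n then Poly_Mapping.lookup p m else 0)"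
  by (auto simp: wpoly_sum coeff_sum lookup_sum lookup_single when_def in_keys_iff if_distrib[of "\<lambda>q. Poly_Mapping.lookup q m"] intro!: sum.neutral cong: if_cong)
    (subst sum.cong[OF refl, of _ _ "\<lambda>m'. if m' = m then Poly_Mapping.lookup p m else 0"], auto simp: in_keys_iff lookup_single when_def)

lemma PA_coeff_wpoly: "p \<in> PA n \<Longrightarrow> coeff (wpoly ws p) d \<in> PA n"
  unfolding PA_iff by (auto simp: in_keys_iff lookup_coeff_wpoly split: if_splits)

lemma weighted_grading_iff: "p \<in> weighted_grading ws n \<longleftrightarrow> p \<in> PA (length ws) \<and> wpoly ws p = monom p n"
proof -
  have "(\<forall>m\<in>Poly_Mapping.keys p. wdeg ws m = n) \<longleftrightarrow> wpoly ws p = monom p n"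
  proof
    assume *: "\<forall>m\<in>Poly_Mapping.keys p. wdeg ws m = n"
    show "wpoly ws p = monom p n"
      by (rule poly_eqI, rule poly_mapping_eqI) (use * in \<open>auto simp: lookup_coeff_wpoly in_keys_iff\<close>)
  next
    assume *: "wpoly ws p = monom p n"
    show "\<forall>m\<in>Poly_Mapping.keys p. wdeg ws m = n"
    proof (rule ballI, rule ccontr)
      fix m assume m: "m \<in> Poly_Mapping.keys p" "wdeg ws m \<noteq> n"
      have "Poly_Mapping.lookup (coeff (wpoly ws p) (wdeg ws m)) m = 0" using * m(2) by simp
      then show False using m(1) by (simp add: lookup_coeff_wpoly in_keys_iff)
    qed
  qed
  then show ?thesis by (simp add: weighted_grading_def wdeg_def)
qed

lemma wpoly_coeff: "wpoly ws (coeff (wpoly ws p) n) = monom (coeff (wpoly ws p) n) n"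
  by (rule poly_eqI, rule poly_mapping_eqI) (auto simp: lookup_coeff_wpoly)

lemma poly_wpoly_1: "poly (wpoly ws p) 1 = p"
  by (simp add: wpoly_def hom_peval[OF poly_hom] poly_monom flip: substitute_peval)

lemma sum_coeff_wpoly: "(\<Sum>n\<le>degree (wpoly ws p). coeff (wpoly ws p) n) = p"
  using poly_wpoly_1[of ws p] by (simp add: poly_altdef)

lemma coeff_wpoly_in_grading: "p \<in> PA (length ws) \<Longrightarrow> coeff (wpoly ws p) n \<in> weighted_grading ws n"
  by (simp add: weighted_grading_iff PA_coeff_wpoly wpoly_coeff)

lemma substitute_hom: "comm_ring_hom (substitute \<sigma>)"
  unfolding substitute_peval by (rule peval_hom[OF const_hom])

text \<open>A substitution that respects the weights commutes with taking components.\<close>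

lemma wpoly_substitute:
  assumes p: "p \<in> PA (length ws)" and \<sigma>: "\<And>x. x < length ws \<Longrightarrow> wpoly ws' (\<sigma> x) = monom (\<sigma> x) (ws ! x)"
  shows "wpoly ws' (substitute \<sigma> p) = map_poly (substitute \<sigma>) (wpoly ws p)"
proof -
  interpret s: comm_ring_hom "substitute \<sigma>" by (rule substitute_hom)
  interpret m: map_poly_comm_ring_hom "substitute \<sigma>" ..
  have "wpoly ws' (substitute \<sigma> p) = peval (\<lambda>c. [:const c:]) (\<lambda>x. wpoly ws' (\<sigma> x)) p"
    unfolding wpoly_def peval_substitute[OF const_pCons_hom] ..
  also have "\<dots> = peval (\<lambda>c. [:const c:]) (\<lambda>x. monom (\<sigma> x) (ws ! x)) p"
    by (rule peval_cong[OF p \<sigma>])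
  also have "\<dots> = map_poly (substitute \<sigma>) (wpoly ws p)"
  proof -
    have "comm_ring_hom (map_poly (substitute \<sigma>))" by unfold_locales
    from hom_peval[OF this, of "\<lambda>c. [:const c:]" "\<lambda>x. monom (var x) (ws ! x)" p]
    moreover have "map_poly (substitute \<sigma>) [:const c:] = [:const c:]" for c :: 'a
      by (intro poly_eqI) (simp add: coeff_map_poly substitute_simps coeff_pCons split: nat.split)
    ultimately show ?thesis by (simp add: wpoly_def substitute_simps)
  qed
  finally show ?thesis .
qed

lemma coeff_wpoly_substitute:
  assumes "p \<in> PA (length ws)" "\<And>x. x < length ws \<Longrightarrow> wpoly ws' (\<sigma> x) = monom (\<sigma> x) (ws ! x)"
  shows "coeff (wpoly ws' (substitute \<sigma> p)) n = substitute \<sigma> (coeff (wpoly ws p) n)"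
  using wpoly_substitute[OF assms] by (simp add: coeff_map_poly substitute_simps)

subsection \<open>Quotient algebras\<close>

lemma poly_alg_cring: "cring (poly_alg n :: ('k::field, 'k mpoly) module)"
proof (rule cringI)
  show "abelian_group (poly_alg n :: ('k, 'k mpoly) module)"
    by (rule abelian_groupI) (auto simp: algebra_simps intro!: PA_add bexI[OF _ PA_uminus])
  show "comm_monoid (poly_alg n :: ('k, 'k mpoly) module)"
    by (rule comm_monoidI) (auto simp: algebra_simps intro!: PA_mult)
qed (auto simp: algebra_simps)

lemma cring_hom_image:
  fixes S :: "('b, 'n) ring_scheme" and R :: "('a, 'm) ring_scheme"
  assumes R: "cring R" and surj: "carrier S = h ` carrier R"
    and add: "\<And>x y. x \<in> carrier R \<Longrightarrow> y \<in> carrier R \<Longrightarrow> h x \<oplus>\<^bsub>S\<^esub> h y = h (x \<oplus>\<^bsub>R\<^esub> y)"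
    and mult: "\<And>x y. x \<in> carrier R \<Longrightarrow> y \<in> carrier R \<Longrightarrow> h x \<otimes>\<^bsub>S\<^esub> h y = h (x \<otimes>\<^bsub>R\<^esub> y)"
    and zero: "\<zero>\<^bsub>S\<^esub> = h \<zero>\<^bsub>R\<^esub>" and one: "\<one>\<^bsub>S\<^esub> = h \<one>\<^bsub>R\<^esub>"
  shows "cring S"
proof -
  interpret R: cring R by (rule R)
  note [simp] = surj add mult zero one
  show ?thesis
  proof (rule cringI)
    show "abelian_group S"
    proof (rule abelian_groupI)
      fix x assume "x \<in> carrier S"
      then obtain a where "a \<in> carrier R" "x = h a" by auto
      then show "\<exists>y\<in>carrier S. y \<oplus>\<^bsub>S\<^esub> x = \<zero>\<^bsub>S\<^esub>"
        by (intro bexI[of _ "h (\<ominus>\<^bsub>R\<^esub> a)"]) (auto simp: R.l_neg)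
    qed (auto simp: R.a_ac)
    show "comm_monoid S"
      by (rule comm_monoidI) (auto simp: R.m_ac)
  qed (auto simp: R.l_distr)
qed

text \<open>Calculation with residue classes through their representatives.\<close>

locale quotient_poly_alg =
  fixes n :: nat and I :: "'k::field mpoly set"
  assumes I: "ideal I (poly_alg n :: ('k, 'k mpoly) module)"
begin

abbreviation "R \<equiv> poly_alg n :: ('k, 'k mpoly) module"
abbreviation "S \<equiv> quot_alg R I"
abbreviation cls :: "'k mpoly \<Rightarrow> 'k mpoly set" where "cls p \<equiv> I +>\<^bsub>R\<^esub> p"

interpretation R: cring R by (rule poly_alg_cring)
interpretation I: ideal I R by (rule I)

lemma cls_eq: "cls p = {i + p |i. i \<in> I}"
  by (auto simp: a_r_coset_def')

lemma I_sub: "i \<in> I \<Longrightarrow> i \<in> PA n" using I.a_Hcarr by blast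
lemma I_add: "i \<in> I \<Longrightarrow> j \<in> I \<Longrightarrow> i + j \<in> I" using I.a_closed[of i j] by simp
lemma I_zero: "0 \<in> I" using I.zero_closed by simp
lemma I_mult: "i \<in> I \<Longrightarrow> p \<in> PA n \<Longrightarrow> i * p \<in> I" "i \<in> I \<Longrightarrow> p \<in> PA n \<Longrightarrow> p * i \<in> I"
  using I.I_r_closed[of i p] I.I_l_closed[of i p] by simp_all
lemma I_neg: "i \<in> I \<Longrightarrow> - i \<in> I"
  using I_mult(1)[of i "- 1", OF _ PA_uminus[OF PA_one]] by simp
lemma cls_eq_iff: "cls p = cls q \<longleftrightarrow> p - q \<in> I"
proof
  assume "cls p = cls q"
  moreover have "p \<in> cls p" unfolding cls_eq using I_zero by force
  ultimately obtain i where "i \<in> I" "p = i + q" unfolding cls_eq by blast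
  then show "p - q \<in> I" by simp
next
  have *: "cls p \<subseteq> cls q" if "p - q \<in> I" for p q
  proof
    fix x assume "x \<in> cls p"
    then obtain i where "i \<in> I" "x = i + p" unfolding cls_eq by blast
    then have "i + (p - q) \<in> I" "x = (i + (p - q)) + q" using that I_add by auto
    then show "x \<in> cls q" unfolding cls_eq by blast
  qed
  assume "p - q \<in> I"
  moreover from this have "q - p \<in> I" using I_neg by fastforce
  ultimately show "cls p = cls q" using * by blast
qed

lemma carrier_S: "carrier S = cls ` PA n"
  by (auto simp: quot_alg_def FactRing_def A_RCOSETS_def')

lemma S_one: "\<one>\<^bsub>S\<^esub> = cls 1" and S_zero: "\<zero>\<^bsub>S\<^esub> = cls 0"
  unfolding cls_eq by (auto simp: quot_alg_def FactRing_def a_r_coset_def')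

lemma S_ops:
  assumes "p \<in> PA n" "q \<in> PA n"
  shows "cls p \<oplus>\<^bsub>S\<^esub> cls q = cls (p + q)" "cls p \<otimes>\<^bsub>S\<^esub> cls q = cls (p * q)"
    "c \<odot>\<^bsub>S\<^esub> cls p = cls (const c * p)"
proof -
  show "cls p \<oplus>\<^bsub>S\<^esub> cls q = cls (p + q)"
    using I.a_rcos_sum[of p q] assms by (simp add: quot_alg_def FactRing_def)
  show "cls p \<otimes>\<^bsub>S\<^esub> cls q = cls (p * q)"
    using I.rcoset_mult_add[of p q] assms by (simp add: quot_alg_def FactRing_def)
  have "cls (const c * a) = cls (const c * p)" if a: "a \<in> cls p" for a
  proof -
    obtain i where "i \<in> I" "a = i + p" using a unfolding cls_eq by blast
    then have "const c * a - const c * p = const c * i" by (simp add: algebra_simps)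
    then show ?thesis unfolding cls_eq_iff using I_mult(2)[OF \<open>i \<in> I\<close> PA_const, of c] by simp
  qed
  then have "(\<Union>a\<in>cls p. cls (const c * a)) = (\<Union>a\<in>cls p. cls (const c * p))" by (rule SUP_cong[OF refl])
  moreover have "p \<in> cls p" unfolding cls_eq using I_zero by force
  then have "(\<Union>a\<in>cls p. cls (const c * p)) = cls (const c * p)" by (intro SUP_const) blast
  moreover have "c \<odot>\<^bsub>S\<^esub> cls p = (\<Union>a\<in>cls p. cls (const c * a))" by (simp add: quot_alg_def)
  ultimately show "c \<odot>\<^bsub>S\<^esub> cls p = cls (const c * p)" by (simp only:)
qed

lemma S_cring: "cring S"
  by (rule cring_hom_image[OF poly_alg_cring[of n] carrier_S]) (simp_all add: S_ops S_one S_zero)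

lemma cls_sum_mem:
  assumes Q: "ideal Q S" and f: "\<And>i. i \<in> A \<Longrightarrow> f i \<in> PA n \<and> cls (f i) \<in> Q"
  shows "cls (sum f A) \<in> Q"
proof -
  have zero: "cls 0 \<in> Q" using additive_subgroup.zero_closed[OF ideal.axioms(1)[OF Q]] by (simp only: S_zero)
  show ?thesis using f
  proof (induction A rule: infinite_finite_induct)
    case (insert i A)
    have s: "sum f A \<in> PA n" using insert.prems by (intro PA_sum) blast
    have "cls (f i) \<oplus>\<^bsub>S\<^esub> cls (sum f A) \<in> Q" 
      using insert by (intro additive_subgroup.a_closed[OF ideal.axioms(1)[OF Q]]) auto
    then show ?case using insert s by (simp add: S_ops)
  qed (simp_all add: zero)
qed

end

subsection \<open>The two homogeneous coordinate rings\<close>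

abbreviation to_K :: "'k::field \<Rightarrow> 'k mpoly fract" where "to_K c \<equiv> to_fract (const c)"

abbreviation ones :: "nat list" where "ones \<equiv> replicate 8 (Suc 0)"

text \<open>The grading of \<open>A\<^sub>3\<close> as a homomorphism to polynomials over the function field.\<close>

definition eps :: "'k::field mpoly \<Rightarrow> 'k mpoly fract poly" where
  "eps p = map_poly to_fract (wpoly ones p)"

lemma eps_hom: "comm_ring_hom (eps :: 'k::field mpoly \<Rightarrow> _)"
proof -
  interpret f: comm_ring_hom "to_fract :: 'k mpoly \<Rightarrow> _" by (rule to_fract_hom)
  interpret m: map_poly_comm_ring_hom "to_fract :: 'k mpoly \<Rightarrow> _" ..
  have "comm_ring_hom (map_poly (to_fract :: 'k mpoly \<Rightarrow> _))" by unfold_locales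
  from comp_hom[OF this wpoly_hom[of ones]] show ?thesis by (simp add: eps_def[abs_def])
qed

lemma eps_simps:
  fixes p q :: "'k::field mpoly"
  shows "eps (p + q) = eps p + eps q" "eps (p * q) = eps p * eps q" "eps (1 :: 'k mpoly) = 1"
proof -
  interpret h: comm_ring_hom "eps :: 'k mpoly \<Rightarrow> _" by (rule eps_hom)
  show "eps (p + q) = eps p + eps q" "eps (p * q) = eps p * eps q" "eps (1 :: 'k mpoly) = 1" by (simp_all add: h.hom_add h.hom_mult)
qed

lemma coeff_eps: "coeff (eps p) n = to_fract (coeff (wpoly ones p) n)"
  by (simp add: eps_def coeff_map_poly)

lemma eps_eq_monom_iff: "eps p = monom (to_fract p) n \<longleftrightarrow> wpoly ones p = monom p n"
proof -
  have "eps p = monom (to_fract p) n \<longleftrightarrow> (\<forall>i. to_fract (coeff (wpoly ones p) i) = (if i = n then to_fract p else 0))"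
    by (auto simp: poly_eq_iff coeff_eps)
  also have "\<dots> \<longleftrightarrow> (\<forall>i. coeff (wpoly ones p) i = (if i = n then p else 0))"
    by (rule all_cong1) (auto simp: to_fract_eq_iff)
  also have "\<dots> \<longleftrightarrow> wpoly ones p = monom p n" by (auto simp: poly_eq_iff)
  finally show ?thesis .
qed

lemma poly_eps_1: "poly (eps p) 1 = to_fract p"
proof -
  interpret f: comm_ring_hom "to_fract :: 'a mpoly \<Rightarrow> _" by (rule to_fract_hom)
  have "poly (map_poly to_fract (wpoly ones p)) (to_fract 1) = to_fract (poly (wpoly ones p) 1)"
    by (rule f.poly_map_poly)
  then show ?thesis by (simp add: eps_def poly_wpoly_1)
qed

lemma length_weights [simp]: "length weights = 6" by (simp add: weights_def)

lemma wpoly_numeral [simp]: "wpoly ws (numeral w) = monom (numeral w) 0"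
  using wpoly_const[of ws "numeral w"] by simp

lemma monom_simps: "monom a m + monom b m = monom (a + b) m" "monom a m - monom b m = monom (a - b) m"
  "monom (a::'a::comm_ring_1) m ^ e = monom (a ^ e) (m * e)"
  by (simp_all add: add_monom diff_monom) (induction e, simp_all add: mult_monom monom_0 one_pCons)

lemma wpoly_al: "m \<le> 4 \<Longrightarrow> wpoly ones (al m) = monom (al m) 1" and wpoly_be: "m \<le> 2 \<Longrightarrow> wpoly ones (be m) = monom (be m) 1"
  by (auto simp: al_def be_def wpoly_simps mult_monom monom_simps minus_monom nth_Cons')

lemma wpoly_invs: "l < 6 \<Longrightarrow> wpoly ones (invs l) = monom (invs l) (weights ! l)"
proof -
  assume "l < 6"
  have a: "wpoly ones (al 0) = monom (al 0) 1" "wpoly ones (al 1) = monom (al 1) 1" "wpoly ones (al (Suc 0)) = monom (al (Suc 0)) 1"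
    "wpoly ones (al 2) = monom (al 2) 1" "wpoly ones (al (Suc (Suc 0))) = monom (al (Suc (Suc 0))) 1"
    "wpoly ones (al 3) = monom (al 3) 1" "wpoly ones (al (Suc (Suc (Suc 0)))) = monom (al (Suc (Suc (Suc 0)))) 1"
    "wpoly ones (al 4) = monom (al 4) 1" "wpoly ones (be 0) = monom (be 0) 1" "wpoly ones (be 1) = monom (be 1) 1"
    "wpoly ones (be (Suc 0)) = monom (be (Suc 0)) 1" "wpoly ones (be 2) = monom (be 2) 1"
    by (simp_all add: wpoly_al wpoly_be)
  have "l = 0 \<or> l = 1 \<or> l = 2 \<or> l = 3 \<or> l = 4 \<or> l = 5" using \<open>l < 6\<close> by auto
  then show ?thesis
    by (elim disjE)
      (simp_all add: invs_def weights_def pair2_def contract_def det3_def quartic_i_def quartic_j_def wpoly_simps a mult_monom monom_simps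
        eval_nat_numeral(1) flip: numeral_2_eq_2)
qed

lemma wpoly_rho: "wpoly weights rho = monom rho 6"
  by (simp add: rho_def Let_def wpoly_simps mult_monom monom_simps weights_def)

lemma rho_PA: "rho \<in> PA 6"
  unfolding rho_def Let_def by (intro PA_add PA_mult PA_diff PA_power PA_const) simp_all

lemma rho_homogeneous: "rho \<in> weighted_grading weights 6"
  by (simp add: weighted_grading_iff rho_PA wpoly_rho)

lemma Res3_nz: "Res3 \<noteq> (0 :: 'k::field_char_0 mpoly)"
proof
  assume "Res3 = (0 :: 'k mpoly)"
  then have "ev (\<lambda>m. if m = 3 \<or> m = 4 then 1 else 0 :: 'k) Res3 = 0" by (simp add: id_hom)
  then show False unfolding Res3_def resultant_bezout coeff_F01 by (simp add: id_hom)
qed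

lemma wpoly_ones_substitute_invs:
  "p \<in> PA 6 \<Longrightarrow> coeff (wpoly ones (substitute invs p)) n = substitute invs (coeff (wpoly weights p) n)"
  by (rule coeff_wpoly_substitute) (simp_all add: wpoly_invs)

text \<open>Since \<open>Res\<close> is \<open>\<rho>\<close> evaluated at the invariants, its degree follows from the weight of \<open>\<rho>\<close>.\<close>

lemma Res3_homogeneous: "(Res3 :: 'k::field_char_0 mpoly) \<in> weighted_grading ones 6"
proof -
  have r: "rho \<in> (PA 6 :: 'k mpoly set)" "wpoly weights rho = monom (rho :: 'k mpoly) 6" by (rule rho_PA, rule wpoly_rho)
  have "(Res3 :: 'k mpoly) \<in> PA 8" unfolding substitute_invs_rho[symmetric] by (rule PA_substitute[OF r(1)]) simp
  moreover have "wpoly ones (Res3 :: 'k mpoly) = monom Res3 6"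
  proof (rule poly_eqI)
    fix n
    show "coeff (wpoly ones (Res3 :: 'k mpoly)) n = coeff (monom (Res3 :: 'k mpoly) 6) n"
      unfolding substitute_invs_rho[symmetric] wpoly_ones_substitute_invs[OF r(1)] r(2)
      by (simp add: substitute_simps)
  qed
  ultimately show ?thesis by (simp add: weighted_grading_iff)
qed

lemma A3_frac_embed: "frac_embed (poly_alg 8 :: ('k::field, 'k mpoly) module) to_fract to_K"
  by unfold_locales
    (auto simp: to_fract_eq_iff inj_on_def const_minus intro!: PA_add PA_mult bexI[OF _ PA_uminus])

lemma A3_graded:
  "graded_embed (poly_alg 8 :: ('k::field_char_0, 'k mpoly) module) to_fract to_K (weighted_grading ones) eps 6 Res3"
proof (rule graded_embed.intro[OF A3_frac_embed], rule graded_embed_axioms.intro)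
  interpret h: comm_ring_hom "eps :: 'k mpoly \<Rightarrow> _" by (rule eps_hom)
  fix x y :: "'k mpoly" and n c
  show "eps (x \<oplus>\<^bsub>poly_alg 8\<^esub> y) = eps x + eps y" "eps (x \<otimes>\<^bsub>poly_alg 8\<^esub> y) = eps x * eps y"
    "eps \<one>\<^bsub>poly_alg 8 :: ('k, 'k mpoly) module\<^esub> = 1" by (simp_all add: hom_distribs)
  show "to_fract x = poly (eps x) 1" by (simp add: poly_eps_1)
  show "x \<in> weighted_grading ones n \<longleftrightarrow> x \<in> PA 8 \<and> eps x = monom (to_fract x) n"
    by (simp add: weighted_grading_iff eps_eq_monom_iff)
  show "\<exists>y\<in>PA 8. eps y = monom (coeff (eps x) n) n" if "x \<in> PA 8"
    by (rule bexI[of _ "coeff (wpoly ones x) n"])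
      (simp_all add: coeff_eps eps_eq_monom_iff wpoly_coeff PA_coeff_wpoly that)
  show "c \<odot>\<^bsub>poly_alg 8\<^esub> x \<in> weighted_grading ones n" if "x \<in> weighted_grading ones n"
    using that by (auto simp: weighted_grading_iff wpoly_simps mult_monom)
  show "(Res3 :: 'k mpoly) \<in> weighted_grading ones 6" by (rule Res3_homogeneous)
  show "to_fract (Res3 :: 'k mpoly) \<noteq> 0" using Res3_nz by (simp add: to_fract_eq_0_iff)
qed simp

interpretation B: quotient_poly_alg 6 "relation_ideal :: 'k::field_char_0 mpoly set"
proof (rule quotient_poly_alg.intro)
  interpret R: cring "poly_alg 6 :: ('k, 'k mpoly) module" by (rule poly_alg_cring)
  show "ideal (relation_ideal :: 'k mpoly set) (poly_alg 6)"
    unfolding relation_ideal_def by (rule R.cgenideal_ideal) simp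
qed

text \<open>The ideal of the relation is the kernel of the evaluation at the invariants, so the coordinate ring
  of the relation is isomorphic to the subring of \<open>A\<^sub>3\<close> generated by them; in particular it is a domain.\<close>

lemma relation_ideal_iff: "p \<in> relation_ideal \<longleftrightarrow> p \<in> PA 6 \<and> substitute invs p = (0 :: 'k::field_char_0 mpoly)"
proof
  assume "p \<in> relation_ideal"
  then show "p \<in> PA 6 \<and> substitute invs p = 0"
    by (auto simp: relation_ideal_def cgenideal_def substitute_simps substitute_invs_relation)
next
  assume "p \<in> PA 6 \<and> substitute invs p = 0"
  then obtain X where "X \<in> PA 6" "p = X * relation_poly" using relations_generated by blast
  then show "p \<in> relation_ideal" by (auto simp: relation_ideal_def cgenideal_def)
qed

text \<open>The element of the invariant ring represented by a residue class.\<close>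

definition realize :: "'k::field_char_0 mpoly set \<Rightarrow> 'k mpoly" where
  "realize X = substitute invs (SOME p. p \<in> X)"

lemma realize_cls: "p \<in> PA 6 \<Longrightarrow> realize (B.cls p) = substitute invs p"
proof -
  assume p: "p \<in> PA 6"
  have "p \<in> B.cls p" unfolding B.cls_eq using B.I_zero by force
  then have "(SOME q. q \<in> B.cls p) \<in> B.cls p" by (rule someI)
  then obtain i where "i \<in> relation_ideal" "(SOME q. q \<in> B.cls p) = i + p" unfolding B.cls_eq by blast
  then show ?thesis by (simp add: realize_def substitute_simps relation_ideal_iff)
qed

lemma realize_inj: "p \<in> PA 6 \<Longrightarrow> q \<in> PA 6 \<Longrightarrow> substitute invs p = substitute invs q \<Longrightarrow> B.cls p = B.cls (q :: 'k::field_char_0 mpoly)"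
  unfolding B.cls_eq_iff relation_ideal_iff by (auto simp: substitute_simps)

lemma B_frac_embed: "frac_embed (B.S :: ('k::field_char_0, 'k mpoly set) module) (\<lambda>X. to_fract (realize X)) to_K"
proof -
  note [simp] = B.S_ops B.S_one B.S_zero realize_cls substitute_simps B.carrier_S PA_add PA_mult
  show ?thesis
  proof
    show "inj_on (\<lambda>X. to_fract (realize X)) (carrier (B.S :: ('k, 'k mpoly set) module))"
    proof (rule inj_onI)
      fix X Y :: "'k mpoly set" assume "X \<in> carrier B.S" "Y \<in> carrier B.S" and e: "to_fract (realize X) = to_fract (realize Y)"
      then obtain p q where pq: "p \<in> PA 6" "X = B.cls p" "q \<in> PA 6" "Y = B.cls q" by auto
      then have "substitute invs p = substitute invs q" using e by simp
      then show "X = Y" using realize_inj pq by blast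
    qed
    fix a assume "a \<in> carrier (B.S :: ('k, 'k mpoly set) module)"
    then obtain p where "p \<in> PA 6" "a = B.cls p" by auto
    then show "\<exists>b\<in>carrier B.S. to_fract (realize b) = - to_fract (realize a)"
      by (intro bexI[of _ "B.cls (- p)"]) (auto simp: PA_uminus substitute_peval peval_uminus[OF const_hom])
  qed (auto simp: const_minus)
qed

abbreviation B_gr :: "nat \<Rightarrow> 'k::field mpoly set set" where "B_gr \<equiv> quot_grading weights relation_ideal"

lemma B_gr_eq: "B_gr n = B.cls ` weighted_grading weights n"
  by (simp add: quot_grading_def)

text \<open>The coordinate ring of the relation as a graded subring of the function field of \<open>A\<^sub>3\<close>, with \<open>\<rho>\<close> as
  the distinguished element.\<close>

lemma B_graded:
  "graded_embed (B.S :: ('k::field_char_0, 'k mpoly set) module) (\<lambda>X. to_fract (realize X)) to_K B_gr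
    (\<lambda>X. eps (realize X)) 6 (B.cls rho)"
proof (rule graded_embed.intro[OF B_frac_embed], rule graded_embed_axioms.intro)
  note [simp] = B.S_ops B.S_one B.S_zero realize_cls substitute_simps B.carrier_S PA_add PA_mult
  fix x y :: "'k mpoly set" and n c
  show "eps (realize \<one>\<^bsub>B.S :: ('k, 'k mpoly set) module\<^esub>) = 1" by (simp add: eps_simps)
  show "x \<in> B_gr n \<longleftrightarrow> x \<in> carrier B.S \<and> eps (realize x) = monom (to_fract (realize x)) n"
  proof
    assume "x \<in> B_gr n"
    then obtain p where p: "p \<in> PA 6" "wpoly weights p = monom p n" "x = B.cls p" by (auto simp: B_gr_eq weighted_grading_iff)
    have "wpoly ones (substitute invs p) = monom (substitute invs p) n"
      by (rule poly_eqI) (simp add: wpoly_ones_substitute_invs p)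
    then show "x \<in> carrier B.S \<and> eps (realize x) = monom (to_fract (realize x)) n" using p by (simp add: eps_eq_monom_iff)
  next
    assume x: "x \<in> carrier B.S \<and> eps (realize x) = monom (to_fract (realize x)) n"
    then obtain p where p: "p \<in> PA 6" "x = B.cls p" by auto
    then have "wpoly ones (substitute invs p) = monom (substitute invs p) n" using x by (simp add: eps_eq_monom_iff)
    then have "substitute invs (coeff (wpoly weights p) n) = substitute invs p"
      using wpoly_ones_substitute_invs[OF p(1), of n] by simp
    then have "x = B.cls (coeff (wpoly weights p) n)"
      using realize_inj p PA_coeff_wpoly[OF p(1)] by metis
    then show "x \<in> B_gr n" using coeff_wpoly_in_grading[of p weights n] p(1) by (auto simp: B_gr_eq)
  qed
  show "eps (realize (x \<oplus>\<^bsub>B.S\<^esub> y)) = eps (realize x) + eps (realize y)"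
    "eps (realize (x \<otimes>\<^bsub>B.S\<^esub> y)) = eps (realize x) * eps (realize y)"
    if xy: "x \<in> carrier B.S" "y \<in> carrier B.S"
  proof -
    obtain p q where "p \<in> PA 6" "x = B.cls p" "q \<in> PA 6" "y = B.cls q" using xy by auto
    then show "eps (realize (x \<oplus>\<^bsub>B.S\<^esub> y)) = eps (realize x) + eps (realize y)"
      "eps (realize (x \<otimes>\<^bsub>B.S\<^esub> y)) = eps (realize x) * eps (realize y)"
      by (simp_all add: eps_simps)
  qed
  show "\<exists>y\<in>carrier B.S. eps (realize y) = monom (coeff (eps (realize x)) n) n" if x: "x \<in> carrier B.S"
  proof -
    obtain p where p: "p \<in> PA 6" "x = B.cls p" using x by auto
    let ?q = "coeff (wpoly weights p) n"
    have q: "?q \<in> PA 6" by (rule PA_coeff_wpoly[OF p(1)])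
    have "eps (substitute invs ?q) = monom (coeff (eps (substitute invs p)) n) n"
      unfolding coeff_eps wpoly_ones_substitute_invs[OF p(1), symmetric] eps_eq_monom_iff by (rule wpoly_coeff)
    then show ?thesis using p q by (intro bexI[of _ "B.cls ?q"]) auto
  qed
  show "c \<odot>\<^bsub>B.S\<^esub> x \<in> B_gr n" if "x \<in> B_gr n"
    using that by (auto simp: B_gr_eq weighted_grading_iff wpoly_simps mult_monom intro!: imageI)
  show "B.cls rho \<in> B_gr 6" using rho_homogeneous by (auto simp: B_gr_eq)
  have "rho \<in> (PA 6 :: 'k mpoly set)" by (rule rho_PA)
  then show "to_fract (realize (B.cls rho)) \<noteq> (0 :: 'k mpoly fract)"
    using Res3_nz[where ?'k = 'k] by (simp add: substitute_invs_rho to_fract_eq_0_iff)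
qed (auto simp: poly_eps_1 eps_simps)

section \<open>Invariant functions and the isomorphism\<close>

text \<open>The prefix \<open>A\<close> refers to \<open>P\<^sub>3\<close> with the resultant, \<open>Bg\<close> to the relation locus with \<open>\<rho>\<close>.  Both
  live in the function field of \<open>A\<^sub>3\<close>, and \<open>\<rho>\<close> is mapped to the resultant, so that the affine coordinate rings
  \<open>A.W\<close> and \<open>Bg.W\<close> can be compared as sets.\<close>

interpretation A: graded_embed "poly_alg 8 :: ('k::field_char_0, 'k mpoly) module" to_fract to_K "weighted_grading ones" eps 6 Res3
  by (rule A3_graded)

interpretation Bg: graded_embed "B.S :: ('k::field_char_0, 'k mpoly set) module" "\<lambda>X. to_fract (realize X)" to_K B_gr
    "\<lambda>X. eps (realize X)" 6 "B.cls rho"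
  by (rule B_graded)

lemma realize_homogeneous:
  assumes "X \<in> B_gr n" shows "realize X \<in> weighted_grading ones n"
proof -
  obtain p where p: "p \<in> PA 6" "wpoly weights p = monom p n" "X = B.cls p"
    using assms by (auto simp: B_gr_eq weighted_grading_iff)
  have "wpoly ones (substitute invs p) = monom (substitute invs p) n"
    by (rule poly_eqI) (simp add: wpoly_ones_substitute_invs p substitute_simps)
  moreover have "substitute invs p \<in> PA 8" by (rule PA_substitute[OF p(1)]) simp
  ultimately show ?thesis using p by (simp add: realize_cls weighted_grading_iff)
qed

lemma realize_rho: "realize (B.cls rho) = Res3"
  by (simp add: realize_cls rho_PA substitute_invs_rho)

lemma Bg_W_iff: "x \<in> Bg.W \<longleftrightarrow> (\<exists>N. \<exists>p\<in>weighted_grading weights (6 * N). x = to_fract (substitute invs p) / to_fract Res3 ^ N)"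
proof -
  have G: "Bg.G n = (\<lambda>p. to_fract (substitute invs p)) ` weighted_grading weights n" for n
    unfolding Bg.G_def B_gr_eq by (auto simp: image_image realize_cls weighted_grading_iff intro!: image_cong)
  show ?thesis unfolding Bg.W_def realize_rho G by blast
qed

lemma A_W_iff: "x \<in> A.W \<longleftrightarrow> (\<exists>N. \<exists>F\<in>weighted_grading ones (6 * N). x = to_fract F / to_fract Res3 ^ N)"
  unfolding A.W_def A.G_def by blast

lemma Bg_W_subset: "Bg.W \<subseteq> A.W"
proof
  fix x assume "x \<in> Bg.W"
  then obtain X N where "X \<in> B_gr (6 * N)" "x = to_fract (realize X) / to_fract Res3 ^ N"
    unfolding Bg.W_def Bg.G_def realize_rho by blast
  then show "x \<in> A.W" unfolding A_W_iff using realize_homogeneous by blast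
qed

subsection \<open>The space of rational maps\<close>

lemma P3_eq: "P3 = A.proj.X"
  by (simp add: P3_def weighted_proj_def A.Proj_eq)

lemma Rat3_eq: "Rat3 = open_subspace A.proj.X A.U0"
  by (simp add: Rat3_def P3_eq A.proj.points_X A.U0_def)

lemma points_Rat3: "points Rat3 = A.U0"
  unfolding Rat3_eq using A.proj.points_X by (auto simp: open_subspace_def A.U0_def)

lemma global_sections_Rat3: "global_sections Rat3 = sheaf A.proj.X A.U0"
  unfolding points_Rat3 by (simp add: Rat3_eq open_subspace_def)

lemma carrier_sections_Rat3: "carrier (global_sections Rat3) = A.proj.sec A.U0 ` A.W"
  unfolding global_sections_Rat3 A.proj.sections_eq[OF A.basic.U0_open] A.regular_on_basic_open ..

subsection \<open>The product with \<open>SL\<^sub>2\<close>\<close>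

lemma SL2_generator_PA: "var 8 * var 11 - var 9 * var 10 - 1 \<in> PA 12"
  by (intro PA_diff PA_mult PA_one) simp_all

interpretation C: quotient_poly_alg 12 "SL2_ideal :: 'k::field_char_0 mpoly set"
proof (rule quotient_poly_alg.intro)
  interpret R: cring "poly_alg 12 :: ('k, 'k mpoly) module" by (rule poly_alg_cring)
  show "ideal (SL2_ideal :: 'k mpoly set) (poly_alg 12)"
    unfolding SL2_ideal_def by (rule R.cgenideal_ideal) (rule SL2_generator_PA)
qed

lemma SL2_ideal_iff: "p \<in> SL2_ideal \<longleftrightarrow> (\<exists>g\<in>PA 12. p = g * (var 8 * var 11 - var 9 * var 10 - 1))"
  by (auto simp: SL2_ideal_def cgenideal_def)

lemma SL2_A3_eq: "SL2_A3 = C.S"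
  by (simp add: SL2_A3_def)

interpretation SC: cring "C.S :: ('k::field_char_0, 'k mpoly set) module"
  by (rule C.S_cring)

lemma length_SL2_weights [simp]: "length SL2_weights = 12"
  by (simp add: SL2_weights_def)

lemma SL2_weights_nth: "x < 8 \<Longrightarrow> SL2_weights ! x = 1" "SL2_weights ! 8 = 0" "SL2_weights ! 9 = 0" "SL2_weights ! 10 = 0" "SL2_weights ! 11 = 0"
  by (simp_all add: SL2_weights_def nth_append)

abbreviation "wS \<equiv> wpoly SL2_weights"

lemma SL2_grading_eq: "SL2_grading n = C.cls ` weighted_grading SL2_weights n"
  by (simp add: SL2_grading_def quot_grading_def)

lemma SL2_grading_carrier: "X \<in> SL2_grading n \<Longrightarrow> X \<in> carrier C.S"
  by (auto simp: SL2_grading_eq C.carrier_S weighted_grading_iff)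

lemma weighted_grading_mult:
  "p \<in> weighted_grading ws m \<Longrightarrow> q \<in> weighted_grading ws n \<Longrightarrow> p * q \<in> weighted_grading ws (m + n)"
  by (auto simp: weighted_grading_iff wpoly_simps mult_monom)

lemma SL2_grading_mult: "X \<in> SL2_grading m \<Longrightarrow> Y \<in> SL2_grading n \<Longrightarrow> X \<otimes>\<^bsub>C.S\<^esub> Y \<in> SL2_grading (m + n)"
proof -
  assume "X \<in> SL2_grading m" "Y \<in> SL2_grading n"
  then obtain p q where *: "p \<in> weighted_grading SL2_weights m" "X = C.cls p" "q \<in> weighted_grading SL2_weights n" "Y = C.cls q"
    unfolding SL2_grading_eq by blast
  then have "p \<in> PA 12" "q \<in> PA 12" by (simp_all add: weighted_grading_iff)
  then show ?thesis using * weighted_grading_mult[OF *(1,3)] by (simp add: C.S_ops SL2_grading_eq)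
qed

lemma points_SL2_P3:
  "points SL2_P3 = {Q. primeideal Q C.S \<and> Idl\<^bsub>C.S\<^esub> (Q \<inter> (\<Union>n. SL2_grading n)) = Q \<and> \<not> (\<Union>n\<in>{1..}. SL2_grading n) \<subseteq> Q}"
  (is "_ = ?P")
proof -
  have "topspace (zariski C.S ?P) = ?P" by (rule topspace_zariski[OF C.S_cring]) simp
  then show ?thesis unfolding SL2_P3_def Proj_def frac_space_def SL2_A3_eq by simp
qed

text \<open>An ideal generated by homogeneous elements contains the components of its elements.  The equation
  \<open>det = 1\<close> has weight zero, so components are well-defined modulo it.\<close>

lemma homogeneous_ideal_component:
  fixes h :: "'k::field_char_0 mpoly"
  assumes Q: "Q \<in> points SL2_P3" and h: "h \<in> PA 12" "C.cls h \<in> Q"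
  shows "C.cls (coeff (wS h) n) \<in> Q"
proof -
  have pQ: "primeideal Q C.S" and hom: "Idl\<^bsub>C.S\<^esub> (Q \<inter> (\<Union>n. SL2_grading n)) = Q"
    using Q by (simp_all add: points_SL2_P3)
  interpret Q: primeideal Q C.S by (rule pQ)
  define J where "J = {X. \<exists>h\<in>PA 12. X = C.cls h \<and> (\<forall>n. C.cls (coeff (wS h) n) \<in> Q)}"
  have zero: "C.cls 0 \<in> Q" using Q.zero_closed by (simp only: C.S_zero)
  have "ideal J C.S"
  proof (rule SC.ideal_if_closed)
    show "J \<subseteq> carrier C.S" unfolding J_def C.carrier_S by blast
    show "\<zero>\<^bsub>C.S\<^esub> \<in> J" unfolding J_def C.S_zero using zero
      by (auto intro!: bexI[of _ 0])
    fix X Y :: "'k mpoly set" assume "X \<in> J"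
    then obtain x where x: "x \<in> PA 12" "X = C.cls x" "\<And>n. C.cls (coeff (wS x) n) \<in> Q" unfolding J_def by blast
    note px = PA_coeff_wpoly[OF x(1), of SL2_weights]
    {
      assume "Y \<in> J"
      then obtain y where y: "y \<in> PA 12" "Y = C.cls y" "\<And>n. C.cls (coeff (wS y) n) \<in> Q" unfolding J_def by blast
      have "C.cls (coeff (wS (x + y)) n) \<in> Q" for n
        using Q.a_closed[OF x(3)[of n] y(3)[of n]] px PA_coeff_wpoly[OF y(1)] by (simp add: C.S_ops wpoly_simps)
      then show "X \<oplus>\<^bsub>C.S\<^esub> Y \<in> J" unfolding J_def
        using x(1,2) y(1,2) by (auto simp: C.S_ops intro!: bexI[of _ "x + y"] PA_add)
    }
    {
      assume "Y \<in> carrier C.S"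
      then obtain y where y: "y \<in> PA 12" "Y = C.cls y" unfolding C.carrier_S by blast
      note py = PA_coeff_wpoly[OF y(1), of SL2_weights]
      have "C.cls (\<Sum>i\<le>n. coeff (wS x) i * coeff (wS y) (n - i)) \<in> Q" for n
      proof (rule C.cls_sum_mem[OF Q.is_ideal], intro conjI)
        fix i
        show "coeff (wS x) i * coeff (wS y) (n - i) \<in> PA 12" using px py by blast
        have "C.cls (coeff (wS x) i) \<otimes>\<^bsub>C.S\<^esub> C.cls (coeff (wS y) (n - i)) \<in> Q"
          by (rule Q.I_r_closed[OF x(3)]) (use py C.carrier_S in blast)
        then show "C.cls (coeff (wS x) i * coeff (wS y) (n - i)) \<in> Q" using px py by (simp add: C.S_ops)
      qed
      then have "C.cls (coeff (wS (x * y)) n) \<in> Q" for n by (simp add: wpoly_simps coeff_mult)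
      then show "X \<otimes>\<^bsub>C.S\<^esub> Y \<in> J" unfolding J_def
        using x(1,2) y(1,2) by (auto simp: C.S_ops intro!: bexI[of _ "x * y"] PA_mult)
    }
  qed
  moreover have "Q \<inter> (\<Union>n. SL2_grading n) \<subseteq> J"
  proof
    fix X assume "X \<in> Q \<inter> (\<Union>n. SL2_grading n)"
    then obtain m x where x: "x \<in> PA 12" "wS x = monom x m" "X = C.cls x" "X \<in> Q"
      by (auto simp: SL2_grading_eq weighted_grading_iff)
    have "C.cls (coeff (wS x) n) \<in> Q" for n
      using x(2-4) zero by (cases "n = m") auto
    then show "X \<in> J" unfolding J_def using x by blast
  qed
  ultimately have "Q \<subseteq> J" using SC.genideal_minimal[of J "Q \<inter> (\<Union>n. SL2_grading n)"] hom by simp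
  then obtain h' where h': "h' \<in> PA 12" "C.cls h = C.cls h'" "C.cls (coeff (wS h') n) \<in> Q" using h(2) unfolding J_def by blast
  obtain g where g: "g \<in> PA 12" "h - h' = g * (var 8 * var 11 - var 9 * var 10 - 1)"
    using h'(2) unfolding C.cls_eq_iff SL2_ideal_iff by blast
  have "wS (h - h') = smult (var 8 * var 11 - var 9 * var 10 - 1) (wS g)"
    unfolding g(2) by (simp add: wpoly_simps SL2_weights_nth mult_monom monom_simps monom_0 flip: one_pCons)
      (simp add: algebra_simps smult_diff_left smult_add_left)
  then have "coeff (wS h) n - coeff (wS h') n = coeff (wS g) n * (var 8 * var 11 - var 9 * var 10 - 1)"
    by (simp add: wpoly_simps poly_eq_iff algebra_simps)
  then have "coeff (wS h) n - coeff (wS h') n \<in> SL2_ideal"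
    unfolding SL2_ideal_iff using PA_coeff_wpoly[OF g(1)] by blast
  then have "C.cls (coeff (wS h) n) = C.cls (coeff (wS h') n)" unfolding C.cls_eq_iff .
  then show ?thesis using h'(3) by simp
qed

text \<open>The action and the projection are treated simultaneously, as substitutions that are linear in the
  coefficients of the forms.\<close>

definition sub_hom :: "(nat \<Rightarrow> 'k::field_char_0 mpoly) \<Rightarrow> 'k mpoly \<Rightarrow> 'k mpoly set" where
  "sub_hom \<tau> p = C.cls (substitute \<tau> p)"

lemma act_hom_sub: "act_hom = sub_hom act_sub" and pr_hom_sub: "pr_hom = sub_hom var"
  by (simp_all add: fun_eq_iff sub_hom_def act_hom_eq pr_hom_def)

definition linear_sub :: "(nat \<Rightarrow> 'k::field mpoly) \<Rightarrow> bool" where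
  "linear_sub \<tau> \<longleftrightarrow> (\<forall>x<8. \<tau> x \<in> PA 12 \<and> wS (\<tau> x) = monom (\<tau> x) 1)"

lemma linear_sub_var: "linear_sub var"
  by (simp add: linear_sub_def SL2_weights_nth)

lemma linear_sub_act: "linear_sub (act_sub :: nat \<Rightarrow> 'k::field mpoly)"
proof -
  have c: "coeff (pCons u f) 2 = coeff f 1" "coeff (pCons u f) 3 = coeff f 2" for u :: "'k mpoly" and f
    by (simp_all add: eval_nat_numeral)
  have "(coeff (cubic_comp F) m :: 'k mpoly) \<in> PA 12 \<and> wS (coeff (cubic_comp F) m) = monom (coeff (cubic_comp F) m) 1"
    if "m < 4" "F = F0 \<or> F = F1" for m F
  proof -
    have "m = 0 \<or> m = 1 \<or> m = 2 \<or> m = 3" using that by auto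
    with that(2) show ?thesis
      by (elim disjE)
        (simp_all add: cubic_comp_eq c coeff_F01 wpoly_simps SL2_weights_nth mult_monom monom_simps PA_add PA_mult PA_power)
  qed
  note F = this
  have 1: "(act_sub m :: 'k mpoly) \<in> PA 12 \<and> wS (act_sub m) = monom (act_sub m :: 'k mpoly) 1"
    "(act_sub (4 + m) :: 'k mpoly) \<in> PA 12 \<and> wS (act_sub (4 + m)) = monom (act_sub (4 + m) :: 'k mpoly) 1" if "m < 4" for m
    using that F[of m F0] F[of m F1] by (auto simp: act_sub_def conj_F0_def conj_F1_def wpoly_simps SL2_weights_nth mult_monom monom_simps intro!: PA_diff PA_mult)
  show ?thesis unfolding linear_sub_def
  proof (intro allI impI)
    fix x :: nat assume "x < 8"
    then show "(act_sub x :: 'k mpoly) \<in> PA 12 \<and> wS (act_sub x) = monom (act_sub x :: 'k mpoly) 1"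
      using 1(1)[of x] 1(2)[of "x - 4"] by (cases "x < 4") auto
  qed
qed

context
  fixes \<tau> :: "nat \<Rightarrow> 'k::field_char_0 mpoly"
  assumes \<tau>: "linear_sub \<tau>"
begin

lemma sub_PA: "p \<in> PA 8 \<Longrightarrow> substitute \<tau> p \<in> PA 12"
  using \<tau> by (auto simp: linear_sub_def intro: PA_substitute)

lemma sub_hom_ops:
  "p \<in> PA 8 \<Longrightarrow> q \<in> PA 8 \<Longrightarrow> sub_hom \<tau> p \<oplus>\<^bsub>C.S\<^esub> sub_hom \<tau> q = sub_hom \<tau> (p + q)"
  "p \<in> PA 8 \<Longrightarrow> q \<in> PA 8 \<Longrightarrow> sub_hom \<tau> p \<otimes>\<^bsub>C.S\<^esub> sub_hom \<tau> q = sub_hom \<tau> (p * q)"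
  "sub_hom \<tau> 0 = \<zero>\<^bsub>C.S\<^esub>" "sub_hom \<tau> 1 = \<one>\<^bsub>C.S\<^esub>" "p \<in> PA 8 \<Longrightarrow> sub_hom \<tau> p \<in> carrier C.S"
  by (auto simp: sub_hom_def C.S_ops sub_PA substitute_simps C.S_zero C.S_one C.carrier_S)

lemma coeff_wS_sub: "p \<in> PA 8 \<Longrightarrow> coeff (wS (substitute \<tau> p)) n = substitute \<tau> (coeff (wpoly ones p) n)"
  by (rule coeff_wpoly_substitute) (use \<tau> in \<open>auto simp: linear_sub_def\<close>)

lemma sub_hom_grading: "p \<in> weighted_grading ones n \<Longrightarrow> sub_hom \<tau> p \<in> SL2_grading n"
proof -
  assume p: "p \<in> weighted_grading ones n"
  then have "wS (substitute \<tau> p) = monom (substitute \<tau> p) n"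
    by (intro poly_eqI) (simp add: coeff_wS_sub weighted_grading_iff substitute_simps)
  then show ?thesis using p sub_PA by (auto simp: sub_hom_def SL2_grading_eq weighted_grading_iff)
qed

text \<open>The contraction of a homogeneous prime along a graded homomorphism is again determined by its
  homogeneous elements.\<close>

lemma preimage_in_Rat3:
  assumes Q: "Q \<in> points SL2_P3" and Res: "sub_hom \<tau> Res3 \<notin> Q"
  shows "proj_map (poly_alg 8) (sub_hom \<tau>) Q \<in> A.U0"
proof -
  have pQ: "primeideal Q C.S" using Q by (simp add: points_SL2_P3)
  interpret Q: primeideal Q C.S by (rule pQ)
  define H where "H = {(n, c). \<exists>y\<in>weighted_grading ones n. c = to_fract y \<and> sub_hom \<tau> y \<in> Q}"
  have PA: "y \<in> PA 8" if "y \<in> weighted_grading ones n" for y :: "'k mpoly" and n using that by (simp add: weighted_grading_iff)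
  have H: "(n, to_fract y) \<in> H \<longleftrightarrow> sub_hom \<tau> y \<in> Q" if "y \<in> weighted_grading ones n" for n y
    using that unfolding H_def by auto
  have gi: "A.graded_ideal H"
    unfolding A.graded_ideal_def A.G_def
  proof (intro conjI allI impI; (elim conjE)?)
    fix n c assume "(n, c) \<in> H" then show "c \<in> to_fract ` weighted_grading ones n" unfolding H_def by blast
  next
    fix n show "(n, 0) \<in> H"
      using H[of 0 n] A.gr_closed(1)[of n] sub_hom_ops(3) Q.zero_closed by simp
  next
    fix n :: nat and c d :: "'k mpoly fract" assume "(n, c) \<in> H" "(n, d) \<in> H"
    then obtain x y where xy: "x \<in> weighted_grading ones n" "c = to_fract x" "sub_hom \<tau> x \<in> Q"
      "y \<in> weighted_grading ones n" "d = to_fract y" "sub_hom \<tau> y \<in> Q" unfolding H_def by blast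
    have "x + y \<in> weighted_grading ones n" using A.gr_closed(3)[OF xy(1,4)] by simp
    moreover have "sub_hom \<tau> (x + y) \<in> Q"
      using Q.a_closed[OF xy(3,6)] sub_hom_ops(1) PA xy by simp
    ultimately have "(n, to_fract (x + y)) \<in> H" using H by blast
    then show "(n, c + d) \<in> H" using xy by simp
  next
    fix m n :: nat and c d :: "'k mpoly fract" assume "(m, c) \<in> H" "d \<in> to_fract ` weighted_grading ones n"
    then obtain x y where xy: "x \<in> weighted_grading ones m" "c = to_fract x" "sub_hom \<tau> x \<in> Q"
      "y \<in> weighted_grading ones n" "d = to_fract y" unfolding H_def by blast
    have "x * y \<in> weighted_grading ones (m + n)" by (rule weighted_grading_mult[OF xy(1,4)])
    moreover have "sub_hom \<tau> (x * y) \<in> Q"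
      using Q.I_r_closed[OF xy(3)] sub_hom_ops(2,5) PA xy by metis
    ultimately have "(m + n, to_fract (x * y)) \<in> H" using H by blast
    then show "(m + n, c * d) \<in> H" using xy by simp
  qed
  have "A.graded_prime H"
    unfolding A.graded_prime_def
  proof (intro conjI allI impI gi; (elim conjE)?)
    have "\<one>\<^bsub>C.S\<^esub> \<notin> Q" using Q.I_notcarr Q.one_imp_carrier by metis
    then show "(0, 1) \<notin> H" using H[OF A.gr_closed(2)] sub_hom_ops(4) by simp
  next
    fix m n :: nat and c d :: "'k mpoly fract" assume cd: "c \<in> A.G m" "d \<in> A.G n" "(m + n, c * d) \<in> H"
    then obtain x y where xy: "x \<in> weighted_grading ones m" "c = to_fract x" "y \<in> weighted_grading ones n" "d = to_fract y"
      unfolding A.G_def by blast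
    have "(m + n, to_fract (x * y)) \<in> H" using cd(3) xy by simp
    then have "sub_hom \<tau> x \<otimes>\<^bsub>C.S\<^esub> sub_hom \<tau> y \<in> Q"
      using H[OF weighted_grading_mult[OF xy(1,3)]] sub_hom_ops(2) PA xy by simp
    then have "sub_hom \<tau> x \<in> Q \<or> sub_hom \<tau> y \<in> Q" using Q.I_prime sub_hom_ops(5) PA xy by blast
    then show "(m, c) \<in> H \<or> (n, d) \<in> H" using H xy by blast
  qed
  moreover have "(6, to_fract Res3) \<notin> H" using H[OF Res3_homogeneous] Res by simp
  moreover have "proj_map (poly_alg 8) (sub_hom \<tau>) Q = A.idl H"
  proof -
    have "sub_hom \<tau> x \<in> Q \<longleftrightarrow> (\<forall>n. sub_hom \<tau> (coeff (wpoly ones x) n) \<in> Q)" if x: "x \<in> PA 8" for x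
    proof
      assume "sub_hom \<tau> x \<in> Q"
      then show "\<forall>n. sub_hom \<tau> (coeff (wpoly ones x) n) \<in> Q"
        using homogeneous_ideal_component[OF Q sub_PA[OF x]] by (simp add: sub_hom_def coeff_wS_sub[OF x])
    next
      assume *: "\<forall>n. sub_hom \<tau> (coeff (wpoly ones x) n) \<in> Q"
      interpret s: comm_ring_hom "substitute \<tau>" by (rule substitute_hom)
      have "C.cls (\<Sum>n\<le>degree (wpoly ones x). substitute \<tau> (coeff (wpoly ones x) n)) \<in> Q"
        by (rule C.cls_sum_mem[OF Q.is_ideal]) (use * sub_PA PA_coeff_wpoly[OF x] in \<open>auto simp: sub_hom_def\<close>)
      also have "(\<Sum>n\<le>degree (wpoly ones x). substitute \<tau> (coeff (wpoly ones x) n)) = substitute \<tau> x"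
        using sum_coeff_wpoly[of ones x] by (simp flip: s.hom_sum)
      finally show "sub_hom \<tau> x \<in> Q" by (simp add: sub_hom_def)
    qed
    moreover have "(n, coeff (eps x) n) \<in> H \<longleftrightarrow> sub_hom \<tau> (coeff (wpoly ones x) n) \<in> Q" if "x \<in> PA 8" for x n
      unfolding coeff_eps by (rule H) (use that in \<open>simp add: coeff_wpoly_in_grading\<close>)
    ultimately show ?thesis unfolding proj_map_def A.idl_def by auto
  qed
  ultimately show ?thesis unfolding A.U0_iff by blast
qed

end

lemma fraction_eqI:
  assumes Q: "primeideal Q C.S" and as: "(a, s) \<in> homogeneous_fracs SL2_grading Q" and bt: "(b, t) \<in> homogeneous_fracs SL2_grading Q"
    and eq: "a \<otimes>\<^bsub>C.S\<^esub> t = b \<otimes>\<^bsub>C.S\<^esub> s"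
  shows "fraction C.S (homogeneous_fracs SL2_grading Q) a s = fraction C.S (homogeneous_fracs SL2_grading Q) b t"
proof -
  interpret Q: primeideal Q C.S by (rule Q)
  let ?D = "homogeneous_fracs SL2_grading Q"
  have carr: "x \<in> carrier C.S \<and> y \<in> carrier C.S" if "(x, y) \<in> ?D" for x y
    using that SL2_grading_carrier by (auto simp: homogeneous_fracs_def)
  have step: "\<exists>u\<in>snd ` ?D. u \<otimes>\<^bsub>C.S\<^esub> (v \<otimes>\<^bsub>C.S\<^esub> b) = u \<otimes>\<^bsub>C.S\<^esub> (t \<otimes>\<^bsub>C.S\<^esub> c)"
    if as: "(a, s) \<in> ?D" and bt: "(b, t) \<in> ?D" and eq: "a \<otimes>\<^bsub>C.S\<^esub> t = b \<otimes>\<^bsub>C.S\<^esub> s" and cv: "(c, v) \<in> ?D"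
      and u: "u \<in> snd ` ?D" "u \<otimes>\<^bsub>C.S\<^esub> (v \<otimes>\<^bsub>C.S\<^esub> a) = u \<otimes>\<^bsub>C.S\<^esub> (s \<otimes>\<^bsub>C.S\<^esub> c)" for a s b t c v u
  proof -
    obtain m where um: "u \<in> SL2_grading m" "u \<notin> Q" using u(1) by (auto simp: homogeneous_fracs_def)
    obtain n where sn: "s \<in> SL2_grading n" "s \<notin> Q" using as by (auto simp: homogeneous_fracs_def)
    note C1 = carr[OF as] carr[OF bt] carr[OF cv] SL2_grading_carrier[OF um(1)]
    have "u \<otimes>\<^bsub>C.S\<^esub> s \<notin> Q" using Q.I_prime[of u s] C1 um sn by blast
    then have "(u \<otimes>\<^bsub>C.S\<^esub> s, u \<otimes>\<^bsub>C.S\<^esub> s) \<in> ?D"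
      using SL2_grading_mult[OF um(1) sn(1)] unfolding homogeneous_fracs_def by blast
    then have "u \<otimes>\<^bsub>C.S\<^esub> s \<in> snd ` ?D" by force
    moreover have "(u \<otimes>\<^bsub>C.S\<^esub> s) \<otimes>\<^bsub>C.S\<^esub> (v \<otimes>\<^bsub>C.S\<^esub> b) = (u \<otimes>\<^bsub>C.S\<^esub> s) \<otimes>\<^bsub>C.S\<^esub> (t \<otimes>\<^bsub>C.S\<^esub> c)"
    proof -
      have "(u \<otimes>\<^bsub>C.S\<^esub> s) \<otimes>\<^bsub>C.S\<^esub> (v \<otimes>\<^bsub>C.S\<^esub> b) = (u \<otimes>\<^bsub>C.S\<^esub> v) \<otimes>\<^bsub>C.S\<^esub> (b \<otimes>\<^bsub>C.S\<^esub> s)"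
        using C1 by (simp add: SC.m_ac)
      also have "\<dots> = (u \<otimes>\<^bsub>C.S\<^esub> (v \<otimes>\<^bsub>C.S\<^esub> a)) \<otimes>\<^bsub>C.S\<^esub> t"
        using C1 by (simp add: eq[symmetric] SC.m_ac)
      also have "\<dots> = (u \<otimes>\<^bsub>C.S\<^esub> s) \<otimes>\<^bsub>C.S\<^esub> (t \<otimes>\<^bsub>C.S\<^esub> c)"
        unfolding u(2) using C1 by (simp add: SC.m_ac)
      finally show ?thesis .
    qed
    ultimately show ?thesis by blast
  qed
  show ?thesis
    unfolding fraction_def using step[OF as bt eq] step[OF bt as eq[symmetric]] by blast
qed

text \<open>The pullback of the section \<open>F / Res\<^sup>N\<close> is the fraction of the images: for any other pair \<open>(b, t)\<close> with the
  same value, \<open>b Res\<^sup>N = F t\<close> holds in \<open>A\<^sub>3\<close> and is preserved by the substitution.\<close>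

lemma pullback_eq:
  fixes \<tau> :: "nat \<Rightarrow> 'k::field_char_0 mpoly"
  assumes \<tau>: "linear_sub \<tau>" and Q: "Q \<in> points SL2_P3" and Res: "sub_hom \<tau> Res3 \<notin> Q"
    and F: "F \<in> weighted_grading ones (6 * N)"
  shows "(sub_hom \<tau> F, sub_hom \<tau> (Res3 ^ N)) \<in> homogeneous_fracs SL2_grading Q"
    and "proj_pullback (poly_alg 8) C.S SL2_grading (sub_hom \<tau>) (A.proj.sec A.U0 (to_fract F / to_fract Res3 ^ N)) Q
      = fraction C.S (homogeneous_fracs SL2_grading Q) (sub_hom \<tau> F) (sub_hom \<tau> (Res3 ^ N))"
proof -
  let ?D = "homogeneous_fracs SL2_grading Q" and ?x = "to_fract F / to_fract Res3 ^ N"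
  let ?p = "proj_map (poly_alg 8) (sub_hom \<tau>) Q"
  have pQ: "primeideal Q C.S" using Q by (simp add: points_SL2_P3)
  interpret Q: primeideal Q C.S by (rule pQ)
  have pU: "?p \<in> A.U0" by (rule preimage_in_Rat3[OF \<tau> Q Res])
  have RP: "Res3 ^ N \<in> (PA 8 :: 'k mpoly set)" and R1: "Res3 \<in> (PA 8 :: 'k mpoly set)"
    using Res3_homogeneous[where ?'k = 'k] by (auto simp: weighted_grading_iff)
  have RN: "Res3 ^ N \<in> (weighted_grading ones (6 * N) :: 'k mpoly set)"
    using Res3_homogeneous[where ?'k = 'k] by (auto simp: weighted_grading_iff wpoly_simps monom_simps)
  have "sub_hom \<tau> (Res3 ^ N) \<notin> Q"
  proof (induction N)
    case 0
    have "\<one>\<^bsub>C.S\<^esub> \<notin> Q" using Q.I_notcarr Q.one_imp_carrier by metis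
    then show ?case using sub_hom_ops(4)[OF \<tau>] by simp
  next
    case (Suc N)
    have "Res3 ^ N \<in> (PA 8 :: 'k mpoly set)" using R1 by blast
    then show ?case
      using Suc Res Q.I_prime[of "sub_hom \<tau> Res3" "sub_hom \<tau> (Res3 ^ N)"] sub_hom_ops(2,5)[OF \<tau>] R1 by auto
  qed
  then show FR: "(sub_hom \<tau> F, sub_hom \<tau> (Res3 ^ N)) \<in> ?D"
    using sub_hom_grading[OF \<tau> F] sub_hom_grading[OF \<tau> RN] unfolding homogeneous_fracs_def by blast
  then have notin: "Res3 ^ N \<notin> ?p" by (auto simp: proj_map_def homogeneous_fracs_def)
  have PA: "y \<in> PA 8" if "y \<in> weighted_grading ones n" for y :: "'k mpoly" and n using that by (simp add: weighted_grading_iff)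
  have "fraction C.S ?D (sub_hom \<tau> b) (sub_hom \<tau> t) = fraction C.S ?D (sub_hom \<tau> F) (sub_hom \<tau> (Res3 ^ N))"
    if bt: "(b, t) \<in> stalk to_fract A.HD ?p ?x" for b t
  proof -
    obtain n where n: "b \<in> weighted_grading ones n" "t \<in> weighted_grading ones n" "t \<notin> ?p" "to_fract b / to_fract t = ?x"
      using bt by (auto simp: stalk_def homogeneous_fracs_def)
    have "A.hprimes \<subseteq> {p. primeideal p (poly_alg 8)}" by (auto simp: A.hprimes_def)
    then have "ideal ?p (poly_alg 8)" using pU by (auto simp: A.U0_def intro: primeideal.axioms(1))
    then have "0 \<in> ?p" using additive_subgroup.zero_closed[OF ideal.axioms(1)] by fastforce
    then have "t \<noteq> 0" using n(3) by auto
    then have "to_fract b * to_fract Res3 ^ N = to_fract F * to_fract t"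
      using n(4) Res3_nz[where ?'k = 'k] by (simp add: frac_eq_eq)
    then have "to_fract (b * Res3 ^ N) = to_fract (F * t)"
    proof -
      interpret f: comm_ring_hom "to_fract :: 'k mpoly \<Rightarrow> _" by (rule to_fract_hom)
      show ?thesis using \<open>to_fract b * to_fract Res3 ^ N = to_fract F * to_fract t\<close> by (simp only: f.hom_mult f.hom_power)
    qed
    then have bR: "b * Res3 ^ N = F * t" by (simp only: to_fract_eq_iff)
    have "sub_hom \<tau> t \<notin> Q" using n(2,3) PA by (auto simp: proj_map_def)
    then have D: "(sub_hom \<tau> b, sub_hom \<tau> t) \<in> ?D"
      using sub_hom_grading[OF \<tau>] n unfolding homogeneous_fracs_def by blast
    show ?thesis
      by (rule fraction_eqI[OF pQ D FR]) (simp add: sub_hom_ops[OF \<tau>] PA[OF n(1)] PA[OF n(2)] PA[OF F] RP bR)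
  qed
  moreover have "(F, Res3 ^ N) \<in> stalk to_fract A.HD ?p ?x"
  proof -
    interpret f: comm_ring_hom "to_fract :: 'k mpoly \<Rightarrow> _" by (rule to_fract_hom)
    show ?thesis using F RN notin by (auto simp: stalk_def homogeneous_fracs_def f.hom_power)
  qed
  ultimately have "(\<Union>(b, t)\<in>stalk to_fract A.HD ?p ?x. fraction C.S ?D (sub_hom \<tau> b) (sub_hom \<tau> t))
      = fraction C.S ?D (sub_hom \<tau> F) (sub_hom \<tau> (Res3 ^ N))" by fast
  then show "proj_pullback (poly_alg 8) C.S SL2_grading (sub_hom \<tau>) (A.proj.sec A.U0 ?x) Q
      = fraction C.S ?D (sub_hom \<tau> F) (sub_hom \<tau> (Res3 ^ N))"
    using pU by (simp add: proj_pullback_def const_section_def)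
qed

subsection \<open>Points of \<open>SL\<^sub>2 \<times> P\<^sub>3\<close>\<close>

text \<open>Evaluation at the point \<open>z\<close> of \<open>SL\<^sub>2 \<times> A\<^sup>8\<close>, keeping track of degrees: its kernel consists of the
  polynomials all of whose components vanish at \<open>z\<close>, the homogeneous prime of a point of \<open>SL\<^sub>2 \<times> P\<^sub>3\<close>.\<close>

definition point_eval :: "(nat \<Rightarrow> 'k::field_char_0) \<Rightarrow> 'k mpoly \<Rightarrow> 'k poly" where
  "point_eval z h = map_poly (ev z) (wS h)"

lemma point_eval_hom: "comm_ring_hom (point_eval z)"
proof -
  interpret e: comm_ring_hom "ev z" by (rule peval_hom[OF id_hom])
  interpret m: map_poly_comm_ring_hom "ev z" ..
  have "comm_ring_hom (map_poly (ev z))" by unfold_locales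
  from comp_hom[OF this wpoly_hom[of SL2_weights]] show ?thesis by (simp add: point_eval_def[abs_def])
qed

lemma coeff_point_eval: "coeff (point_eval z h) n = ev z (coeff (wS h) n)"
  by (simp add: point_eval_def coeff_map_poly id_hom)

lemma poly_point_eval_1: "poly (point_eval z h) 1 = ev z h"
proof -
  interpret e: comm_ring_hom "ev z" by (rule peval_hom[OF id_hom])
  have "poly (map_poly (ev z) (wS h)) (ev z 1) = ev z (poly (wS h) 1)" by (rule e.poly_map_poly)
  then show ?thesis by (simp add: point_eval_def poly_wpoly_1 id_hom)
qed

lemma point_eval_homogeneous: "h \<in> weighted_grading SL2_weights n \<Longrightarrow> point_eval z h = monom (ev z h) n"
  by (rule poly_eqI) (simp add: coeff_point_eval weighted_grading_iff id_hom)

definition point_prime :: "(nat \<Rightarrow> 'k::field_char_0) \<Rightarrow> 'k mpoly set set" where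
  "point_prime z = {X. \<exists>h\<in>PA 12. X = C.cls h \<and> point_eval z h = 0}"

context
  fixes z :: "nat \<Rightarrow> 'k::field_char_0"
  assumes z: "z 8 * z 11 - z 9 * z 10 = 1"
begin

interpretation pe: comm_ring_hom "point_eval z" by (rule point_eval_hom)

lemma point_eval_ideal: "h \<in> SL2_ideal \<Longrightarrow> point_eval z h = 0"
proof -
  assume "h \<in> SL2_ideal"
  then obtain g where g: "h = g * (var 8 * var 11 - var 9 * var 10 - 1)" unfolding SL2_ideal_iff by blast
  have "point_eval z (var 8 * var 11 - var 9 * var 10 - 1) = 0"
    using z by (intro poly_eqI) (simp add: coeff_point_eval wpoly_simps SL2_weights_nth mult_monom monom_simps id_hom flip: monom_0)
  then show ?thesis unfolding g by (simp add: pe.hom_mult)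
qed

lemma point_prime_iff: "h \<in> PA 12 \<Longrightarrow> C.cls h \<in> point_prime z \<longleftrightarrow> point_eval z h = 0"
proof
  assume "C.cls h \<in> point_prime z"
  then obtain h' where h': "h' \<in> PA 12" "C.cls h = C.cls h'" "point_eval z h' = 0" unfolding point_prime_def by blast
  then have "point_eval z (h - h') = 0" using point_eval_ideal C.cls_eq_iff by blast
  then show "point_eval z h = 0" using h'(3) by (simp add: hom_distribs)
qed (auto simp: point_prime_def)

lemma point_prime_primeideal: "primeideal (point_prime z) C.S"
proof (rule primeidealI)
  show "ideal (point_prime z) C.S"
  proof (rule SC.ideal_if_closed)
    show "point_prime z \<subseteq> carrier C.S" unfolding point_prime_def C.carrier_S by blast
    show "\<zero>\<^bsub>C.S\<^esub> \<in> point_prime z" unfolding C.S_zero by (simp add: point_prime_iff)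
    fix X Y :: "'k mpoly set" assume "X \<in> point_prime z"
    then obtain x where x: "x \<in> PA 12" "X = C.cls x" "point_eval z x = 0" unfolding point_prime_def by blast
    {
      assume "Y \<in> point_prime z"
      then obtain y where "y \<in> PA 12" "Y = C.cls y" "point_eval z y = 0" unfolding point_prime_def by blast
      then show "X \<oplus>\<^bsub>C.S\<^esub> Y \<in> point_prime z" using x by (simp add: C.S_ops point_prime_iff PA_add pe.hom_add)
    }
    {
      assume "Y \<in> carrier C.S"
      then obtain y where "y \<in> PA 12" "Y = C.cls y" unfolding C.carrier_S by blast
      then show "X \<otimes>\<^bsub>C.S\<^esub> Y \<in> point_prime z" using x by (simp add: C.S_ops point_prime_iff PA_mult pe.hom_mult)
    }
  qed
  show "cring C.S" by (rule C.S_cring)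
  have "C.cls 1 \<notin> point_prime z" by (simp add: point_prime_iff)
  moreover have "C.cls 1 \<in> carrier C.S" unfolding C.carrier_S by (rule imageI) simp
  ultimately show "carrier C.S \<noteq> point_prime z" by blast
  fix X Y :: "'k mpoly set" assume "X \<in> carrier C.S" "Y \<in> carrier C.S" and XY: "X \<otimes>\<^bsub>C.S\<^esub> Y \<in> point_prime z"
  then obtain x y where xy: "x \<in> PA 12" "X = C.cls x" "y \<in> PA 12" "Y = C.cls y" unfolding C.carrier_S by blast
  then have "point_eval z x * point_eval z y = 0"
    using XY by (simp add: C.S_ops point_prime_iff PA_mult pe.hom_mult)
  then show "X \<in> point_prime z \<or> Y \<in> point_prime z" using xy by (simp add: point_prime_iff)
qed

lemma point_prime_in_P3:
  assumes Res: "ev z Res3 \<noteq> 0"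
  shows "point_prime z \<in> points SL2_P3" "sub_hom var Res3 \<notin> point_prime z"
proof -
  let ?Q = "point_prime z"
  interpret Q: primeideal ?Q C.S by (rule point_prime_primeideal)
  have sub: "?Q \<inter> (\<Union>n. SL2_grading n) \<subseteq> carrier C.S" using SL2_grading_carrier by blast
  have "?Q \<subseteq> Idl\<^bsub>C.S\<^esub> (?Q \<inter> (\<Union>n. SL2_grading n))"
  proof
    fix X assume "X \<in> ?Q"
    then obtain h where h: "h \<in> PA 12" "X = C.cls h" "point_eval z h = 0" unfolding point_prime_def by blast
    let ?I = "Idl\<^bsub>C.S\<^esub> (?Q \<inter> (\<Union>n. SL2_grading n))"
    have "C.cls (\<Sum>n\<le>degree (wS h). coeff (wS h) n) \<in> ?I"
    proof (rule C.cls_sum_mem[OF SC.genideal_ideal[OF sub]], intro conjI)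
      fix n
      show p: "coeff (wS h) n \<in> PA 12" by (rule PA_coeff_wpoly[OF h(1)])
      have g: "coeff (wS h) n \<in> weighted_grading SL2_weights n" using h(1) by (simp add: coeff_wpoly_in_grading)
      have "ev z (coeff (wS h) n) = 0" using coeff_point_eval[of z h n] h(3) by simp
      then have "C.cls (coeff (wS h) n) \<in> ?Q" using point_prime_iff[OF p] point_eval_homogeneous[OF g, of z] by simp
      moreover have "C.cls (coeff (wS h) n) \<in> SL2_grading n" using g by (auto simp: SL2_grading_eq)
      ultimately show "C.cls (coeff (wS h) n) \<in> ?I" using SC.genideal_self[OF sub] by blast
    qed
    then show "X \<in> ?I" unfolding sum_coeff_wpoly h(2) .
  qed
  then have "Idl\<^bsub>C.S\<^esub> (?Q \<inter> (\<Union>n. SL2_grading n)) = ?Q"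
    using SC.genideal_minimal[OF Q.is_ideal, of "?Q \<inter> (\<Union>n. SL2_grading n)"] by blast
  moreover have R: "sub_hom var Res3 \<in> SL2_grading 6" by (rule sub_hom_grading[OF linear_sub_var Res3_homogeneous])
  moreover have "Res3 \<in> (PA 12 :: 'k mpoly set)"
    using Res3_homogeneous[where ?'k = 'k] by (intro PA_mono[of 8 12]) (simp_all add: weighted_grading_iff)
  then show notin: "sub_hom var Res3 \<notin> ?Q"
    using poly_point_eval_1[of z Res3] Res by (auto simp: sub_hom_def point_prime_iff)
  ultimately show "?Q \<in> points SL2_P3"
    using point_prime_primeideal
    by (auto simp: points_SL2_P3 subset_iff Bex_def intro!: exI[of _ "sub_hom var Res3"] exI[of _ "6 :: nat"])
qed

end

subsection \<open>Invariant functions\<close>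

lemma act_Delta: "C.cls (Delta ^ n * p) = C.cls p" if "p \<in> PA 12" for p :: "'k::field_char_0 mpoly"
proof -
  have D: "Delta - 1 \<in> (SL2_ideal :: 'k mpoly set)"
    unfolding SL2_ideal_iff Delta_def by (rule bexI[of _ 1]) auto
  have DP: "Delta \<in> (PA 12 :: 'k mpoly set)" unfolding Delta_def by (intro PA_diff PA_mult) simp_all
  have "Delta ^ n - 1 \<in> (SL2_ideal :: 'k mpoly set)"
  proof (induction n)
    case (Suc n)
    have "Delta ^ Suc n - 1 = (Delta ^ n - 1) * Delta + (Delta - 1 :: 'k mpoly)" by (simp add: algebra_simps)
    then show ?case using C.I_add[OF C.I_mult(1)[OF Suc DP] D] by (simp only:)
  qed (simp add: C.I_zero)
  from C.I_mult(1)[OF this that] show ?thesis unfolding C.cls_eq_iff by (simp add: algebra_simps)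
qed

text \<open>Modulo \<open>det = 1\<close> the powers of the determinant disappear.\<close>

lemma act_invariant: "P \<in> PA 6 \<Longrightarrow> sub_hom act_sub (substitute invs P) = sub_hom var (substitute invs P :: 'k::field_char_0 mpoly)"
proof -
  assume P: "P \<in> PA 6"
  note ops = sub_hom_ops[OF linear_sub_act] sub_hom_ops[OF linear_sub_var]
  have inv: "substitute invs p \<in> PA 8" if "p \<in> PA 6" for p :: "'k mpoly" by (rule PA_substitute[OF that]) simp
  have "P \<in> {P \<in> PA 6. sub_hom act_sub (substitute invs P) = sub_hom var (substitute invs P)}"
    using P
  proof (induction rule: PA_induct)
    case (var x)
    have "invs x \<in> (PA 12 :: 'k mpoly set)" by (rule PA_mono[OF _ PA_invs]) simp
    then show ?case using var substitute_act_invs[of x, where ?'k = 'k] act_Delta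
      by (simp add: sub_hom_def substitute_simps)
  next
    case (add p q)
    then have *: "p \<in> PA 6" "q \<in> PA 6" by auto
    have "sub_hom \<tau> (substitute invs (p + q)) = sub_hom \<tau> (substitute invs p) \<oplus>\<^bsub>C.S\<^esub> sub_hom \<tau> (substitute invs q)"
      if "linear_sub \<tau>" for \<tau> :: "nat \<Rightarrow> 'k mpoly"
      by (simp add: sub_hom_ops[OF that] inv * substitute_simps)
    from this[OF linear_sub_act] this[OF linear_sub_var] show ?case
      using add by (simp add: PA_add)
  next
    case (mult p q)
    then have *: "p \<in> PA 6" "q \<in> PA 6" by auto
    have "sub_hom \<tau> (substitute invs (p * q)) = sub_hom \<tau> (substitute invs p) \<otimes>\<^bsub>C.S\<^esub> sub_hom \<tau> (substitute invs q)"
      if "linear_sub \<tau>" for \<tau> :: "nat \<Rightarrow> 'k mpoly"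
      by (simp add: sub_hom_ops[OF that] inv * substitute_simps)
    from this[OF linear_sub_act] this[OF linear_sub_var] show ?case
      using mult by (simp add: PA_mult)
  qed (simp add: sub_hom_def substitute_simps)
  then show ?thesis by blast
qed

lemma SL2_Rat3_points_iff:
  "Q \<in> SL2_Rat3_points \<longleftrightarrow> Q \<in> points SL2_P3 \<and> sub_hom var (Res3 :: 'k::field_char_0 mpoly) \<notin> Q"
proof -
  have R: "(Res3 :: 'k mpoly) \<in> PA 8" using Res3_homogeneous[where ?'k = 'k] by (simp add: weighted_grading_iff)
  have A3: "A3 = poly_alg 8" by (simp add: A3_def)
  show ?thesis
    unfolding SL2_Rat3_points_def points_Rat3 A3 pr_hom_sub
    using preimage_in_Rat3[OF linear_sub_var] R by (auto simp: A.U0_def proj_map_def)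
qed

lemma act_Res: "sub_hom act_sub Res3 = sub_hom var (Res3 :: 'k::field_char_0 mpoly)"
  using act_invariant[OF rho_PA] by (simp add: substitute_invs_rho)

lemma act_Res_pow: "sub_hom act_sub (Res3 ^ N) = sub_hom var (Res3 ^ N :: 'k::field_char_0 mpoly)"
  using act_invariant[OF PA_power[OF rho_PA, of N]] by (simp add: substitute_simps substitute_invs_rho)

lemma SL2_invariant_iff:
  fixes F :: "'k::field_char_0 mpoly"
  assumes F: "F \<in> weighted_grading ones (6 * N)"
  shows "SL2_invariant (A.proj.sec A.U0 (to_fract F / to_fract Res3 ^ N)) \<longleftrightarrow>
    (\<forall>Q. Q \<in> points SL2_P3 \<longrightarrow> sub_hom var Res3 \<notin> Q \<longrightarrow>
      fraction C.S (homogeneous_fracs SL2_grading Q) (sub_hom act_sub F) (sub_hom var (Res3 ^ N))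
      = fraction C.S (homogeneous_fracs SL2_grading Q) (sub_hom var F) (sub_hom var (Res3 ^ N)))"
proof -
  have A3: "A3 = poly_alg 8" by (simp add: A3_def)
  have a: "proj_pullback (poly_alg 8) C.S SL2_grading (sub_hom act_sub) (A.proj.sec A.U0 (to_fract F / to_fract Res3 ^ N)) Q
      = fraction C.S (homogeneous_fracs SL2_grading Q) (sub_hom act_sub F) (sub_hom var (Res3 ^ N))"
    and p: "proj_pullback (poly_alg 8) C.S SL2_grading (sub_hom var) (A.proj.sec A.U0 (to_fract F / to_fract Res3 ^ N)) Q
      = fraction C.S (homogeneous_fracs SL2_grading Q) (sub_hom var F) (sub_hom var (Res3 ^ N))"
    if "Q \<in> points SL2_P3" "sub_hom var Res3 \<notin> Q" for Q
    using pullback_eq(2)[OF linear_sub_act that(1) _ F] pullback_eq(2)[OF linear_sub_var that(1) that(2) F] that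
    by (simp_all add: act_Res act_Res_pow)
  show ?thesis
    unfolding SL2_invariant_def A3 SL2_A3_eq act_hom_sub pr_hom_sub
    using a p by (auto simp: SL2_Rat3_points_iff)
qed

text \<open>At a rational point with nonvanishing resultant the equality of the two pullbacks says that \<open>F\<close> has
  the same value at a map and its conjugate.  For a fixed matrix such points are dense.\<close>

lemma invariant_poly_if_SL2_invariant:
  fixes F :: "'k::field_char_0 mpoly"
  assumes F: "F \<in> weighted_grading ones (6 * N)"
    and inv: "SL2_invariant (A.proj.sec A.U0 (to_fract F / to_fract Res3 ^ N))"
  shows "invariant_poly F"
  unfolding invariant_poly_def
proof (intro allI impI)
  fix x :: "nat \<Rightarrow> 'k" and p q r s :: 'k assume D: "p * s - q * r = 1"
  have FP: "F \<in> PA 8" using F by (simp add: weighted_grading_iff)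
  have RP: "Res3 \<in> (PA 8 :: 'k mpoly set)" using Res3_homogeneous[where ?'k = 'k] by (simp add: weighted_grading_iff)
  have main: "ev (act y p q r s) F = ev y F" if y: "ev y Res3 \<noteq> 0" for y
  proof -
    let ?z = "point y p q r s" and ?D = "homogeneous_fracs SL2_grading (point_prime (point y p q r s))"
    have z: "?z 8 * ?z 11 - ?z 9 * ?z 10 = 1" using D by (simp add: point_def)
    interpret pe: comm_ring_hom "point_eval ?z" by (rule point_eval_hom)
    have Rz: "ev ?z Res3 \<noteq> 0" using y ev_point[OF RP] by simp
    note Q = point_prime_in_P3[OF z Rz]
    have frac: "fraction C.S ?D (sub_hom act_sub F) (sub_hom var (Res3 ^ N)) = fraction C.S ?D (sub_hom var F) (sub_hom var (Res3 ^ N))"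
      using inv Q unfolding SL2_invariant_iff[OF F] by blast
    have mem: "(sub_hom act_sub F, sub_hom var (Res3 ^ N)) \<in> ?D"
      using pullback_eq(1)[OF linear_sub_act Q(1) _ F] Q(2) by (simp add: act_Res act_Res_pow)
    then have "sub_hom var (Res3 ^ N) \<in> snd ` ?D" by force
    then have "(sub_hom act_sub F, sub_hom var (Res3 ^ N)) \<in> fraction C.S ?D (sub_hom act_sub F) (sub_hom var (Res3 ^ N))"
      unfolding fraction_def using mem by blast
    then have "(sub_hom act_sub F, sub_hom var (Res3 ^ N)) \<in> fraction C.S ?D (sub_hom var F) (sub_hom var (Res3 ^ N))"
      unfolding frac .
    then obtain u where u: "u \<in> snd ` ?D"
      "u \<otimes>\<^bsub>C.S\<^esub> (sub_hom var (Res3 ^ N) \<otimes>\<^bsub>C.S\<^esub> sub_hom var F) = u \<otimes>\<^bsub>C.S\<^esub> (sub_hom var (Res3 ^ N) \<otimes>\<^bsub>C.S\<^esub> sub_hom act_sub F)"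
      unfolding fraction_def by blast
    then obtain h where h: "h \<in> PA 12" "u = C.cls h" "C.cls h \<notin> point_prime ?z"
      by (auto simp: homogeneous_fracs_def SL2_grading_eq weighted_grading_iff)
    have P12: "Res3 ^ N \<in> (PA 12 :: 'k mpoly set)" "F \<in> PA 12" "substitute act_sub F \<in> PA 12"
      using PA_mono[of 8 12] PA_power[OF RP] FP sub_PA[OF linear_sub_act FP] by auto
    have "C.cls (h * (Res3 ^ N * F)) = C.cls (h * (Res3 ^ N * substitute act_sub F))"
      using u(2) h(1,2) P12 by (simp add: sub_hom_def C.S_ops PA_mult)
    then have "point_eval ?z (h * (Res3 ^ N * F) - h * (Res3 ^ N * substitute act_sub F)) = 0"
      unfolding C.cls_eq_iff by (rule point_eval_ideal[OF z])
    then have "point_eval ?z h * (point_eval ?z (Res3 ^ N) * (point_eval ?z F - point_eval ?z (substitute act_sub F))) = 0"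
      by (simp add: hom_distribs algebra_simps)
    moreover have "point_eval ?z h \<noteq> 0" using h(1,3) point_prime_iff[OF z] by blast
    moreover have "point_eval ?z (Res3 ^ N) \<noteq> 0"
      using poly_point_eval_1[of ?z Res3] Rz by (auto simp: hom_distribs)
    ultimately have "point_eval ?z F = point_eval ?z (substitute act_sub F)" by simp
    then have "ev ?z F = ev ?z (substitute act_sub F)" by (metis poly_point_eval_1)
    then show ?thesis by (simp add: ev_point[OF FP] peval_substitute id_hom act_def)
  qed
  define G where "G = substitute (\<lambda>m. substitute (\<lambda>i. if i < 8 then var i else const (point x p q r s i)) (act_sub m)) F - F"
  have ev_G: "ev y G = ev (act y p q r s) F - ev y F" for y
  proof -
    have "ev y (if i < 8 then var i else const (point x p q r s i)) = point y p q r s i" for i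
      by (simp add: id_hom point_def)
    then show ?thesis by (simp add: G_def id_hom peval_substitute act_def)
  qed
  have "G = 0"
    by (rule ev_zero_if_dense[OF inf_UNIV Res3_nz]) (simp add: ev_G main)
  then show "ev (act x p q r s) F = ev x F" using ev_G[of x] by (simp add: id_hom)
qed

text \<open>Invariant fractions \<open>F / Res\<^sup>N\<close> have invariant numerators, which are polynomials in the six invariants;
  and the numerator of degree \<open>6 N\<close> only involves terms of that weight.\<close>

lemma SL2_invariant_section_iff:
  assumes x: "x \<in> A.W"
  shows "SL2_invariant (A.proj.sec A.U0 x) \<longleftrightarrow> x \<in> (Bg.W :: 'k::field_char_0 mpoly fract set)"
proof
  obtain N F where F: "F \<in> weighted_grading ones (6 * N)" "x = to_fract F / to_fract Res3 ^ N"
    using x unfolding A_W_iff by blast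
  assume "SL2_invariant (A.proj.sec A.U0 x)"
  then have "invariant_poly F" using invariant_poly_if_SL2_invariant F by blast
  moreover have FP: "F \<in> PA 8" "wpoly ones F = monom F (6 * N)" using F(1) by (simp_all add: weighted_grading_iff)
  ultimately obtain P where P: "P \<in> PA 6" "F = substitute invs P" using invariants_generated by blast
  let ?P = "coeff (wpoly weights P) (6 * N)"
  have "substitute invs ?P = F"
    using wpoly_ones_substitute_invs[OF P(1), of "6 * N"] FP(2) P(2) by simp
  moreover have "?P \<in> weighted_grading weights (6 * N)" by (rule coeff_wpoly_in_grading) (simp add: P(1))
  ultimately show "x \<in> Bg.W" unfolding Bg_W_iff F(2) by blast
next
  assume "x \<in> Bg.W"
  then obtain N P where P: "P \<in> weighted_grading weights (6 * N)" "x = to_fract (substitute invs P) / to_fract Res3 ^ N"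
    unfolding Bg_W_iff by blast
  have P6: "P \<in> PA 6" using P(1) by (simp add: weighted_grading_iff)
  have "B.cls P \<in> B_gr (6 * N)" using P(1) by (auto simp: B_gr_eq)
  from realize_homogeneous[OF this] have F: "substitute invs P \<in> weighted_grading ones (6 * N)" by (simp add: realize_cls[OF P6])
  show "SL2_invariant (A.proj.sec A.U0 x)"
    unfolding P(2) SL2_invariant_iff[OF F] act_invariant[OF P6] by blast
qed

lemma Bg_W_smult: "x \<in> Bg.W \<Longrightarrow> to_K c * x \<in> Bg.W"
proof -
  assume "x \<in> Bg.W"
  then obtain b N where b: "b \<in> Bg.G (6 * N)" "x = b / Bg.\<phi> ^ N" unfolding Bg.W_def by blast
  have "to_K c * x = (to_K c * b) / Bg.\<phi> ^ N" by (simp add: b(2))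
  then show ?thesis using Bg.W_memI[OF Bg.G_closed(7)[OF b(1)] refl] by simp
qed

lemma invariant_functions_carrier:
  "carrier (invariant_functions :: ('k::field_char_0, _) module) = A.proj.sec A.U0 ` Bg.W"
  unfolding invariant_functions_def partial_object.simps carrier_sections_Rat3
  using SL2_invariant_section_iff Bg_W_subset by auto

lemma invariant_functions_embed:
  "frac_embed (invariant_functions :: ('k::field_char_0, _) module) (A.proj.section_value A.U0) to_K"
  and invariant_functions_values:
  "A.proj.section_value A.U0 ` carrier (invariant_functions :: ('k, _) module) = Bg.W"
proof -
  let ?T = "invariant_functions :: ('k, _) module"
  have ne: "A.U0 \<noteq> ({} :: 'k mpoly set set)" using A.zero_in_U0 by blast
  note op = A.basic.U0_open[where ?'k = 'k]
  have UP: "A.U0 \<subseteq> (A.hprimes :: 'k mpoly set set)" by (auto simp: A.U0_def)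
  have reg: "x \<in> A.proj.reg A.U0" if "x \<in> Bg.W" for x :: "'k mpoly fract"
    using that Bg_W_subset unfolding A.regular_on_basic_open by blast
  have sv: "A.proj.section_value A.U0 (A.proj.sec A.U0 x) = x" if "x \<in> Bg.W" for x :: "'k mpoly fract"
    by (rule A.proj.section_value_sec[OF op ne reg[OF that]])
  have ops: "A.proj.sec A.U0 x \<otimes>\<^bsub>?T\<^esub> A.proj.sec A.U0 y = A.proj.sec A.U0 (x * y)"
    "A.proj.sec A.U0 x \<oplus>\<^bsub>?T\<^esub> A.proj.sec A.U0 y = A.proj.sec A.U0 (x + y)"
    "c \<odot>\<^bsub>?T\<^esub> A.proj.sec A.U0 x = A.proj.sec A.U0 (to_K c * x)"
    if "x \<in> Bg.W" "y \<in> Bg.W" for x y c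
    using A.proj.sheaf_ops[OF UP reg[OF that(1)] reg[OF that(2)]]
    by (simp_all add: invariant_functions_def global_sections_Rat3)
  have const_eq: "\<one>\<^bsub>?T\<^esub> = A.proj.sec A.U0 1" "\<zero>\<^bsub>?T\<^esub> = A.proj.sec A.U0 0"
    using A.proj.sheaf_consts[OF UP] by (simp_all add: invariant_functions_def global_sections_Rat3)
  note W = Bg.W_closed Bg_W_smult
  show "A.proj.section_value A.U0 ` carrier ?T = Bg.W"
    unfolding invariant_functions_carrier by (auto simp: image_image sv intro!: image_eqI)
  have neg: "- x \<in> Bg.W" if "x \<in> Bg.W" for x :: "'k mpoly fract"
    using Bg_W_smult[OF that, of "- 1"] by (simp add: const_minus)
  show "frac_embed ?T (A.proj.section_value A.U0) to_K"
  proof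
    show "inj_on (A.proj.section_value A.U0) (carrier ?T)"
      unfolding invariant_functions_carrier by (auto intro!: inj_onI simp: sv)
    fix a assume "a \<in> carrier ?T"
    then obtain x where "x \<in> Bg.W" "a = A.proj.sec A.U0 x" unfolding invariant_functions_carrier by blast
    then show "\<exists>b\<in>carrier ?T. A.proj.section_value A.U0 b = - A.proj.section_value A.U0 a"
      unfolding invariant_functions_carrier by (intro bexI[of _ "A.proj.sec A.U0 (- x)"]) (auto simp: sv neg)
  qed (auto simp: invariant_functions_carrier ops const_eq sv W const_minus)
qed

lemma relation_locus_eq: "relation_locus = Proj B.S B_gr"
  by (simp add: relation_locus_def weighted_proj_closed_def)

lemma invariant_variety_eq:
  "invariant_variety = open_subspace (Proj (B.S :: ('k::field_char_0, _) module) B_gr) Bg.U0"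
proof -
  have "points (Proj (B.S :: ('k, _) module) B_gr) = Bg.hprimes" unfolding Bg.Proj_eq by (rule Bg.proj.points_X)
  then show ?thesis unfolding invariant_variety_def relation_locus_eq Bg.U0_def by simp
qed

text \<open>The ring of invariant functions on \<open>Rat\<^sub>3\<close> is, inside the function field, the degree-zero part of the
  coordinate ring of the relation with \<open>\<rho>\<close> inverted.\<close>

theorem M3_isomorphic: "isomorphic (M3 :: ('k::field_char_0, _) frac_space) (invariant_variety :: ('k, _) frac_space)"
  unfolding M3_def invariant_variety_eq
  by (rule Bg.spec_isomorphic_basic_open[OF invariant_functions_embed invariant_functions_values])

section \<open>Homogeneous primes of the relation locus\<close>

text \<open>The homogeneous primes of the coordinate ring that avoid \<open>\<rho>\<close>, as subsets of the polynomial ring.\<close>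

definition homogeneous_prime :: "'k::field_char_0 mpoly set \<Rightarrow> bool" where
  "homogeneous_prime J \<longleftrightarrow> J \<subseteq> PA 6 \<and> relation_ideal \<subseteq> J \<and> rho \<notin> J \<and> (\<forall>x\<in>J. \<forall>y\<in>J. x + y \<in> J) \<and>
    (\<forall>x\<in>J. \<forall>y\<in>PA 6. x * y \<in> J) \<and> (\<forall>x\<in>PA 6. \<forall>y\<in>PA 6. x * y \<in> J \<longrightarrow> x \<in> J \<or> y \<in> J) \<and>
    (\<forall>x\<in>J. \<forall>n. coeff (wpoly weights x) n \<in> J)"

lemma homogeneous_primeD:
  assumes "homogeneous_prime (J :: 'k::field_char_0 mpoly set)"
  shows "x \<in> J \<Longrightarrow> x \<in> PA 6" and "x \<in> relation_ideal \<Longrightarrow> x \<in> J" and "rho \<notin> J"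
    and "x \<in> J \<Longrightarrow> y \<in> J \<Longrightarrow> x + y \<in> J" and "x \<in> J \<Longrightarrow> y \<in> PA 6 \<Longrightarrow> x * y \<in> J"
    and "x \<in> J \<Longrightarrow> y \<in> PA 6 \<Longrightarrow> y * x \<in> J"
    and "x * y \<in> J \<Longrightarrow> x \<in> PA 6 \<Longrightarrow> y \<in> PA 6 \<Longrightarrow> x \<in> J \<or> y \<in> J"
    and "x \<in> J \<Longrightarrow> coeff (wpoly weights x) n \<in> J"
    and "0 \<in> J" and "x \<in> J \<Longrightarrow> y \<in> J \<Longrightarrow> x - y \<in> J"
    and "const c \<in> J \<Longrightarrow> c = 0" and "1 \<notin> J"
proof -
  note h = assms[unfolded homogeneous_prime_def]
  show J: "x \<in> J \<Longrightarrow> x \<in> PA 6" "x \<in> relation_ideal \<Longrightarrow> x \<in> J" "rho \<notin> J" "x \<in> J \<Longrightarrow> y \<in> J \<Longrightarrow> x + y \<in> J"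
    "x \<in> J \<Longrightarrow> y \<in> PA 6 \<Longrightarrow> x * y \<in> J" "x * y \<in> J \<Longrightarrow> x \<in> PA 6 \<Longrightarrow> y \<in> PA 6 \<Longrightarrow> x \<in> J \<or> y \<in> J"
    "x \<in> J \<Longrightarrow> coeff (wpoly weights x) n \<in> J" for x y n
    using h by (fast, fast, fast, simp, simp, simp, simp)
  show m: "x \<in> J \<Longrightarrow> y \<in> PA 6 \<Longrightarrow> y * x \<in> J" for x y using J(5)[of x y] by (simp add: mult.commute)
  show "0 \<in> J" using J(2) B.I_zero by blast
  have "- 1 \<in> (PA 6 :: 'k mpoly set)" by (intro PA_uminus PA_one)
  then show "x \<in> J \<Longrightarrow> y \<in> J \<Longrightarrow> x - y \<in> J" using J(4)[of x "y * - 1"] J(5)[of y "- 1"] by simp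
  show c: "c = 0" if "const c \<in> J" for c
  proof (rule ccontr)
    assume "c \<noteq> 0"
    then have "const c * (const (inverse c) * rho) = rho" by (simp add: mult.assoc[symmetric] flip: const_mult)
    then show False using J(5)[OF that, of "const (inverse c) * rho"] J(3) rho_PA PA_mult[OF PA_const] by metis
  qed
  show "1 \<notin> J" using c[of 1] by auto
qed

lemma poly_in_PA:
  assumes "\<And>i. coeff p i \<in> PA n" "x \<in> PA n" shows "poly p x \<in> PA n"
  unfolding poly_altdef using assms by (intro PA_sum PA_mult PA_power)

lemma PA_0: "P \<in> PA 0 \<Longrightarrow> \<exists>c. P = const c"
proof -
  assume "P \<in> PA 0"
  then have "P \<in> range const"
    by (induction rule: PA_induct) (auto simp flip: const_add const_mult)
  then show ?thesis by blast
qed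

lemma PA_Suc_decomposition:
  fixes P :: "'k::field mpoly"
  assumes "P \<in> PA (Suc k)" shows "\<exists>p. (\<forall>i. coeff p i \<in> PA k) \<and> P = poly p (var k)"
proof -
  have "P \<in> {P. \<exists>p. (\<forall>i. coeff p i \<in> PA k) \<and> P = poly p (var k)}" using assms
  proof (induction rule: PA_induct)
    case (const c)
    show ?case by (auto intro!: exI[of _ "[:const c:]"] simp: coeff_pCons split: nat.split)
  next
    case (var x)
    show ?case
    proof (cases "x = k")
      case True
      then show ?thesis by (auto intro!: exI[of _ "[:0, 1:]"] simp: coeff_pCons split: nat.split)
    next
      case False
      then show ?thesis using var by (auto intro!: exI[of _ "[:Defs.var x:]"] simp: coeff_pCons split: nat.split)
    qed
  next
    case (add p q)
    then obtain p' q' where "\<forall>i. coeff p' i \<in> PA k" "p = poly p' (Defs.var k)" "\<forall>i. coeff q' i \<in> PA k" "q = poly q' (Defs.var k)"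
      by blast
    then show ?case by (auto intro!: exI[of _ "p' + q'"] PA_add)
  next
    case (mult p q)
    then obtain p' q' where "\<forall>i. coeff p' i \<in> PA k" "p = poly p' (Defs.var k)" "\<forall>i. coeff q' i \<in> PA k" "q = poly q' (Defs.var k)"
      by blast
    then show ?case by (auto intro!: exI[of _ "p' * q'"] PA_sum PA_mult simp: coeff_mult)
  qed
  then show ?thesis by blast
qed

text \<open>One step of the independence proof: if the constant terms of polynomials in \<open>y\<^sub>k\<close> can be
  separated off, then a polynomial in \<open>y\<^sub>k \<notin> J\<close> whose value is in \<open>J\<close> vanishes, coefficient by coefficient, since
  \<open>y\<^sub>k\<close> can be cancelled modulo the prime \<open>J\<close>.\<close>

lemma vanishing_step:
  fixes J :: "'k::field_char_0 mpoly set"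
  assumes J: "homogeneous_prime J" and yk: "y k \<notin> J" and y: "\<And>l. l < Suc k \<Longrightarrow> y l \<in> PA 6"
    and lead: "\<And>a q. a \<in> PA k \<Longrightarrow> q \<in> PA 6 \<Longrightarrow> substitute y a + y k * q \<in> J \<Longrightarrow> a = 0"
    and P: "P \<in> PA (Suc k)" "substitute y P \<in> J"
  shows "P = 0"
proof -
  have sub: "substitute y (poly q (var k)) \<in> PA 6" if "\<And>i. coeff q i \<in> PA k" for q
    by (rule PA_substitute[OF poly_in_PA y]) (auto intro: PA_mono[OF _ that])
  have z: "p = 0" if "\<And>i. coeff p i \<in> PA k" "substitute y (poly p (var k)) \<in> J" for p
    using that
  proof (induction p)
    case (pCons a q)
    have a: "a \<in> PA k" and q: "\<And>i. coeff q i \<in> PA k"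
      using pCons.prems(1)[of 0] pCons.prems(1)[of "Suc _"] by simp_all
    have e: "substitute y a + y k * substitute y (poly q (var k)) \<in> J"
      using pCons.prems(2) by (simp add: substitute_simps)
    have "a = 0" by (rule lead[OF a sub[OF q] e])
    then have "y k * substitute y (poly q (var k)) \<in> J" using e by (simp add: substitute_simps)
    then have "substitute y (poly q (var k)) \<in> J"
      using homogeneous_primeD(7)[OF J] yk y[of k] sub[OF q] by blast
    then show ?case using pCons.IH[OF q] \<open>a = 0\<close> by simp
  qed simp
  obtain p where p: "\<And>i. coeff p i \<in> PA k" "P = poly p (var k)" using PA_Suc_decomposition[OF P(1)] by blast
  have "p = 0" by (rule z[OF p(1)]) (use P(2) p(2) in simp)
  then show ?thesis using p(2) by simp
qed

text \<open>Elements \<open>x\<^sub>i \<in> J\<^sub>i\<close> outside \<open>J\<^sub>i\<^sub>+\<^sub>1\<close> are algebraically independent modulo \<open>J\<^sub>n\<close>: modulo \<open>J\<^sub>k\<close> a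
  polynomial in \<open>x\<^sub>k\<close> reduces to its constant term, to which the induction hypothesis applies.  The element \<open>\<rho>\<close> comes
  for free, because it is homogeneous of positive degree and constants are separated from its multiples by
  degree; this accounts for the difference between the dimension of \<open>Proj\<close> and of the cone.\<close>

lemma prime_chain_independent:
  fixes J :: "nat \<Rightarrow> 'k::field_char_0 mpoly set"
  assumes J: "\<And>i. i \<le> n \<Longrightarrow> homogeneous_prime (J i)" and sub: "\<And>i. i < n \<Longrightarrow> J (Suc i) \<subseteq> J i"
    and x: "\<And>i. i < n \<Longrightarrow> x i \<in> J i - J (Suc i)" and k: "k \<le> n"
  shows "P \<in> PA (Suc k) \<Longrightarrow> substitute (case_nat rho x) P \<in> J k \<Longrightarrow> P = 0"
  using k
proof (induction k arbitrary: P)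
  let ?y = "case_nat rho x"
  have y: "?y l \<in> PA 6" if "l \<le> n" for l
    using that x[of "l - 1"] homogeneous_primeD(1)[OF J[of "l - 1"]] rho_PA by (cases l) auto
  {
    case 0
    show ?case
    proof (rule vanishing_step[OF J[of 0] _ _ _ 0(1,2)])
      fix a q :: "'k mpoly"
      assume "a \<in> PA 0" and q: "q \<in> PA 6" "substitute ?y a + ?y 0 * q \<in> J 0"
      then obtain c where c: "a = const c" using PA_0 by blast
      \<comment> \<open>The component of weight zero sees only the constant.\<close>
      have "coeff (wpoly weights (substitute ?y a + ?y 0 * q)) 0 = const c"
        by (simp add: c substitute_simps wpoly_simps wpoly_rho coeff_monom_mult)
      then have "const c \<in> J 0" using homogeneous_primeD(8)[OF J[of 0] q(2), of 0] by simp
      then have "c = 0" by (rule homogeneous_primeD(11)[OF J[of 0], rotated]) simp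
      then show "a = 0" by (simp add: c)
    qed (use y rho_PA homogeneous_primeD(3)[OF J] in auto)
  next
    case (Suc k)
    show ?case
    proof (rule vanishing_step[OF J[of "Suc k"] _ _ _ Suc.prems(1,2)])
      fix a q :: "'k mpoly"
      assume a: "a \<in> PA (Suc k)" and q: "q \<in> PA 6" "substitute ?y a + ?y (Suc k) * q \<in> J (Suc k)"
      have Jk: "homogeneous_prime (J k)" using J Suc.prems by simp
      have "x k * q \<in> J k" using homogeneous_primeD(5)[OF Jk _ q(1)] x[of k] Suc.prems by auto
      moreover have "substitute ?y a + x k * q \<in> J k" using q(2) sub[of k] Suc.prems by auto
      ultimately have "substitute ?y a \<in> J k" using homogeneous_primeD(10)[OF Jk] by fastforce
      then show "a = 0" using Suc.IH[OF a] Suc.prems by simp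
    qed (use y x Suc.prems in auto)
  }
qed

section \<open>Counting monomials\<close>

definition exponent_box :: "nat \<Rightarrow> nat \<Rightarrow> (nat \<Rightarrow>\<^sub>0 nat) set" where
  "exponent_box n N = {m. Poly_Mapping.keys m \<subseteq> {..<n} \<and> (\<forall>x. Poly_Mapping.lookup m x \<le> N)}"

lemma card_exponent_box: "finite (exponent_box n N)" "card (exponent_box n N) = Suc N ^ n"
proof -
  have l: "Poly_Mapping.lookup (Abs_poly_mapping (\<lambda>x. if x < n then g x else 0)) = (\<lambda>x. if x < n then g x else (0::nat))" for g
    by (rule lookup_Abs_poly_mapping) (rule finite_subset[of _ "{..<n}"], auto)
  have b: "bij_betw (\<lambda>m. restrict (Poly_Mapping.lookup m) {..<n}) (exponent_box n N) ({..<n} \<rightarrow>\<^sub>E {..N})"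
  proof (rule bij_betwI[where g = "\<lambda>g. Abs_poly_mapping (\<lambda>x. if x < n then g x else 0)"])
    show "Abs_poly_mapping (\<lambda>x. if x < n then restrict (Poly_Mapping.lookup m) {..<n} x else 0) = m" if "m \<in> exponent_box n N" for m
    proof (rule poly_mapping_eqI)
      fix x
      have "x \<notin> Poly_Mapping.keys m" if "\<not> x < n" using \<open>m \<in> _\<close> that by (auto simp: exponent_box_def)
      then show "Poly_Mapping.lookup (Abs_poly_mapping (\<lambda>x. if x < n then restrict (Poly_Mapping.lookup m) {..<n} x else 0)) x = Poly_Mapping.lookup m x"
        unfolding l by (auto simp: in_keys_iff)
    qed
    show "restrict (Poly_Mapping.lookup (Abs_poly_mapping (\<lambda>x. if x < n then g x else 0))) {..<n} = g"
      if "g \<in> {..<n} \<rightarrow>\<^sub>E {..N}" for g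
      unfolding l using that by (auto simp: fun_eq_iff PiE_def extensional_def)
    show "(\<lambda>m. restrict (Poly_Mapping.lookup m) {..<n}) \<in> exponent_box n N \<rightarrow> {..<n} \<rightarrow>\<^sub>E {..N}"
      by (auto simp: exponent_box_def)
    show "(\<lambda>g. Abs_poly_mapping (\<lambda>x. if x < n then g x else 0)) \<in> ({..<n} \<rightarrow>\<^sub>E {..N}) \<rightarrow> exponent_box n N"
    proof
      fix g :: "nat \<Rightarrow> nat" assume g: "g \<in> {..<n} \<rightarrow>\<^sub>E {..N}"
      have "Poly_Mapping.keys (Abs_poly_mapping (\<lambda>x. if x < n then g x else 0)) \<subseteq> {..<n}"
        by (rule subsetI) (simp add: in_keys_iff l split: if_splits)
      then show "Abs_poly_mapping (\<lambda>x. if x < n then g x else 0) \<in> exponent_box n N"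
        using g by (simp add: exponent_box_def l PiE_iff)
    qed
  qed
  show "card (exponent_box n N) = Suc N ^ n" using bij_betw_same_card[OF b] by (simp add: card_PiE)
  show "finite (exponent_box n N)" using bij_betw_finite[OF b] by (simp add: finite_PiE)
qed

lemma keys_if_homogeneous:
  fixes A :: "'k::field mpoly"
  assumes A: "A \<in> PA 5" "wpoly weights A = monom A e" and m: "m \<in> Poly_Mapping.keys A"
  shows "m \<in> exponent_box 5 e"
proof -
  have "A \<in> PA 6" using A(1) by (rule PA_mono[rotated]) simp
  then have "A \<in> weighted_grading weights e" by (simp add: weighted_grading_iff A)
  then have w: "(\<Sum>x\<in>Poly_Mapping.keys m. weights ! x * Poly_Mapping.lookup m x) = e" using m by (simp add: weighted_grading_def)
  have k: "Poly_Mapping.keys m \<subseteq> {..<5}" using A(1) m by (auto simp: PA_iff)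
  have "Poly_Mapping.lookup m x \<le> e" for x
  proof (cases "x \<in> Poly_Mapping.keys m")
    case True
    then have "x < 5" using k by auto
    then have "1 \<le> weights ! x" by (auto simp: weights_def nth_Cons' numeral_eq_Suc less_Suc_eq)
    then have "Poly_Mapping.lookup m x \<le> weights ! x * Poly_Mapping.lookup m x" by simp
    also have "\<dots> \<le> e" unfolding w[symmetric] using True by (intro member_le_sum) auto
    finally show ?thesis .
  qed (simp add: in_keys_iff)
  then show ?thesis using k by (simp add: exponent_box_def)
qed

lemma scaling_vector_space: "vector_space (\<lambda>(c::'k::field) (p::'k mpoly). const c * p)"
  by unfold_locales (simp_all add: const_add const_mult algebra_simps)

text \<open>In normal form a homogeneous element of weight \<open>e\<close> is spanned by monomials in five variables, all of
  whose exponents are at most \<open>e\<close>, and by \<open>c\<close> times such monomials.\<close>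

lemma homogeneous_span:
  fixes X :: "'k::field_char_0 mpoly"
  defines "mo \<equiv> (\<lambda>m. substitute invs (Poly_Mapping.single m 1) :: 'k mpoly)"
  assumes X: "X \<in> PA 6" "wpoly weights X = monom X e" "e \<le> E"
  shows "substitute invs X \<in> module.span (\<lambda>c p. const c * p) (mo ` exponent_box 5 E \<union> (\<lambda>m. invs 5 * mo m) ` exponent_box 5 E)"
proof -
  interpret V: vector_space "\<lambda>(c::'k) (p::'k mpoly). const c * p" by (rule scaling_vector_space)
  let ?T = "mo ` exponent_box 5 E \<union> (\<lambda>m. invs 5 * mo m) ` exponent_box 5 E"
  obtain A C Y where n: "A \<in> PA 5" "C \<in> PA 5" "Y \<in> PA 6" "X = A + var 5 * C + Y * relation_poly"
    using normal_form[OF X(1)] by blast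
  have up: "A + var 5 * C \<in> PA 6"
    using PA_mono[OF _ n(1), of 6] PA_mono[OF _ n(2), of 6] by (intro PA_add PA_mult) simp_all
  define A' C' where "A' = coeff (wpoly weights A) e"
    and "C' = (if 6 \<le> e then coeff (wpoly weights C) (e - 6) else 0)"
  have w5: "weights ! 5 = 6" by (simp add: weights_def)
  have XP: "substitute invs X = substitute invs (A + var 5 * C)"
    by (simp add: n(4) substitute_simps substitute_invs_relation)
  have "substitute invs X = substitute invs (coeff (wpoly weights X) e)" using X by simp
  also have "\<dots> = coeff (wpoly ones (substitute invs (A + var 5 * C))) e"
    unfolding XP[symmetric] using wpoly_ones_substitute_invs[OF X(1)] by simp
  also have "coeff (wpoly ones (substitute invs (A + var 5 * C))) e = substitute invs (A' + var 5 * C')"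
    unfolding wpoly_ones_substitute_invs[OF up] by (simp add: wpoly_simps w5 coeff_monom_mult A'_def C'_def)
  finally have eq: "substitute invs X = substitute invs A' + invs 5 * substitute invs C'" by (simp add: substitute_simps)
  have expand: "substitute invs Z = (\<Sum>m\<in>Poly_Mapping.keys Z. const (Poly_Mapping.lookup Z m) * mo m)" for Z :: "'k mpoly"
    unfolding substitute_peval peval_def mo_def by (simp add: peval_single)
  have box: "m \<in> exponent_box 5 E" if "m \<in> exponent_box 5 n" "n \<le> E" for m n
    using that by (auto simp: exponent_box_def intro: order_trans)
  have "A' \<in> PA 5" "C' \<in> PA 5" using PA_coeff_wpoly n by (auto simp: A'_def C'_def)
  moreover have "wpoly weights A' = monom A' e" "wpoly weights C' = monom C' (e - 6)"
    by (auto simp: A'_def C'_def wpoly_coeff)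
  ultimately have keys: "m \<in> Poly_Mapping.keys A' \<Longrightarrow> m \<in> exponent_box 5 E" "m \<in> Poly_Mapping.keys C' \<Longrightarrow> m \<in> exponent_box 5 E" for m
    using keys_if_homogeneous box X(3) by (meson, meson diff_le_self le_trans)
  have "substitute invs A' \<in> V.span ?T" unfolding expand
    by (intro V.span_sum V.span_scale V.span_base) (use keys in auto)
  moreover have "invs 5 * substitute invs C' = (\<Sum>m\<in>Poly_Mapping.keys C'. const (Poly_Mapping.lookup C' m) * (invs 5 * mo m))"
    unfolding expand sum_distrib_left by (rule sum.cong) (simp_all add: mult.left_commute)
  moreover have "\<dots> \<in> V.span ?T"
    by (intro V.span_sum V.span_scale V.span_base) (use keys in auto)
  ultimately show ?thesis unfolding eq by (simp add: V.span_add)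
qed

text \<open>Otherwise the \<open>(N + 1)\<^sup>6\<close> monomials in the \<open>y\<^sub>l\<close> with exponents up to \<open>N\<close>, whose weights are at most
  \<open>K N\<close>, would be linearly independent in a space of dimension at most \<open>2 (K N + 1)\<^sup>5\<close>.\<close>

lemma algebraically_dependent:
  fixes y :: "nat \<Rightarrow> 'k::field_char_0 mpoly"
  assumes y: "\<And>l. l < 6 \<Longrightarrow> y l \<in> PA 6" "\<And>l. l < 6 \<Longrightarrow> wpoly weights (y l) = monom (y l) (v l)"
  shows "\<exists>P\<in>PA 6. P \<noteq> 0 \<and> substitute y P \<in> relation_ideal"
proof (rule ccontr)
  assume "\<not> ?thesis"
  then have indep: "P = 0" if "P \<in> PA 6" "substitute invs (substitute y P) = 0" for P
    using that PA_substitute[OF that(1) y(1)] by (auto simp: relation_ideal_iff)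
  interpret V: vector_space "\<lambda>(c::'k) (p::'k mpoly). const c * p" by (rule scaling_vector_space)
  define K where "K = (\<Sum>l<6. v l)"
  \<comment> \<open>Large enough, as \<open>2 (K N + 1)\<^sup>5 \<le> 2 (K + 1)\<^sup>5 (N + 1)\<^sup>5\<close>.\<close>
  define N where "N = 2 * (K + 1) ^ 5"
  define mo where "mo = (\<lambda>m. substitute invs (Poly_Mapping.single m 1) :: 'k mpoly)"
  define T where "T = mo ` exponent_box 5 (K * N) \<union> (\<lambda>m. invs 5 * mo m) ` exponent_box 5 (K * N)"
  define f where "f = (\<lambda>m. substitute invs (substitute y (Poly_Mapping.single m 1)))"
  have keys: "Poly_Mapping.keys m \<subseteq> {..<6}" if "m \<in> exponent_box 6 N" for m using that by (simp add: exponent_box_def)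
  have span: "f m \<in> V.span T" if m: "m \<in> exponent_box 6 N" for m
  proof -
    have sub: "substitute y (Poly_Mapping.single m 1) = mono_eval y m" by (simp add: substitute_peval peval_single[OF const_hom])
    have "mono_eval y m \<in> PA 6" using PA_substitute[OF PA_single[OF keys[OF m], of 1], of y] y(1) by (simp add: sub)
    moreover define e where "e = (\<Sum>x\<in>Poly_Mapping.keys m. v x * Poly_Mapping.lookup m x)"
    have "wpoly weights (mono_eval y m) = monom (mono_eval y m) e"
    proof -
      have "wpoly weights (mono_eval y m) = mono_eval (\<lambda>x. wpoly weights (y x)) m"
        unfolding wpoly_def by (rule peval_mono_eval[OF const_pCons_hom])
      also have "\<dots> = mono_eval (\<lambda>x. monom (y x) (v x)) m"
        unfolding mono_eval_def by (rule prod.cong) (use y(2) keys[OF m] in auto)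
      finally show ?thesis by (simp add: wpoly_mono e_def)
    qed
    moreover have "e \<le> K * N"
    proof -
      have "e \<le> (\<Sum>x\<in>Poly_Mapping.keys m. v x * N)"
        unfolding e_def by (intro sum_mono mult_left_mono) (use m in \<open>auto simp: exponent_box_def\<close>)
      also have "\<dots> \<le> (\<Sum>x<6. v x * N)" by (rule sum_mono2) (use keys[OF m] in auto)
      finally show ?thesis by (simp add: K_def sum_distrib_right)
    qed
    ultimately show ?thesis unfolding f_def sub T_def mo_def by (rule homogeneous_span)
  qed
  have inj: "inj_on f (exponent_box 6 N)"
  proof (rule inj_onI)
    fix m m' assume m: "m \<in> exponent_box 6 N" "m' \<in> exponent_box 6 N" "f m = f m'"
    have "Poly_Mapping.single m 1 - Poly_Mapping.single m' 1 = (0 :: 'k mpoly)"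
      by (rule indep) (use m keys in \<open>auto simp: f_def substitute_simps intro!: PA_diff PA_single\<close>)
    then have "Poly_Mapping.lookup (Poly_Mapping.single m (1::'k)) m = Poly_Mapping.lookup (Poly_Mapping.single m' 1) m" by simp
    then show "m = m'" by (auto simp: lookup_single when_def split: if_splits)
  qed
  have "V.independent (f ` exponent_box 6 N)"
  proof (rule V.independent_if_scalars_zero)
    fix u X assume u: "(\<Sum>X\<in>f ` exponent_box 6 N. const (u X) * X) = 0" and X: "X \<in> f ` exponent_box 6 N"
    define P where "P = (\<Sum>m\<in>exponent_box 6 N. Poly_Mapping.single m (u (f m)))"
    have "substitute invs (substitute y P) = (\<Sum>m\<in>exponent_box 6 N. const (u (f m)) * f m)"
      unfolding P_def f_def substitute_peval
      by (simp add: peval_sum[OF const_hom] peval_single[OF const_hom] peval_mult[OF const_hom] const_hom)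
    also have "\<dots> = 0" using u by (simp add: sum.reindex[OF inj])
    finally have z: "substitute invs (substitute y P) = 0" .
    have "P \<in> PA 6" unfolding P_def by (intro PA_sum PA_single keys)
    then have "P = 0" by (rule indep[OF _ z])
    moreover have "Poly_Mapping.lookup P m = u (f m)" if "m \<in> exponent_box 6 N" for m
      using that card_exponent_box by (simp add: P_def lookup_sum lookup_single when_def)
    ultimately show "u X = 0" using X by auto
  qed (use card_exponent_box in simp)
  moreover have T: "finite T" "card T \<le> 2 * (K * N + 1) ^ 5"
  proof -
    note fin = card_exponent_box(1)[of 5 "K * N"]
    show "finite T" unfolding T_def using fin by simp
    have "card T \<le> card (exponent_box 5 (K * N)) + card (exponent_box 5 (K * N))"
      unfolding T_def by (rule order_trans[OF card_Un_le]) (intro add_mono card_image_le fin)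
    then show "card T \<le> 2 * (K * N + 1) ^ 5" by (simp add: card_exponent_box)
  qed
  ultimately have "card (f ` exponent_box 6 N) \<le> card T"
    using V.independent_span_bound[OF T(1)] span by blast
  then have "(N + 1) ^ 6 \<le> 2 * (K * N + 1) ^ 5"
    using T(2) card_image[OF inj] by (simp add: card_exponent_box)
  also have "\<dots> \<le> 2 * ((K + 1) * (N + 1)) ^ 5" by (intro mult_left_mono power_mono) (simp_all add: algebra_simps)
  also have "\<dots> = N * (N + 1) ^ 5" unfolding power_mult_distrib N_def by simp
  also have "\<dots> < (N + 1) ^ 6" by (simp add: power_Suc[symmetric] numeral_eq_Suc)
  finally show False by simp
qed

text \<open>Some homogeneous component of an element of \<open>J\<^sub>i\<close> outside \<open>J\<^sub>i\<^sub>+\<^sub>1\<close> is outside \<open>J\<^sub>i\<^sub>+\<^sub>1\<close> too.\<close>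

lemma prime_chain_length:
  fixes J :: "nat \<Rightarrow> 'k::field_char_0 mpoly set"
  assumes J: "\<And>i. i \<le> n \<Longrightarrow> homogeneous_prime (J i)" and sub: "\<And>i. i < n \<Longrightarrow> J (Suc i) \<subset> J i"
  shows "n \<le> 4"
proof (rule ccontr)
  assume "\<not> n \<le> 4"
  then have n: "5 \<le> n" by simp
  have "\<exists>z w. z \<in> J i - J (Suc i) \<and> wpoly weights z = monom z w" if i: "i < n" for i
  proof (rule ccontr)
    assume no: "\<not> ?thesis"
    have Ji: "homogeneous_prime (J i)" "homogeneous_prime (J (Suc i))" using J i by simp_all
    obtain z where z: "z \<in> J i" "z \<notin> J (Suc i)" using sub[OF i] by blast
    have c: "coeff (wpoly weights z) l \<in> J (Suc i)" for l
      using no homogeneous_primeD(8)[OF Ji(1) z(1)] wpoly_coeff[of weights z l] by blast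
    have "(\<Sum>l\<in>L. coeff (wpoly weights z) l) \<in> J (Suc i)" for L
      by (induction L rule: infinite_finite_induct) (simp_all add: homogeneous_primeD(4,9)[OF Ji(2)] c)
    then show False using z(2) sum_coeff_wpoly[of weights z] by metis
  qed
  then obtain x w where xw: "\<And>i. i < n \<Longrightarrow> x i \<in> J i - J (Suc i) \<and> wpoly weights (x i) = monom (x i) (w i)" by metis
  define y where "y = case_nat rho x"
  have "\<exists>P\<in>PA 6. P \<noteq> 0 \<and> substitute y P \<in> relation_ideal"
  proof (rule algebraically_dependent)
    fix l :: nat assume l: "l < 6"
    show "y l \<in> PA 6" using xw[of "l - 1"] l n homogeneous_primeD(1)[OF J[of "l - 1"]] rho_PA
      by (cases l) (auto simp: y_def)
    show "wpoly weights (y l) = monom (y l) (case_nat 6 w l)"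
      using xw[of "l - 1"] l n wpoly_rho by (cases l) (auto simp: y_def)
  qed
  then obtain P where P: "P \<in> PA 6" "P \<noteq> 0" "substitute y P \<in> relation_ideal" by blast
  then have "substitute (case_nat rho x) P \<in> J 5" using homogeneous_primeD(2)[OF J[OF n]] by (simp add: y_def)
  then show False
    using prime_chain_independent[of n J x 5 P] J sub xw n P by auto
qed

section \<open>The dimension of the variety\<close>

lemma points_variety: "points (invariant_variety :: ('k::field_char_0, _) frac_space) = Bg.U0"
  unfolding invariant_variety_eq Bg.Proj_eq open_subspace_def
  using Bg.proj.points_X by (auto simp: Bg.U0_def)

lemma openin_variety:
  "openin (topo (invariant_variety :: ('k::field_char_0, _) frac_space)) V \<longleftrightarrow> openin (topo Bg.proj.X) V \<and> V \<subseteq> Bg.U0"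
  unfolding invariant_variety_eq Bg.Proj_eq open_subspace_def
  by (simp add: openin_open_subtopology[OF Bg.basic.U0_open])

lemma variety_integral: "integral_space (invariant_variety :: ('k::field_char_0, 'k mpoly set) frac_space)"
proof -
  have "sheaf (invariant_variety :: ('k, _) frac_space) = sheaf Bg.proj.X"
    by (simp add: invariant_variety_eq Bg.Proj_eq open_subspace_def)
  then show ?thesis
    unfolding integral_space_def points_variety openin_variety
    using Bg.zero_in_U0 Bg.proj.sections_domain by auto
qed

definition vanishing :: "'k::field_char_0 mpoly set set set \<Rightarrow> 'k mpoly set" where
  "vanishing C = {x \<in> PA 6. \<forall>p\<in>C. B.cls x \<in> p}"

lemma U0_D:
  fixes p :: "'k::field_char_0 mpoly set set"
  assumes p: "p \<in> Bg.U0"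
  shows "primeideal p B.S" and "B.cls rho \<notin> p"
    and "x \<in> PA 6 \<Longrightarrow> B.cls x \<in> p \<Longrightarrow> B.cls (coeff (wpoly weights x) n) \<in> p"
proof -
  show "primeideal p B.S" "B.cls rho \<notin> p" using p by (auto simp: Bg.U0_def Bg.hprimes_def)
  assume x: "x \<in> PA 6" "B.cls x \<in> p"
  obtain H where H: "Bg.graded_prime H" "p = Bg.idl H" using p unfolding Bg.U0_iff by blast
  have gi: "Bg.graded_ideal H" using H(1) by (simp add: Bg.graded_prime_def)
  let ?c = "coeff (wpoly weights x) n"
  have "(n, coeff (eps (realize (B.cls x))) n) \<in> H" using x(2) H(2) by (simp add: Bg.idl_def)
  then have "(n, to_fract (realize (B.cls ?c))) \<in> H"
    using PA_coeff_wpoly[OF x(1), of weights n]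
    by (simp add: realize_cls x coeff_eps wpoly_ones_substitute_invs)
  moreover have "B.cls ?c \<in> B_gr n"
    using coeff_wpoly_in_grading[of x weights n] x(1) by (auto simp: B_gr_eq)
  ultimately show "B.cls ?c \<in> p" using Bg.idl_gr[OF gi] H(2) by blast
qed

lemma cls_times_mem_iff:
  fixes p :: "'k::field_char_0 mpoly set set"
  assumes "p \<in> Bg.U0" "x \<in> PA 6" "y \<in> PA 6"
  shows "B.cls (x * y) \<in> p \<longleftrightarrow> B.cls x \<in> p \<or> B.cls y \<in> p"
proof -
  interpret p: primeideal p B.S by (rule U0_D(1)[OF assms(1)])
  have c: "B.cls x \<in> carrier B.S" "B.cls y \<in> carrier B.S" using assms by (auto simp: B.carrier_S)
  have "B.cls (x * y) = B.cls x \<otimes>\<^bsub>B.S\<^esub> B.cls y" using assms by (simp add: B.S_ops)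
  then show ?thesis using p.I_prime[OF c] p.I_l_closed[OF _ c(1)] p.I_r_closed[OF _ c(2)] by auto
qed

text \<open>Multiplying an equation by \<open>\<rho>\<close> turns a basic open set of the relation locus into one inside the variety.\<close>

lemma closedin_variety:
  fixes C :: "'k::field_char_0 mpoly set set set"
  shows "closedin (topo invariant_variety) C \<longleftrightarrow>
    C \<subseteq> Bg.U0 \<and> (\<forall>p\<in>Bg.U0 - C. \<exists>x\<in>vanishing C. B.cls x \<notin> p)"
proof -
  note rho_PA = rho_PA[where ?'a = 'k]
  have "openin (topo Bg.proj.X) (Bg.U0 - C) \<longleftrightarrow> (\<forall>p\<in>Bg.U0 - C. \<exists>x\<in>vanishing C. B.cls x \<notin> p)" if "C \<subseteq> Bg.U0"
  proof
    assume o: "openin (topo Bg.proj.X) (Bg.U0 - C)"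
    show "\<forall>p\<in>Bg.U0 - C. \<exists>x\<in>vanishing C. B.cls x \<notin> p"
    proof
      fix p assume "p \<in> Bg.U0 - C"
      then obtain f where f: "f \<in> carrier B.S" "f \<notin> p" "{q \<in> Bg.hprimes. f \<notin> q} \<subseteq> Bg.U0 - C"
        using o unfolding Bg.proj.openin_iff by blast
      obtain x where x: "x \<in> PA 6" "f = B.cls x" using f(1) by (auto simp: B.carrier_S)
      have "x \<in> vanishing C" using x f(3) that by (auto simp: vanishing_def Bg.U0_def)
      then show "\<exists>x\<in>vanishing C. B.cls x \<notin> p" using f x by blast
    qed
  next
    assume *: "\<forall>p\<in>Bg.U0 - C. \<exists>x\<in>vanishing C. B.cls x \<notin> p"
    show "openin (topo Bg.proj.X) (Bg.U0 - C)"
      unfolding Bg.proj.openin_iff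
    proof (intro conjI ballI)
      show "Bg.U0 - C \<subseteq> Bg.hprimes" by (auto simp: Bg.U0_def)
      fix p assume p: "p \<in> Bg.U0 - C"
      then obtain x where x: "x \<in> vanishing C" "B.cls x \<notin> p" using * by blast
      have xP: "x \<in> PA 6" using x by (simp add: vanishing_def)
      have sub: "{q \<in> Bg.hprimes. B.cls (x * rho) \<notin> q} \<subseteq> Bg.U0 - C"
      proof
        fix q assume q: "q \<in> {q \<in> Bg.hprimes. B.cls (x * rho) \<notin> q}"
        interpret q: primeideal q B.S using q by (simp add: Bg.hprimes_def)
        have "B.cls (x * rho) = B.cls x \<otimes>\<^bsub>B.S\<^esub> B.cls rho" using xP rho_PA by (simp add: B.S_ops)
        moreover have "B.cls x \<in> carrier B.S" "B.cls (rho :: 'k mpoly) \<in> carrier B.S"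
          unfolding B.carrier_S using xP rho_PA by (simp_all only: imageI)
        ultimately have "B.cls x \<notin> q" "B.cls rho \<notin> q" using q q.I_l_closed q.I_r_closed by (metis (lifting) mem_Collect_eq)+
        then show "q \<in> Bg.U0 - C" using q x by (auto simp: Bg.U0_def vanishing_def)
      qed
      have "B.cls (x * rho) \<notin> p" using p x(2) U0_D(2)[of p] cls_times_mem_iff[of p x rho] xP rho_PA by blast
      moreover have "B.cls (x * rho) \<in> carrier B.S" using xP rho_PA by (auto simp: B.carrier_S)
      ultimately show "\<exists>f\<in>carrier B.S. f \<notin> p \<and> {q \<in> Bg.hprimes. f \<notin> q} \<subseteq> Bg.U0 - C"
        using sub by blast
    qed
  qed
  then show ?thesis unfolding closedin_def points_variety openin_variety by blast
qed

text \<open>The zero locus of every element of the coordinate ring, homogeneous or not, is closed, so irreducibility gives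
  primality for all pairs of elements.\<close>

lemma vanishing_homogeneous_prime:
  fixes C :: "'k::field_char_0 mpoly set set set"
  assumes C: "irreducible_closed (topo invariant_variety) C"
  shows "homogeneous_prime (vanishing C)"
proof -
  have cl: "closedin (topo invariant_variety) C" and ne: "C \<noteq> {}"
    and irr: "\<And>A B. closedin (topo invariant_variety) A \<Longrightarrow> closedin (topo invariant_variety) B \<Longrightarrow> C \<subseteq> A \<union> B \<Longrightarrow> C \<subseteq> A \<or> C \<subseteq> B"
    using C by (auto simp: irreducible_closed_def)
  have CU: "p \<in> Bg.U0" if "p \<in> C" for p using cl that unfolding closedin_variety by blast
  have add: "B.cls (x + y) \<in> p" if "p \<in> C" "x \<in> PA 6" "y \<in> PA 6" "B.cls x \<in> p" "B.cls y \<in> p" for x y p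
  proof -
    interpret p: primeideal p B.S by (rule U0_D(1)[OF CU[OF that(1)]])
    have "B.cls (x + y) = B.cls x \<oplus>\<^bsub>B.S\<^esub> B.cls y" using that by (simp add: B.S_ops)
    then show ?thesis using p.a_closed that by metis
  qed
  have zero: "B.cls x \<in> p" if "p \<in> C" "x \<in> relation_ideal" for x p
  proof -
    interpret p: primeideal p B.S by (rule U0_D(1)[OF CU[OF that(1)]])
    have "B.cls x = \<zero>\<^bsub>B.S\<^esub>" unfolding B.S_zero B.cls_eq_iff using that by simp
    then show ?thesis using p.zero_closed by metis
  qed
  have prime: "x \<in> vanishing C \<or> y \<in> vanishing C" if xy: "x \<in> PA 6" "y \<in> PA 6" "x * y \<in> vanishing C" for x y
  proof -
    have V: "closedin (topo invariant_variety) {p \<in> Bg.U0. B.cls z \<in> p}" if "z \<in> PA 6" for z :: "'k mpoly"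
      unfolding closedin_variety using that by (auto simp: vanishing_def)
    have "C \<subseteq> {p \<in> Bg.U0. B.cls x \<in> p} \<union> {p \<in> Bg.U0. B.cls y \<in> p}"
    proof
      fix p assume p: "p \<in> C"
      then have "B.cls (x * y) \<in> p" using xy(3) by (simp add: vanishing_def)
      then show "p \<in> {p \<in> Bg.U0. B.cls x \<in> p} \<union> {p \<in> Bg.U0. B.cls y \<in> p}"
        using CU[OF p] cls_times_mem_iff[OF CU[OF p] xy(1,2)] by blast
    qed
    then show ?thesis using irr[OF V[OF xy(1)] V[OF xy(2)]] xy by (auto simp: vanishing_def)
  qed
  show ?thesis unfolding homogeneous_prime_def
  proof (intro conjI ballI allI impI)
    show "relation_ideal \<subseteq> vanishing C" using zero B.I_sub by (auto simp: vanishing_def)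
    show "rho \<notin> vanishing C" using ne CU U0_D(2) by (auto simp: vanishing_def)
    show "vanishing C \<subseteq> PA 6" by (auto simp: vanishing_def)
    show "x + y \<in> vanishing C" if "x \<in> vanishing C" "y \<in> vanishing C" for x y
      using that add by (simp add: vanishing_def PA_add)
    show "x * y \<in> vanishing C" if "x \<in> vanishing C" "y \<in> PA 6" for x y
      using that cls_times_mem_iff[OF CU] by (simp add: vanishing_def PA_mult)
    show "coeff (wpoly weights x) n \<in> vanishing C" if "x \<in> vanishing C" for x n
      using that U0_D(3)[OF CU] PA_coeff_wpoly[of x 6 weights n] by (simp add: vanishing_def)
  qed (rule prime)
qed

lemma dimension_le: "dimension (invariant_variety :: ('k::field_char_0, 'k mpoly set) frac_space) \<le> 4"
  unfolding dimension_def
proof (rule Sup_least, clarify)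
  fix n and C :: "nat \<Rightarrow> 'k mpoly set set set"
  assume C: "\<forall>i\<le>n. irreducible_closed (topo invariant_variety) (C i)" "\<forall>i<n. C i \<subset> C (Suc i)"
  have "vanishing (C (Suc i)) \<subset> vanishing (C i)" if i: "i < n" for i
  proof -
    obtain p where p: "p \<in> C (Suc i)" "p \<notin> C i" using C(2) i by blast
    have "closedin (topo invariant_variety) (C i)" "closedin (topo invariant_variety) (C (Suc i))"
      using C(1) i by (auto simp: irreducible_closed_def)
    then obtain x where "x \<in> vanishing (C i)" "B.cls x \<notin> p" unfolding closedin_variety using p by blast
    moreover have "vanishing (C (Suc i)) \<subseteq> vanishing (C i)" using C(2) i by (auto simp: vanishing_def)
    ultimately show ?thesis using p by (auto simp: vanishing_def)
  qed
  then have "n \<le> 4" using prime_chain_length[of n "\<lambda>i. vanishing (C i)"] vanishing_homogeneous_prime C(1) by blast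
  then show "enat n \<le> 4" by (simp add: numeral_eq_enat)
qed

lemma prime_point:
  fixes J :: "'k::field_char_0 mpoly set"
  assumes J: "homogeneous_prime J"
  shows "B.cls ` J \<in> Bg.U0" and "x \<in> PA 6 \<Longrightarrow> B.cls x \<in> B.cls ` J \<longleftrightarrow> x \<in> J"
proof -
  note h = homogeneous_primeD[OF J]
  have S: "cring (B.S :: ('k, 'k mpoly set) module)" by (rule B.S_cring)
  note S_ring = cring.axioms(1)[OF S]
  have mem: "B.cls x \<in> B.cls ` J \<longleftrightarrow> x \<in> J" for x
  proof
    assume "B.cls x \<in> B.cls ` J"
    then obtain z where z: "z \<in> J" "x - z \<in> relation_ideal" by (auto simp: B.cls_eq_iff)
    have "(x - z) + z \<in> J" using h(4)[OF h(2)[OF z(2)] z(1)] .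
    then show "x \<in> J" by simp
  qed auto
  show "x \<in> PA 6 \<Longrightarrow> B.cls x \<in> B.cls ` J \<longleftrightarrow> x \<in> J" for x by (rule mem)
  have id: "ideal (B.cls ` J) B.S"
  proof (rule cring.ideal_if_closed[OF S])
    show "B.cls ` J \<subseteq> carrier B.S" using h(1) by (auto simp: B.carrier_S)
    show "\<zero>\<^bsub>B.S\<^esub> \<in> B.cls ` J" unfolding B.S_zero using h(9) by blast
    fix X Y assume "X \<in> B.cls ` J"
    then obtain x where x: "x \<in> J" "x \<in> PA 6" "X = B.cls x" using h(1) by blast
    show "X \<oplus>\<^bsub>B.S\<^esub> Y \<in> B.cls ` J" if Y: "Y \<in> B.cls ` J"
    proof -
      obtain y where y: "y \<in> J" "y \<in> PA 6" "Y = B.cls y" using Y h(1) by blast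
      show ?thesis using x y h(4) by (simp add: B.S_ops)
    qed
    show "X \<otimes>\<^bsub>B.S\<^esub> Y \<in> B.cls ` J" if Y: "Y \<in> carrier B.S"
    proof -
      obtain y where y: "y \<in> PA 6" "Y = B.cls y" using Y by (auto simp: B.carrier_S)
      show ?thesis using x y h(5) by (simp add: B.S_ops)
    qed
  qed
  have pr: "primeideal (B.cls ` J) B.S"
  proof (rule primeidealI[OF id S])
    have "B.cls 1 \<notin> B.cls ` J" using h(12) mem by blast
    moreover have "B.cls 1 \<in> carrier B.S" unfolding B.carrier_S by (rule imageI) simp
    ultimately show "carrier B.S \<noteq> B.cls ` J" by metis
    fix X Y assume "X \<in> carrier B.S" "Y \<in> carrier B.S" and m: "X \<otimes>\<^bsub>B.S\<^esub> Y \<in> B.cls ` J"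
    then obtain x y where xy: "x \<in> PA 6" "X = B.cls x" "y \<in> PA 6" "Y = B.cls y" by (auto simp: B.carrier_S)
    have "B.cls (x * y) \<in> B.cls ` J" using m xy by (simp add: B.S_ops)
    then show "X \<in> B.cls ` J \<or> Y \<in> B.cls ` J" using h(7)[of x y] xy unfolding xy mem by blast
  qed
  have sub: "B.cls ` J \<inter> (\<Union>n. B_gr n) \<subseteq> carrier B.S" using h(1) by (auto simp: B.carrier_S)
  have "B.cls ` J \<subseteq> Idl\<^bsub>B.S\<^esub> (B.cls ` J \<inter> (\<Union>n. B_gr n))"
  proof
    fix X assume "X \<in> B.cls ` J"
    then obtain x where x: "x \<in> J" "x \<in> PA 6" "X = B.cls x" using h(1) by blast
    have "B.cls (\<Sum>n\<le>degree (wpoly weights x). coeff (wpoly weights x) n) \<in> Idl\<^bsub>B.S\<^esub> (B.cls ` J \<inter> (\<Union>n. B_gr n))"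
    proof (rule B.cls_sum_mem[OF ring.genideal_ideal[OF S_ring sub]], intro conjI)
      fix n
      show "coeff (wpoly weights x) n \<in> PA 6" by (rule PA_coeff_wpoly[OF x(2)])
      have "coeff (wpoly weights x) n \<in> weighted_grading weights n" using x(2) by (simp add: coeff_wpoly_in_grading)
      then have "B.cls (coeff (wpoly weights x) n) \<in> B_gr n" by (auto simp: B_gr_eq)
      then show "B.cls (coeff (wpoly weights x) n) \<in> Idl\<^bsub>B.S\<^esub> (B.cls ` J \<inter> (\<Union>n. B_gr n))"
        using h(8)[OF x(1)] ring.genideal_self[OF S_ring sub] by blast
    qed
    then show "X \<in> Idl\<^bsub>B.S\<^esub> (B.cls ` J \<inter> (\<Union>n. B_gr n))" unfolding sum_coeff_wpoly x(3) .
  qed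
  then have idl: "Idl\<^bsub>B.S\<^esub> (B.cls ` J \<inter> (\<Union>n. B_gr n)) = B.cls ` J"
    using ring.genideal_minimal[OF S_ring id, of "B.cls ` J \<inter> (\<Union>n. B_gr n)"] by blast
  have rho: "B.cls rho \<notin> B.cls ` J" using h(3) mem by blast
  moreover have "B.cls rho \<in> (\<Union>n\<in>{1..}. B_gr n)" using Bg.f_gr by (intro UN_I[of 6]) simp_all
  ultimately show "B.cls ` J \<in> Bg.U0" using pr idl by (auto simp: Bg.U0_def Bg.hprimes_def)
qed

lemma irreducible_closed_above:
  fixes J :: "'k::field_char_0 mpoly set"
  assumes J: "homogeneous_prime J"
  shows "irreducible_closed (topo invariant_variety) {p \<in> Bg.U0. B.cls ` J \<subseteq> p}" (is "irreducible_closed _ ?C")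
proof -
  have pt: "B.cls ` J \<in> ?C" using prime_point(1)[OF J] by simp
  have in_closed: "?C \<subseteq> A" if A: "closedin (topo invariant_variety) A" "B.cls ` J \<in> A" for A
  proof
    fix p assume p: "p \<in> ?C"
    show "p \<in> A"
    proof (rule ccontr)
      assume "p \<notin> A"
      then obtain x where "x \<in> vanishing A" "B.cls x \<notin> p" using A(1) p unfolding closedin_variety by blast
      then show False using A(2) p by (auto simp: vanishing_def)
    qed
  qed
  have V: "x \<in> vanishing ?C" if "x \<in> J" for x
    using homogeneous_primeD(1)[OF J that] that by (auto simp: vanishing_def)
  have "closedin (topo invariant_variety) ?C" unfolding closedin_variety
  proof (intro conjI ballI)
    show "?C \<subseteq> Bg.U0" by (rule Collect_subset)
    fix p assume "p \<in> Bg.U0 - ?C"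
    then obtain x where "x \<in> J" "B.cls x \<notin> p" by (auto simp: image_subset_iff)
    then show "\<exists>x\<in>vanishing ?C. B.cls x \<notin> p" using V by (intro bexI[of _ x])
  qed
  then show ?thesis unfolding irreducible_closed_def
  proof (intro conjI allI impI)
    show "?C \<noteq> {}" using pt by (metis empty_iff)
    fix A B assume AB: "closedin (topo invariant_variety) A \<and> closedin (topo invariant_variety) B \<and> ?C \<subseteq> A \<union> B"
    then have "B.cls ` J \<in> A \<union> B" using subsetD[OF conjunct2[OF conjunct2[OF AB]] pt] by simp
    then show "?C \<subseteq> A \<or> ?C \<subseteq> B" using in_closed AB by (elim UnE) simp_all
  qed
qed

text \<open>The closures of the points \<open>J\<^sub>i\<close>; larger primes have smaller closures.\<close>

lemma dimension_ge_if_prime_chain: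
  fixes J :: "nat \<Rightarrow> 'k::field_char_0 mpoly set"
  assumes J: "\<And>i. i \<le> n \<Longrightarrow> homogeneous_prime (J i)" and sub: "\<And>i. i < n \<Longrightarrow> J (Suc i) \<subset> J i"
  shows "enat n \<le> dimension (invariant_variety :: ('k, 'k mpoly set) frac_space)"
  unfolding dimension_def
proof (rule Sup_upper, clarify, intro exI conjI allI impI)
  let ?C = "\<lambda>i. {p \<in> Bg.U0. B.cls ` J i \<subseteq> p}"
  show "enat n = enat n" ..
  show "irreducible_closed (topo invariant_variety) (?C i)" if "i \<le> n" for i
    by (rule irreducible_closed_above[OF J[OF that]])
  show "?C i \<subset> ?C (Suc i)" if i: "i < n" for i
  proof -
    have Ji: "homogeneous_prime (J i)" "homogeneous_prime (J (Suc i))" using J i by simp_all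
    obtain x where x: "x \<in> J i" "x \<notin> J (Suc i)" using sub[OF i] by blast
    have "B.cls x \<notin> B.cls ` J (Suc i)"
      using prime_point(2)[OF Ji(2) homogeneous_primeD(1)[OF Ji(1) x(1)]] x(2) by simp
    then have "B.cls ` J (Suc i) \<notin> ?C i" using imageI[OF x(1), of B.cls] by (auto simp only: mem_Collect_eq)
    moreover have "B.cls ` J (Suc i) \<in> ?C (Suc i)" using prime_point(1)[OF Ji(2)] by simp
    moreover have "?C i \<subseteq> ?C (Suc i)"
    proof (rule Collect_mono, rule impI, elim conjE, rule conjI)
      fix p assume p: "B.cls ` J i \<subseteq> p"
      show "B.cls ` J (Suc i) \<subseteq> p"
        by (rule order_trans[OF image_mono[OF psubset_imp_subset[OF sub[OF i]]] p])
    qed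
    moreover have "?C i \<noteq> ?C (Suc i)"
    proof
      assume "?C i = ?C (Suc i)"
      then show False using calculation by (simp only: not_True_eq_False)
    qed
    ultimately show ?thesis by (intro psubsetI)
  qed
qed

lemma kernel_homogeneous_prime:
  fixes \<tau> :: "nat \<Rightarrow> 'k::field_char_0 mpoly"
  assumes \<tau>: "\<And>l. l < 6 \<Longrightarrow> wpoly ws (\<tau> l) = monom (\<tau> l) (weights ! l)"
    and rel: "substitute \<tau> relation_poly = 0" and rho: "substitute \<tau> rho \<noteq> 0"
  shows "homogeneous_prime {x \<in> PA 6. substitute \<tau> x = 0}"
proof -
  have "substitute \<tau> (coeff (wpoly weights x) n) = 0" if "x \<in> PA 6" "substitute \<tau> x = 0" for x n
    using coeff_wpoly_substitute[of x weights ws \<tau> n] that \<tau> by simp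
  moreover have "relation_ideal \<subseteq> {x \<in> PA 6. substitute \<tau> x = 0}"
    using rel by (auto simp: relation_ideal_def cgenideal_def substitute_simps)
  ultimately show ?thesis
    using rho PA_coeff_wpoly unfolding homogeneous_prime_def by (auto simp: substitute_simps)
qed

lemma substitute_numeral: "substitute \<sigma> (numeral w) = numeral w"
  by (simp add: substitute_peval const_hom)

text \<open>A parametrisation of the part of the locus \<open>d = 0\<close> with \<open>a \<noteq> 0\<close>: with \<open>b = a \<beta>\<close> and \<open>c = a\<^sup>2 \<delta>\<close> the relation becomes divisible by
  \<open>a\<^sup>3\<close> and can be solved for \<open>j\<close>.  The parameters \<open>i, a, \<beta>, \<delta>\<close> have weights 2, 3, 1, 0 and are represented by the
  variables 0 to 3; \<open>a\<close>, \<open>\<beta>\<close> and \<open>\<delta>\<close> can be replaced by zero, and \<open>\<rho>\<close> stays nonzero as it contains \<open>i\<^sup>3\<close>.\<close>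

definition degeneration :: "'k::field_char_0 mpoly \<Rightarrow> 'k mpoly \<Rightarrow> 'k mpoly \<Rightarrow> nat \<Rightarrow> 'k mpoly" where
  "degeneration a \<beta> \<delta> =
    (!) [0, var 0, const (3/2) * var 0 * \<beta> - 3 * \<beta> ^ 3 - 6 * a * \<delta> ^ 2, a, a * \<beta>, a ^ 2 * \<delta>]"

lemma degeneration_values:
  "degeneration a \<beta> \<delta> 0 = 0" "degeneration a \<beta> \<delta> 1 = var 0" "degeneration a \<beta> \<delta> (Suc 0) = var 0"
  "degeneration a \<beta> \<delta> 2 = const (3/2) * var 0 * \<beta> - 3 * \<beta> ^ 3 - 6 * a * \<delta> ^ 2"
  "degeneration a \<beta> \<delta> 3 = a" "degeneration a \<beta> \<delta> 4 = a * \<beta>" "degeneration a \<beta> \<delta> 5 = a ^ 2 * \<delta>"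
  by (simp_all add: degeneration_def)

lemma degeneration_homogeneous_prime:
  fixes a \<beta> \<delta> :: "'k::field_char_0 mpoly"
  assumes a: "a \<in> {0, var 1}" and \<beta>: "\<beta> \<in> {0, var 2}" and \<delta>: "\<delta> \<in> {0, var 3}"
  shows "homogeneous_prime {x \<in> PA 6. substitute (degeneration a \<beta> \<delta>) x = 0}"
proof (rule kernel_homogeneous_prime[where ws = "[2, 3, 1, 0]"])
  have w: "wpoly [2, 3, 1, 0] a = monom a 3" "wpoly [2, 3, 1, 0] \<beta> = monom \<beta> 1" "wpoly [2, 3, 1, 0] \<delta> = monom \<delta> 0"
    using a \<beta> \<delta> by auto
  show "wpoly [2, 3, 1, 0] (degeneration a \<beta> \<delta> l) = monom (degeneration a \<beta> \<delta> l) (weights ! l)" if "l < 6" for l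
  proof -
    have "l \<in> {0, 1, 2, 3, 4, 5}" using that by auto
    then show ?thesis
      by (elim insertE emptyE)
        (simp_all add: degeneration_values weights_def wpoly_simps w w[unfolded One_nat_def] mult_monom monom_simps,
          simp add: diff_monom numeral_3_eq_3)
  qed
  \<comment> \<open>With \<open>h = 1/6\<close> all coefficients of the relation at \<open>d = 0\<close> are integral multiples of \<open>h\<close>, and \<open>6 h = 1\<close> is a ring equation.\<close>
  define h where "h = (const (1/6) :: 'k mpoly)"
  have h: "const (3/2) = 9 * h" "const (1/3) = 2 * h" "const (1/2) = 3 * h" "6 * h = 1"
      "substitute (degeneration a \<beta> \<delta>) h = h"
    unfolding h_def by (simp_all add: substitute_simps flip: const_mult const_numeral)
  have "2 * (a ^ 2 * \<delta>) ^ 2 - (- (2 * h * (9 * h * var 0 * \<beta> - 3 * \<beta> ^ 3 - 6 * a * \<delta> ^ 2) * a ^ 3)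
      + 3 * h * var 0 * a ^ 2 * (a * \<beta>) - (a * \<beta>) ^ 3) = 0"
    using h(4) by Groebner_Basis.algebra
  then show "substitute (degeneration a \<beta> \<delta>) relation_poly = 0"
    unfolding relation_poly_def Let_def
    by (simp add: substitute_simps substitute_numeral degeneration_values h(1-3,5))
  let ?z = "(\<lambda>l. if l = 0 then 1 else 0) :: nat \<Rightarrow> 'k"
  have z: "ev ?z a = 0" "ev ?z \<beta> = 0" "ev ?z \<delta> = 0" using a \<beta> \<delta> by (auto simp: id_hom)
  have "ev ?z (substitute (degeneration a \<beta> \<delta>) rho) = 1/8"
    unfolding peval_substitute[OF id_hom] rho_def Let_def
    by (simp add: peval_hom_simps[OF id_hom] id_hom degeneration_values z)
  then show "substitute (degeneration a \<beta> \<delta>) rho \<noteq> 0" by (auto simp: id_hom)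
qed

text \<open>The chain is the ideal of the relation, then the degenerations with parameters \<open>(a, \<beta>, \<delta>)\<close>, \<open>(a, \<beta>, 0)\<close>,
  \<open>(a, 0, 0)\<close>, \<open>(0, 0, 0)\<close>; the inclusions are strict because of the variables \<open>d, c, b, a\<close> respectively.\<close>

lemma dimension_ge: "4 \<le> dimension (invariant_variety :: ('k::field_char_0, 'k mpoly set) frac_space)"
proof -
  define K :: "(nat \<Rightarrow> 'k mpoly) \<Rightarrow> 'k mpoly set" where "K \<tau> = {x \<in> PA 6. substitute \<tau> x = 0}" for \<tau>
  let ?\<tau> = "\<lambda>i::nat. degeneration (if i \<ge> 1 then var 1 else 0) (if i \<ge> 2 then var 2 else 0) (if i \<ge> 3 then var 3 else 0) :: nat \<Rightarrow> 'k mpoly"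
  define J where "J i = (if i = 4 then relation_ideal else K (?\<tau> i))" for i :: nat
  have prime: "homogeneous_prime (J i)" if "i \<le> 4" for i
  proof (cases "i = 4")
    case True
    have "homogeneous_prime {x \<in> PA 6. substitute invs x = (0 :: 'k mpoly)}"
      by (rule kernel_homogeneous_prime[where ws = ones])
        (simp_all add: wpoly_invs substitute_invs_relation substitute_invs_rho Res3_nz)
    moreover have "relation_ideal = {x \<in> PA 6. substitute invs x = (0 :: 'k mpoly)}" using relation_ideal_iff by blast
    ultimately show ?thesis using True by (simp add: J_def)
  next
    case False
    have "homogeneous_prime (K (?\<tau> i))" unfolding K_def by (rule degeneration_homogeneous_prime) simp_all
    then show ?thesis using False by (simp only: J_def if_False)
  qed
  have sub: "K (degeneration a \<beta> \<delta>) \<subset> K (degeneration a' \<beta>' \<delta>')"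
    if \<sigma>: "substitute \<sigma> (var 0) = var 0" "substitute \<sigma> a = a'" "substitute \<sigma> \<beta> = \<beta>'" "substitute \<sigma> \<delta> = \<delta>'"
      and v: "v < 6" "degeneration a \<beta> \<delta> v \<noteq> 0" "degeneration a' \<beta>' \<delta>' v = 0" for \<sigma> a \<beta> \<delta> a' \<beta>' \<delta>' v
  proof -
    have l: "substitute \<sigma> (degeneration a \<beta> \<delta> l) = degeneration a' \<beta>' \<delta>' l" if "l < 6" for l
    proof -
      have "l \<in> {0, 1, 2, 3, 4, 5}" using that by auto
      then show ?thesis
        by (elim insertE emptyE) (simp_all add: degeneration_values \<sigma>[unfolded substitute_simps] substitute_simps substitute_numeral \<sigma>(2-))
    qed
    have "K (degeneration a \<beta> \<delta>) \<subseteq> K (degeneration a' \<beta>' \<delta>')"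
    proof
      fix x assume x: "x \<in> K (degeneration a \<beta> \<delta>)"
      have "substitute \<sigma> (substitute (degeneration a \<beta> \<delta>) x) = substitute (\<lambda>l. substitute \<sigma> (degeneration a \<beta> \<delta> l)) x"
        unfolding substitute_peval[of \<sigma>] peval_substitute[OF const_hom] unfolding substitute_peval ..
      also have "\<dots> = substitute (degeneration a' \<beta>' \<delta>') x"
        unfolding substitute_peval
        by (rule peval_cong[of _ 6]) (use x l in \<open>simp_all add: K_def substitute_peval\<close>)
      finally show "x \<in> K (degeneration a' \<beta>' \<delta>')" using x by (simp add: K_def substitute_simps)
    qed
    moreover have "var v \<in> K (degeneration a' \<beta>' \<delta>')" "var v \<notin> K (degeneration a \<beta> \<delta>)"
      using v by (simp_all add: K_def substitute_simps)
    ultimately show ?thesis by blast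
  qed
  have nz: "var x \<noteq> (0 :: 'k mpoly)" for x by (metis single_zero lookup_single_eq lookup_zero var_def zero_neq_one)
  have "J (Suc i) \<subset> J i" if i: "i < 4" for i
  proof -
    have "relation_ideal \<subset> K (degeneration (var 1) (var 2) (var 3))"
    proof -
      have "homogeneous_prime (K (degeneration (var 1) (var 2) (var 3)))"
        unfolding K_def by (rule degeneration_homogeneous_prime) auto
      then have "relation_ideal \<subseteq> K (degeneration (var 1) (var 2) (var 3))" using homogeneous_primeD(2) by blast
      moreover have "var 0 \<in> K (degeneration (var 1) (var 2) (var 3))"
        by (simp add: K_def substitute_simps degeneration_values)
      moreover have "var 0 \<notin> (relation_ideal :: 'k mpoly set)"
        using invs_0_nz[where ?'k = 'k] by (simp add: relation_ideal_iff substitute_simps)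
      ultimately show ?thesis by blast
    qed
    moreover have "K (degeneration (var 1) (var 2) (var 3)) \<subset> K (degeneration (var 1) (var 2) 0)"
      by (rule sub[of "var(3 := 0)" _ _ _ _ _ _ 5]) (simp_all add: substitute_simps degeneration_values nz)
    moreover have "K (degeneration (var 1) (var 2) 0) \<subset> K (degeneration (var 1) 0 0)"
      by (rule sub[of "var(2 := 0)" _ _ _ _ _ _ 4]) (simp_all add: substitute_simps degeneration_values nz)
    moreover have "K (degeneration (var 1) 0 0) \<subset> K (degeneration 0 0 0)"
      by (rule sub[of "var(1 := 0)" _ _ _ _ _ _ 3]) (simp_all add: substitute_simps degeneration_values nz)
    moreover have "i = 0 \<or> i = 1 \<or> i = 2 \<or> i = 3" using i by auto
    ultimately show ?thesis by (elim disjE) (simp_all add: J_def)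
  qed
  with prime have "enat 4 \<le> dimension (invariant_variety :: ('k, 'k mpoly set) frac_space)"
    by (intro dimension_ge_if_prime_chain[of 4 J]) auto
  then show ?thesis by (simp add: numeral_eq_enat)
qed

theorem theorem3p2:
  shows "let X = (invariant_variety :: ('k::field_char_0, 'k mpoly set) frac_space) in
    isomorphic M3 X \<and> integral_space X \<and> dimension X = 4"
  using M3_isomorphic variety_integral dimension_le dimension_ge by (auto simp: Let_def intro: order_antisym)

end
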